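(* Let $(R,\mu)$ be a Hopf-Galois algebra over a field $k$, let $(\tau,\omega,g,h,c,\xi)$ be an admissible sextuple for $(R,\mu)$ (as defined in the context), and let $A_R=A(R,X,Y,\tau,\omega,c,\xi)$ be the associated Hopf-Galois algebra. Consider the commuting algebra automorphisms $\tau',\omega'$ of $\underline{H}(R)$ given by $$\tau'(r\otimes s)=g\cdot r\otimes\tau(s),\qquad \omega'(r\otimes s)=h\cdot r\otimes\omega(s),\qquad r\otimes s\in\underline{H}(R),$$ the group-like elements $g^{-1}\otimes g,\ h^{-1}\otimes h\in G(\underline{H}(R))$, the scalar $\lambda\in k^*$ such that $gh=\lambda hg$, and the elements $c'\in\underline{H}(R)$ and $\xi'\in k^*$ defined by $$c'=(gh)^{-1}\otimes c-(gh)^{-1}c\otimes 1,\qquad \xi'=\xi\lambda^{-1}.$$ Then $A(\underline{H}(R),E,F,\tau',\omega',c',\xi')$ has a Hopf algebra structure extending that of $\underline{H}(R)$ and such that $$\Delta(E)=E\otimes 1+(g^{-1}\otimes g)\otimes E,\qquad \Delta(F)=F\otimes 1+(h^{-1}\otimes h)\otimes F,$$ and there is a Hopf algebra isomorphism $$\underline{H}(A_R)\simeq A(\underline{H}(R),E,F,\tau',\omega',c',\xi').$$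
   Context: All algebras and tensor products are over a field $k$. A Hopf-Galois algebra is a non-zero algebra $R$ with an algebra map $\mu:R\to R\otimes R^{\rm op}\otimes R$, written $\mu(r)=r_{(1)}\otimes r_{(2)}\otimes r_{(3)}$, such that $(\mu\otimes{\rm id}\otimes{\rm id})\circ\mu=({\rm id}\otimes{\rm id}\otimes\mu)\circ\mu$, $r_{(1)}r_{(2)}\otimes r_{(3)}=1\otimes r$ and $r_{(1)}\otimes r_{(2)}r_{(3)}=r\otimes 1$ for all $r\in R$. A group-like element is an invertible $g\in R$ with $\mu(g)=g\otimes g^{-1}\otimes g$; $G_0(R)$ is the group of these. An element $g\in G_0(R)$ is quasi-central if there is a character $\alpha:G_0(R)\to k^*$ with $xg=\alpha(x)gx$ for all $x\in G_0(R)$. Write $g\cdot r:=grg^{-1}$. Products inside a middle tensor factor are written using the product of $R$ (not of $R^{\rm op}$). The Hopf algebra $\underline{H}(R)$: writing a general element $\sum_i x_i\otimes y_i$ of $R^{\rm op}\otimes R$ simply as $x\otimes y$, $\underline{H}(R)$ is the subalgebra $\{x\otimes y: xy_{(1)}\otimes y_{(2)}\otimes y_{(3)}=1\otimes x\otimes y\}$ of $R^{\rm op}\otimes R$; it is a Hopf algebra (Grunspan, Schauenburg) with $\Delta(x\otimes y)=(x\otimes y_{(1)})\otimes(y_{(2)}\otimes y_{(3)})$ and $\varepsilon(x\otimes y)=xy$. $G(\cdot)$ denotes group-like elements of a Hopf algebra. For commuting algebra automorphisms $\tau,\omega$ of an algebra $R$, $\sigma=\tau\omega$, $c\in Z_\sigma(R)=\{x\in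 R: xr=\sigma(r)x\ \forall r\in R\}$ and $\xi\in k^*$, the generalized ambiskew polynomial algebra $A(R,X,Y,\tau,\omega,c,\xi)$ is the quotient of the free product $R*k\langle X,Y\rangle$ by the relations $Xr=\tau(r)X$, $Yr=\omega(r)Y$ ($r\in R$), $XY-\xi YX=c$. (For $\underline H(R)$ the variables are called $E,F$.) Admissible sextuple for $(R,\mu)$ (name introduced here): $(\tau,\omega,g,h,c,\xi)$ such that (1) $\tau,\omega$ are commuting algebra automorphisms of $R$ with, for all $r\in R$, $\mu(\tau(r))=\tau(r_{(1)})\otimes r_{(2)}\otimes r_{(3)}=\tau(r_{(1)})\otimes\tau(r_{(2)})\otimes\tau(r_{(3)})$ and $\mu(\omega(r))=\omega(r_{(1)})\otimes r_{(2)}\otimes r_{(3)}=\omega(r_{(1)})\otimes\omega(r_{(2)})\otimes\omega(r_{(3)})$; (2) $g,h\in G_0(R)$ are quasi-central and, for all $r\in R$, $g\cdot r_{(1)}\otimes g\cdot r_{(2)}\otimes r_{(3)}=\tau(r_{(1)})\otimes\tau(r_{(2)})\otimes r_{(3)}$ and $h\cdot r_{(1)}\otimes h\cdot r_{(2)}\otimes r_{(3)}=\omega(r_{(1)})\otimes\omega(r_{(2)})\otimes r_{(3)}$; (3) $\xi\in k^*$, $\tau(h)=\xi h$, $\omega(g)=\xi^{-1}g$; (4) $c\in Z_\sigma(R)$ for $\sigma=\tau\omega$, and $\mu(c)=c\otimes 1\otimes 1-gh\otimes(gh)^{-1}c\otimes 1+gh\otimes(gh)^{-1}\otimes c$. For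 such a sextuple, $A_R=A(R,X,Y,\tau,\omega,c,\xi)$ has a unique Hopf-Galois algebra structure extending $\mu$ with $\mu(X)=X\otimes 1\otimes 1-g\otimes g^{-1}X\otimes 1+g\otimes g^{-1}\otimes X$ and $\mu(Y)=Y\otimes 1\otimes 1-h\otimes h^{-1}Y\otimes 1+h\otimes h^{-1}\otimes Y$; this is the associated Hopf-Galois algebra. It is also known that in this situation $g\cdot r\otimes\tau(s)$ and $h\cdot r\otimes\omega(s)$ lie in $\underline{H}(R)$ whenever $r\otimes s\in\underline H(R)$, so $\tau',\omega'$ are well defined, and that $g,h$ commute up to a scalar, so $\lambda$ exists. *)

theory Defs
  imports "HOL-Algebra.QuotRing" "HOL-Algebra.Module"
begin

section \<open>Algebras over a field\<close>

text \<open>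
  Algebras are associative and unital but not necessarily commutative, so the locale
  \<open>algebra\<close> of HOL-Algebra is too narrow.
\<close>

locale k_algebra = K?: field K + A?: ring A + module K A
  for K :: "'k ring" (structure) and A :: "('k, 'a) module" (structure) +
  assumes smult_mult_left:
      "\<lbrakk>s \<in> carrier K; x \<in> carrier A; y \<in> carrier A\<rbrakk>
        \<Longrightarrow> (s \<odot>\<^bsub>A\<^esub> x) \<otimes>\<^bsub>A\<^esub> y = s \<odot>\<^bsub>A\<^esub> (x \<otimes>\<^bsub>A\<^esub> y)"
    and smult_mult_right:
      "\<lbrakk>s \<in> carrier K; x \<in> carrier A; y \<in> carrier A\<rbrakk>
        \<Longrightarrow> x \<otimes>\<^bsub>A\<^esub> (s \<odot>\<^bsub>A\<^esub> y) = s \<odot>\<^bsub>A\<^esub> (x \<otimes>\<^bsub>A\<^esub> y)"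

definition lin_maps :: "'k ring \<Rightarrow> ('k, 'a) module \<Rightarrow> ('k, 'b) module \<Rightarrow> ('a \<Rightarrow> 'b) set" where
  "lin_maps K A B =
    {f. f \<in> carrier A \<rightarrow> carrier B
      \<and> (\<forall>x\<in>carrier A. \<forall>y\<in>carrier A. f (x \<oplus>\<^bsub>A\<^esub> y) = f x \<oplus>\<^bsub>B\<^esub> f y)
      \<and> (\<forall>s\<in>carrier K. \<forall>x\<in>carrier A. f (s \<odot>\<^bsub>A\<^esub> x) = s \<odot>\<^bsub>B\<^esub> f x)}"

definition alg_hom :: "'k ring \<Rightarrow> ('k, 'a) module \<Rightarrow> ('k, 'b) module \<Rightarrow> ('a \<Rightarrow> 'b) set" where
  "alg_hom K A B = ring_hom A B \<inter> lin_maps K A B"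

definition alg_iso :: "'k ring \<Rightarrow> ('k, 'a) module \<Rightarrow> ('k, 'b) module \<Rightarrow> ('a \<Rightarrow> 'b) set" where
  "alg_iso K A B = {f \<in> alg_hom K A B. bij_betw f (carrier A) (carrier B)}"

abbreviation alg_auto :: "'k ring \<Rightarrow> ('k, 'a) module \<Rightarrow> ('a \<Rightarrow> 'a) set" where
  "alg_auto K A \<equiv> alg_iso K A A"

definition opp :: "('k, 'a) module \<Rightarrow> ('k, 'a) module" where
  "opp A = A\<lparr>mult := (\<lambda>x y. y \<otimes>\<^bsub>A\<^esub> x)\<rparr>"

text \<open>The field as an algebra over itself (the codomain of counits).\<close>

definition base_alg :: "'k ring \<Rightarrow> ('k, 'k) module" where
  "base_alg K = ring.extend K (module.fields (\<lambda>s x. s \<otimes>\<^bsub>K\<^esub> x))"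

definition conj_by :: "('k, 'a) module \<Rightarrow> 'a \<Rightarrow> 'a \<Rightarrow> 'a" where
  "conj_by A g r = g \<otimes>\<^bsub>A\<^esub> r \<otimes>\<^bsub>A\<^esub> inv\<^bsub>A\<^esub> g"


section \<open>Monoid algebras and quotients\<close>

definition monoid_alg :: "'k ring \<Rightarrow> 'm monoid \<Rightarrow> ('k, 'm \<Rightarrow> 'k) module" where
  "monoid_alg K M =
    \<lparr>carrier = {p. (\<forall>m. p m \<in> carrier K) \<and> finite {m. p m \<noteq> \<zero>\<^bsub>K\<^esub>}
                   \<and> {m. p m \<noteq> \<zero>\<^bsub>K\<^esub>} \<subseteq> carrier M},
     mult = (\<lambda>p q m. \<Oplus>\<^bsub>K\<^esub>x\<in>{x. p x \<noteq> \<zero>\<^bsub>K\<^esub>}. \<Oplus>\<^bsub>K\<^esub>y\<in>{y. q y \<noteq> \<zero>\<^bsub>K\<^esub>}.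
               if x \<otimes>\<^bsub>M\<^esub> y = m then p x \<otimes>\<^bsub>K\<^esub> q y else \<zero>\<^bsub>K\<^esub>),
     one = (\<lambda>m. if m = \<one>\<^bsub>M\<^esub> then \<one>\<^bsub>K\<^esub> else \<zero>\<^bsub>K\<^esub>),
     zero = (\<lambda>m. \<zero>\<^bsub>K\<^esub>),
     add = (\<lambda>p q m. p m \<oplus>\<^bsub>K\<^esub> q m),
     smult = (\<lambda>s p m. s \<otimes>\<^bsub>K\<^esub> p m)\<rparr>"

definition basis_elem :: "'k ring \<Rightarrow> 'm \<Rightarrow> 'm \<Rightarrow> 'k" where
  "basis_elem K m = (\<lambda>m'. if m' = m then \<one>\<^bsub>K\<^esub> else \<zero>\<^bsub>K\<^esub>)"

text \<open>
  Linear extension to the monoid algebra of a map into the module \<open>D\<close> given on the monoid basis.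
\<close>

definition lin_ext :: "'k ring \<Rightarrow> ('k, 'd) module \<Rightarrow> ('m \<Rightarrow> 'd) \<Rightarrow> ('m \<Rightarrow> 'k) \<Rightarrow> 'd" where
  "lin_ext K D f p = (\<Oplus>\<^bsub>D\<^esub>m\<in>{m. p m \<noteq> \<zero>\<^bsub>K\<^esub>}. p m \<odot>\<^bsub>D\<^esub> f m)"

text \<open>The quotient of an algebra by the two-sided ideal generated by a set of relators.\<close>

definition alg_quot :: "('k, 'a) module \<Rightarrow> 'a set \<Rightarrow> ('k, 'a set) module" where
  "alg_quot A S = ring.extend (A Quot (Idl\<^bsub>A\<^esub> S))
     (module.fields (\<lambda>s C. \<Union>x\<in>C. (Idl\<^bsub>A\<^esub> S) +>\<^bsub>A\<^esub> (s \<odot>\<^bsub>A\<^esub> x)))"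

definition quot_proj :: "('k, 'a) module \<Rightarrow> 'a set \<Rightarrow> 'a \<Rightarrow> 'a set" where
  "quot_proj A S x = (Idl\<^bsub>A\<^esub> S) +>\<^bsub>A\<^esub> x"


section \<open>Tensor products of algebras\<close>

text \<open>
  The tensor product of \<open>A\<close> and \<open>B\<close> is the free vector space on \<open>carrier A \<times> carrier B\<close> modulo
  the bilinearity relators. The free vector space carries the product
  \<open>(a, b) (a', b') = (a a', b b')\<close>, i.e. it is the monoid algebra of the direct product of the
  multiplicative monoids. A basis element times a bilinearity relator, on either side, is again
  a bilinearity relator, so the ideal generated by the relators is just their linear span and the
  quotient is the usual tensor product with its usual algebra structure.
\<close>

type_synonym ('k, 'a, 'b) tens = "('a \<times> 'b \<Rightarrow> 'k) set"

abbreviation pair_alg :: "'k ring \<Rightarrow> ('k, 'a) module \<Rightarrow> ('k, 'b) module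
    \<Rightarrow> ('k, 'a \<times> 'b \<Rightarrow> 'k) module" where
  "pair_alg K A B \<equiv> monoid_alg K (A \<times>\<times> B)"

definition bilin_rels :: "'k ring \<Rightarrow> ('k, 'a) module \<Rightarrow> ('k, 'b) module \<Rightarrow> ('a \<times> 'b \<Rightarrow> 'k) set" where
  "bilin_rels K A B = (let P = pair_alg K A B; e = (\<lambda>a b. basis_elem K (a, b)) in
     {e (a \<oplus>\<^bsub>A\<^esub> a') b \<ominus>\<^bsub>P\<^esub> (e a b \<oplus>\<^bsub>P\<^esub> e a' b) | a a' b.
        a \<in> carrier A \<and> a' \<in> carrier A \<and> b \<in> carrier B}
   \<union> {e a (b \<oplus>\<^bsub>B\<^esub> b') \<ominus>\<^bsub>P\<^esub> (e a b \<oplus>\<^bsub>P\<^esub> e a b') | a b b'.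
        a \<in> carrier A \<and> b \<in> carrier B \<and> b' \<in> carrier B}
   \<union> {e (s \<odot>\<^bsub>A\<^esub> a) b \<ominus>\<^bsub>P\<^esub> s \<odot>\<^bsub>P\<^esub> e a b | s a b.
        s \<in> carrier K \<and> a \<in> carrier A \<and> b \<in> carrier B}
   \<union> {e a (s \<odot>\<^bsub>B\<^esub> b) \<ominus>\<^bsub>P\<^esub> s \<odot>\<^bsub>P\<^esub> e a b | s a b.
        s \<in> carrier K \<and> a \<in> carrier A \<and> b \<in> carrier B})"

definition tensor :: "'k ring \<Rightarrow> ('k, 'a) module \<Rightarrow> ('k, 'b) module
    \<Rightarrow> ('k, ('k, 'a, 'b) tens) module" where
  "tensor K A B = alg_quot (pair_alg K A B) (bilin_rels K A B)"

text \<open>Pure tensors.\<close>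

definition tens :: "'k ring \<Rightarrow> ('k, 'a) module \<Rightarrow> ('k, 'b) module \<Rightarrow> 'a \<Rightarrow> 'b \<Rightarrow> ('k, 'a, 'b) tens" where
  "tens K A B a b = quot_proj (pair_alg K A B) (bilin_rels K A B) (basis_elem K (a, b))"

text \<open>
  \<open>tens_lift K D f\<close> is the linear map into \<open>D\<close> sending \<open>a \<otimes> b\<close> to \<open>f a b\<close>. It is meaningful
  when \<open>f\<close> is bilinear; then the sum below does not depend on the representative \<open>p\<close> of the
  class \<open>t\<close>. It is the formal counterpart of writing a formula for a general element
  \<open>x \<otimes> y\<close> with the summation suppressed.
\<close>

definition tens_lift :: "'k ring \<Rightarrow> ('k, 'd) module \<Rightarrow> ('a \<Rightarrow> 'b \<Rightarrow> 'd) \<Rightarrow> ('k, 'a, 'b) tens \<Rightarrow> 'd" where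
  "tens_lift K D f t = (THE z. \<forall>p\<in>t. z = lin_ext K D (\<lambda>(a, b). f a b) p)"


section \<open>Hopf algebras\<close>

text \<open>
  Coalgebra structures are given by \<open>\<Delta>\<close> and \<open>\<epsilon>\<close>; the antipode is unique and is automatically
  preserved by bialgebra morphisms, so its existence is stated as a property. In the
  coassociativity axiom the left-hand side is \<open>(\<Delta> \<otimes> id) \<circ> \<Delta>\<close> rebracketed to
  \<open>A \<otimes> (A \<otimes> A)\<close>.
\<close>

definition hopf_algebra :: "'k ring \<Rightarrow> ('k, 'a) module \<Rightarrow> ('a \<Rightarrow> ('k, 'a, 'a) tens) \<Rightarrow> ('a \<Rightarrow> 'k) \<Rightarrow> bool"
  where
  "hopf_algebra K A \<Delta> \<epsilon> \<longleftrightarrow>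
     k_algebra K A
   \<and> \<Delta> \<in> alg_hom K A (tensor K A A)
   \<and> \<epsilon> \<in> alg_hom K A (base_alg K)
   \<and> (\<forall>x\<in>carrier A. let T = tensor K A (tensor K A A) in
        tens_lift K T (\<lambda>a b. tens_lift K T
            (\<lambda>u v. tens K A (tensor K A A) u (tens K A A v b)) (\<Delta> a)) (\<Delta> x)
      = tens_lift K T (\<lambda>a b. tens K A (tensor K A A) a (\<Delta> b)) (\<Delta> x))
   \<and> (\<forall>x\<in>carrier A. tens_lift K A (\<lambda>a b. \<epsilon> a \<odot>\<^bsub>A\<^esub> b) (\<Delta> x) = x
                    \<and> tens_lift K A (\<lambda>a b. \<epsilon> b \<odot>\<^bsub>A\<^esub> a) (\<Delta> x) = x)
   \<and> (\<exists>S\<in>lin_maps K A A. \<forall>x\<in>carrier A.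
          tens_lift K A (\<lambda>a b. S a \<otimes>\<^bsub>A\<^esub> b) (\<Delta> x) = \<epsilon> x \<odot>\<^bsub>A\<^esub> \<one>\<^bsub>A\<^esub>
        \<and> tens_lift K A (\<lambda>a b. a \<otimes>\<^bsub>A\<^esub> S b) (\<Delta> x) = \<epsilon> x \<odot>\<^bsub>A\<^esub> \<one>\<^bsub>A\<^esub>)"

definition hopf_group_likes :: "'k ring \<Rightarrow> ('k, 'a) module \<Rightarrow> ('a \<Rightarrow> ('k, 'a, 'a) tens) \<Rightarrow> ('a \<Rightarrow> 'k)
    \<Rightarrow> 'a set" where
  "hopf_group_likes K A \<Delta> \<epsilon> = {x \<in> carrier A. \<Delta> x = tens K A A x x \<and> \<epsilon> x = \<one>\<^bsub>K\<^esub>}"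

definition hopf_hom :: "'k ring \<Rightarrow> ('k, 'a) module \<Rightarrow> ('a \<Rightarrow> ('k, 'a, 'a) tens) \<Rightarrow> ('a \<Rightarrow> 'k)
    \<Rightarrow> ('k, 'b) module \<Rightarrow> ('b \<Rightarrow> ('k, 'b, 'b) tens) \<Rightarrow> ('b \<Rightarrow> 'k) \<Rightarrow> ('a \<Rightarrow> 'b) set" where
  "hopf_hom K A \<Delta>A \<epsilon>A B \<Delta>B \<epsilon>B =
    {f \<in> alg_hom K A B. \<forall>x\<in>carrier A.
        \<Delta>B (f x) = tens_lift K (tensor K B B) (\<lambda>a b. tens K B B (f a) (f b)) (\<Delta>A x)
      \<and> \<epsilon>B (f x) = \<epsilon>A x}"

definition hopf_iso :: "'k ring \<Rightarrow> ('k, 'a) module \<Rightarrow> ('a \<Rightarrow> ('k, 'a, 'a) tens) \<Rightarrow> ('a \<Rightarrow> 'k)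
    \<Rightarrow> ('k, 'b) module \<Rightarrow> ('b \<Rightarrow> ('k, 'b, 'b) tens) \<Rightarrow> ('b \<Rightarrow> 'k) \<Rightarrow> ('a \<Rightarrow> 'b) set" where
  "hopf_iso K A \<Delta>A \<epsilon>A B \<Delta>B \<epsilon>B =
    {f \<in> hopf_hom K A \<Delta>A \<epsilon>A B \<Delta>B \<epsilon>B. bij_betw f (carrier A) (carrier B)}"


section \<open>Hopf-Galois algebras\<close>

text \<open>\<open>R \<otimes> R\<^sup>o\<^sup>p \<otimes> R\<close>, bracketed to the right, its pure tensors, and trilinear formulas.\<close>

type_synonym ('k, 'a) tens3 = "('k, 'a, ('k, 'a, 'a) tens) tens"

definition tensor3 :: "'k ring \<Rightarrow> ('k, 'a) module \<Rightarrow> ('k, ('k, 'a) tens3) module" where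
  "tensor3 K R = tensor K R (tensor K (opp R) R)"

definition tens3 :: "'k ring \<Rightarrow> ('k, 'a) module \<Rightarrow> 'a \<Rightarrow> 'a \<Rightarrow> 'a \<Rightarrow> ('k, 'a) tens3" where
  "tens3 K R a b c = tens K R (tensor K (opp R) R) a (tens K (opp R) R b c)"

definition tens3_lift :: "'k ring \<Rightarrow> ('k, 'd) module \<Rightarrow> ('a \<Rightarrow> 'a \<Rightarrow> 'a \<Rightarrow> 'd) \<Rightarrow> ('k, 'a) tens3 \<Rightarrow> 'd" where
  "tens3_lift K D f t = tens_lift K D (\<lambda>a u. tens_lift K D (\<lambda>b c. f a b c) u) t"

text \<open>\<open>R \<otimes> R\<^sup>o\<^sup>p \<otimes> (R \<otimes> R\<^sup>o\<^sup>p \<otimes> R)\<close>\<close>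

definition tensor5 :: "'k ring \<Rightarrow> ('k, 'a) module \<Rightarrow> ('k, ('k, 'a, ('k, 'a, ('k, 'a) tens3) tens) tens) module" where
  "tensor5 K R = tensor K R (tensor K (opp R) (tensor3 K R))"

definition tens5 :: "'k ring \<Rightarrow> ('k, 'a) module \<Rightarrow> 'a \<Rightarrow> 'a \<Rightarrow> ('k, 'a) tens3
    \<Rightarrow> ('k, 'a, ('k, 'a, ('k, 'a) tens3) tens) tens" where
  "tens5 K R a b t = tens K R (tensor K (opp R) (tensor3 K R)) a (tens K (opp R) (tensor3 K R) b t)"

text \<open>
  In \<open>hopf_galois\<close>, \<open>\<lambda>a b c. \<dots>\<close> binds the Sweedler components \<open>r\<^sub>(\<^sub>1\<^sub>)\<close>, \<open>r\<^sub>(\<^sub>2\<^sub>)\<close>, \<open>r\<^sub>(\<^sub>3\<^sub>)\<close> of \<open>\<mu> r\<close>.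
  The products \<open>a b\<close> and \<open>b c\<close> are products in \<open>R\<close>.
\<close>

definition hopf_galois :: "'k ring \<Rightarrow> ('k, 'a) module \<Rightarrow> ('a \<Rightarrow> ('k, 'a) tens3) \<Rightarrow> bool" where
  "hopf_galois K R \<mu> \<longleftrightarrow>
     k_algebra K R \<and> \<one>\<^bsub>R\<^esub> \<noteq> \<zero>\<^bsub>R\<^esub>
   \<and> \<mu> \<in> alg_hom K R (tensor3 K R)
   \<and> (\<forall>r\<in>carrier R.
        tens3_lift K (tensor5 K R) (\<lambda>a b c. tens3_lift K (tensor5 K R)
            (\<lambda>u v w. tens5 K R u v (tens3 K R w b c)) (\<mu> a)) (\<mu> r)
      = tens3_lift K (tensor5 K R) (\<lambda>a b c. tens5 K R a b (\<mu> c)) (\<mu> r))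
   \<and> (\<forall>r\<in>carrier R.
        tens3_lift K (tensor K R R) (\<lambda>a b c. tens K R R (a \<otimes>\<^bsub>R\<^esub> b) c) (\<mu> r) = tens K R R \<one>\<^bsub>R\<^esub> r
      \<and> tens3_lift K (tensor K R R) (\<lambda>a b c. tens K R R a (b \<otimes>\<^bsub>R\<^esub> c)) (\<mu> r) = tens K R R r \<one>\<^bsub>R\<^esub>)"

text \<open>The group of group-like elements, as a subgroup of the group of units.\<close>

definition G0 :: "'k ring \<Rightarrow> ('k, 'a) module \<Rightarrow> ('a \<Rightarrow> ('k, 'a) tens3) \<Rightarrow> 'a monoid" where
  "G0 K R \<mu> = (units_of R)\<lparr>carrier := {g \<in> Units R. \<mu> g = tens3 K R g (inv\<^bsub>R\<^esub> g) g}\<rparr>"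

definition quasi_central :: "'k ring \<Rightarrow> ('k, 'a) module \<Rightarrow> ('a \<Rightarrow> ('k, 'a) tens3) \<Rightarrow> 'a \<Rightarrow> bool" where
  "quasi_central K R \<mu> g \<longleftrightarrow>
     g \<in> carrier (G0 K R \<mu>)
   \<and> (\<exists>\<alpha>\<in>hom (G0 K R \<mu>) (units_of K). \<forall>x\<in>carrier (G0 K R \<mu>).
        x \<otimes>\<^bsub>R\<^esub> g = \<alpha> x \<odot>\<^bsub>R\<^esub> (g \<otimes>\<^bsub>R\<^esub> x))"


subsection \<open>The Hopf algebra of a Hopf-Galois algebra\<close>

text \<open>The ambient algebra \<open>R\<^sup>o\<^sup>p \<otimes> R\<close>.\<close>

abbreviation opR :: "'k ring \<Rightarrow> ('k, 'a) module \<Rightarrow> ('k, ('k, 'a, 'a) tens) module" where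
  "opR K R \<equiv> tensor K (opp R) R"

definition H_alg :: "'k ring \<Rightarrow> ('k, 'a) module \<Rightarrow> ('a \<Rightarrow> ('k, 'a) tens3)
    \<Rightarrow> ('k, ('k, 'a, 'a) tens) module" where
  "H_alg K R \<mu> = (opR K R)\<lparr>carrier := {t \<in> carrier (opR K R).
     tens_lift K (tensor3 K R)
       (\<lambda>x y. tens3_lift K (tensor3 K R) (\<lambda>a b c. tens3 K R (x \<otimes>\<^bsub>R\<^esub> a) b c) (\<mu> y)) t
     = tens K R (opR K R) \<one>\<^bsub>R\<^esub> t}\<rparr>"

text \<open>
  The formula \<open>(x \<otimes> y\<^sub>(\<^sub>1\<^sub>)) \<otimes> (y\<^sub>(\<^sub>2\<^sub>) \<otimes> y\<^sub>(\<^sub>3\<^sub>))\<close> is an element of the tensor square of the ambient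
  algebra \<open>R\<^sup>o\<^sup>p \<otimes> R\<close>. It lies in the image of the tensor square of the subalgebra \<open>H_alg\<close> under
  the (injective) map induced by the inclusion, and \<open>H_\<Delta>\<close> is its preimage.
\<close>

definition H_incl2 :: "'k ring \<Rightarrow> ('k, 'a) module
    \<Rightarrow> ('k, ('k, 'a, 'a) tens, ('k, 'a, 'a) tens) tens
    \<Rightarrow> ('k, ('k, 'a, 'a) tens, ('k, 'a, 'a) tens) tens" where
  "H_incl2 K R = tens_lift K (tensor K (opR K R) (opR K R)) (tens K (opR K R) (opR K R))"

definition H_\<Delta> :: "'k ring \<Rightarrow> ('k, 'a) module \<Rightarrow> ('a \<Rightarrow> ('k, 'a) tens3)
    \<Rightarrow> ('k, 'a, 'a) tens \<Rightarrow> ('k, ('k, 'a, 'a) tens, ('k, 'a, 'a) tens) tens" where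
  "H_\<Delta> K R \<mu> t = (THE u. u \<in> carrier (tensor K (H_alg K R \<mu>) (H_alg K R \<mu>))
     \<and> H_incl2 K R u =
        (let TT = tensor K (opR K R) (opR K R) in
         tens_lift K TT (\<lambda>x y. tens3_lift K TT
           (\<lambda>a b c. tens K (opR K R) (opR K R) (tens K (opp R) R x a) (tens K (opp R) R b c))
           (\<mu> y)) t))"

text \<open>The counit \<open>x \<otimes> y \<mapsto> x y\<close> takes values in the scalar multiples of the unit of \<open>R\<close>.\<close>

definition H_\<epsilon> :: "'k ring \<Rightarrow> ('k, 'a) module \<Rightarrow> ('k, 'a, 'a) tens \<Rightarrow> 'k" where
  "H_\<epsilon> K R t = (THE s. s \<in> carrier K \<and> s \<odot>\<^bsub>R\<^esub> \<one>\<^bsub>R\<^esub> = tens_lift K R (\<lambda>x y. x \<otimes>\<^bsub>R\<^esub> y) t)"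


section \<open>Generalized ambiskew polynomial algebras\<close>

definition free_monoid :: "'g set \<Rightarrow> 'g list monoid" where
  "free_monoid S = \<lparr>carrier = lists S, mult = (@), one = []\<rparr>"

definition free_alg :: "'k ring \<Rightarrow> 'g set \<Rightarrow> ('k, 'g list \<Rightarrow> 'k) module" where
  "free_alg K S = monoid_alg K (free_monoid S)"

text \<open>
  The free product (coproduct) of the algebras \<open>A\<close> and \<open>B\<close>: the free algebra on the disjoint union
  of their carriers, modulo the relators making both insertions algebra homomorphisms.
\<close>

definition insertion_rels :: "'k ring \<Rightarrow> ('k, 'g list \<Rightarrow> 'k) module \<Rightarrow> ('k, 'a) module \<Rightarrow> ('a \<Rightarrow> 'g)
    \<Rightarrow> ('g list \<Rightarrow> 'k) set" where
  "insertion_rels K F A j = (let e = (\<lambda>a. basis_elem K [j a]) in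
     {e (a \<oplus>\<^bsub>A\<^esub> b) \<ominus>\<^bsub>F\<^esub> (e a \<oplus>\<^bsub>F\<^esub> e b) | a b. a \<in> carrier A \<and> b \<in> carrier A}
   \<union> {e (s \<odot>\<^bsub>A\<^esub> a) \<ominus>\<^bsub>F\<^esub> s \<odot>\<^bsub>F\<^esub> e a | s a. s \<in> carrier K \<and> a \<in> carrier A}
   \<union> {e (a \<otimes>\<^bsub>A\<^esub> b) \<ominus>\<^bsub>F\<^esub> e a \<otimes>\<^bsub>F\<^esub> e b | a b. a \<in> carrier A \<and> b \<in> carrier A}
   \<union> {e \<one>\<^bsub>A\<^esub> \<ominus>\<^bsub>F\<^esub> \<one>\<^bsub>F\<^esub>})"

definition free_product_base :: "'k ring \<Rightarrow> ('k, 'a) module \<Rightarrow> ('k, 'b) module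
    \<Rightarrow> ('k, ('a + 'b) list \<Rightarrow> 'k) module" where
  "free_product_base K A B = free_alg K (carrier A <+> carrier B)"

definition free_product_rels :: "'k ring \<Rightarrow> ('k, 'a) module \<Rightarrow> ('k, 'b) module
    \<Rightarrow> (('a + 'b) list \<Rightarrow> 'k) set" where
  "free_product_rels K A B =
     insertion_rels K (free_product_base K A B) A Inl \<union> insertion_rels K (free_product_base K A B) B Inr"

definition free_product :: "'k ring \<Rightarrow> ('k, 'a) module \<Rightarrow> ('k, 'b) module
    \<Rightarrow> ('k, (('a + 'b) list \<Rightarrow> 'k) set) module" where
  "free_product K A B = alg_quot (free_product_base K A B) (free_product_rels K A B)"

definition free_product_inl :: "'k ring \<Rightarrow> ('k, 'a) module \<Rightarrow> ('k, 'b) module \<Rightarrow> 'a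
    \<Rightarrow> (('a + 'b) list \<Rightarrow> 'k) set" where
  "free_product_inl K A B a =
     quot_proj (free_product_base K A B) (free_product_rels K A B) (basis_elem K [Inl a])"

definition free_product_inr :: "'k ring \<Rightarrow> ('k, 'a) module \<Rightarrow> ('k, 'b) module \<Rightarrow> 'b
    \<Rightarrow> (('a + 'b) list \<Rightarrow> 'k) set" where
  "free_product_inr K A B b =
     quot_proj (free_product_base K A B) (free_product_rels K A B) (basis_elem K [Inr b])"

datatype xy = VX | VY

type_synonym ('k, 'a) fp_xy = "(('a + (xy list \<Rightarrow> 'k)) list \<Rightarrow> 'k) set"

type_synonym ('k, 'a) amb = "('k, 'a) fp_xy set"

definition ambiskew_data :: "'k ring \<Rightarrow> ('k, 'a) module \<Rightarrow> ('a \<Rightarrow> 'a) \<Rightarrow> ('a \<Rightarrow> 'a) \<Rightarrow> 'a \<Rightarrow> 'k \<Rightarrow> bool" where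
  "ambiskew_data K R \<tau> \<omega> c \<xi> \<longleftrightarrow>
     k_algebra K R
   \<and> \<tau> \<in> alg_auto K R \<and> \<omega> \<in> alg_auto K R \<and> (\<forall>r\<in>carrier R. \<tau> (\<omega> r) = \<omega> (\<tau> r))
   \<and> c \<in> carrier R \<and> (\<forall>r\<in>carrier R. c \<otimes>\<^bsub>R\<^esub> r = \<tau> (\<omega> r) \<otimes>\<^bsub>R\<^esub> c)
   \<and> \<xi> \<in> carrier K - {\<zero>\<^bsub>K\<^esub>}"

definition ambiskew_rels :: "'k ring \<Rightarrow> ('k, 'a) module \<Rightarrow> ('a \<Rightarrow> 'a) \<Rightarrow> ('a \<Rightarrow> 'a) \<Rightarrow> 'a \<Rightarrow> 'k
    \<Rightarrow> ('k, 'a) fp_xy set" where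
  "ambiskew_rels K R \<tau> \<omega> c \<xi> =
     (let L = free_alg K (UNIV :: xy set); P = free_product K R L;
          i = free_product_inl K R L;
          X = free_product_inr K R L (basis_elem K [VX]);
          Y = free_product_inr K R L (basis_elem K [VY]) in
       {X \<otimes>\<^bsub>P\<^esub> i r \<ominus>\<^bsub>P\<^esub> i (\<tau> r) \<otimes>\<^bsub>P\<^esub> X | r. r \<in> carrier R}
     \<union> {Y \<otimes>\<^bsub>P\<^esub> i r \<ominus>\<^bsub>P\<^esub> i (\<omega> r) \<otimes>\<^bsub>P\<^esub> Y | r. r \<in> carrier R}
     \<union> {(X \<otimes>\<^bsub>P\<^esub> Y \<ominus>\<^bsub>P\<^esub> \<xi> \<odot>\<^bsub>P\<^esub> (Y \<otimes>\<^bsub>P\<^esub> X)) \<ominus>\<^bsub>P\<^esub> i c})"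

definition ambiskew :: "'k ring \<Rightarrow> ('k, 'a) module \<Rightarrow> ('a \<Rightarrow> 'a) \<Rightarrow> ('a \<Rightarrow> 'a) \<Rightarrow> 'a \<Rightarrow> 'k
    \<Rightarrow> ('k, ('k, 'a) amb) module" where
  "ambiskew K R \<tau> \<omega> c \<xi> =
     alg_quot (free_product K R (free_alg K (UNIV :: xy set))) (ambiskew_rels K R \<tau> \<omega> c \<xi>)"

definition amb_in :: "'k ring \<Rightarrow> ('k, 'a) module \<Rightarrow> ('a \<Rightarrow> 'a) \<Rightarrow> ('a \<Rightarrow> 'a) \<Rightarrow> 'a \<Rightarrow> 'k
    \<Rightarrow> 'a \<Rightarrow> ('k, 'a) amb" where
  "amb_in K R \<tau> \<omega> c \<xi> r = (let L = free_alg K (UNIV :: xy set) in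
     quot_proj (free_product K R L) (ambiskew_rels K R \<tau> \<omega> c \<xi>) (free_product_inl K R L r))"

definition amb_var :: "'k ring \<Rightarrow> ('k, 'a) module \<Rightarrow> ('a \<Rightarrow> 'a) \<Rightarrow> ('a \<Rightarrow> 'a) \<Rightarrow> 'a \<Rightarrow> 'k
    \<Rightarrow> xy \<Rightarrow> ('k, 'a) amb" where
  "amb_var K R \<tau> \<omega> c \<xi> v = (let L = free_alg K (UNIV :: xy set) in
     quot_proj (free_product K R L) (ambiskew_rels K R \<tau> \<omega> c \<xi>)
       (free_product_inr K R L (basis_elem K [v])))"


section \<open>Admissible sextuples\<close>

definition admissible :: "'k ring \<Rightarrow> ('k, 'a) module \<Rightarrow> ('a \<Rightarrow> ('k, 'a) tens3)
    \<Rightarrow> ('a \<Rightarrow> 'a) \<Rightarrow> ('a \<Rightarrow> 'a) \<Rightarrow> 'a \<Rightarrow> 'a \<Rightarrow> 'a \<Rightarrow> 'k \<Rightarrow> bool" where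
  "admissible K R \<mu> \<tau> \<omega> g h c \<xi> \<longleftrightarrow>
     (let T = tensor3 K R; t3 = tens3 K R; lift = tens3_lift K T in
      ambiskew_data K R \<tau> \<omega> c \<xi>
    \<and> (\<forall>\<rho>\<in>{\<tau>, \<omega>}. \<forall>r\<in>carrier R.
          \<mu> (\<rho> r) = lift (\<lambda>a b d. t3 (\<rho> a) b d) (\<mu> r)
        \<and> \<mu> (\<rho> r) = lift (\<lambda>a b d. t3 (\<rho> a) (\<rho> b) (\<rho> d)) (\<mu> r))
    \<and> quasi_central K R \<mu> g \<and> quasi_central K R \<mu> h
    \<and> (\<forall>r\<in>carrier R.
          lift (\<lambda>a b d. t3 (conj_by R g a) (conj_by R g b) d) (\<mu> r)
            = lift (\<lambda>a b d. t3 (\<tau> a) (\<tau> b) d) (\<mu> r)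
        \<and> lift (\<lambda>a b d. t3 (conj_by R h a) (conj_by R h b) d) (\<mu> r)
            = lift (\<lambda>a b d. t3 (\<omega> a) (\<omega> b) d) (\<mu> r))
    \<and> \<tau> h = \<xi> \<odot>\<^bsub>R\<^esub> h \<and> \<omega> g = inv\<^bsub>K\<^esub> \<xi> \<odot>\<^bsub>R\<^esub> g
    \<and> \<mu> c = (t3 c \<one>\<^bsub>R\<^esub> \<one>\<^bsub>R\<^esub>
               \<ominus>\<^bsub>T\<^esub> t3 (g \<otimes>\<^bsub>R\<^esub> h) (inv\<^bsub>R\<^esub> (g \<otimes>\<^bsub>R\<^esub> h) \<otimes>\<^bsub>R\<^esub> c) \<one>\<^bsub>R\<^esub>)
               \<oplus>\<^bsub>T\<^esub> t3 (g \<otimes>\<^bsub>R\<^esub> h) (inv\<^bsub>R\<^esub> (g \<otimes>\<^bsub>R\<^esub> h)) c)"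

text \<open>
  \<open>\<mu>A\<close> is the Hopf-Galois structure on the ambiskew algebra extending \<open>\<mu>\<close> with the prescribed
  values at \<open>X\<close> and \<open>Y\<close>; it is determined by these conditions on the carrier of the algebra.
\<close>

definition associated_hopf_galois :: "'k ring \<Rightarrow> ('k, 'a) module \<Rightarrow> ('a \<Rightarrow> ('k, 'a) tens3)
    \<Rightarrow> ('a \<Rightarrow> 'a) \<Rightarrow> ('a \<Rightarrow> 'a) \<Rightarrow> 'a \<Rightarrow> 'a \<Rightarrow> 'a \<Rightarrow> 'k
    \<Rightarrow> (('k, 'a) amb \<Rightarrow> ('k, ('k, 'a) amb) tens3) \<Rightarrow> bool" where
  "associated_hopf_galois K R \<mu> \<tau> \<omega> g h c \<xi> \<mu>A \<longleftrightarrow>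
     (let A = ambiskew K R \<tau> \<omega> c \<xi>; T = tensor3 K A; t3 = tens3 K A;
          i = amb_in K R \<tau> \<omega> c \<xi>;
          skew_primitive = (\<lambda>g x. \<mu>A x =
             (t3 x \<one>\<^bsub>A\<^esub> \<one>\<^bsub>A\<^esub> \<ominus>\<^bsub>T\<^esub> t3 (i g) (i (inv\<^bsub>R\<^esub> g) \<otimes>\<^bsub>A\<^esub> x) \<one>\<^bsub>A\<^esub>)
               \<oplus>\<^bsub>T\<^esub> t3 (i g) (i (inv\<^bsub>R\<^esub> g)) x) in
      hopf_galois K A \<mu>A
    \<and> (\<forall>r\<in>carrier R. \<mu>A (i r) = tens3_lift K T (\<lambda>a b d. t3 (i a) (i b) (i d)) (\<mu> r))
    \<and> skew_primitive g (amb_var K R \<tau> \<omega> c \<xi> VX)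
    \<and> skew_primitive h (amb_var K R \<tau> \<omega> c \<xi> VY))"

end

theory Submission
  imports Defs
begin

text \<open>
  A linear functional \<open>f\<close> on \<open>R\<close> with \<open>f 1 = 1\<close> gives the projection
  \<open>x \<otimes> y \<mapsto> f (x y\<^sub>1) y\<^sub>2 \<otimes> y\<^sub>3\<close> of \<open>R\<^sup>o\<^sup>p \<otimes> R\<close> onto \<open>H = H(R)\<close>, which makes the comultiplication, the
  antipode and the coaction \<open>r \<mapsto> r\<^sub>1 \<otimes> (r\<^sub>2 \<otimes> r\<^sub>3)\<close> of \<open>H\<close> on \<open>R\<close> explicit.

  Let \<open>A\<close> be the ambiskew algebra over \<open>R\<close> and \<open>B\<close> the one over \<open>H\<close>. The elements
  \<open>g\<^sup>-\<^sup>1 \<otimes> X - g\<^sup>-\<^sup>1 X \<otimes> 1\<close> and \<open>h\<^sup>-\<^sup>1 \<otimes> Y - h\<^sup>-\<^sup>1 Y \<otimes> 1\<close> of \<open>H(A)\<close> satisfy the relations of \<open>E\<close> and \<open>F\<close>,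
  whence an algebra map \<open>\<psi>: B \<rightarrow> H(A)\<close>. No basis of \<open>A\<close> or \<open>B\<close> is needed to invert it: the coaction of
  \<open>H\<close> extends to an algebra map \<open>\<rho>: A \<rightarrow> A \<otimes> B\<close> with \<open>X \<mapsto> X \<otimes> 1 + g \<otimes> E\<close> and
  \<open>Y \<mapsto> Y \<otimes> 1 + h \<otimes> F\<close>, and \<open>(id \<otimes> \<psi>) \<rho>\<close> is the Hopf-Galois structure \<open>\<mu>\<close> of \<open>A\<close>. The map
  \<open>m (y \<otimes> z) = (y \<otimes> 1) \<rho>(z)\<close> sends \<open>\<psi> b\<close> to \<open>1 \<otimes> b\<close>, and \<open>(id \<otimes> \<psi>) m\<close> sends \<open>u \<in> H(A)\<close> to
  \<open>1 \<otimes> u\<close>, so \<open>m\<close> followed by a functional on \<open>A\<close> with value 1 at 1 is the inverse of \<open>\<psi>\<close>. The Hopf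
  structure of \<open>B\<close> is transported from \<open>H(A)\<close> along \<open>\<psi>\<close>.
\<close>

section \<open>Linear maps and finite sums\<close>

text \<open>The elements E and F come from reading \<mu>(X) = X \<otimes> 1 \<otimes> 1 + g
  \<otimes> E0 with E0 = g^{-1} \<otimes> X - g^{-1} X \<otimes> 1; in the same way \<mu>(c) = c
  \<otimes> 1 \<otimes> 1 + gh \<otimes> c', which is the origin of c'. The constant \<xi>' balances
  three scalars: X passes h^{-1} with factor \<xi>^{-1}, Y passes g^{-1} with factor \<xi>, and
  g^{-1} h^{-1} is \<lambda> times h^{-1} g^{-1}. The commutation of E0 with H needs more than X r =
  \<tau>(r) X: one term of the two products differs by \<tau> \<otimes> \<tau>, which is the
  identity on H because the two expressions for \<mu>(\<tau>(r)) agree. The obstacle that shapes the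
  development is formal. A tensor is a coset, a map out of a tensor product is a definite
  description, and the description is meaningful only for bilinear arguments. Hence a Sweedler
  computation is a chain of equalities of linear maps tested on pure tensors, and each link carries
  multilinearity obligations. The brackets \<open>M\<close> and \<open>L\<close> and the rules
  \<open>lin_intros\<close> make such chains routine.\<close>

lemma k_algebraD:
  assumes "k_algebra K A"
  shows "field K" "ring A" "module K A" "abelian_group A" "abelian_monoid A" "monoid A" "cring K"
    "ring K" "abelian_monoid K"
proof -
  interpret k_algebra K A by fact
  show "field K" "ring A" "module K A" "abelian_group A" "abelian_monoid A" "monoid A" "cring K"
    "ring K" "abelian_monoid K" by unfold_locales
qed

lemma k_algebraI:
  assumes "field K" "ring A"
    and "\<And>s x. s \<in> carrier K \<Longrightarrow> x \<in> carrier A \<Longrightarrow> s \<odot>\<^bsub>A\<^esub> x \<in> carrier A"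
    and "\<And>s t x. s \<in> carrier K \<Longrightarrow> t \<in> carrier K \<Longrightarrow> x \<in> carrier A \<Longrightarrow>
      (s \<oplus>\<^bsub>K\<^esub> t) \<odot>\<^bsub>A\<^esub> x = s \<odot>\<^bsub>A\<^esub> x \<oplus>\<^bsub>A\<^esub> t \<odot>\<^bsub>A\<^esub> x"
    and "\<And>s x y. s \<in> carrier K \<Longrightarrow> x \<in> carrier A \<Longrightarrow> y \<in> carrier A \<Longrightarrow>
      s \<odot>\<^bsub>A\<^esub> (x \<oplus>\<^bsub>A\<^esub> y) = s \<odot>\<^bsub>A\<^esub> x \<oplus>\<^bsub>A\<^esub> s \<odot>\<^bsub>A\<^esub> y"
    and "\<And>s t x. s \<in> carrier K \<Longrightarrow> t \<in> carrier K \<Longrightarrow> x \<in> carrier A \<Longrightarrow>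
      (s \<otimes>\<^bsub>K\<^esub> t) \<odot>\<^bsub>A\<^esub> x = s \<odot>\<^bsub>A\<^esub> (t \<odot>\<^bsub>A\<^esub> x)"
    and "\<And>x. x \<in> carrier A \<Longrightarrow> \<one>\<^bsub>K\<^esub> \<odot>\<^bsub>A\<^esub> x = x"
    and "\<And>s x y. s \<in> carrier K \<Longrightarrow> x \<in> carrier A \<Longrightarrow> y \<in> carrier A \<Longrightarrow>
      (s \<odot>\<^bsub>A\<^esub> x) \<otimes>\<^bsub>A\<^esub> y = s \<odot>\<^bsub>A\<^esub> (x \<otimes>\<^bsub>A\<^esub> y)"
    and "\<And>s x y. s \<in> carrier K \<Longrightarrow> x \<in> carrier A \<Longrightarrow> y \<in> carrier A \<Longrightarrow>
      x \<otimes>\<^bsub>A\<^esub> (s \<odot>\<^bsub>A\<^esub> y) = s \<odot>\<^bsub>A\<^esub> (x \<otimes>\<^bsub>A\<^esub> y)"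
  shows "k_algebra K A"
proof -
  interpret K: field K by fact
  interpret A: ring A by fact
  have "module K A"
    by (rule moduleI[OF K.is_cring A.is_abelian_group]) (use assms in auto)
  then show ?thesis
    by (intro k_algebra.intro k_algebra_axioms.intro assms)
qed

lemma lin_mapsI:
  assumes "\<And>x. x \<in> carrier A \<Longrightarrow> f x \<in> carrier B"
    and "\<And>x y. x \<in> carrier A \<Longrightarrow> y \<in> carrier A \<Longrightarrow> f (x \<oplus>\<^bsub>A\<^esub> y) = f x \<oplus>\<^bsub>B\<^esub> f y"
    and "\<And>s x. s \<in> carrier K \<Longrightarrow> x \<in> carrier A \<Longrightarrow> f (s \<odot>\<^bsub>A\<^esub> x) = s \<odot>\<^bsub>B\<^esub> f x"
  shows "f \<in> lin_maps K A B"
  using assms by (auto simp: lin_maps_def)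

lemma lin_maps_closed: "f \<in> lin_maps K A B \<Longrightarrow> x \<in> carrier A \<Longrightarrow> f x \<in> carrier B"
  and lin_maps_add: "f \<in> lin_maps K A B \<Longrightarrow> x \<in> carrier A \<Longrightarrow> y \<in> carrier A \<Longrightarrow>
    f (x \<oplus>\<^bsub>A\<^esub> y) = f x \<oplus>\<^bsub>B\<^esub> f y"
  and lin_maps_smult: "f \<in> lin_maps K A B \<Longrightarrow> s \<in> carrier K \<Longrightarrow> x \<in> carrier A \<Longrightarrow>
    f (s \<odot>\<^bsub>A\<^esub> x) = s \<odot>\<^bsub>B\<^esub> f x"
  by (auto simp: lin_maps_def)

text \<open>\<open>lin_maps\<close> constrains a function only on the carrier, so linearity passes
  along equality there. The algebra hypothesis keeps sums and multiples inside the carrier, where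
  the two functions can be exchanged.\<close>

lemma lin_maps_cong:
  "f \<in> lin_maps K A B \<Longrightarrow> (\<And>x. x \<in> carrier A \<Longrightarrow> f x = g x) \<Longrightarrow> k_algebra K A \<Longrightarrow> g \<in> lin_maps K A B"
  by (rule lin_mapsI)
    (auto simp: lin_maps_def Pi_iff k_algebraD(5)[THEN abelian_monoid.a_closed]
      k_algebraD(3)[THEN module.smult_closed])

lemma lin_maps_id: "(\<lambda>x. x) \<in> lin_maps K A A"
  by (rule lin_mapsI) auto

lemma lin_maps_comp:
  "g \<in> lin_maps K B C \<Longrightarrow> f \<in> lin_maps K A B \<Longrightarrow> (\<lambda>x. g (f x)) \<in> lin_maps K A C"
  by (rule lin_mapsI) (auto simp: lin_maps_def Pi_iff)

lemma lin_maps_zero: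
  assumes "k_algebra K A" "k_algebra K B" "f \<in> lin_maps K A B"
  shows "f \<zero>\<^bsub>A\<^esub> = \<zero>\<^bsub>B\<^esub>"
proof -
  interpret A: k_algebra K A by fact
  interpret B: k_algebra K B by fact
  have "f \<zero>\<^bsub>A\<^esub> = f (\<zero>\<^bsub>K\<^esub> \<odot>\<^bsub>A\<^esub> \<zero>\<^bsub>A\<^esub>)" by simp
  also have "\<dots> = \<zero>\<^bsub>B\<^esub>"
    using lin_maps_smult[OF assms(3), of "\<zero>\<^bsub>K\<^esub>" "\<zero>\<^bsub>A\<^esub>"] lin_maps_closed[OF assms(3)] by simp
  finally show ?thesis .
qed

lemma lin_maps_neg:
  assumes "k_algebra K A" "k_algebra K B" "f \<in> lin_maps K A B" "x \<in> carrier A"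
  shows "f (\<ominus>\<^bsub>A\<^esub> x) = \<ominus>\<^bsub>B\<^esub> f x"
proof -
  interpret A: k_algebra K A by fact
  interpret B: k_algebra K B by fact
  have "f (\<ominus>\<^bsub>A\<^esub> x) \<oplus>\<^bsub>B\<^esub> f x = f (\<ominus>\<^bsub>A\<^esub> x \<oplus>\<^bsub>A\<^esub> x)"
    using assms(4) by (simp add: lin_maps_add[OF assms(3)])
  also have "\<dots> = \<zero>\<^bsub>B\<^esub>" using assms(4) by (simp add: A.A.l_neg lin_maps_zero[OF assms(1,2,3)])
  finally show ?thesis
    using assms lin_maps_closed[OF assms(3)] by (metis A.a_inv_closed B.A.minus_equality)
qed

lemma lin_maps_minus:
  assumes "k_algebra K A" "k_algebra K B" "f \<in> lin_maps K A B" "x \<in> carrier A" "y \<in> carrier A"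
  shows "f (x \<ominus>\<^bsub>A\<^esub> y) = f x \<ominus>\<^bsub>B\<^esub> f y"
proof -
  interpret A: k_algebra K A by fact
  show ?thesis
    using assms by (simp add: a_minus_def lin_maps_add[OF assms(3)] lin_maps_neg[OF assms(1-3)])
qed

text \<open>Phrased for additive maps of abelian monoids because it is applied to scalar
  multiplication, to multiplication in the field and to evaluation of functions at a point, also at
  places where no algebra structure has been established yet.\<close>

lemma additive_finsum:
  assumes "abelian_monoid A" "abelian_monoid B" "finite S" "g \<in> S \<rightarrow> carrier A"
    and "\<And>x. x \<in> carrier A \<Longrightarrow> f x \<in> carrier B"
    and "\<And>x y. x \<in> carrier A \<Longrightarrow> y \<in> carrier A \<Longrightarrow> f (x \<oplus>\<^bsub>A\<^esub> y) = f x \<oplus>\<^bsub>B\<^esub> f y"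
    and "f \<zero>\<^bsub>A\<^esub> = \<zero>\<^bsub>B\<^esub>"
  shows "f (finsum A g S) = finsum B (\<lambda>i. f (g i)) S"
proof -
  interpret A: abelian_monoid A by fact
  interpret B: abelian_monoid B by fact
  from assms(3,4) show ?thesis
  proof (induction S)
    case empty
    then show ?case using assms(7) by simp
  next
    case (insert x F)
    then have g: "g \<in> F \<rightarrow> carrier A" "g x \<in> carrier A" by auto
    then have "(\<lambda>i. f (g i)) \<in> F \<rightarrow> carrier B" using assms(5) by (auto simp: Pi_iff)
    then show ?case using insert g assms(5,6)
      by (simp add: A.finsum_insert[OF insert(1,2) g] B.finsum_insert A.finsum_closed)
  qed
qed

lemma base_alg_simps [simp]:
  "carrier (base_alg K) = carrier K" "mult (base_alg K) = mult K" "one (base_alg K) = one K"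
  "zero (base_alg K) = zero K" "add (base_alg K) = add K" "smult (base_alg K) = mult K"
  by (simp_all add: base_alg_def ring.defs module.defs)

lemma k_algebra_base:
  assumes "field K"
  shows "k_algebra K (base_alg K)"
proof -
  interpret K: field K by fact
  have ab: "abelian_group (base_alg K)"
    by (rule abelian_groupI) (auto simp: K.a_ac intro: K.l_neg)
  have "monoid (base_alg K)" by (rule monoidI) (auto simp: K.m_assoc)
  with ab have "ring (base_alg K)"
    by (rule ringI) (auto simp: K.l_distr K.r_distr)
  with assms show ?thesis
    by (rule k_algebraI) (auto simp: K.l_distr K.r_distr K.m_ac)
qed

text \<open>\<open>finsum\<close> depends on the whole record, so the two sums are different terms
  although carrier and operations coincide; the identity is an additive map between the two
  records.\<close>

lemma finsum_base_alg:
  assumes "field K" "finite S" "g \<in> S \<rightarrow> carrier K"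
  shows "finsum (base_alg K) g S = finsum K g S"
proof -
  interpret K: field K by fact
  interpret B: k_algebra K "base_alg K" using k_algebra_base assms(1) .
  have "abelian_monoid (base_alg K)" "abelian_monoid K" by unfold_locales
  from additive_finsum[OF this assms(2), of g "\<lambda>x. x"] assms(3)
  show ?thesis by auto
qed

section \<open>Monoid algebras\<close>

lemma monoid_alg_simps [simp]:
  "add (monoid_alg K M) p q = (\<lambda>m. p m \<oplus>\<^bsub>K\<^esub> q m)"
  "zero (monoid_alg K M) = (\<lambda>m. \<zero>\<^bsub>K\<^esub>)"
  "smult (monoid_alg K M) s p = (\<lambda>m. s \<otimes>\<^bsub>K\<^esub> p m)"
  by (simp_all add: monoid_alg_def)

lemma monoid_alg_one: "one (monoid_alg K M) = basis_elem K \<one>\<^bsub>M\<^esub>"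
  by (simp add: monoid_alg_def basis_elem_def)

lemma monoid_alg_carrier:
  "p \<in> carrier (monoid_alg K M) \<longleftrightarrow>
    (\<forall>m. p m \<in> carrier K) \<and> finite {m. p m \<noteq> \<zero>\<^bsub>K\<^esub>} \<and> {m. p m \<noteq> \<zero>\<^bsub>K\<^esub>} \<subseteq> carrier M"
  by (simp add: monoid_alg_def)

locale field_monoid = K?: field K + M?: monoid M for K :: "'k ring" and M :: "'m monoid"
begin

abbreviation "P \<equiv> monoid_alg K M"
abbreviation "e \<equiv> basis_elem K"

lemma carrierD:
  assumes "p \<in> carrier P"
  shows "p m \<in> carrier K" "finite {m. p m \<noteq> \<zero>\<^bsub>K\<^esub>}" "p m \<noteq> \<zero>\<^bsub>K\<^esub> \<Longrightarrow> m \<in> carrier M"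
  using assms by (auto simp: monoid_alg_carrier)

lemma add_closedP:
  assumes "p \<in> carrier P" "q \<in> carrier P"
  shows "p \<oplus>\<^bsub>P\<^esub> q \<in> carrier P"
proof -
  have "{m. p m \<oplus>\<^bsub>K\<^esub> q m \<noteq> \<zero>\<^bsub>K\<^esub>} \<subseteq> {m. p m \<noteq> \<zero>\<^bsub>K\<^esub>} \<union> {m. q m \<noteq> \<zero>\<^bsub>K\<^esub>}" by auto
  moreover have "finite ({m. p m \<noteq> \<zero>\<^bsub>K\<^esub>} \<union> {m. q m \<noteq> \<zero>\<^bsub>K\<^esub>})" using assms by (simp add: carrierD)
  ultimately show ?thesis using assms
    unfolding monoid_alg_carrier by (auto intro: finite_subset)
qed

lemma smult_closedP: "s \<in> carrier K \<Longrightarrow> p \<in> carrier P \<Longrightarrow> s \<odot>\<^bsub>P\<^esub> p \<in> carrier P"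
  unfolding monoid_alg_carrier
  by (auto intro: finite_subset[of _ "{m. p m \<noteq> \<zero>\<^bsub>K\<^esub>}"])

lemma basis_closed: "m \<in> carrier M \<Longrightarrow> e m \<in> carrier P"
  by (auto simp: monoid_alg_carrier basis_elem_def)

lemma abelian_group_P: "abelian_group P"
proof (rule abelian_groupI)
  fix p q r assume pq: "p \<in> carrier P" "q \<in> carrier P"
  show "p \<oplus>\<^bsub>P\<^esub> q \<in> carrier P" using pq by (rule add_closedP)
  show "p \<oplus>\<^bsub>P\<^esub> q = q \<oplus>\<^bsub>P\<^esub> p" using pq by (auto simp: carrierD K.a_comm)
  assume "r \<in> carrier P"
  then show "p \<oplus>\<^bsub>P\<^esub> q \<oplus>\<^bsub>P\<^esub> r = p \<oplus>\<^bsub>P\<^esub> (q \<oplus>\<^bsub>P\<^esub> r)"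
    using pq by (auto simp: carrierD K.a_assoc)
next
  show "\<zero>\<^bsub>P\<^esub> \<in> carrier P" by (simp add: monoid_alg_carrier)
next
  fix p assume p: "p \<in> carrier P"
  then show "\<zero>\<^bsub>P\<^esub> \<oplus>\<^bsub>P\<^esub> p = p" by (auto simp: carrierD)
  have "(\<ominus>\<^bsub>K\<^esub> \<one>\<^bsub>K\<^esub>) \<odot>\<^bsub>P\<^esub> p \<in> carrier P" by (rule smult_closedP[OF _ p]) simp
  moreover have "((\<ominus>\<^bsub>K\<^esub> \<one>\<^bsub>K\<^esub>) \<odot>\<^bsub>P\<^esub> p) \<oplus>\<^bsub>P\<^esub> p = \<zero>\<^bsub>P\<^esub>"
    using p by (auto simp: carrierD K.l_neg K.l_minus)
  ultimately show "\<exists>q\<in>carrier P. q \<oplus>\<^bsub>P\<^esub> p = \<zero>\<^bsub>P\<^esub>" by blast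
qed

sublocale P: module K P
  by (rule moduleI[OF K.is_cring abelian_group_P smult_closedP])
    (auto simp: carrierD K.l_distr K.r_distr K.m_assoc)

text \<open>The supports of p, q and p + q differ, so the defining sums run over different sets.
  Summing over a common finite superset makes them comparable.\<close>

lemma lin_ext_superset:
  assumes D: "k_algebra K D" and p: "p \<in> carrier P" and f: "f \<in> carrier M \<rightarrow> carrier D"
    and S: "finite S" "{m. p m \<noteq> \<zero>\<^bsub>K\<^esub>} \<subseteq> S" "S \<subseteq> carrier M"
  shows "lin_ext K D f p = (\<Oplus>\<^bsub>D\<^esub>m\<in>S. p m \<odot>\<^bsub>D\<^esub> f m)"
proof -
  interpret D: k_algebra K D by fact
  show ?thesis unfolding lin_ext_def
    by (rule D.A.add.finprod_mono_neutral_cong_left) (use p f S carrierD[OF p] in \<open>auto simp: Pi_iff\<close>)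
qed

lemma lin_ext_lin:
  assumes D: "k_algebra K D" and f: "f \<in> carrier M \<rightarrow> carrier D"
  shows "lin_ext K D f \<in> lin_maps K P D"
proof -
  interpret D: k_algebra K D by fact
  have f': "f m \<in> carrier D" if "m \<in> carrier M" for m using f that by auto
  show ?thesis
  proof (rule lin_mapsI)
    fix p assume p: "p \<in> carrier P"
    then show "lin_ext K D f p \<in> carrier D"
      unfolding lin_ext_def by (intro D.A.finsum_closed) (auto intro!: D.smult_closed f' dest: carrierD)
    fix q assume q: "q \<in> carrier P"
    let ?S = "{m. p m \<noteq> \<zero>\<^bsub>K\<^esub>} \<union> {m. q m \<noteq> \<zero>\<^bsub>K\<^esub>}"
    have S: "finite ?S" "?S \<subseteq> carrier M" using p q by (auto simp: monoid_alg_carrier)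
    have pq: "p \<oplus>\<^bsub>P\<^esub> q \<in> carrier P" using p q by (rule add_closedP)
    have "{m. (p \<oplus>\<^bsub>P\<^esub> q) m \<noteq> \<zero>\<^bsub>K\<^esub>} \<subseteq> ?S" by auto
    then show "lin_ext K D f (p \<oplus>\<^bsub>P\<^esub> q) = lin_ext K D f p \<oplus>\<^bsub>D\<^esub> lin_ext K D f q"
      using S f p q carrierD[OF p] carrierD[OF q]
      by (subst (1 2 3) lin_ext_superset[OF D _ f S(1) _ S(2)])
        (auto simp: pq[simplified] intro!: D.A.finsum_cong' f' simp: D.smult_l_distr subset_iff Pi_iff
          simp flip: D.A.finsum_addf)
  next
    fix s p assume s: "s \<in> carrier K" and p: "p \<in> carrier P"
    let ?S = "{m. p m \<noteq> \<zero>\<^bsub>K\<^esub>}"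
    have S: "finite ?S" "?S \<subseteq> carrier M" using p by (auto simp: monoid_alg_carrier)
    have sp: "s \<odot>\<^bsub>P\<^esub> p \<in> carrier P" using s p by (rule smult_closedP)
    have fs: "(\<lambda>m. p m \<odot>\<^bsub>D\<^esub> f m) \<in> ?S \<rightarrow> carrier D"
      using S p by (auto intro!: D.smult_closed f' dest: carrierD)
    have "{m. (s \<odot>\<^bsub>P\<^esub> p) m \<noteq> \<zero>\<^bsub>K\<^esub>} \<subseteq> ?S" using s by auto
    then have "lin_ext K D f (s \<odot>\<^bsub>P\<^esub> p) = (\<Oplus>\<^bsub>D\<^esub>m\<in>?S. (s \<odot>\<^bsub>P\<^esub> p) m \<odot>\<^bsub>D\<^esub> f m)"
      by (rule lin_ext_superset[OF D sp f S(1) _ S(2)])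
    also have "\<dots> = (\<Oplus>\<^bsub>D\<^esub>m\<in>?S. s \<odot>\<^bsub>D\<^esub> (p m \<odot>\<^bsub>D\<^esub> f m))"
      using s S(2) carrierD[OF p] fs
      by (intro D.A.finsum_cong') (auto simp: D.smult_assoc1 f' subset_iff)
    also have "\<dots> = s \<odot>\<^bsub>D\<^esub> (\<Oplus>\<^bsub>D\<^esub>m\<in>?S. p m \<odot>\<^bsub>D\<^esub> f m)"
      by (rule additive_finsum[symmetric]) (use S fs s in \<open>auto simp: D.smult_r_distr D.A.abelian_monoid_axioms\<close>)
    also have "\<dots> = s \<odot>\<^bsub>D\<^esub> lin_ext K D f p" by (simp add: lin_ext_def)
    finally show "lin_ext K D f (s \<odot>\<^bsub>P\<^esub> p) = s \<odot>\<^bsub>D\<^esub> lin_ext K D f p" .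
  qed
qed

lemma lin_ext_basis:
  assumes D: "k_algebra K D" and m: "m \<in> carrier M" and f: "f \<in> carrier M \<rightarrow> carrier D"
  shows "lin_ext K D f (e m) = f m"
proof -
  interpret D: k_algebra K D by fact
  have fm: "f m \<in> carrier D" using f m by auto
  have "lin_ext K D f (e m) = (\<Oplus>\<^bsub>D\<^esub>m'\<in>{m}. e m m' \<odot>\<^bsub>D\<^esub> f m')"
    by (rule lin_ext_superset[OF D basis_closed[OF m] f]) (use m in \<open>auto simp: basis_elem_def\<close>)
  also have "\<dots> = f m" using fm by (simp add: D.A.finsum_insert basis_elem_def)
  finally show ?thesis .
qed

lemma finsum_P_apply:
  assumes "finite S" "g \<in> S \<rightarrow> carrier P"
  shows "(finsum P g S) m = (\<Oplus>\<^bsub>K\<^esub>i\<in>S. g i m)"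
  by (rule additive_finsum[where f = "\<lambda>p. p m"])
    (use assms in \<open>auto simp: carrierD P.M.abelian_monoid_axioms K.abelian_monoid_axioms\<close>)

lemma basis_expansion:
  assumes p: "p \<in> carrier P"
  shows "(\<Oplus>\<^bsub>P\<^esub>m\<in>{m. p m \<noteq> \<zero>\<^bsub>K\<^esub>}. p m \<odot>\<^bsub>P\<^esub> e m) = p"
proof (rule ext)
  fix x
  let ?S = "{m. p m \<noteq> \<zero>\<^bsub>K\<^esub>}"
  have "(\<Oplus>\<^bsub>P\<^esub>m\<in>?S. p m \<odot>\<^bsub>P\<^esub> e m) x = (\<Oplus>\<^bsub>K\<^esub>m\<in>?S. (p m \<odot>\<^bsub>P\<^esub> e m) x)"
    by (rule finsum_P_apply) (use p in \<open>auto intro!: smult_closedP[unfolded monoid_alg_simps] basis_closed dest: carrierD\<close>)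
  also have "\<dots> = (\<Oplus>\<^bsub>K\<^esub>m\<in>?S. if x = m then p m else \<zero>\<^bsub>K\<^esub>)"
    by (rule K.finsum_cong') (use carrierD[OF p] in \<open>auto simp: basis_elem_def\<close>)
  also have "\<dots> = p x"
  proof (cases "p x = \<zero>\<^bsub>K\<^esub>")
    case True
    then have "(\<Oplus>\<^bsub>K\<^esub>m\<in>?S. if x = m then p m else \<zero>\<^bsub>K\<^esub>) = (\<Oplus>\<^bsub>K\<^esub>m\<in>?S. \<zero>\<^bsub>K\<^esub>)"
      by (intro K.finsum_cong') auto
    with True show ?thesis by simp
  next
    case False
    then show ?thesis using K.add.finprod_singleton[of x ?S p] carrierD[OF p] by auto
  qed
  finally show "(\<Oplus>\<^bsub>P\<^esub>m\<in>?S. p m \<odot>\<^bsub>P\<^esub> e m) x = p x" .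
qed

text \<open>By \<open>basis_expansion\<close> every element is a finite combination of basis
  elements, and the closure assumptions carry the property through its partial sums.\<close>

lemma P_induct [consumes 1]:
  assumes p: "p \<in> carrier P" and Q0: "Q \<zero>\<^bsub>P\<^esub>"
    and Qe: "\<And>m. m \<in> carrier M \<Longrightarrow> Q (e m)"
    and Qs: "\<And>s q. s \<in> carrier K \<Longrightarrow> q \<in> carrier P \<Longrightarrow> Q q \<Longrightarrow> Q (s \<odot>\<^bsub>P\<^esub> q)"
    and Qa: "\<And>q r. q \<in> carrier P \<Longrightarrow> r \<in> carrier P \<Longrightarrow> Q q \<Longrightarrow> Q r \<Longrightarrow> Q (q \<oplus>\<^bsub>P\<^esub> r)"
  shows "Q p"
proof -
  have *: "Q (\<Oplus>\<^bsub>P\<^esub>m\<in>S. p m \<odot>\<^bsub>P\<^esub> e m)" if "finite S" "S \<subseteq> carrier M" for S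
    using that
  proof (induction S)
    case empty
    then show ?case using Q0 by simp
  next
    case (insert x F)
    have "p m \<odot>\<^bsub>P\<^esub> e m \<in> carrier P" if "m \<in> insert x F" for m
      using that insert by (intro smult_closedP basis_closed carrierD(1)[OF p]) auto
    then show ?case using insert
      by (subst P.M.finsum_insert)
        (auto simp del: monoid_alg_simps intro!: Qa Qs Qe P.M.finsum_closed basis_closed carrierD(1)[OF p])
  qed
  show ?thesis using *[of "{m. p m \<noteq> \<zero>\<^bsub>K\<^esub>}"] p unfolding basis_expansion[OF p]
    by (auto simp: monoid_alg_carrier)
qed

end

section \<open>The convolution product of the monoid algebra\<close>

context field_monoid begin

lemma lin_eq_on_basis:
  assumes D: "k_algebra K D" and F: "F \<in> lin_maps K P D" "G \<in> lin_maps K P D"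
    and eq: "\<And>m. m \<in> carrier M \<Longrightarrow> F (e m) = G (e m)" and p: "p \<in> carrier P"
  shows "F p = G p"
proof -
  interpret D: k_algebra K D by fact
  \<comment> \<open>At this point \<open>P\<close> is only known to be a module, so the general rule
    for the image of zero under linear maps of algebras does not apply yet.\<close>
  have "F \<zero>\<^bsub>P\<^esub> = \<zero>\<^bsub>D\<^esub>" if "F \<in> lin_maps K P D" for F
  proof -
    have "F \<zero>\<^bsub>P\<^esub> = F (\<zero>\<^bsub>K\<^esub> \<odot>\<^bsub>P\<^esub> \<zero>\<^bsub>P\<^esub>)" by simp
    also have "\<dots> = \<zero>\<^bsub>D\<^esub>"
      using lin_maps_smult[OF that, of "\<zero>\<^bsub>K\<^esub>" "\<zero>\<^bsub>P\<^esub>"] lin_maps_closed[OF that P.M.zero_closed] P.M.zero_closed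
      by simp
    finally show ?thesis .
  qed
  from p show ?thesis
    by (induction p rule: P_induct)
      (simp_all only: F \<open>\<And>F. F \<in> lin_maps K P D \<Longrightarrow> F \<zero>\<^bsub>P\<^esub> = \<zero>\<^bsub>D\<^esub>\<close> eq
        lin_maps_add[OF F(1)] lin_maps_add[OF F(2)] lin_maps_smult[OF F(1)] lin_maps_smult[OF F(2)])
qed

lemma mult_supp:
  assumes p: "p \<in> carrier P" and q: "q \<in> carrier P" and m: "(p \<otimes>\<^bsub>P\<^esub> q) m \<noteq> \<zero>\<^bsub>K\<^esub>"
  shows "m \<in> (\<lambda>(x, y). x \<otimes>\<^bsub>M\<^esub> y) ` ({m. p m \<noteq> \<zero>\<^bsub>K\<^esub>} \<times> {m. q m \<noteq> \<zero>\<^bsub>K\<^esub>})"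
proof (rule ccontr)
  assume "\<not> ?thesis"
  then have *: "x \<otimes>\<^bsub>M\<^esub> y \<noteq> m" if "p x \<noteq> \<zero>\<^bsub>K\<^esub>" "q y \<noteq> \<zero>\<^bsub>K\<^esub>" for x y using that by (auto simp: image_iff)
  have "(p \<otimes>\<^bsub>P\<^esub> q) m = (\<Oplus>\<^bsub>K\<^esub>x\<in>{x. p x \<noteq> \<zero>\<^bsub>K\<^esub>}. \<Oplus>\<^bsub>K\<^esub>y\<in>{y. q y \<noteq> \<zero>\<^bsub>K\<^esub>}. \<zero>\<^bsub>K\<^esub>)"
    unfolding monoid_alg_def monoid.simps by (intro K.finsum_cong') (auto intro!: K.finsum_cong' simp: *)
  with m show False by simp
qed

lemma mult_closed:
  assumes p: "p \<in> carrier P" and q: "q \<in> carrier P"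
  shows "p \<otimes>\<^bsub>P\<^esub> q \<in> carrier P"
proof -
  have "(p \<otimes>\<^bsub>P\<^esub> q) m \<in> carrier K" for m
    using p q by (auto simp: monoid_alg_def[of K M] intro!: K.finsum_closed)
  moreover have "{m. (p \<otimes>\<^bsub>P\<^esub> q) m \<noteq> \<zero>\<^bsub>K\<^esub>}
    \<subseteq> (\<lambda>(x, y). x \<otimes>\<^bsub>M\<^esub> y) ` ({m. p m \<noteq> \<zero>\<^bsub>K\<^esub>} \<times> {m. q m \<noteq> \<zero>\<^bsub>K\<^esub>})" (is "_ \<subseteq> ?I")
    using mult_supp[OF p q] by blast
  moreover have "finite ?I" "?I \<subseteq> carrier M" using carrierD[OF p] carrierD[OF q] by auto
  ultimately show ?thesis unfolding monoid_alg_carrier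
    by (meson finite_subset subset_trans)
qed

text \<open>Writing a coefficient of the convolution product as an iterated linear extension lets
  bilinearity of the product follow from linearity of \<open>lin_ext\<close>.\<close>

lemma mult_apply:
  assumes p: "p \<in> carrier P" and q: "q \<in> carrier P"
  shows "(p \<otimes>\<^bsub>P\<^esub> q) m =
    lin_ext K (base_alg K) (\<lambda>x. lin_ext K (base_alg K) (\<lambda>y. e (x \<otimes>\<^bsub>M\<^esub> y) m) q) p"
proof -
  have inner: "lin_ext K (base_alg K) (\<lambda>y. e (x \<otimes>\<^bsub>M\<^esub> y) m) q
      = (\<Oplus>\<^bsub>K\<^esub>y\<in>{y. q y \<noteq> \<zero>\<^bsub>K\<^esub>}. q y \<otimes>\<^bsub>K\<^esub> e (x \<otimes>\<^bsub>M\<^esub> y) m)" if "x \<in> carrier M" for x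
    unfolding lin_ext_def by (subst finsum_base_alg)
      (use q K.field_axioms carrierD[OF q] that in \<open>auto simp: basis_elem_def\<close>)
  have ic: "lin_ext K (base_alg K) (\<lambda>y. e (x \<otimes>\<^bsub>M\<^esub> y) m) q \<in> carrier K" if "x \<in> carrier M" for x
    unfolding inner[OF that] using carrierD[OF q] by (auto simp: basis_elem_def intro!: K.finsum_closed)
  have "lin_ext K (base_alg K) (\<lambda>x. lin_ext K (base_alg K) (\<lambda>y. e (x \<otimes>\<^bsub>M\<^esub> y) m) q) p
    = (\<Oplus>\<^bsub>K\<^esub>x\<in>{x. p x \<noteq> \<zero>\<^bsub>K\<^esub>}. p x \<otimes>\<^bsub>K\<^esub> lin_ext K (base_alg K) (\<lambda>y. e (x \<otimes>\<^bsub>M\<^esub> y) m) q)"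
    unfolding lin_ext_def[of _ _ _ p]
    by (subst finsum_base_alg)
      (use p q K.field_axioms carrierD[OF p] carrierD[OF q] in \<open>auto simp: ic\<close>)
  also have "\<dots> = (\<Oplus>\<^bsub>K\<^esub>x\<in>{x. p x \<noteq> \<zero>\<^bsub>K\<^esub>}. \<Oplus>\<^bsub>K\<^esub>y\<in>{y. q y \<noteq> \<zero>\<^bsub>K\<^esub>}.
      p x \<otimes>\<^bsub>K\<^esub> (q y \<otimes>\<^bsub>K\<^esub> e (x \<otimes>\<^bsub>M\<^esub> y) m))"
  proof (rule K.finsum_cong')
    fix x assume x: "x \<in> {x. p x \<noteq> \<zero>\<^bsub>K\<^esub>}"
    show "p x \<otimes>\<^bsub>K\<^esub> lin_ext K (base_alg K) (\<lambda>y. e (x \<otimes>\<^bsub>M\<^esub> y) m) q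
      = (\<Oplus>\<^bsub>K\<^esub>y\<in>{y. q y \<noteq> \<zero>\<^bsub>K\<^esub>}. p x \<otimes>\<^bsub>K\<^esub> (q y \<otimes>\<^bsub>K\<^esub> e (x \<otimes>\<^bsub>M\<^esub> y) m))"
      using x p q carrierD[OF p] carrierD[OF q]
      by (subst inner) (auto intro!: additive_finsum simp: basis_elem_def K.r_distr K.abelian_monoid_axioms)
  qed (use p q carrierD[OF p] carrierD[OF q] in \<open>auto intro!: K.finsum_closed simp: basis_elem_def\<close>)
  also have "\<dots> = (p \<otimes>\<^bsub>P\<^esub> q) m"
    unfolding monoid_alg_def using carrierD[OF p] carrierD[OF q]
    by (auto simp: basis_elem_def intro!: K.finsum_cong' K.finsum_closed)
  finally show ?thesis by simp
qed

lemma base: "k_algebra K (base_alg K)" by (rule k_algebra_base) (rule K.field_axioms)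

lemma apply_basis_Pi: "(\<lambda>y. e (x \<otimes>\<^bsub>M\<^esub> y) m) \<in> carrier M \<rightarrow> carrier (base_alg K)"
  by (auto simp: basis_elem_def)

text \<open>The second factor sits in the inner extension of \<open>mult_apply\<close>, so linearity
  is checked term by term under the sum over p. The first factor is the argument of the outer
  extension, which is why \<open>mult_lin_left\<close> is shorter.\<close>

lemma mult_lin_right:
  assumes p: "p \<in> carrier P"
  shows "(\<lambda>q. p \<otimes>\<^bsub>P\<^esub> q) \<in> lin_maps K P P"
proof (rule lin_mapsI)
  have I: "lin_ext K (base_alg K) (\<lambda>y. e (x \<otimes>\<^bsub>M\<^esub> y) m) \<in> lin_maps K P (base_alg K)" for x m
    by (rule lin_ext_lin[OF base apply_basis_Pi])
  have E: "lin_ext K (base_alg K) g p = (\<Oplus>\<^bsub>K\<^esub>m\<in>{m. p m \<noteq> \<zero>\<^bsub>K\<^esub>}. p m \<otimes>\<^bsub>K\<^esub> g m)"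
    if "\<And>m. m \<in> carrier M \<Longrightarrow> g m \<in> carrier K" for g
    unfolding lin_ext_def by (subst finsum_base_alg) (use K.field_axioms carrierD[OF p] that in auto)
  have C: "lin_ext K (base_alg K) (\<lambda>y. e (x \<otimes>\<^bsub>M\<^esub> y) m) q \<in> carrier K" if "q \<in> carrier P" for q x m
    using lin_maps_closed[OF I that] by simp
  fix q assume q: "q \<in> carrier P"
  show "p \<otimes>\<^bsub>P\<^esub> q \<in> carrier P" using p q by (rule mult_closed)
  {
    fix r assume r: "r \<in> carrier P"
    have qr: "q \<oplus>\<^bsub>P\<^esub> r \<in> carrier P" using q r by (rule add_closedP)
    show "p \<otimes>\<^bsub>P\<^esub> (q \<oplus>\<^bsub>P\<^esub> r) = p \<otimes>\<^bsub>P\<^esub> q \<oplus>\<^bsub>P\<^esub> p \<otimes>\<^bsub>P\<^esub> r"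
    proof
      fix m
      show "(p \<otimes>\<^bsub>P\<^esub> (q \<oplus>\<^bsub>P\<^esub> r)) m = (p \<otimes>\<^bsub>P\<^esub> q \<oplus>\<^bsub>P\<^esub> p \<otimes>\<^bsub>P\<^esub> r) m"
        using C q r carrierD[OF p]
        by (simp add: mult_apply[OF p qr, unfolded monoid_alg_simps] mult_apply[OF p q] mult_apply[OF p r]
            lin_maps_add[OF I q r, unfolded monoid_alg_simps base_alg_simps] E K.r_distr
            flip: K.finsum_addf)
    qed
  next
    fix s assume s: "s \<in> carrier K"
    have sq: "s \<odot>\<^bsub>P\<^esub> q \<in> carrier P" using s q by (rule smult_closedP)
    show "p \<otimes>\<^bsub>P\<^esub> (s \<odot>\<^bsub>P\<^esub> q) = s \<odot>\<^bsub>P\<^esub> (p \<otimes>\<^bsub>P\<^esub> q)"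
    proof
      fix m
      have "(p \<otimes>\<^bsub>P\<^esub> (s \<odot>\<^bsub>P\<^esub> q)) m = (\<Oplus>\<^bsub>K\<^esub>x\<in>{m. p m \<noteq> \<zero>\<^bsub>K\<^esub>}.
          s \<otimes>\<^bsub>K\<^esub> (p x \<otimes>\<^bsub>K\<^esub> lin_ext K (base_alg K) (\<lambda>y. e (x \<otimes>\<^bsub>M\<^esub> y) m) q))"
        using C q s carrierD[OF p]
        by (simp add: mult_apply[OF p sq, unfolded monoid_alg_simps]
            lin_maps_smult[OF I s q, unfolded monoid_alg_simps base_alg_simps] E)
          (auto intro!: K.finsum_cong' simp: K.m_ac)
      also have "\<dots> = s \<otimes>\<^bsub>K\<^esub> (\<Oplus>\<^bsub>K\<^esub>x\<in>{m. p m \<noteq> \<zero>\<^bsub>K\<^esub>}.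
          p x \<otimes>\<^bsub>K\<^esub> lin_ext K (base_alg K) (\<lambda>y. e (x \<otimes>\<^bsub>M\<^esub> y) m) q)"
        by (rule additive_finsum[symmetric])
          (use C q s carrierD[OF p] in \<open>auto simp: K.r_distr K.abelian_monoid_axioms\<close>)
      also have "\<dots> = (s \<odot>\<^bsub>P\<^esub> (p \<otimes>\<^bsub>P\<^esub> q)) m" using C q by (simp add: mult_apply[OF p q] E)
      finally show "(p \<otimes>\<^bsub>P\<^esub> (s \<odot>\<^bsub>P\<^esub> q)) m = (s \<odot>\<^bsub>P\<^esub> (p \<otimes>\<^bsub>P\<^esub> q)) m" .
    qed
  }
qed

lemma mult_lin_left:
  assumes q: "q \<in> carrier P"
  shows "(\<lambda>p. p \<otimes>\<^bsub>P\<^esub> q) \<in> lin_maps K P P"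
proof -
  have "(\<lambda>x. lin_ext K (base_alg K) (\<lambda>y. e (x \<otimes>\<^bsub>M\<^esub> y) m) q) \<in> carrier M \<rightarrow> carrier (base_alg K)" for m
    using lin_maps_closed[OF lin_ext_lin[OF base apply_basis_Pi] q] by auto
  then have I: "lin_ext K (base_alg K) (\<lambda>x. lin_ext K (base_alg K) (\<lambda>y. e (x \<otimes>\<^bsub>M\<^esub> y) m) q)
      \<in> lin_maps K P (base_alg K)" for m
    by (rule lin_ext_lin[OF base])
  show ?thesis
  proof (rule lin_mapsI)
    fix p assume p: "p \<in> carrier P"
    show "p \<otimes>\<^bsub>P\<^esub> q \<in> carrier P" using p q by (rule mult_closed)
    {
      fix r assume r: "r \<in> carrier P"
      show "(p \<oplus>\<^bsub>P\<^esub> r) \<otimes>\<^bsub>P\<^esub> q = p \<otimes>\<^bsub>P\<^esub> q \<oplus>\<^bsub>P\<^esub> r \<otimes>\<^bsub>P\<^esub> q"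
        using lin_maps_add[OF I p r] mult_apply[OF p q] mult_apply[OF r q]
          mult_apply[OF add_closedP[OF p r] q] by (intro ext) simp
    next
      fix s assume s: "s \<in> carrier K"
      show "(s \<odot>\<^bsub>P\<^esub> p) \<otimes>\<^bsub>P\<^esub> q = s \<odot>\<^bsub>P\<^esub> (p \<otimes>\<^bsub>P\<^esub> q)"
        using lin_maps_smult[OF I s p] mult_apply[OF p q]
          mult_apply[OF smult_closedP[OF s p] q] by (intro ext) simp
    }
  qed
qed

lemma basis_mult:
  assumes "x \<in> carrier M" "y \<in> carrier M"
  shows "e x \<otimes>\<^bsub>P\<^esub> e y = e (x \<otimes>\<^bsub>M\<^esub> y)"
proof
  fix m
  have "(e x \<otimes>\<^bsub>P\<^esub> e y) m
    = lin_ext K (base_alg K) (\<lambda>x. lin_ext K (base_alg K) (\<lambda>y. e (x \<otimes>\<^bsub>M\<^esub> y) m) (e y)) (e x)"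
    by (rule mult_apply) (simp_all add: assms basis_closed)
  also have "\<dots> = lin_ext K (base_alg K) (\<lambda>y. e (x \<otimes>\<^bsub>M\<^esub> y) m) (e y)"
    by (rule lin_ext_basis[OF base assms(1)])
      (use lin_maps_closed[OF lin_ext_lin[OF base apply_basis_Pi] basis_closed[OF assms(2)]] in auto)
  also have "\<dots> = e (x \<otimes>\<^bsub>M\<^esub> y) m"
    by (rule lin_ext_basis[OF base assms(2) apply_basis_Pi])
  finally show "(e x \<otimes>\<^bsub>P\<^esub> e y) m = e (x \<otimes>\<^bsub>M\<^esub> y) m" .
qed

text \<open>Associativity is trilinear, so \<open>P_induct\<close> is applied to r, then q, then p,
  until only associativity of the monoid on basis elements is left.\<close>

lemma P_assoc:
  assumes p: "p \<in> carrier P" and q: "q \<in> carrier P" and r: "r \<in> carrier P"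
  shows "p \<otimes>\<^bsub>P\<^esub> q \<otimes>\<^bsub>P\<^esub> r = p \<otimes>\<^bsub>P\<^esub> (q \<otimes>\<^bsub>P\<^esub> r)"
proof -
  note [simp del] = monoid_alg_simps
  note L = lin_maps_add[OF mult_lin_left] lin_maps_add[OF mult_lin_right]
    lin_maps_smult[OF mult_lin_left] lin_maps_smult[OF mult_lin_right]
  have Z: "\<zero>\<^bsub>P\<^esub> \<otimes>\<^bsub>P\<^esub> a = \<zero>\<^bsub>P\<^esub>" "a \<otimes>\<^bsub>P\<^esub> \<zero>\<^bsub>P\<^esub> = \<zero>\<^bsub>P\<^esub>" if "a \<in> carrier P" for a
  proof -
    show "\<zero>\<^bsub>P\<^esub> \<otimes>\<^bsub>P\<^esub> a = \<zero>\<^bsub>P\<^esub>"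
      using lin_maps_smult[OF mult_lin_left[OF that] K.zero_closed P.M.zero_closed]
        mult_closed[OF P.M.zero_closed that] by (simp add: P.smult_l_null)
    show "a \<otimes>\<^bsub>P\<^esub> \<zero>\<^bsub>P\<^esub> = \<zero>\<^bsub>P\<^esub>"
      using lin_maps_smult[OF mult_lin_right[OF that] K.zero_closed P.M.zero_closed]
        mult_closed[OF that P.M.zero_closed] by (simp add: P.smult_l_null)
  qed
  note [simp] = mult_closed basis_closed L Z
  have 1: "e x \<otimes>\<^bsub>P\<^esub> e y \<otimes>\<^bsub>P\<^esub> r = e x \<otimes>\<^bsub>P\<^esub> (e y \<otimes>\<^bsub>P\<^esub> r)" if "x \<in> carrier M" "y \<in> carrier M" for x y
    using r that by (induction r rule: P_induct) (simp_all add: basis_mult M.m_assoc)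
  have 2: "e x \<otimes>\<^bsub>P\<^esub> q \<otimes>\<^bsub>P\<^esub> r = e x \<otimes>\<^bsub>P\<^esub> (q \<otimes>\<^bsub>P\<^esub> r)" if "x \<in> carrier M" for x
    using q that r by (induction q rule: P_induct) (simp_all add: 1)
  show ?thesis
    using p q r by (induction p rule: P_induct) (simp_all add: 2)
qed

lemma k_algebra_monoid_alg: "k_algebra K P"
proof (rule k_algebraI)
  note [simp del] = monoid_alg_simps
  note L = lin_maps_add[OF mult_lin_left] lin_maps_add[OF mult_lin_right]
    lin_maps_smult[OF mult_lin_left] lin_maps_smult[OF mult_lin_right]
  have "(\<lambda>p. \<one>\<^bsub>P\<^esub> \<otimes>\<^bsub>P\<^esub> p) p = p" "(\<lambda>p. p \<otimes>\<^bsub>P\<^esub> \<one>\<^bsub>P\<^esub>) p = p" if "p \<in> carrier P" for p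
  proof -
    have Z: "\<zero>\<^bsub>P\<^esub> \<otimes>\<^bsub>P\<^esub> a = \<zero>\<^bsub>P\<^esub>" "a \<otimes>\<^bsub>P\<^esub> \<zero>\<^bsub>P\<^esub> = \<zero>\<^bsub>P\<^esub>" if "a \<in> carrier P" for a
    proof -
      show "\<zero>\<^bsub>P\<^esub> \<otimes>\<^bsub>P\<^esub> a = \<zero>\<^bsub>P\<^esub>"
        using lin_maps_smult[OF mult_lin_left[OF that] K.zero_closed P.M.zero_closed]
          mult_closed[OF P.M.zero_closed that] by (simp add: P.smult_l_null)
      show "a \<otimes>\<^bsub>P\<^esub> \<zero>\<^bsub>P\<^esub> = \<zero>\<^bsub>P\<^esub>"
        using lin_maps_smult[OF mult_lin_right[OF that] K.zero_closed P.M.zero_closed]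
          mult_closed[OF that P.M.zero_closed] by (simp add: P.smult_l_null)
    qed
    show "(\<lambda>p. \<one>\<^bsub>P\<^esub> \<otimes>\<^bsub>P\<^esub> p) p = p" "(\<lambda>p. p \<otimes>\<^bsub>P\<^esub> \<one>\<^bsub>P\<^esub>) p = p"
      using that by (induction p rule: P_induct)
        (simp_all add: monoid_alg_one basis_mult basis_closed L Z)
  qed
  then have "monoid P"
    by (intro monoidI) (auto simp: mult_closed P_assoc monoid_alg_one basis_closed)
  then show "ring P"
    by (rule ringI[OF abelian_group_P]) (simp_all add: L)
qed (simp_all only: K.field_axioms P.smult_closed P.smult_l_distr P.smult_r_distr P.smult_assoc1
    P.smult_one lin_maps_smult[OF mult_lin_left] lin_maps_smult[OF mult_lin_right])

text \<open>The analogue of \<open>mult_apply\<close> with values in an arbitrary algebra. It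
  evaluates a linear extension on products in the free space, which is needed to show that the
  common kernel of all bilinear maps is an ideal.\<close>

lemma lin_ext_mult:
  assumes D: "k_algebra K D" and f: "f \<in> carrier M \<rightarrow> carrier D"
    and p: "p \<in> carrier P" and q: "q \<in> carrier P"
  shows "lin_ext K D f (p \<otimes>\<^bsub>P\<^esub> q) = lin_ext K D (\<lambda>x. lin_ext K D (\<lambda>y. f (x \<otimes>\<^bsub>M\<^esub> y)) q) p"
proof -
  note lf = lin_ext_lin[OF D f]
  have f': "(\<lambda>y. f (x \<otimes>\<^bsub>M\<^esub> y)) \<in> carrier M \<rightarrow> carrier D" if "x \<in> carrier M" for x using f that by auto
  have 1: "lin_ext K D f (e x \<otimes>\<^bsub>P\<^esub> q) = lin_ext K D (\<lambda>y. f (x \<otimes>\<^bsub>M\<^esub> y)) q" if x: "x \<in> carrier M" for x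
  proof (rule lin_eq_on_basis[OF D _ _ _ q])
    show "(\<lambda>q. lin_ext K D f (e x \<otimes>\<^bsub>P\<^esub> q)) \<in> lin_maps K P D"
      by (rule lin_maps_comp[OF lf mult_lin_right[OF basis_closed[OF x]]])
    show "lin_ext K D (\<lambda>y. f (x \<otimes>\<^bsub>M\<^esub> y)) \<in> lin_maps K P D" by (rule lin_ext_lin[OF D f'[OF x]])
    show "lin_ext K D f (e x \<otimes>\<^bsub>P\<^esub> e m) = lin_ext K D (\<lambda>y. f (x \<otimes>\<^bsub>M\<^esub> y)) (e m)" if "m \<in> carrier M" for m
      using that x f' by (simp add: basis_mult lin_ext_basis[OF D _ f] lin_ext_basis[OF D])
  qed
  have f2: "(\<lambda>x. lin_ext K D (\<lambda>y. f (x \<otimes>\<^bsub>M\<^esub> y)) q) \<in> carrier M \<rightarrow> carrier D"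
    using lin_maps_closed[OF lin_ext_lin[OF D f'] q] by auto
  show ?thesis
  proof (rule lin_eq_on_basis[OF D _ _ _ p])
    show "(\<lambda>p. lin_ext K D f (p \<otimes>\<^bsub>P\<^esub> q)) \<in> lin_maps K P D"
      by (rule lin_maps_comp[OF lf mult_lin_left[OF q]])
    show "lin_ext K D (\<lambda>x. lin_ext K D (\<lambda>y. f (x \<otimes>\<^bsub>M\<^esub> y)) q) \<in> lin_maps K P D"
      by (rule lin_ext_lin[OF D f2])
    show "lin_ext K D f (e m \<otimes>\<^bsub>P\<^esub> q) = lin_ext K D (\<lambda>x. lin_ext K D (\<lambda>y. f (x \<otimes>\<^bsub>M\<^esub> y)) q) (e m)"
      if "m \<in> carrier M" for m
      using that by (simp add: 1 lin_ext_basis[OF D _ f2])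
  qed
qed

end

section \<open>Quotient algebras\<close>

lemma lin_maps_sum:
  assumes "k_algebra K A" "k_algebra K B" "f \<in> lin_maps K A B" "g \<in> lin_maps K A B"
  shows "(\<lambda>x. f x \<oplus>\<^bsub>B\<^esub> g x) \<in> lin_maps K A B"
proof -
  interpret B: k_algebra K B by fact
  show ?thesis using assms(3,4)
    by (intro lin_mapsI) (auto simp: lin_maps_def Pi_iff B.A.a_ac B.smult_r_distr)
qed

lemma lin_maps_scale:
  assumes "k_algebra K A" "k_algebra K B" "s \<in> carrier K" "f \<in> lin_maps K A B"
  shows "(\<lambda>x. s \<odot>\<^bsub>B\<^esub> f x) \<in> lin_maps K A B"
proof -
  interpret B: k_algebra K B by fact
  show ?thesis using assms(3,4)
    by (intro lin_mapsI)
      (auto simp: lin_maps_def Pi_iff B.smult_r_distr B.K.m_comm simp flip: B.smult_assoc1)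
qed

lemma alg_homI:
  assumes "f \<in> lin_maps K A B" "f \<one>\<^bsub>A\<^esub> = \<one>\<^bsub>B\<^esub>"
    and "\<And>x y. x \<in> carrier A \<Longrightarrow> y \<in> carrier A \<Longrightarrow> f (x \<otimes>\<^bsub>A\<^esub> y) = f x \<otimes>\<^bsub>B\<^esub> f y"
  shows "f \<in> alg_hom K A B"
  using assms by (auto simp: alg_hom_def ring_hom_def lin_maps_def)

lemma alg_hom_lin: "f \<in> alg_hom K A B \<Longrightarrow> f \<in> lin_maps K A B"
  and alg_hom_one: "f \<in> alg_hom K A B \<Longrightarrow> f \<one>\<^bsub>A\<^esub> = \<one>\<^bsub>B\<^esub>"
  and alg_hom_mult: "f \<in> alg_hom K A B \<Longrightarrow> x \<in> carrier A \<Longrightarrow> y \<in> carrier A \<Longrightarrow>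
    f (x \<otimes>\<^bsub>A\<^esub> y) = f x \<otimes>\<^bsub>B\<^esub> f y"
  by (auto simp: alg_hom_def ring_hom_def)

lemma alg_hom_comp: "g \<in> alg_hom K B C \<Longrightarrow> f \<in> alg_hom K A B \<Longrightarrow> (\<lambda>x. g (f x)) \<in> alg_hom K A C"
  by (rule alg_homI)
    (auto intro: lin_maps_comp alg_hom_lin
      simp: alg_hom_one alg_hom_mult lin_maps_closed[OF alg_hom_lin])

context k_algebra begin

lemmas k_add_closed = A.add.m_closed
lemmas k_smult_closed = smult_closed
lemmas k_zero_closed = A.zero_closed

lemma mult_left_lin: "c \<in> carrier A \<Longrightarrow> (\<lambda>x. x \<otimes>\<^bsub>A\<^esub> c) \<in> lin_maps K A A"
  by (rule lin_mapsI) (auto simp: A.l_distr smult_mult_left)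

lemma mult_right_lin: "c \<in> carrier A \<Longrightarrow> (\<lambda>x. c \<otimes>\<^bsub>A\<^esub> x) \<in> lin_maps K A A"
  by (rule lin_mapsI) (auto simp: A.r_distr smult_mult_right)

lemma sub_closed: "x \<in> carrier A \<Longrightarrow> y \<in> carrier A \<Longrightarrow> x \<ominus>\<^bsub>A\<^esub> y \<in> carrier A"
  by (rule abelian_group.minus_closed[OF A.is_abelian_group])

lemma sub_self: "x \<in> carrier A \<Longrightarrow> x \<ominus>\<^bsub>A\<^esub> x = \<zero>\<^bsub>A\<^esub>"
  by (simp add: a_minus_def A.r_neg)

lemma sub_zero_iff: "x \<in> carrier A \<Longrightarrow> y \<in> carrier A \<Longrightarrow> x \<ominus>\<^bsub>A\<^esub> y = \<zero>\<^bsub>A\<^esub> \<longleftrightarrow> x = y"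
  by (metis A.add.inv_closed A.minus_equality A.minus_minus a_minus_def sub_self)

text \<open>Negatives are multiples by -1, so a subspace stable under multiplication on both sides
  already satisfies the additive subgroup condition in the definition of an ideal.\<close>

lemma subspace_ideal:
  assumes N: "N \<subseteq> carrier A" "\<zero>\<^bsub>A\<^esub> \<in> N"
    and add: "\<And>x y. x \<in> N \<Longrightarrow> y \<in> N \<Longrightarrow> x \<oplus>\<^bsub>A\<^esub> y \<in> N"
    and smult: "\<And>s x. s \<in> carrier K \<Longrightarrow> x \<in> N \<Longrightarrow> s \<odot>\<^bsub>A\<^esub> x \<in> N"
    and l: "\<And>x y. x \<in> carrier A \<Longrightarrow> y \<in> N \<Longrightarrow> x \<otimes>\<^bsub>A\<^esub> y \<in> N"
    and r: "\<And>x y. x \<in> carrier A \<Longrightarrow> y \<in> N \<Longrightarrow> y \<otimes>\<^bsub>A\<^esub> x \<in> N"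
  shows "ideal N A"
proof (rule idealI)
  show "ring A" by (rule A.ring_axioms)
  have inv: "\<ominus>\<^bsub>A\<^esub> x \<in> N" if "x \<in> N" for x
  proof -
    have "(\<ominus>\<^bsub>K\<^esub> \<one>\<^bsub>K\<^esub>) \<odot>\<^bsub>A\<^esub> x = \<ominus>\<^bsub>A\<^esub> x" using that N by (auto simp: smult_l_minus)
    then show ?thesis using smult[OF _ that, of "\<ominus>\<^bsub>K\<^esub> \<one>\<^bsub>K\<^esub>"] by simp
  qed
  show "subgroup N (add_monoid A)"
    by (rule A.add.subgroupI) (use N add inv in \<open>auto simp flip: a_inv_def\<close>)
qed (use l r in auto)

end

locale quot_alg = k_algebra K A for K :: "'k ring" (structure) and A :: "('k, 'a) module" (structure) +
  fixes S :: "'a set"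
  assumes S: "S \<subseteq> carrier A"
begin

abbreviation "I \<equiv> Idl\<^bsub>A\<^esub> S"
abbreviation "Q \<equiv> alg_quot A S"
abbreviation "q \<equiv> quot_proj A S"

sublocale I: ideal I A by (rule A.genideal_ideal[OF S])

lemma smult_I: "s \<in> carrier K \<Longrightarrow> x \<in> I \<Longrightarrow> s \<odot>\<^bsub>A\<^esub> x \<in> I"
  using I.I_l_closed[of x "s \<odot>\<^bsub>A\<^esub> \<one>\<^bsub>A\<^esub>"] I.Icarr by (simp add: smult_mult_left)

lemma q_eq_iff: "x \<in> carrier A \<Longrightarrow> y \<in> carrier A \<Longrightarrow> q x = q y \<longleftrightarrow> x \<ominus>\<^bsub>A\<^esub> y \<in> I"
  unfolding quot_proj_def using A.quotient_eq_iff_same_a_r_cos[OF I.ideal_axioms] by blast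

lemma q_mem:
  assumes x: "x \<in> carrier A" and p: "p \<in> q x"
  shows "p \<in> carrier A \<and> q p = q x"
proof -
  obtain i where i: "i \<in> I" "p = i \<oplus>\<^bsub>A\<^esub> x" using p by (auto simp: quot_proj_def a_r_coset_def')
  then have ic: "i \<in> carrier A" using I.Icarr by blast
  then have "p \<ominus>\<^bsub>A\<^esub> x = i" using x i(2) by (simp add: a_minus_def A.a_assoc A.r_neg)
  with i ic x show ?thesis by (simp add: q_eq_iff)
qed

lemma q_self: "x \<in> carrier A \<Longrightarrow> x \<in> q x"
  unfolding quot_proj_def by (rule I.a_rcos_self)

lemma Q_carrier: "carrier Q = q ` carrier A"
  by (auto simp: alg_quot_def quot_proj_def ring.defs FactRing_def A_RCOSETS_def RCOSETS_def
      a_r_coset_def)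

lemma q_closed: "x \<in> carrier A \<Longrightarrow> q x \<in> carrier Q" by (simp add: Q_carrier)

lemma Q_mult: "x \<in> carrier A \<Longrightarrow> y \<in> carrier A \<Longrightarrow> q x \<otimes>\<^bsub>Q\<^esub> q y = q (x \<otimes>\<^bsub>A\<^esub> y)"
  by (simp add: alg_quot_def quot_proj_def ring.defs FactRing_def I.rcoset_mult_add)

lemma Q_add: "x \<in> carrier A \<Longrightarrow> y \<in> carrier A \<Longrightarrow> q x \<oplus>\<^bsub>Q\<^esub> q y = q (x \<oplus>\<^bsub>A\<^esub> y)"
  by (simp add: alg_quot_def quot_proj_def ring.defs FactRing_def I.a_rcos_sum)

lemma Q_one: "\<one>\<^bsub>Q\<^esub> = q \<one>\<^bsub>A\<^esub>"
  by (simp add: alg_quot_def quot_proj_def ring.defs FactRing_def)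

lemma Q_zero: "\<zero>\<^bsub>Q\<^esub> = q \<zero>\<^bsub>A\<^esub>"
  by (simp add: alg_quot_def quot_proj_def ring.defs FactRing_def A.a_rcos_zero[OF I.ideal_axioms]
      I.zero_closed)

text \<open>\<open>alg_quot\<close> defines the multiple of a coset as a union over its members. All
  members contribute the same coset because the ideal is stable under scalars, so the union
  collapses to that coset.\<close>

lemma Q_smult:
  assumes s: "s \<in> carrier K" and x: "x \<in> carrier A"
  shows "s \<odot>\<^bsub>Q\<^esub> q x = q (s \<odot>\<^bsub>A\<^esub> x)"
proof -
  have "q (s \<odot>\<^bsub>A\<^esub> p) = q (s \<odot>\<^bsub>A\<^esub> x)" if p: "p \<in> q x" for p
  proof -
    have pc: "p \<in> carrier A" "q p = q x" using q_mem[OF x p] by auto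
    then have "p \<ominus>\<^bsub>A\<^esub> x \<in> I" using q_eq_iff x by blast
    then have "s \<odot>\<^bsub>A\<^esub> (p \<ominus>\<^bsub>A\<^esub> x) \<in> I" by (rule smult_I[OF s])
    then have "s \<odot>\<^bsub>A\<^esub> p \<ominus>\<^bsub>A\<^esub> s \<odot>\<^bsub>A\<^esub> x \<in> I"
      using s x pc by (simp add: a_minus_def smult_r_distr smult_r_minus)
    then show ?thesis using s x pc q_eq_iff by simp
  qed
  then have "(\<Union>p\<in>q x. q (s \<odot>\<^bsub>A\<^esub> p)) = q (s \<odot>\<^bsub>A\<^esub> x)" using q_self[OF x] by blast
  then show ?thesis
    by (simp add: alg_quot_def quot_proj_def ring.defs module.defs)
qed

lemma k_algebra_quot: "k_algebra K Q"
proof -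
  note [simp] = Q_carrier Q_mult Q_add Q_one Q_zero Q_smult
  have ab: "abelian_group Q"
    by (rule abelian_groupI) (auto simp: A.a_ac simp: A.l_neg A.r_neg intro!: bexI[of _ "\<ominus>\<^bsub>A\<^esub> x" for x])
  moreover have "monoid Q" by (rule monoidI) (auto simp: A.m_assoc)
  ultimately have "ring Q" by (rule ringI) (auto simp: A.l_distr A.r_distr)
  then show ?thesis
    by (rule k_algebraI[OF K.field_axioms])
      (auto simp: smult_l_distr smult_r_distr smult_assoc1 smult_mult_left smult_mult_right)
qed

lemma q_lin: "q \<in> lin_maps K A Q"
  by (rule lin_mapsI) (simp_all add: q_closed Q_add Q_smult)

lemma q_hom: "q \<in> alg_hom K A Q"
  by (rule alg_homI) (simp_all add: q_lin Q_mult Q_one)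

lemma q_rel: "x \<in> carrier A \<Longrightarrow> y \<in> carrier A \<Longrightarrow> x \<ominus>\<^bsub>A\<^esub> y \<in> S \<Longrightarrow> q x = q y"
  using q_eq_iff A.genideal_self[OF S] by blast

text \<open>The description has exactly the shape of the one in \<open>tens_lift_def\<close>, so the
  evaluation of lifts on tensor products is an instance.\<close>

lemma factor_eq:
  assumes D: "k_algebra K D" and F: "F \<in> lin_maps K A D" and I: "\<forall>x\<in>I. F x = \<zero>\<^bsub>D\<^esub>"
    and x: "x \<in> carrier A"
  shows "(THE z. \<forall>p\<in>q x. z = F p) = F x"
proof -
  interpret D: k_algebra K D by fact
  have "F p = F x" if p: "p \<in> q x" for p
  proof -
    have pc: "p \<in> carrier A" "q p = q x" using q_mem[OF x p] by auto
    then have "F (p \<ominus>\<^bsub>A\<^esub> x) = \<zero>\<^bsub>D\<^esub>" using q_eq_iff x I by blast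
    then have "F p \<ominus>\<^bsub>D\<^esub> F x = \<zero>\<^bsub>D\<^esub>"
      using lin_maps_minus[OF k_algebra_axioms D F pc(1) x] by simp
    then show ?thesis using D.sub_zero_iff[OF lin_maps_closed[OF F pc(1)] lin_maps_closed[OF F x]] by blast
  qed
  then have "\<forall>p\<in>q x. F x = F p" by simp
  moreover have "z = F x" if "\<forall>p\<in>q x. z = F p" for z using that q_self[OF x] by (rule bspec)
  ultimately show ?thesis by (rule the_equality)
qed

lemma factor_lin:
  assumes D: "k_algebra K D" and F: "F \<in> lin_maps K A D" and I: "\<forall>x\<in>I. F x = \<zero>\<^bsub>D\<^esub>"
  shows "(\<lambda>C. THE z. \<forall>p\<in>C. z = F p) \<in> lin_maps K Q D"
proof -
  note eq = factor_eq[OF D F I]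
  show ?thesis
    unfolding lin_maps_def Q_carrier
    apply (intro CollectI conjI ballI Pi_I; elim imageE; hypsubst)
      apply (simp_all only: eq lin_maps_closed[OF F])
     apply (simp_all only: Q_add Q_smult)
     apply (simp_all only: eq A.a_closed smult_closed)
     apply (simp_all only: lin_maps_add[OF F] lin_maps_smult[OF F])
    done
qed

text \<open>The kernel of a homomorphism is an ideal, so it contains the ideal generated by any
  subset of it. For maps that are only linear this argument fails, and tensor products rely on
  \<open>lin_ext_vanishes\<close> instead.\<close>

lemma hom_vanishes:
  assumes D: "k_algebra K D" and F: "F \<in> alg_hom K A D" and r: "\<forall>x\<in>S. F x = \<zero>\<^bsub>D\<^esub>"
  shows "\<forall>x\<in>I. F x = \<zero>\<^bsub>D\<^esub>"
proof -
  interpret D: k_algebra K D by fact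
  interpret F: ring_hom_ring A D F
    by (rule ring_hom_ringI2[OF A.ring_axioms D.A.ring_axioms]) (use F in \<open>simp add: alg_hom_def\<close>)
  have ker: "a_kernel A D F = {x \<in> carrier A. F x = \<zero>\<^bsub>D\<^esub>}" by (rule a_kernel_def')
  have "S \<subseteq> a_kernel A D F" unfolding ker using S r by blast
  then have "I \<subseteq> a_kernel A D F" by (rule A.genideal_minimal[OF F.kernel_is_ideal])
  then show ?thesis unfolding ker by blast
qed

lemma factor_hom:
  assumes D: "k_algebra K D" and F: "F \<in> alg_hom K A D" and r: "\<forall>x\<in>S. F x = \<zero>\<^bsub>D\<^esub>"
  shows "\<exists>G\<in>alg_hom K Q D. \<forall>x\<in>carrier A. G (q x) = F x"
proof -
  note I = hom_vanishes[OF D F r]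
  note eq = factor_eq[OF D alg_hom_lin[OF F] I]
  have "(\<lambda>C. THE z. \<forall>p\<in>C. z = F p) \<in> alg_hom K Q D"
  proof (rule alg_homI[OF factor_lin[OF D alg_hom_lin[OF F] I]])
    show "(THE z. \<forall>p\<in>\<one>\<^bsub>Q\<^esub>. z = F p) = \<one>\<^bsub>D\<^esub>"
      by (simp only: Q_one eq A.one_closed alg_hom_one[OF F])
    fix x y assume "x \<in> carrier Q" "y \<in> carrier Q"
    then show "(THE z. \<forall>p\<in>x \<otimes>\<^bsub>Q\<^esub> y. z = F p)
        = (THE z. \<forall>p\<in>x. z = F p) \<otimes>\<^bsub>D\<^esub> (THE z. \<forall>p\<in>y. z = F p)"
      unfolding Q_carrier
      apply (elim imageE; hypsubst)
      apply (simp_all only: Q_mult)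
      apply (simp_all only: eq A.m_closed)
      apply (simp_all only: alg_hom_mult[OF F])
      done
  qed
  then show ?thesis by (rule bexI[rotated]) (intro ballI eq)
qed

end

section \<open>Tensor products\<close>

lemma opp_simps [simp]:
  "carrier (opp A) = carrier A" "mult (opp A) x y = y \<otimes>\<^bsub>A\<^esub> x" "one (opp A) = one A"
  "zero (opp A) = zero A" "add (opp A) = add A" "smult (opp A) = smult A"
  by (simp_all add: opp_def)

lemma lin_maps_opp [simp]: "lin_maps K (opp A) B = lin_maps K A B" "lin_maps K B (opp A) = lin_maps K B A"
  by (simp_all add: lin_maps_def)

lemma k_algebra_opp:
  assumes "k_algebra K A"
  shows "k_algebra K (opp A)"
proof -
  interpret A: k_algebra K A by fact
  have "abelian_group (opp A)"
    by (rule abelian_groupI) (auto simp: A.A.a_ac simp: A.A.l_neg A.A.r_neg intro!: bexI[of _ "\<ominus>\<^bsub>A\<^esub> x" for x])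
  moreover have "monoid (opp A)" by (rule monoidI) (auto simp: A.A.m_assoc)
  ultimately have "ring (opp A)" by (rule ringI) (auto simp: A.A.l_distr A.A.r_distr)
  then show ?thesis
    by (rule k_algebraI[OF A.K.field_axioms])
      (auto simp: A.smult_l_distr A.smult_r_distr A.smult_assoc1 A.smult_mult_left A.smult_mult_right)
qed

definition bilin :: "'k ring \<Rightarrow> ('k, 'a) module \<Rightarrow> ('k, 'b) module \<Rightarrow> ('k, 'd) module
    \<Rightarrow> ('a \<Rightarrow> 'b \<Rightarrow> 'd) \<Rightarrow> bool" where
  "bilin K A B D f \<longleftrightarrow> (\<forall>a\<in>carrier A. (\<lambda>b. f a b) \<in> lin_maps K B D)
    \<and> (\<forall>b\<in>carrier B. (\<lambda>a. f a b) \<in> lin_maps K A D)"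

lemma bilinI:
  assumes "\<And>a. a \<in> carrier A \<Longrightarrow> (\<lambda>b. f a b) \<in> lin_maps K B D"
    and "\<And>b. b \<in> carrier B \<Longrightarrow> (\<lambda>a. f a b) \<in> lin_maps K A D"
  shows "bilin K A B D f"
  using assms by (auto simp: bilin_def)

lemma bilin_right: "bilin K A B D f \<Longrightarrow> a \<in> carrier A \<Longrightarrow> (\<lambda>b. f a b) \<in> lin_maps K B D"
  and bilin_left: "bilin K A B D f \<Longrightarrow> b \<in> carrier B \<Longrightarrow> (\<lambda>a. f a b) \<in> lin_maps K A D"
  by (auto simp: bilin_def)

lemma bilin_closed: "bilin K A B D f \<Longrightarrow> a \<in> carrier A \<Longrightarrow> b \<in> carrier B \<Longrightarrow> f a b \<in> carrier D"
  using lin_maps_closed[OF bilin_right] .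

lemma bilin_comp: "bilin K A B D f \<Longrightarrow> g \<in> lin_maps K D E \<Longrightarrow> bilin K A B E (\<lambda>a b. g (f a b))"
  by (rule bilinI) (blast intro: lin_maps_comp[OF _ bilin_right] lin_maps_comp[OF _ bilin_left])+

locale tensor_alg = A: k_algebra K A + B: k_algebra K B
  for K :: "'k ring" and A :: "('k, 'a) module" and B :: "('k, 'b) module"
begin

sublocale FM: field_monoid K "A \<times>\<times> B"
  by (intro field_monoid.intro DirProd_monoid A.K.field_axioms A.A.monoid_axioms B.A.monoid_axioms)

abbreviation "P \<equiv> pair_alg K A B"
abbreviation "T \<equiv> tensor K A B"
abbreviation "e a b \<equiv> basis_elem K (a, b)"
abbreviation "t \<equiv> tens K A B"

sublocale P: k_algebra K P by (rule FM.k_algebra_monoid_alg)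

lemma e_closed: "a \<in> carrier A \<Longrightarrow> b \<in> carrier B \<Longrightarrow> e a b \<in> carrier P"
  by (rule FM.basis_closed) simp

lemma rels_closed: "bilin_rels K A B \<subseteq> carrier P"
  unfolding bilin_rels_def Let_def
  by (auto simp del: monoid_alg_simps
    intro!: P.sub_closed P.k_add_closed P.k_smult_closed e_closed)

sublocale QQ: quot_alg K P "bilin_rels K A B"
  by unfold_locales (rule rels_closed)

lemma T_def: "T = QQ.Q" by (simp add: tensor_def)
lemma t_def: "t a b = QQ.q (e a b)" by (simp add: tens_def)

lemma k_algebra_tensor: "k_algebra K T"
  unfolding T_def by (rule QQ.k_algebra_quot)

text \<open>The linear extension of a single bilinear map is not multiplicative, so its kernel need
  not be an ideal. The common kernel of all bilinear maps into D is an ideal: multiplying by a basis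
  element replaces a bilinear map by a translate, which is bilinear again. The bilinearity relators
  lie in this common kernel.\<close>

lemma lin_ext_vanishes:
  assumes D: "k_algebra K D" and f: "bilin K A B D f"
  shows "\<forall>x\<in>QQ.I. lin_ext K D (\<lambda>(a, b). f a b) x = \<zero>\<^bsub>D\<^esub>"
proof -
  interpret D: k_algebra K D by fact
  note [simp del] = monoid_alg_simps
  have Pi: "(\<lambda>(a, b). f a b) \<in> carrier (A \<times>\<times> B) \<rightarrow> carrier D" if "bilin K A B D f" for f
    using bilin_closed[OF that] by auto
  let ?L = "\<lambda>f. lin_ext K D (\<lambda>(a, b). f a b)"
  note L = FM.lin_ext_lin[OF D Pi]
  \<comment> \<open>The quantifier over all bilinear maps is what makes N stable under
    multiplication.\<close>
  define N where "N = {p \<in> carrier P. \<forall>f. bilin K A B D f \<longrightarrow> ?L f p = \<zero>\<^bsub>D\<^esub>}"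
  have z: "?L f \<zero>\<^bsub>P\<^esub> = \<zero>\<^bsub>D\<^esub>" if "bilin K A B D f" for f
    by (rule lin_maps_zero[OF P.k_algebra_axioms D L[OF that]])
  have zl: "(\<lambda>_. \<zero>\<^bsub>D\<^esub>) \<in> lin_maps K P D" by (rule lin_mapsI) auto
  have "ideal N P"
  proof (rule P.subspace_ideal)
    fix r p assume r: "r \<in> carrier P" and p: "p \<in> N"
    have pP: "p \<in> carrier P" using p by (simp add: N_def)
    have "?L f (r \<otimes>\<^bsub>P\<^esub> p) = \<zero>\<^bsub>D\<^esub>" if f: "bilin K A B D f" for f
    proof (rule FM.lin_eq_on_basis[OF D _ zl _ r])
      show "(\<lambda>r. ?L f (r \<otimes>\<^bsub>P\<^esub> p)) \<in> lin_maps K P D"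
        by (rule lin_maps_comp[OF L[OF f] FM.mult_lin_left[OF pP]])
      fix m assume m: "m \<in> carrier (A \<times>\<times> B)"
      obtain a b where ab: "m = (a, b)" "a \<in> carrier A" "b \<in> carrier B" using m by auto
      \<comment> \<open>Left multiplication by the basis element (a, b) turns f into this translate.
        It is bilinear, so p is killed by it too.\<close>
      have "bilin K A B D (\<lambda>a' b'. f (a \<otimes>\<^bsub>A\<^esub> a') (b \<otimes>\<^bsub>B\<^esub> b'))"
        by (intro bilinI lin_maps_comp[OF bilin_right[OF f] B.mult_right_lin]
            lin_maps_comp[OF bilin_left[OF f] A.mult_right_lin]) (simp_all add: ab)
      then have A1: "?L (\<lambda>a' b'. f (a \<otimes>\<^bsub>A\<^esub> a') (b \<otimes>\<^bsub>B\<^esub> b')) p = \<zero>\<^bsub>D\<^esub>" using p by (auto simp: N_def)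
      have A2: "?L f (basis_elem K m \<otimes>\<^bsub>P\<^esub> p)
        = lin_ext K D (\<lambda>x. lin_ext K D (\<lambda>y. (\<lambda>(a, b). f a b) (x \<otimes>\<^bsub>A \<times>\<times> B\<^esub> y)) p) (basis_elem K m)"
        by (rule FM.lin_ext_mult[OF D Pi[OF f] FM.basis_closed[OF m] pP])
      also have "\<dots> = lin_ext K D (\<lambda>y. (\<lambda>(a, b). f a b) (m \<otimes>\<^bsub>A \<times>\<times> B\<^esub> y)) p"
      proof (rule FM.lin_ext_basis[OF D m])
        have Pi2: "(\<lambda>y. (\<lambda>(a, b). f a b) (x \<otimes>\<^bsub>A \<times>\<times> B\<^esub> y)) \<in> carrier (A \<times>\<times> B) \<rightarrow> carrier D"
          if "x \<in> carrier (A \<times>\<times> B)" for x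
          using that by (auto simp: DirProd_def intro!: bilin_closed[OF f])
        show "(\<lambda>x. lin_ext K D (\<lambda>y. (\<lambda>(a, b). f a b) (x \<otimes>\<^bsub>A \<times>\<times> B\<^esub> y)) p)
            \<in> carrier (A \<times>\<times> B) \<rightarrow> carrier D"
          by (rule Pi_I, rule lin_maps_closed[OF FM.lin_ext_lin[OF D] pP], rule Pi2)
      qed
      finally have A3: "?L f (basis_elem K m \<otimes>\<^bsub>P\<^esub> p) = lin_ext K D (\<lambda>y. (\<lambda>(a, b). f a b) (m \<otimes>\<^bsub>A \<times>\<times> B\<^esub> y)) p" .
      have A4: "(\<lambda>y. (\<lambda>(a, b). f a b) (m \<otimes>\<^bsub>A \<times>\<times> B\<^esub> y)) = (\<lambda>(a', b'). f (a \<otimes>\<^bsub>A\<^esub> a') (b \<otimes>\<^bsub>B\<^esub> b'))"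
        by (auto simp: ab DirProd_def)
      show "?L f (basis_elem K m \<otimes>\<^bsub>P\<^esub> p) = \<zero>\<^bsub>D\<^esub>"
        unfolding A3 A4 by (rule A1)
    qed
    then show "r \<otimes>\<^bsub>P\<^esub> p \<in> N" using r pP by (simp add: N_def)
    have "?L f (p \<otimes>\<^bsub>P\<^esub> r) = \<zero>\<^bsub>D\<^esub>" if f: "bilin K A B D f" for f
    proof (rule FM.lin_eq_on_basis[OF D _ zl _ r])
      show "(\<lambda>r. ?L f (p \<otimes>\<^bsub>P\<^esub> r)) \<in> lin_maps K P D"
        by (rule lin_maps_comp[OF L[OF f] FM.mult_lin_right[OF pP]])
      fix m assume m: "m \<in> carrier (A \<times>\<times> B)"
      obtain a b where ab: "m = (a, b)" "a \<in> carrier A" "b \<in> carrier B" using m by auto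
      have f2: "bilin K A B D (\<lambda>a' b'. f (a' \<otimes>\<^bsub>A\<^esub> a) (b' \<otimes>\<^bsub>B\<^esub> b))"
        by (intro bilinI lin_maps_comp[OF bilin_right[OF f] B.mult_left_lin]
            lin_maps_comp[OF bilin_left[OF f] A.mult_left_lin]) (simp_all add: ab)
      then have A1: "?L (\<lambda>a' b'. f (a' \<otimes>\<^bsub>A\<^esub> a) (b' \<otimes>\<^bsub>B\<^esub> b)) p = \<zero>\<^bsub>D\<^esub>" using p by (auto simp: N_def)
      have A2: "?L f (p \<otimes>\<^bsub>P\<^esub> basis_elem K m)
        = lin_ext K D (\<lambda>x. lin_ext K D (\<lambda>y. (\<lambda>(a, b). f a b) (x \<otimes>\<^bsub>A \<times>\<times> B\<^esub> y)) (basis_elem K m)) p"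
        by (rule FM.lin_ext_mult[OF D Pi[OF f] pP FM.basis_closed[OF m]])
      also have "\<dots> = ?L (\<lambda>a' b'. f (a' \<otimes>\<^bsub>A\<^esub> a) (b' \<otimes>\<^bsub>B\<^esub> b)) p"
      proof (rule FM.lin_eq_on_basis[OF D _ L[OF f2] _ pP])
        have Pi2: "(\<lambda>y. (\<lambda>(a, b). f a b) (x \<otimes>\<^bsub>A \<times>\<times> B\<^esub> y)) \<in> carrier (A \<times>\<times> B) \<rightarrow> carrier D"
          if "x \<in> carrier (A \<times>\<times> B)" for x
          using that by (auto simp: DirProd_def intro!: bilin_closed[OF f])
        have Pi3: "(\<lambda>x. lin_ext K D (\<lambda>y. (\<lambda>(a, b). f a b) (x \<otimes>\<^bsub>A \<times>\<times> B\<^esub> y)) (basis_elem K m))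
            \<in> carrier (A \<times>\<times> B) \<rightarrow> carrier D"
          by (rule Pi_I, rule lin_maps_closed[OF FM.lin_ext_lin[OF D] FM.basis_closed[OF m]], rule Pi2)
        then show "lin_ext K D (\<lambda>x. lin_ext K D (\<lambda>y. (\<lambda>(a, b). f a b) (x \<otimes>\<^bsub>A \<times>\<times> B\<^esub> y)) (basis_elem K m))
            \<in> lin_maps K P D" by (rule FM.lin_ext_lin[OF D])
        fix m' assume m': "m' \<in> carrier (A \<times>\<times> B)"
        show "lin_ext K D (\<lambda>x. lin_ext K D (\<lambda>y. (\<lambda>(a, b). f a b) (x \<otimes>\<^bsub>A \<times>\<times> B\<^esub> y)) (basis_elem K m))
            (basis_elem K m') = ?L (\<lambda>a' b'. f (a' \<otimes>\<^bsub>A\<^esub> a) (b' \<otimes>\<^bsub>B\<^esub> b)) (basis_elem K m')"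
          unfolding FM.lin_ext_basis[OF D m' Pi3] FM.lin_ext_basis[OF D m Pi2[OF m']]
            FM.lin_ext_basis[OF D m' Pi[OF f2]]
          by (simp add: ab split: prod.split)
      qed
      also note A1
      finally show "?L f (p \<otimes>\<^bsub>P\<^esub> basis_elem K m) = \<zero>\<^bsub>D\<^esub>" .
    qed
    then show "p \<otimes>\<^bsub>P\<^esub> r \<in> N" using r pP by (simp add: N_def)
  qed (auto simp: N_def z lin_maps_add[OF L] lin_maps_smult[OF L])
  moreover have "bilin_rels K A B \<subseteq> N"
  proof
    fix x assume x: "x \<in> bilin_rels K A B"
    have "?L f x = \<zero>\<^bsub>D\<^esub>" if f: "bilin K A B D f" for f
    proof -
      note lm = lin_maps_minus[OF P.k_algebra_axioms D L[OF f]]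
      note basis = FM.lin_ext_basis[OF D _ Pi[OF f]]
      have sub: "u \<ominus>\<^bsub>D\<^esub> u = \<zero>\<^bsub>D\<^esub>" if "u \<in> carrier D" for u using that by (simp add: D.A.r_neg a_minus_def)
      show ?thesis
        using x unfolding bilin_rels_def Let_def
        by (auto simp: lm e_closed basis lin_maps_add[OF L[OF f]] lin_maps_smult[OF L[OF f]]
            lin_maps_add[OF bilin_left[OF f]] lin_maps_smult[OF bilin_left[OF f]]
            lin_maps_add[OF bilin_right[OF f]] lin_maps_smult[OF bilin_right[OF f]]
            bilin_closed[OF f] sub)
    qed
    then show "x \<in> N" using x rels_closed by (auto simp: N_def)
  qed
  ultimately have "QQ.I \<subseteq> N" by (rule P.A.genideal_minimal)
  then show ?thesis using f by (auto simp: N_def)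
qed

lemma fPi: "bilin K A B D f \<Longrightarrow> (\<lambda>(a, b). f a b) \<in> carrier (A \<times>\<times> B) \<rightarrow> carrier D"
  by (auto simp: bilin_closed)

lemma tens_lift_q:
  assumes D: "k_algebra K D" and f: "bilin K A B D f" and p: "p \<in> carrier P"
  shows "tens_lift K D f (QQ.q p) = lin_ext K D (\<lambda>(a, b). f a b) p"
  unfolding tens_lift_def
  by (rule QQ.factor_eq[OF D FM.lin_ext_lin[OF D fPi[OF f]] lin_ext_vanishes[OF D f] p])

lemma tens_lift_lin:
  assumes D: "k_algebra K D" and f: "bilin K A B D f"
  shows "tens_lift K D f \<in> lin_maps K T D"
  unfolding tens_lift_def[abs_def] T_def
  by (rule QQ.factor_lin[OF D FM.lin_ext_lin[OF D fPi[OF f]] lin_ext_vanishes[OF D f]])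

lemma tens_lift_tens:
  assumes D: "k_algebra K D" and f: "bilin K A B D f" and "a \<in> carrier A" "b \<in> carrier B"
  shows "tens_lift K D f (t a b) = f a b"
  using assms by (simp add: t_def tens_lift_q[OF D f] e_closed FM.lin_ext_basis[OF D _ fPi[OF f]])

lemma t_bilin: "bilin K A B T t"
proof (intro bilinI lin_mapsI)
  note [simp] = e_closed P.sub_closed P.k_add_closed P.k_smult_closed
  note [simp del] = monoid_alg_simps
  note R = QQ.q_rel QQ.Q_add[symmetric] QQ.Q_smult[symmetric] t_def T_def
  fix a b assume ab: "a \<in> carrier A" "b \<in> carrier B"
  show tc: "t a b \<in> carrier T" using ab by (simp add: t_def T_def QQ.q_closed)
  then show "t a b \<in> carrier T" .
  {
    fix a' assume a': "a' \<in> carrier A"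
    have "e (a \<oplus>\<^bsub>A\<^esub> a') b \<ominus>\<^bsub>P\<^esub> (e a b \<oplus>\<^bsub>P\<^esub> e a' b) \<in> bilin_rels K A B"
      unfolding bilin_rels_def Let_def using ab a' by blast
    from QQ.q_rel[OF _ _ this] show "t (a \<oplus>\<^bsub>A\<^esub> a') b = t a b \<oplus>\<^bsub>T\<^esub> t a' b"
      using ab a' by (simp add: t_def T_def QQ.Q_add)
  next
    fix b' assume b': "b' \<in> carrier B"
    have "e a (b \<oplus>\<^bsub>B\<^esub> b') \<ominus>\<^bsub>P\<^esub> (e a b \<oplus>\<^bsub>P\<^esub> e a b') \<in> bilin_rels K A B"
      unfolding bilin_rels_def Let_def using ab b' by blast
    from QQ.q_rel[OF _ _ this] show "t a (b \<oplus>\<^bsub>B\<^esub> b') = t a b \<oplus>\<^bsub>T\<^esub> t a b'"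
      using ab b' by (simp add: t_def T_def QQ.Q_add)
  next
    fix s assume s: "s \<in> carrier K"
    have "e (s \<odot>\<^bsub>A\<^esub> a) b \<ominus>\<^bsub>P\<^esub> s \<odot>\<^bsub>P\<^esub> e a b \<in> bilin_rels K A B"
      unfolding bilin_rels_def Let_def using ab s by blast
    from QQ.q_rel[OF _ _ this] show "t (s \<odot>\<^bsub>A\<^esub> a) b = s \<odot>\<^bsub>T\<^esub> t a b"
      using ab s by (simp add: t_def T_def QQ.Q_smult)
    have "e a (s \<odot>\<^bsub>B\<^esub> b) \<ominus>\<^bsub>P\<^esub> s \<odot>\<^bsub>P\<^esub> e a b \<in> bilin_rels K A B"
      unfolding bilin_rels_def Let_def using ab s by blast
    from QQ.q_rel[OF _ _ this] show "t a (s \<odot>\<^bsub>B\<^esub> b) = s \<odot>\<^bsub>T\<^esub> t a b"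
      using ab s by (simp add: t_def T_def QQ.Q_smult)
  }
qed

lemma t_closed: "a \<in> carrier A \<Longrightarrow> b \<in> carrier B \<Longrightarrow> t a b \<in> carrier T"
  by (rule bilin_closed[OF t_bilin])

lemma t_mult:
  "\<lbrakk>a \<in> carrier A; b \<in> carrier B; a' \<in> carrier A; b' \<in> carrier B\<rbrakk> \<Longrightarrow>
    t a b \<otimes>\<^bsub>T\<^esub> t a' b' = t (a \<otimes>\<^bsub>A\<^esub> a') (b \<otimes>\<^bsub>B\<^esub> b')"
  unfolding t_def T_def by (subst QQ.Q_mult) (simp_all add: e_closed FM.basis_mult)

lemma T_one: "\<one>\<^bsub>T\<^esub> = t \<one>\<^bsub>A\<^esub> \<one>\<^bsub>B\<^esub>"
  by (simp add: T_def t_def QQ.Q_one monoid_alg_one)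

text \<open>Every class has a representative in the free space on pairs, so pure tensors span. Later
  identities between general tensors are mostly obtained by viewing both sides as linear maps and
  comparing them here.\<close>

lemma tensor_ext:
  assumes D: "k_algebra K D" and F: "F \<in> lin_maps K T D" and G: "G \<in> lin_maps K T D"
    and eq: "\<And>a b. a \<in> carrier A \<Longrightarrow> b \<in> carrier B \<Longrightarrow> F (t a b) = G (t a b)"
    and x: "x \<in> carrier T"
  shows "F x = G x"
proof -
  obtain p where p: "p \<in> carrier P" "x = QQ.q p" using x by (auto simp: T_def QQ.Q_carrier)
  have "F (QQ.q p) = G (QQ.q p)"
    by (rule FM.lin_eq_on_basis[OF D lin_maps_comp[OF F[unfolded T_def] QQ.q_lin]
          lin_maps_comp[OF G[unfolded T_def] QQ.q_lin] _ p(1)])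
      (use eq in \<open>auto simp: t_def\<close>)
  then show ?thesis using p by simp
qed

end

section \<open>Calculus of multilinear maps\<close>

text \<open>Collects one linearity rule for each operation that may surround a variable, together
  with closure and algebra facts, so that the obligations of a nested bracket are discharged by
  repeated backward application.\<close>

named_theorems lin_intros

lemma tensor_algI: "k_algebra K A \<Longrightarrow> k_algebra K B \<Longrightarrow> tensor_alg K A B"
  by (simp add: tensor_alg_def)

lemma k_algebra_tensor [lin_intros]:
  "k_algebra K A \<Longrightarrow> k_algebra K B \<Longrightarrow> k_algebra K (tensor K A B)"
  by (rule tensor_alg.k_algebra_tensor[OF tensor_algI])

lemmas k_algebra_opp [lin_intros]

lemmas tens_lift_lin = tensor_alg.tens_lift_lin[OF tensor_algI]
lemmas tens_lift_tens = tensor_alg.tens_lift_tens[OF tensor_algI]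
lemmas tens_bilin = tensor_alg.t_bilin[OF tensor_algI]
lemmas tens_closed [lin_intros] = tensor_alg.t_closed[OF tensor_algI]
lemmas tens_mult = tensor_alg.t_mult[OF tensor_algI]
lemmas tensor_one = tensor_alg.T_one[OF tensor_algI]
lemmas tensor_ext = tensor_alg.tensor_ext[OF tensor_algI]

lemma alg_mult_closed [lin_intros]:
  "k_algebra K A \<Longrightarrow> x \<in> carrier A \<Longrightarrow> y \<in> carrier A \<Longrightarrow> x \<otimes>\<^bsub>A\<^esub> y \<in> carrier A"
  using monoid.m_closed[OF k_algebraD(6)] .

lemma alg_one_closed [lin_intros]: "k_algebra K A \<Longrightarrow> \<one>\<^bsub>A\<^esub> \<in> carrier A"
  using monoid.one_closed[OF k_algebraD(6)] .

lemma alg_add_closed [lin_intros]: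
  "k_algebra K A \<Longrightarrow> x \<in> carrier A \<Longrightarrow> y \<in> carrier A \<Longrightarrow> x \<oplus>\<^bsub>A\<^esub> y \<in> carrier A"
  using abelian_monoid.a_closed[OF k_algebraD(5)] .

lemma alg_sub_closed [lin_intros]:
  "k_algebra K A \<Longrightarrow> x \<in> carrier A \<Longrightarrow> y \<in> carrier A \<Longrightarrow> x \<ominus>\<^bsub>A\<^esub> y \<in> carrier A"
  by (rule k_algebra.sub_closed)

lemma alg_smult_closed [lin_intros]:
  "k_algebra K A \<Longrightarrow> s \<in> carrier K \<Longrightarrow> x \<in> carrier A \<Longrightarrow> s \<odot>\<^bsub>A\<^esub> x \<in> carrier A"
  by (rule k_algebra.k_smult_closed)

lemmas lin_maps_id [lin_intros] bilinI [lin_intros]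

lemma lin_oppI [lin_intros]:
  "F \<in> lin_maps K C A \<Longrightarrow> F \<in> lin_maps K C (opp A)" "F \<in> lin_maps K A C \<Longrightarrow> F \<in> lin_maps K (opp A) C"
  by simp_all

lemma opp_carrierI [lin_intros]: "x \<in> carrier A \<Longrightarrow> x \<in> carrier (opp A)"
  by simp

declare lin_maps_id [simp]

lemma lin_mult_left [lin_intros]:
  "k_algebra K A \<Longrightarrow> F \<in> lin_maps K C A \<Longrightarrow> c \<in> carrier A \<Longrightarrow> (\<lambda>x. F x \<otimes>\<^bsub>A\<^esub> c) \<in> lin_maps K C A"
  by (rule lin_maps_comp[OF k_algebra.mult_left_lin])

lemma lin_mult_right [lin_intros]:
  "k_algebra K A \<Longrightarrow> F \<in> lin_maps K C A \<Longrightarrow> c \<in> carrier A \<Longrightarrow> (\<lambda>x. c \<otimes>\<^bsub>A\<^esub> F x) \<in> lin_maps K C A"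
  by (rule lin_maps_comp[OF k_algebra.mult_right_lin])

lemma lin_tens_left [lin_intros]:
  "k_algebra K A \<Longrightarrow> k_algebra K B \<Longrightarrow> F \<in> lin_maps K C A \<Longrightarrow> c \<in> carrier B \<Longrightarrow>
    (\<lambda>x. tens K A B (F x) c) \<in> lin_maps K C (tensor K A B)"
  by (rule lin_maps_comp[OF bilin_left[OF tens_bilin]])

lemma lin_tens_right [lin_intros]:
  "k_algebra K A \<Longrightarrow> k_algebra K B \<Longrightarrow> F \<in> lin_maps K C B \<Longrightarrow> c \<in> carrier A \<Longrightarrow>
    (\<lambda>x. tens K A B c (F x)) \<in> lin_maps K C (tensor K A B)"
  by (rule lin_maps_comp[OF bilin_right[OF tens_bilin]])

lemma lin_smult_const [lin_intros]:
  "k_algebra K A \<Longrightarrow> F \<in> lin_maps K C A \<Longrightarrow> s \<in> carrier K \<Longrightarrow> (\<lambda>x. s \<odot>\<^bsub>A\<^esub> F x) \<in> lin_maps K C A"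
proof -
  assume A: "k_algebra K A" and F: "F \<in> lin_maps K C A" and s: "s \<in> carrier K"
  interpret k_algebra K A by fact
  have "(\<lambda>x. s \<odot>\<^bsub>A\<^esub> x) \<in> lin_maps K A A"
    using s by (intro lin_mapsI) (auto simp: smult_r_distr K.m_comm simp flip: smult_assoc1)
  then show ?thesis using F by (rule lin_maps_comp)
qed

lemma lin_smult_var [lin_intros]:
  "k_algebra K A \<Longrightarrow> F \<in> lin_maps K C (base_alg K) \<Longrightarrow> c \<in> carrier A \<Longrightarrow>
    (\<lambda>x. F x \<odot>\<^bsub>A\<^esub> c) \<in> lin_maps K C A"
proof -
  assume A: "k_algebra K A" and F: "F \<in> lin_maps K C (base_alg K)" and c: "c \<in> carrier A"
  interpret k_algebra K A by fact
  have "(\<lambda>s. s \<odot>\<^bsub>A\<^esub> c) \<in> lin_maps K (base_alg K) A"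
    using c by (intro lin_mapsI) (auto simp: smult_l_distr smult_assoc1)
  then show ?thesis using F by (rule lin_maps_comp)
qed

text \<open>Moves a linear map under a bracket. Naturality holds because both sides are linear in
  the tensor and agree on pure ones.\<close>

lemma tens_lift_comm:
  assumes "k_algebra K A" "k_algebra K B" "k_algebra K D" "k_algebra K E"
    and "G \<in> lin_maps K D E" "bilin K A B D f" "t \<in> carrier (tensor K A B)"
  shows "G (tens_lift K D f t) = tens_lift K E (\<lambda>a b. G (f a b)) t"
proof (rule tensor_ext[OF assms(1,2,4) _ _ _ assms(7)])
  have fE: "bilin K A B E (\<lambda>a b. G (f a b))" by (rule bilin_comp[OF assms(6,5)])
  then show "tens_lift K E (\<lambda>a b. G (f a b)) \<in> lin_maps K (tensor K A B) E"
    by (rule tens_lift_lin[OF assms(1,2,4)])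
  show "(\<lambda>t. G (tens_lift K D f t)) \<in> lin_maps K (tensor K A B) E"
    by (rule lin_maps_comp[OF assms(5) tens_lift_lin[OF assms(1-3,6)]])
  show "G (tens_lift K D f (tens K A B a b)) = tens_lift K E (\<lambda>a b. G (f a b)) (tens K A B a b)"
    if "a \<in> carrier A" "b \<in> carrier B" for a b
    using that by (simp only: tens_lift_tens[OF assms(1,2,3,6)] tens_lift_tens[OF assms(1,2,4) fE])
qed

lemma tens_lift_cong:
  assumes "k_algebra K A" "k_algebra K B" "k_algebra K D"
    and f: "bilin K A B D f" and eq: "\<And>a b. a \<in> carrier A \<Longrightarrow> b \<in> carrier B \<Longrightarrow> f a b = g a b"
    and "t \<in> carrier (tensor K A B)"
  shows "tens_lift K D f t = tens_lift K D g t"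
proof (rule tensor_ext[OF assms(1,2,3) _ _ _ assms(6)])
  have g: "bilin K A B D g"
  proof (rule bilinI)
    show "(\<lambda>b. g a b) \<in> lin_maps K B D" if "a \<in> carrier A" for a
      by (rule lin_maps_cong[OF bilin_right[OF f that] eq[OF that] assms(2)])
    show "(\<lambda>a. g a b) \<in> lin_maps K A D" if "b \<in> carrier B" for b
      by (rule lin_maps_cong[OF bilin_left[OF f that] eq[OF _ that] assms(1)])
  qed
  show "tens_lift K D f \<in> lin_maps K (tensor K A B) D" "tens_lift K D g \<in> lin_maps K (tensor K A B) D"
    by (rule tens_lift_lin[OF assms(1-3)], fact)+
  show "tens_lift K D f (tens K A B a b) = tens_lift K D g (tens K A B a b)"
    if "a \<in> carrier A" "b \<in> carrier B" for a b
    using that eq by (simp only: tens_lift_tens[OF assms(1,2,3) f] tens_lift_tens[OF assms(1,2,3) g])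
qed

lemma tens_lift_self:
  assumes "k_algebra K A" "k_algebra K B" "t \<in> carrier (tensor K A B)"
  shows "tens_lift K (tensor K A B) (tens K A B) t = t"
proof (rule tensor_ext[OF assms(1,2) _ _ lin_maps_id _ assms(3)])
  show 1: "k_algebra K (tensor K A B)" using assms by (intro lin_intros)
  show "tens_lift K (tensor K A B) (tens K A B) \<in> lin_maps K (tensor K A B) (tensor K A B)"
    by (rule tens_lift_lin[OF assms(1,2) 1 tens_bilin[OF assms(1,2)]])
  show "tens_lift K (tensor K A B) (tens K A B) (tens K A B a b) = tens K A B a b"
    if "a \<in> carrier A" "b \<in> carrier B" for a b
    using that by (simp only: tens_lift_tens[OF assms(1,2) 1 tens_bilin[OF assms(1,2)]])
qed

text \<open>In a nested bracket the inner lift depends on the outer variables through its body, and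
  the outer lift is meaningful only if that dependence is linear. This rule provides the
  linearity.\<close>

lemma tens_lift_param:
  assumes A: "k_algebra K A" and B: "k_algebra K B" and D: "k_algebra K D" and C: "k_algebra K C"
    and f: "\<And>z. z \<in> carrier C \<Longrightarrow> bilin K A B D (f z)"
    and z: "\<And>a b. a \<in> carrier A \<Longrightarrow> b \<in> carrier B \<Longrightarrow> (\<lambda>z. f z a b) \<in> lin_maps K C D"
    and t: "t \<in> carrier (tensor K A B)"
  shows "(\<lambda>z. tens_lift K D (f z) t) \<in> lin_maps K C D"
proof (rule lin_mapsI)
  have T: "k_algebra K (tensor K A B)" using A B by (rule k_algebra_tensor)
  note L = tens_lift_lin[OF A B D f] and tt = tens_lift_tens[OF A B D f]
  note Cc = abelian_monoid.a_closed[OF k_algebraD(5)[OF C]] k_algebra.k_smult_closed[OF C]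
  fix x assume x: "x \<in> carrier C"
  show "tens_lift K D (f x) t \<in> carrier D" by (rule lin_maps_closed[OF L[OF x] t])
  {
    fix y assume y: "y \<in> carrier C"
    show "tens_lift K D (f (x \<oplus>\<^bsub>C\<^esub> y)) t = tens_lift K D (f x) t \<oplus>\<^bsub>D\<^esub> tens_lift K D (f y) t"
    proof (rule tensor_ext[OF A B D _ _ _ t])
      show "tens_lift K D (f (x \<oplus>\<^bsub>C\<^esub> y)) \<in> lin_maps K (tensor K A B) D" using x y by (intro L Cc)
      show "(\<lambda>t. tens_lift K D (f x) t \<oplus>\<^bsub>D\<^esub> tens_lift K D (f y) t) \<in> lin_maps K (tensor K A B) D"
        using x y by (intro lin_maps_sum[OF T D] L)
      show "tens_lift K D (f (x \<oplus>\<^bsub>C\<^esub> y)) (tens K A B a b)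
        = tens_lift K D (f x) (tens K A B a b) \<oplus>\<^bsub>D\<^esub> tens_lift K D (f y) (tens K A B a b)"
        if "a \<in> carrier A" "b \<in> carrier B" for a b
        using that x y by (simp only: tt Cc lin_maps_add[OF z])
    qed
  next
    fix s assume s: "s \<in> carrier K"
    show "tens_lift K D (f (s \<odot>\<^bsub>C\<^esub> x)) t = s \<odot>\<^bsub>D\<^esub> tens_lift K D (f x) t"
    proof (rule tensor_ext[OF A B D _ _ _ t])
      show "tens_lift K D (f (s \<odot>\<^bsub>C\<^esub> x)) \<in> lin_maps K (tensor K A B) D" using x s by (intro L Cc)
      show "(\<lambda>t. s \<odot>\<^bsub>D\<^esub> tens_lift K D (f x) t) \<in> lin_maps K (tensor K A B) D"
        using x s by (intro lin_smult_const D L)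
      show "tens_lift K D (f (s \<odot>\<^bsub>C\<^esub> x)) (tens K A B a b)
        = s \<odot>\<^bsub>D\<^esub> tens_lift K D (f x) (tens K A B a b)"
        if "a \<in> carrier A" "b \<in> carrier B" for a b
        using that x s by (simp only: tt Cc lin_maps_smult[OF z])
    qed
  }
qed

text \<open>A product of two unspecified tensors becomes a pair of nested brackets; the two tensors
  are replaced by pure ones one after the other, starting with the left one.\<close>

lemma tens_lift_mult:
  assumes A: "k_algebra K A" and B: "k_algebra K B" and D: "k_algebra K D"
    and f: "bilin K A B D f" and u: "u \<in> carrier (tensor K A B)" and v: "v \<in> carrier (tensor K A B)"
  shows "tens_lift K D f (u \<otimes>\<^bsub>tensor K A B\<^esub> v)
    = tens_lift K D (\<lambda>a b. tens_lift K D (\<lambda>a' b'. f (a \<otimes>\<^bsub>A\<^esub> a') (b \<otimes>\<^bsub>B\<^esub> b')) v) u"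
proof -
  have T: "k_algebra K (tensor K A B)" using A B by (rule k_algebra_tensor)
  note f1 = lin_maps_comp[OF bilin_left[OF f]] and f2 = lin_maps_comp[OF bilin_right[OF f]]
  have b1: "bilin K A B D (\<lambda>a' b'. f (a \<otimes>\<^bsub>A\<^esub> a') (b \<otimes>\<^bsub>B\<^esub> b'))"
    if "a \<in> carrier A" "b \<in> carrier B" for a b
    by (rule bilinI; rule f1 f2; (intro lin_intros A B)?; fact?) (use that A B in \<open>auto intro: lin_intros\<close>)
  have b2: "bilin K A B D (\<lambda>a b. f (a \<otimes>\<^bsub>A\<^esub> a') (b \<otimes>\<^bsub>B\<^esub> b'))"
    if "a' \<in> carrier A" "b' \<in> carrier B" for a' b'
    by (rule bilinI; rule f1 f2; (intro lin_intros A B)?; fact?) (use that A B in \<open>auto intro: lin_intros\<close>)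
  have b3: "bilin K A B D (\<lambda>a b. tens_lift K D (\<lambda>a' b'. f (a \<otimes>\<^bsub>A\<^esub> a') (b \<otimes>\<^bsub>B\<^esub> b')) v)"
  proof (rule bilinI)
    show "(\<lambda>b. tens_lift K D (\<lambda>a' b'. f (a \<otimes>\<^bsub>A\<^esub> a') (b \<otimes>\<^bsub>B\<^esub> b')) v) \<in> lin_maps K B D"
      if a: "a \<in> carrier A" for a
      by (rule tens_lift_param[OF A B D B b1[OF a] bilin_right[OF b2 a] v])
    show "(\<lambda>a. tens_lift K D (\<lambda>a' b'. f (a \<otimes>\<^bsub>A\<^esub> a') (b \<otimes>\<^bsub>B\<^esub> b')) v) \<in> lin_maps K A D"
      if b: "b \<in> carrier B" for b
      by (rule tens_lift_param[OF A B D A b1[OF _ b] bilin_left[OF b2 b] v])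
  qed
  show ?thesis
  proof (rule tensor_ext[OF A B D _ tens_lift_lin[OF A B D b3] _ u])
    show "(\<lambda>u. tens_lift K D f (u \<otimes>\<^bsub>tensor K A B\<^esub> v)) \<in> lin_maps K (tensor K A B) D"
      by (rule lin_maps_comp[OF tens_lift_lin[OF A B D f] k_algebra.mult_left_lin[OF T v]])
    fix a b assume ab: "a \<in> carrier A" "b \<in> carrier B"
    have "tens_lift K D f (tens K A B a b \<otimes>\<^bsub>tensor K A B\<^esub> v)
        = tens_lift K D (\<lambda>a' b'. f (a \<otimes>\<^bsub>A\<^esub> a') (b \<otimes>\<^bsub>B\<^esub> b')) v"
    proof (rule tensor_ext[OF A B D _ tens_lift_lin[OF A B D b1[OF ab]] _ v])
      show "(\<lambda>v. tens_lift K D f (tens K A B a b \<otimes>\<^bsub>tensor K A B\<^esub> v)) \<in> lin_maps K (tensor K A B) D"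
        by (rule lin_maps_comp[OF tens_lift_lin[OF A B D f]
              k_algebra.mult_right_lin[OF T tens_closed[OF A B ab]]])
      show "tens_lift K D f (tens K A B a b \<otimes>\<^bsub>tensor K A B\<^esub> tens K A B a' b')
        = tens_lift K D (\<lambda>a' b'. f (a \<otimes>\<^bsub>A\<^esub> a') (b \<otimes>\<^bsub>B\<^esub> b')) (tens K A B a' b')"
        if "a' \<in> carrier A" "b' \<in> carrier B" for a' b'
        using that ab
        by (simp only: tens_mult[OF A B] tens_lift_tens[OF A B D f] tens_lift_tens[OF A B D b1[OF ab]]
            alg_mult_closed[OF A] alg_mult_closed[OF B])
    qed
    then show "tens_lift K D f (tens K A B a b \<otimes>\<^bsub>tensor K A B\<^esub> v)
      = tens_lift K D (\<lambda>a b. tens_lift K D (\<lambda>a' b'. f (a \<otimes>\<^bsub>A\<^esub> a') (b \<otimes>\<^bsub>B\<^esub> b')) v) (tens K A B a b)"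
      using ab by (simp only: tens_lift_tens[OF A B D b3])
  qed
qed

section \<open>Linear functionals\<close>

text \<open>The functional is the coefficient of the unit modulo a maximal subspace not containing it.\<close>

lemma (in k_algebra) functional_exists:
  assumes ne: "\<one>\<^bsub>A\<^esub> \<noteq> \<zero>\<^bsub>A\<^esub>"
  shows "\<exists>f\<in>lin_maps K A (base_alg K). f \<one>\<^bsub>A\<^esub> = \<one>\<^bsub>K\<^esub>"
proof -
  define sub where "sub W \<longleftrightarrow> W \<subseteq> carrier A \<and> \<zero>\<^bsub>A\<^esub> \<in> W \<and> (\<forall>x\<in>W. \<forall>y\<in>W. x \<oplus>\<^bsub>A\<^esub> y \<in> W)
    \<and> (\<forall>s\<in>carrier K. \<forall>x\<in>W. s \<odot>\<^bsub>A\<^esub> x \<in> W) \<and> \<one>\<^bsub>A\<^esub> \<notin> W" for W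
  have "\<exists>W\<in>Collect sub. \<forall>V\<in>Collect sub. W \<subseteq> V \<longrightarrow> V = W"
  proof (rule subset_Zorn_nonempty)
    have "sub {\<zero>\<^bsub>A\<^esub>}" using ne by (auto simp: sub_def)
    then show "Collect sub \<noteq> {}" by blast
    fix C assume C: "C \<noteq> {}" "subset.chain (Collect sub) C"
    then have subC: "sub W" if "W \<in> C" for W using that by (auto simp: subset.chain_def)
    have lin: "V \<subseteq> W \<or> W \<subseteq> V" if "V \<in> C" "W \<in> C" for V W
      using C(2) that by (auto simp: subset.chain_def)
    have "x \<oplus>\<^bsub>A\<^esub> y \<in> \<Union>C" if xy: "x \<in> \<Union>C" "y \<in> \<Union>C" for x y
    proof -
      obtain V W where VW: "V \<in> C" "W \<in> C" "x \<in> V" "y \<in> W" using xy by blast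
      then show ?thesis using lin[OF VW(1,2)] subC unfolding sub_def by (metis UnionI subsetD)
    qed
    moreover have "\<Union>C \<subseteq> carrier A" "\<one>\<^bsub>A\<^esub> \<notin> \<Union>C" using subC unfolding sub_def by blast+
    moreover have "\<zero>\<^bsub>A\<^esub> \<in> \<Union>C" using subC C(1) unfolding sub_def by blast
    moreover have "s \<odot>\<^bsub>A\<^esub> x \<in> \<Union>C" if "s \<in> carrier K" "x \<in> \<Union>C" for s x
      using subC that unfolding sub_def by blast
    ultimately show "\<Union>C \<in> Collect sub" unfolding mem_Collect_eq sub_def by blast
  qed
  then obtain W where W: "sub W" and max: "\<And>V. sub V \<Longrightarrow> W \<subseteq> V \<Longrightarrow> V = W" by blast
  have Wc: "W \<subseteq> carrier A" and W0: "\<zero>\<^bsub>A\<^esub> \<in> W" and W1: "\<one>\<^bsub>A\<^esub> \<notin> W"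
    and Wa: "\<And>x y. x \<in> W \<Longrightarrow> y \<in> W \<Longrightarrow> x \<oplus>\<^bsub>A\<^esub> y \<in> W"
    and Ws: "\<And>s x. s \<in> carrier K \<Longrightarrow> x \<in> W \<Longrightarrow> s \<odot>\<^bsub>A\<^esub> x \<in> W"
    using W by (auto simp: sub_def)
  have Wm: "\<ominus>\<^bsub>A\<^esub> x \<in> W" if "x \<in> W" for x
    using Ws[of "\<ominus>\<^bsub>K\<^esub> \<one>\<^bsub>K\<^esub>" x] that Wc by (auto simp: smult_l_minus subset_iff)
  have ex: "\<exists>s\<in>carrier K. \<exists>w\<in>W. r = w \<oplus>\<^bsub>A\<^esub> s \<odot>\<^bsub>A\<^esub> \<one>\<^bsub>A\<^esub>" if r: "r \<in> carrier A" for r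
  proof (cases "r \<in> W")
    case True
    then show ?thesis using r by (intro bexI[of _ "\<zero>\<^bsub>K\<^esub>"] bexI[of _ r]) auto
  next
    case False
    \<comment> \<open>By maximality of W, the larger subspace spanned by W and r can no longer avoid
      the unit. The unit is therefore a combination that can be solved for r.\<close>
    define V where "V = {w \<oplus>\<^bsub>A\<^esub> s \<odot>\<^bsub>A\<^esub> r | w s. w \<in> W \<and> s \<in> carrier K}"
    have WV: "W \<subseteq> V"
    proof
      fix w assume "w \<in> W"
      then show "w \<in> V" using r Wc unfolding V_def
        by (intro CollectI exI[of _ w] exI[of _ "\<zero>\<^bsub>K\<^esub>"]) (auto simp: subset_iff)
    qed
    have rV: "r \<in> V" using r W0 unfolding V_def
      by (intro CollectI exI[of _ "\<zero>\<^bsub>A\<^esub>"] exI[of _ "\<one>\<^bsub>K\<^esub>"]) auto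
    have "\<not> sub V" using max[OF _ WV] rV False by blast
    moreover have "V \<subseteq> carrier A" using Wc r by (auto simp: V_def)
    moreover have "x \<oplus>\<^bsub>A\<^esub> y \<in> V" if xV: "x \<in> V" and yV: "y \<in> V" for x y
    proof -
      obtain w s where 1: "w \<in> W" "s \<in> carrier K" "x = w \<oplus>\<^bsub>A\<^esub> s \<odot>\<^bsub>A\<^esub> r"
        using xV unfolding V_def by blast
      obtain w' s' where 2: "w' \<in> W" "s' \<in> carrier K" "y = w' \<oplus>\<^bsub>A\<^esub> s' \<odot>\<^bsub>A\<^esub> r"
        using yV unfolding V_def by blast
      note * = 1 2
      then have "w \<in> carrier A" "w' \<in> carrier A" using Wc by auto
      then have "x \<oplus>\<^bsub>A\<^esub> y = (w \<oplus>\<^bsub>A\<^esub> w') \<oplus>\<^bsub>A\<^esub> (s \<oplus>\<^bsub>K\<^esub> s') \<odot>\<^bsub>A\<^esub> r"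
        using * r by (simp add: smult_l_distr A.a_ac)
      then show ?thesis using * Wa unfolding V_def by blast
    qed
    moreover have "a \<odot>\<^bsub>A\<^esub> x \<in> V" if xV: "x \<in> V" and aK: "a \<in> carrier K" for x a
    proof -
      obtain w s where *: "w \<in> W" "s \<in> carrier K" "x = w \<oplus>\<^bsub>A\<^esub> s \<odot>\<^bsub>A\<^esub> r"
        using xV unfolding V_def by blast
      then have "w \<in> carrier A" using Wc by auto
      then have "a \<odot>\<^bsub>A\<^esub> x = a \<odot>\<^bsub>A\<^esub> w \<oplus>\<^bsub>A\<^esub> (a \<otimes>\<^bsub>K\<^esub> s) \<odot>\<^bsub>A\<^esub> r"
        using * r aK by (simp add: smult_r_distr smult_assoc1)
      then show ?thesis using * Ws aK unfolding V_def by blast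
    qed
    ultimately have "\<one>\<^bsub>A\<^esub> \<in> V" using WV W0 unfolding sub_def by blast
    then obtain w s where ws: "w \<in> W" "s \<in> carrier K" "\<one>\<^bsub>A\<^esub> = w \<oplus>\<^bsub>A\<^esub> s \<odot>\<^bsub>A\<^esub> r"
      unfolding V_def by blast
    have wc: "w \<in> carrier A" using ws Wc by auto
    \<comment> \<open>With s = 0 the unit would equal w and lie in W, so the equation may be divided
      by s.\<close>
    have s0: "s \<noteq> \<zero>\<^bsub>K\<^esub>" using ws W1 wc r by auto
    then have su: "s \<in> Units K" using ws K.field_Units by auto
    then have si: "inv\<^bsub>K\<^esub> s \<in> carrier K" "inv\<^bsub>K\<^esub> s \<otimes>\<^bsub>K\<^esub> s = \<one>\<^bsub>K\<^esub>" by auto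
    have "inv\<^bsub>K\<^esub> s \<odot>\<^bsub>A\<^esub> \<one>\<^bsub>A\<^esub> = inv\<^bsub>K\<^esub> s \<odot>\<^bsub>A\<^esub> w \<oplus>\<^bsub>A\<^esub> r"
      using ws r wc si by (simp add: smult_r_distr flip: smult_assoc1)
    then have "\<ominus>\<^bsub>A\<^esub> (inv\<^bsub>K\<^esub> s \<odot>\<^bsub>A\<^esub> w) \<oplus>\<^bsub>A\<^esub> inv\<^bsub>K\<^esub> s \<odot>\<^bsub>A\<^esub> \<one>\<^bsub>A\<^esub>
        = \<ominus>\<^bsub>A\<^esub> (inv\<^bsub>K\<^esub> s \<odot>\<^bsub>A\<^esub> w) \<oplus>\<^bsub>A\<^esub> (inv\<^bsub>K\<^esub> s \<odot>\<^bsub>A\<^esub> w \<oplus>\<^bsub>A\<^esub> r)" by simp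
    also have "\<dots> = r" using wc r si by (simp add: A.a_assoc[symmetric] A.l_neg)
    finally show ?thesis using Wm[OF Ws[OF si(1) ws(1)]] si by metis
  qed
  \<comment> \<open>Two decompositions with different scalars would put a nonzero multiple of the
    unit into W, and hence the unit itself.\<close>
  have uniq: "s = s'" if "s \<in> carrier K" "s' \<in> carrier K" "w \<in> W" "w' \<in> W"
    and eq: "w \<oplus>\<^bsub>A\<^esub> s \<odot>\<^bsub>A\<^esub> \<one>\<^bsub>A\<^esub> = w' \<oplus>\<^bsub>A\<^esub> s' \<odot>\<^bsub>A\<^esub> \<one>\<^bsub>A\<^esub>" for s s' w w'
  proof (rule ccontr)
    assume ne: "s \<noteq> s'"
    have wc: "w \<in> carrier A" "w' \<in> carrier A" using that Wc by auto
    define d where "d = s \<ominus>\<^bsub>K\<^esub> s'"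
    have dc: "d \<in> carrier K" using that by (simp add: d_def)
    have "d \<noteq> \<zero>\<^bsub>K\<^esub>"
      using ne that by (metis K.add.inv_closed K.minus_equality K.minus_minus a_minus_def d_def)
    then have du: "d \<in> Units K" using dc K.field_Units by auto
    have eq1: "s \<odot>\<^bsub>A\<^esub> \<one>\<^bsub>A\<^esub> = \<ominus>\<^bsub>A\<^esub> w \<oplus>\<^bsub>A\<^esub> (w' \<oplus>\<^bsub>A\<^esub> s' \<odot>\<^bsub>A\<^esub> \<one>\<^bsub>A\<^esub>)"
      using that wc by (simp add: A.a_assoc[symmetric] A.l_neg flip: eq)
    have "d \<odot>\<^bsub>A\<^esub> \<one>\<^bsub>A\<^esub> = s \<odot>\<^bsub>A\<^esub> \<one>\<^bsub>A\<^esub> \<oplus>\<^bsub>A\<^esub> \<ominus>\<^bsub>A\<^esub> (s' \<odot>\<^bsub>A\<^esub> \<one>\<^bsub>A\<^esub>)"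
      using that by (simp add: d_def a_minus_def smult_l_distr smult_l_minus)
    also have "\<dots> = \<ominus>\<^bsub>A\<^esub> w \<oplus>\<^bsub>A\<^esub> w'"
      using that wc by (simp add: eq1 A.a_assoc A.r_neg)
    finally have "d \<odot>\<^bsub>A\<^esub> \<one>\<^bsub>A\<^esub> \<in> W" using Wa Wm that by simp
    from Ws[OF K.Units_inv_closed[OF du] this]
    have "inv\<^bsub>K\<^esub> d \<odot>\<^bsub>A\<^esub> (d \<odot>\<^bsub>A\<^esub> \<one>\<^bsub>A\<^esub>) \<in> W" .
    then show False using W1 du dc by (simp flip: smult_assoc1)
  qed
  define f where "f r = (THE s. s \<in> carrier K \<and> (\<exists>w\<in>W. r = w \<oplus>\<^bsub>A\<^esub> s \<odot>\<^bsub>A\<^esub> \<one>\<^bsub>A\<^esub>))" for r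
  have f: "f r = s" if "s \<in> carrier K" "w \<in> W" "r = w \<oplus>\<^bsub>A\<^esub> s \<odot>\<^bsub>A\<^esub> \<one>\<^bsub>A\<^esub>" for r s w
    unfolding f_def by (rule the_equality) (use that uniq in blast)+
  have "f \<in> lin_maps K A (base_alg K)"
  proof (rule lin_mapsI)
    fix x assume x: "x \<in> carrier A"
    obtain s w where sw: "s \<in> carrier K" "w \<in> W" "x = w \<oplus>\<^bsub>A\<^esub> s \<odot>\<^bsub>A\<^esub> \<one>\<^bsub>A\<^esub>" using ex[OF x] by blast
    have wc: "w \<in> carrier A" using sw Wc by auto
    show "f x \<in> carrier (base_alg K)" using f[OF sw] sw by simp
    {
      fix y assume y: "y \<in> carrier A"
      obtain s' w' where sw': "s' \<in> carrier K" "w' \<in> W" "y = w' \<oplus>\<^bsub>A\<^esub> s' \<odot>\<^bsub>A\<^esub> \<one>\<^bsub>A\<^esub>"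
        using ex[OF y] by blast
      have wc': "w' \<in> carrier A" using sw' Wc by auto
      have "x \<oplus>\<^bsub>A\<^esub> y = (w \<oplus>\<^bsub>A\<^esub> w') \<oplus>\<^bsub>A\<^esub> (s \<oplus>\<^bsub>K\<^esub> s') \<odot>\<^bsub>A\<^esub> \<one>\<^bsub>A\<^esub>"
        using sw sw' wc wc' by (simp add: smult_l_distr A.a_ac)
      from f[OF _ _ this] show "f (x \<oplus>\<^bsub>A\<^esub> y) = f x \<oplus>\<^bsub>base_alg K\<^esub> f y"
        using f[OF sw] f[OF sw'] sw sw' Wa by simp
    next
      fix a assume a: "a \<in> carrier K"
      have "a \<odot>\<^bsub>A\<^esub> x = a \<odot>\<^bsub>A\<^esub> w \<oplus>\<^bsub>A\<^esub> (a \<otimes>\<^bsub>K\<^esub> s) \<odot>\<^bsub>A\<^esub> \<one>\<^bsub>A\<^esub>"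
        using sw a wc by (simp add: smult_r_distr smult_assoc1)
      from f[OF _ _ this] show "f (a \<odot>\<^bsub>A\<^esub> x) = a \<odot>\<^bsub>base_alg K\<^esub> f x"
        using f[OF sw] sw a Ws by simp
    }
  qed
  moreover have "f \<one>\<^bsub>A\<^esub> = \<one>\<^bsub>K\<^esub>" by (rule f[of _ "\<zero>\<^bsub>A\<^esub>"]) (use W0 in auto)
  ultimately show ?thesis by blast
qed

section \<open>Free products and ambiskew polynomial algebras\<close>

definition sub_alg :: "'k ring \<Rightarrow> ('k, 'a) module \<Rightarrow> 'a set \<Rightarrow> bool" where
  "sub_alg K A Q \<longleftrightarrow> \<one>\<^bsub>A\<^esub> \<in> Q
    \<and> (\<forall>x\<in>carrier A \<inter> Q. \<forall>y\<in>carrier A \<inter> Q. x \<oplus>\<^bsub>A\<^esub> y \<in> Q \<and> x \<otimes>\<^bsub>A\<^esub> y \<in> Q)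
    \<and> (\<forall>s\<in>carrier K. \<forall>x\<in>carrier A \<inter> Q. s \<odot>\<^bsub>A\<^esub> x \<in> Q)"

lemma sub_algI:
  assumes "\<one>\<^bsub>A\<^esub> \<in> Q"
    and "\<And>x y. x \<in> carrier A \<Longrightarrow> y \<in> carrier A \<Longrightarrow> x \<in> Q \<Longrightarrow> y \<in> Q \<Longrightarrow> x \<oplus>\<^bsub>A\<^esub> y \<in> Q"
    and "\<And>x y. x \<in> carrier A \<Longrightarrow> y \<in> carrier A \<Longrightarrow> x \<in> Q \<Longrightarrow> y \<in> Q \<Longrightarrow> x \<otimes>\<^bsub>A\<^esub> y \<in> Q"
    and "\<And>s x. s \<in> carrier K \<Longrightarrow> x \<in> carrier A \<Longrightarrow> x \<in> Q \<Longrightarrow> s \<odot>\<^bsub>A\<^esub> x \<in> Q"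
  shows "sub_alg K A Q"
  using assms by (auto simp: sub_alg_def)

text \<open>Generation statements descend to quotients in this way: a subalgebra of the quotient is
  pulled back along the projection and compared with the generators above.\<close>

lemma sub_alg_vimage:
  assumes A: "k_algebra K A" and F: "F \<in> alg_hom K A B" and Q: "sub_alg K B Q"
  shows "sub_alg K A {x. F x \<in> Q}"
  using Q lin_maps_closed[OF alg_hom_lin[OF F]]
  by (auto simp: sub_alg_def alg_hom_one[OF F] alg_hom_mult[OF F]
      lin_maps_add[OF alg_hom_lin[OF F]] lin_maps_smult[OF alg_hom_lin[OF F]])

section \<open>Free algebras\<close>

lemma monoid_free_monoid: "monoid (free_monoid S)"
  by (rule monoidI) (auto simp: free_monoid_def)

locale free_algebra = K?: field K for K :: "'k ring" +
  fixes S :: "'g set"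
begin

sublocale FM: field_monoid K "free_monoid S"
  by (intro field_monoid.intro monoid_free_monoid K.field_axioms)

abbreviation "FA \<equiv> free_alg K S"

lemma k_algebra_free: "k_algebra K FA"
  unfolding free_alg_def by (rule FM.k_algebra_monoid_alg)

lemma letter_closed: "x \<in> S \<Longrightarrow> basis_elem K [x] \<in> carrier FA"
  unfolding free_alg_def by (rule FM.basis_closed) (simp add: free_monoid_def)

lemma free_lift:
  assumes D: "k_algebra K D" and g: "\<And>x. x \<in> S \<Longrightarrow> g x \<in> carrier D"
  shows "\<exists>G\<in>alg_hom K FA D. \<forall>x\<in>S. G (basis_elem K [x]) = g x"
proof -
  interpret D: k_algebra K D by fact
  define w where "w = (\<lambda>l. foldr (\<lambda>x acc. g x \<otimes>\<^bsub>D\<^esub> acc) l \<one>\<^bsub>D\<^esub>)"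
  have wc: "w l \<in> carrier D" if "l \<in> lists S" for l
    using that by (induction l) (auto simp: w_def g)
  have wa: "w (l @ l') = w l \<otimes>\<^bsub>D\<^esub> w l'" if "l \<in> lists S" "l' \<in> lists S" for l l'
    using that(1)
  proof (induction l)
    case (Cons x l)
    then have "w ((x # l) @ l') = g x \<otimes>\<^bsub>D\<^esub> (w l \<otimes>\<^bsub>D\<^esub> w l')" by (simp add: w_def)
    also have "\<dots> = w (x # l) \<otimes>\<^bsub>D\<^esub> w l'"
      using D.A.m_assoc[OF g wc wc] Cons that by (simp add: w_def)
    finally show ?case .
  qed (use wc that in \<open>simp add: w_def\<close>)
  have Pi: "w \<in> carrier (free_monoid S) \<rightarrow> carrier D" using wc by (auto simp: free_monoid_def)
  note L = FM.lin_ext_lin[OF D Pi]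
  have basis: "lin_ext K D w (basis_elem K l) = w l" if "l \<in> lists S" for l
    by (rule FM.lin_ext_basis[OF D _ Pi]) (use that in \<open>simp add: free_monoid_def\<close>)
  have "lin_ext K D w \<in> alg_hom K FA D"
    unfolding free_alg_def
  proof (rule alg_homI[OF L])
    show "lin_ext K D w \<one>\<^bsub>FM.P\<^esub> = \<one>\<^bsub>D\<^esub>"
      unfolding monoid_alg_one using basis[of "[]"] by (simp add: free_monoid_def w_def)
    fix p q assume p: "p \<in> carrier FM.P" and q: "q \<in> carrier FM.P"
    have bq: "lin_ext K D w (basis_elem K l \<otimes>\<^bsub>FM.P\<^esub> q) = lin_ext K D w (basis_elem K l) \<otimes>\<^bsub>D\<^esub> lin_ext K D w q"
      if l: "l \<in> carrier (free_monoid S)" for l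
    proof (rule FM.lin_eq_on_basis[OF D _ _ _ q])
      show "(\<lambda>q. lin_ext K D w (basis_elem K l \<otimes>\<^bsub>FM.P\<^esub> q)) \<in> lin_maps K FM.P D"
        by (rule lin_maps_comp[OF L FM.mult_lin_right[OF FM.basis_closed[OF l]]])
      show "(\<lambda>q. lin_ext K D w (basis_elem K l) \<otimes>\<^bsub>D\<^esub> lin_ext K D w q) \<in> lin_maps K FM.P D"
        by (rule lin_mult_right[OF D L lin_maps_closed[OF L FM.basis_closed[OF l]]])
      fix m assume m: "m \<in> carrier (free_monoid S)"
      show "lin_ext K D w (basis_elem K l \<otimes>\<^bsub>FM.P\<^esub> basis_elem K m)
        = lin_ext K D w (basis_elem K l) \<otimes>\<^bsub>D\<^esub> lin_ext K D w (basis_elem K m)"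
        unfolding FM.basis_mult[OF l m] using l m by (simp add: free_monoid_def basis wa)
    qed
    show "lin_ext K D w (p \<otimes>\<^bsub>FM.P\<^esub> q) = lin_ext K D w p \<otimes>\<^bsub>D\<^esub> lin_ext K D w q"
    proof (rule FM.lin_eq_on_basis[OF D _ _ _ p])
      show "(\<lambda>p. lin_ext K D w (p \<otimes>\<^bsub>FM.P\<^esub> q)) \<in> lin_maps K FM.P D"
        by (rule lin_maps_comp[OF L FM.mult_lin_left[OF q]])
      show "(\<lambda>p. lin_ext K D w p \<otimes>\<^bsub>D\<^esub> lin_ext K D w q) \<in> lin_maps K FM.P D"
        by (rule lin_mult_left[OF D L lin_maps_closed[OF L q]])
    qed (rule bq)
  qed
  moreover have "lin_ext K D w (basis_elem K [x]) = g x" if "x \<in> S" for x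
    using basis[of "[x]"] that g by (simp add: w_def)
  ultimately show ?thesis by blast
qed

text \<open>Words are products of letters and the empty word is the unit, so a subalgebra containing
  the letters contains the whole monoid basis.\<close>

lemma free_generated:
  assumes Q: "sub_alg K FA Q" and g: "\<And>x. x \<in> S \<Longrightarrow> basis_elem K [x] \<in> Q" and p: "p \<in> carrier FA"
  shows "p \<in> Q"
proof -
  interpret FA: k_algebra K FA by (rule k_algebra_free)
  have Q1: "basis_elem K [] \<in> Q"
    using Q by (simp add: sub_alg_def free_alg_def monoid_alg_one) (simp add: free_monoid_def)
  have words: "basis_elem K l \<in> Q" if "l \<in> lists S" for l
    using that
  proof (induction l)
    case Nil
    then show ?case by (simp add: Q1)
  next
    case (Cons x l)
    have "basis_elem K (x # l) = basis_elem K [x] \<otimes>\<^bsub>FA\<^esub> basis_elem K l"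
      using Cons FM.basis_mult[of "[x]" l] by (simp add: free_alg_def free_monoid_def)
    moreover have "basis_elem K l \<in> carrier FA" "basis_elem K [x] \<in> carrier FA"
      using Cons FM.basis_closed[of l] letter_closed by (auto simp: free_alg_def free_monoid_def)
    ultimately show ?case using Q g Cons by (simp add: sub_alg_def)
  qed
  have z: "\<zero>\<^bsub>FA\<^esub> \<in> Q"
  proof -
    have "\<zero>\<^bsub>K\<^esub> \<odot>\<^bsub>FA\<^esub> \<one>\<^bsub>FA\<^esub> \<in> Q" using Q FA.k_zero_closed unfolding sub_alg_def by blast
    then show ?thesis using FA.smult_l_null[of "\<one>\<^bsub>FA\<^esub>"] by simp
  qed
  show ?thesis
    using p unfolding free_alg_def
    by (induction p rule: FM.P_induct)
      (use z Q words in \<open>auto simp: sub_alg_def free_alg_def free_monoid_def simp del: monoid_alg_simps\<close>)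
qed

end

section \<open>Free products of algebras\<close>

lemma insertion_rels_closed:
  assumes "k_algebra K F" "k_algebra K A"
    and "\<And>a. a \<in> carrier A \<Longrightarrow> basis_elem K [j a] \<in> carrier F"
  shows "insertion_rels K F A j \<subseteq> carrier F"
  unfolding insertion_rels_def Let_def
  by (auto intro!: assms(3) alg_sub_closed[OF assms(1)] alg_add_closed[OF assms(1)] alg_mult_closed[OF assms(1)]
      alg_smult_closed[OF assms(1)] alg_one_closed[OF assms(1)] alg_add_closed[OF assms(2)]
      alg_mult_closed[OF assms(2)] alg_smult_closed[OF assms(2)] alg_one_closed[OF assms(2)])

text \<open>Each family of insertion relators is one axiom of an algebra homomorphism, read modulo
  the ideal.\<close>

lemma insertion_hom:
  assumes q: "quot_alg K F S" and A: "k_algebra K A"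
    and j: "\<And>a. a \<in> carrier A \<Longrightarrow> basis_elem K [j a] \<in> carrier F" and rS: "insertion_rels K F A j \<subseteq> S"
  shows "(\<lambda>a. quot_proj F S (basis_elem K [j a])) \<in> alg_hom K A (alg_quot F S)"
proof -
  interpret quot_alg K F S by fact
  interpret A: k_algebra K A by fact
  let ?e = "\<lambda>a. basis_elem K [j a]"
  have r: "q x = q y" if "x \<ominus>\<^bsub>F\<^esub> y \<in> insertion_rels K F A j" "x \<in> carrier F" "y \<in> carrier F" for x y
    by (rule q_rel[OF that(2,3) subsetD[OF rS that(1)]])
  have 1: "?e (a \<oplus>\<^bsub>A\<^esub> b) \<ominus>\<^bsub>F\<^esub> (?e a \<oplus>\<^bsub>F\<^esub> ?e b) \<in> insertion_rels K F A j"
    "?e (a \<otimes>\<^bsub>A\<^esub> b) \<ominus>\<^bsub>F\<^esub> ?e a \<otimes>\<^bsub>F\<^esub> ?e b \<in> insertion_rels K F A j"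
    if "a \<in> carrier A" "b \<in> carrier A" for a b
    using that unfolding insertion_rels_def Let_def by blast+
  have 2: "?e (s \<odot>\<^bsub>A\<^esub> a) \<ominus>\<^bsub>F\<^esub> s \<odot>\<^bsub>F\<^esub> ?e a \<in> insertion_rels K F A j"
    if "s \<in> carrier K" "a \<in> carrier A" for s a
    using that unfolding insertion_rels_def Let_def by blast
  have 3: "?e \<one>\<^bsub>A\<^esub> \<ominus>\<^bsub>F\<^esub> \<one>\<^bsub>F\<^esub> \<in> insertion_rels K F A j"
    unfolding insertion_rels_def Let_def by blast
  note cl = j alg_add_closed[OF A.k_algebra_axioms] alg_mult_closed[OF A.k_algebra_axioms]
    alg_smult_closed[OF A.k_algebra_axioms] alg_one_closed[OF A.k_algebra_axioms]
    alg_add_closed[OF k_algebra_axioms] alg_mult_closed[OF k_algebra_axioms]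
    alg_smult_closed[OF k_algebra_axioms] alg_one_closed[OF k_algebra_axioms]
  show ?thesis
  proof (intro alg_homI lin_mapsI)
    fix x y assume xy: "x \<in> carrier A" "y \<in> carrier A"
    show "q (?e (x \<oplus>\<^bsub>A\<^esub> y)) = q (?e x) \<oplus>\<^bsub>Q\<^esub> q (?e y)"
      unfolding Q_add[OF j[OF xy(1)] j[OF xy(2)]] by (rule r[OF 1(1)[OF xy]]) (intro cl xy)+
    show "q (?e (x \<otimes>\<^bsub>A\<^esub> y)) = q (?e x) \<otimes>\<^bsub>Q\<^esub> q (?e y)"
      unfolding Q_mult[OF j[OF xy(1)] j[OF xy(2)]] by (rule r[OF 1(2)[OF xy]]) (intro cl xy)+
  next
    fix s x assume sx: "s \<in> carrier K" "x \<in> carrier A"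
    show "q (?e (s \<odot>\<^bsub>A\<^esub> x)) = s \<odot>\<^bsub>Q\<^esub> q (?e x)"
      unfolding Q_smult[OF sx(1) j[OF sx(2)]] by (rule r[OF 2[OF sx]]) (intro cl sx)+
  next
    show "q (?e \<one>\<^bsub>A\<^esub>) = \<one>\<^bsub>Q\<^esub>"
      unfolding Q_one by (rule r[OF 3]) (intro cl)+
  qed (rule q_closed[OF j])
qed

lemma insertion_vanishes:
  assumes F: "k_algebra K F" and A: "k_algebra K A" and D: "k_algebra K D"
    and j: "\<And>a. a \<in> carrier A \<Longrightarrow> basis_elem K [j a] \<in> carrier F"
    and G: "G \<in> alg_hom K F D" and p: "p \<in> alg_hom K A D"
    and eq: "\<And>a. a \<in> carrier A \<Longrightarrow> G (basis_elem K [j a]) = p a"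
    and x: "x \<in> insertion_rels K F A j"
  shows "G x = \<zero>\<^bsub>D\<^esub>"
proof -
  interpret F: k_algebra K F by fact
  interpret A: k_algebra K A by fact
  interpret D: k_algebra K D by fact
  note Gl = alg_hom_lin[OF G] and pl = alg_hom_lin[OF p]
  note rules = lin_maps_minus[OF F D Gl] lin_maps_add[OF Gl] lin_maps_smult[OF Gl] alg_hom_mult[OF G]
    alg_hom_one[OF G] lin_maps_add[OF pl] lin_maps_smult[OF pl] alg_hom_mult[OF p]
    alg_hom_one[OF p] eq j lin_maps_closed[OF pl]
  show ?thesis using x unfolding insertion_rels_def Let_def
    by (auto simp: rules intro!: D.sub_self)
qed

locale free_prod = A: k_algebra K A + B: k_algebra K B
  for K :: "'k ring" and A :: "('k, 'a) module" and B :: "('k, 'b) module"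
begin

sublocale FA: free_algebra K "carrier A <+> carrier B"
  by (rule free_algebra.intro) (rule A.K.field_axioms)

abbreviation "FB \<equiv> free_product_base K A B"
abbreviation "FP \<equiv> free_product K A B"
abbreviation "inl \<equiv> free_product_inl K A B"
abbreviation "inr \<equiv> free_product_inr K A B"

lemma k_algebra_FB: "k_algebra K FB"
  unfolding free_product_base_def by (rule FA.k_algebra_free)

lemma e_closed: "a \<in> carrier A \<Longrightarrow> basis_elem K [Inl a] \<in> carrier FB"
  "b \<in> carrier B \<Longrightarrow> basis_elem K [Inr b] \<in> carrier FB"
  unfolding free_product_base_def by (rule FA.letter_closed, auto)+

sublocale FQ: quot_alg K FB "free_product_rels K A B"
  unfolding quot_alg_def quot_alg_axioms_def free_product_rels_def
  using insertion_rels_closed[OF k_algebra_FB A.k_algebra_axioms e_closed(1)]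
    insertion_rels_closed[OF k_algebra_FB B.k_algebra_axioms e_closed(2)]
  by (simp add: k_algebra_FB)

lemma k_algebra_FP: "k_algebra K FP"
  unfolding free_product_def by (rule FQ.k_algebra_quot)

lemma inl_hom: "inl \<in> alg_hom K A FP" and inr_hom: "inr \<in> alg_hom K B FP"
  unfolding free_product_inl_def[abs_def] free_product_inr_def[abs_def] free_product_def
  by (rule insertion_hom[OF FQ.quot_alg_axioms A.k_algebra_axioms e_closed(1)];
      simp add: free_product_rels_def)
    (rule insertion_hom[OF FQ.quot_alg_axioms B.k_algebra_axioms e_closed(2)];
      simp add: free_product_rels_def)

lemma free_product_lift:
  assumes D: "k_algebra K D" and p: "p \<in> alg_hom K A D" and q: "q \<in> alg_hom K B D"
  shows "\<exists>G\<in>alg_hom K FP D. (\<forall>a\<in>carrier A. G (inl a) = p a) \<and> (\<forall>b\<in>carrier B. G (inr b) = q b)"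
proof -
  have "case_sum p q x \<in> carrier D" if "x \<in> carrier A <+> carrier B" for x
    using that by (elim PlusE) (simp_all add: lin_maps_closed[OF alg_hom_lin[OF p]] lin_maps_closed[OF alg_hom_lin[OF q]])
  from FA.free_lift[OF D this, folded free_product_base_def]
  obtain G where G: "G \<in> alg_hom K FB D"
    and g0: "\<forall>x\<in>carrier A <+> carrier B. G (basis_elem K [x]) = case_sum p q x" by (rule bexE)
  note g = bspec[OF g0]
  have gl: "G (basis_elem K [Inl a]) = p a" if "a \<in> carrier A" for a using g[of "Inl a"] that by auto
  have gr: "G (basis_elem K [Inr b]) = q b" if "b \<in> carrier B" for b using g[of "Inr b"] that by auto
  have "\<forall>x\<in>free_product_rels K A B. G x = \<zero>\<^bsub>D\<^esub>"
    unfolding free_product_rels_def ball_Un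
    by (intro conjI ballI; rule insertion_vanishes[OF k_algebra_FB _ D e_closed(1) G p gl]
        insertion_vanishes[OF k_algebra_FB _ D e_closed(2) G q gr])
      (assumption | rule A.k_algebra_axioms B.k_algebra_axioms)+
  from FQ.factor_hom[OF D G this, folded free_product_def] obtain G' where G': "G' \<in> alg_hom K FP D"
    and g': "\<forall>x\<in>carrier FB. G' (FQ.q x) = G x" by (rule bexE)
  show ?thesis
    by (rule bexI[OF _ G'])
      (simp add: free_product_inl_def free_product_inr_def bspec[OF g'] e_closed gl gr)
qed

lemma free_product_generated:
  assumes Q: "sub_alg K FP Q" and l: "\<And>a. a \<in> carrier A \<Longrightarrow> inl a \<in> Q"
    and r: "\<And>b. b \<in> carrier B \<Longrightarrow> inr b \<in> Q" and x: "x \<in> carrier FP"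
  shows "x \<in> Q"
proof -
  obtain y where y: "y \<in> carrier FB" "x = FQ.q y" using x by (auto simp: free_product_def FQ.Q_carrier)
  have "sub_alg K FB {y. FQ.q y \<in> Q}"
    by (rule sub_alg_vimage[OF k_algebra_FB FQ.q_hom]) (rule Q[unfolded free_product_def])
  then have "y \<in> {y. FQ.q y \<in> Q}"
    by (rule FA.free_generated[of "{y. FQ.q y \<in> Q}" y, folded free_product_base_def])
      (use y l r in \<open>auto simp: free_product_inl_def free_product_inr_def\<close>)
  then show ?thesis using y by simp
qed

end

section \<open>Universal property and generation of ambiskew polynomial algebras\<close>

locale ambiskew_alg =
  fixes K :: "'k ring" and R :: "('k, 'a) module" and \<tau> \<omega> :: "'a \<Rightarrow> 'a" and c :: 'a and \<xi> :: 'k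
  assumes data: "ambiskew_data K R \<tau> \<omega> c \<xi>"
begin

abbreviation "L \<equiv> free_alg K (UNIV :: xy set)"

lemma R_alg: "k_algebra K R" and xi_closed: "\<xi> \<in> carrier K" and xi_nz: "\<xi> \<noteq> \<zero>\<^bsub>K\<^esub>"
  and c_closed: "c \<in> carrier R"
  and tau_auto: "\<tau> \<in> alg_auto K R" and omega_auto: "\<omega> \<in> alg_auto K R"
  using data by (auto simp: ambiskew_data_def)

lemma tau_hom: "\<tau> \<in> alg_hom K R R" and omega_hom: "\<omega> \<in> alg_hom K R R"
  using tau_auto omega_auto by (auto simp: alg_iso_def)

lemma tau_closed: "r \<in> carrier R \<Longrightarrow> \<tau> r \<in> carrier R" and omega_closed: "r \<in> carrier R \<Longrightarrow> \<omega> r \<in> carrier R"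
  by (rule lin_maps_closed[OF alg_hom_lin[OF tau_hom]] lin_maps_closed[OF alg_hom_lin[OF omega_hom]],
      assumption)+

sublocale L: free_algebra K "UNIV :: xy set"
  by (rule free_algebra.intro) (rule k_algebraD(1)[OF R_alg])

sublocale FP: free_prod K R L
  by (rule free_prod.intro[OF R_alg L.k_algebra_free])

abbreviation "A \<equiv> ambiskew K R \<tau> \<omega> c \<xi>"
abbreviation "ain \<equiv> amb_in K R \<tau> \<omega> c \<xi>"
abbreviation "avar \<equiv> amb_var K R \<tau> \<omega> c \<xi>"
abbreviation "v x \<equiv> FP.inr (basis_elem K [x])"

lemma inl_closed: "r \<in> carrier R \<Longrightarrow> FP.inl r \<in> carrier FP.FP"
  by (rule lin_maps_closed[OF alg_hom_lin[OF FP.inl_hom]])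

lemma v_closed: "v x \<in> carrier FP.FP"
  by (rule lin_maps_closed[OF alg_hom_lin[OF FP.inr_hom] L.letter_closed]) simp

lemma rels_closed: "ambiskew_rels K R \<tau> \<omega> c \<xi> \<subseteq> carrier FP.FP"
  unfolding ambiskew_rels_def Let_def
  by (auto intro!: alg_sub_closed[OF FP.k_algebra_FP] alg_mult_closed[OF FP.k_algebra_FP]
      alg_smult_closed[OF FP.k_algebra_FP] inl_closed v_closed tau_closed omega_closed c_closed xi_closed)

sublocale AQ: quot_alg K FP.FP "ambiskew_rels K R \<tau> \<omega> c \<xi>"
  by (intro quot_alg.intro FP.k_algebra_FP quot_alg_axioms.intro rels_closed)

lemma A_alg: "k_algebra K A"
  unfolding ambiskew_def by (rule AQ.k_algebra_quot)

lemma ain_def: "ain r = AQ.q (FP.inl r)" and avar_def: "avar x = AQ.q (v x)"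
  by (simp_all only: amb_in_def amb_var_def Let_def)

lemma ain_hom: "ain \<in> alg_hom K R A"
  using alg_hom_comp[OF AQ.q_hom FP.inl_hom] unfolding ain_def[abs_def] ambiskew_def .

lemma avar_closed: "avar x \<in> carrier A"
  unfolding avar_def ambiskew_def by (rule AQ.q_closed) (rule v_closed)

lemma X_rel: "r \<in> carrier R \<Longrightarrow> avar VX \<otimes>\<^bsub>A\<^esub> ain r = ain (\<tau> r) \<otimes>\<^bsub>A\<^esub> avar VX"
  and Y_rel: "r \<in> carrier R \<Longrightarrow> avar VY \<otimes>\<^bsub>A\<^esub> ain r = ain (\<omega> r) \<otimes>\<^bsub>A\<^esub> avar VY"
  unfolding ain_def avar_def ambiskew_def
  by (simp_all add: AQ.Q_mult inl_closed v_closed tau_closed omega_closed)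
    (rule AQ.q_rel; (simp add: alg_mult_closed[OF FP.k_algebra_FP] inl_closed v_closed tau_closed omega_closed)?;
      auto simp: ambiskew_rels_def Let_def)+

lemma XY_rel: "avar VX \<otimes>\<^bsub>A\<^esub> avar VY \<ominus>\<^bsub>A\<^esub> \<xi> \<odot>\<^bsub>A\<^esub> (avar VY \<otimes>\<^bsub>A\<^esub> avar VX) = ain c"
proof -
  note cl = alg_mult_closed[OF FP.k_algebra_FP] alg_smult_closed[OF FP.k_algebra_FP]
    alg_sub_closed[OF FP.k_algebra_FP] inl_closed v_closed c_closed xi_closed
  have "avar VX \<otimes>\<^bsub>A\<^esub> avar VY \<ominus>\<^bsub>A\<^esub> \<xi> \<odot>\<^bsub>A\<^esub> (avar VY \<otimes>\<^bsub>A\<^esub> avar VX)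
    = AQ.q (v VX \<otimes>\<^bsub>FP.FP\<^esub> v VY \<ominus>\<^bsub>FP.FP\<^esub> \<xi> \<odot>\<^bsub>FP.FP\<^esub> (v VY \<otimes>\<^bsub>FP.FP\<^esub> v VX))"
    unfolding avar_def ambiskew_def
    by (subst lin_maps_minus[OF FP.k_algebra_FP AQ.k_algebra_quot AQ.q_lin])
      (simp_all add: cl AQ.Q_mult AQ.Q_smult)
  also have "\<dots> = ain c" unfolding ain_def
    by (rule AQ.q_rel) (simp_all add: cl ambiskew_rels_def Let_def)
  finally show ?thesis .
qed

text \<open>Both algebra maps of the main argument, \<open>\<psi>\<close> out of the algebra over H
  and \<open>coaction\<close> out of the algebra over R, are produced by this universal
  property.\<close>

lemma ambiskew_lift:
  assumes D: "k_algebra K D" and p: "p \<in> alg_hom K R D" and x: "x \<in> carrier D" and y: "y \<in> carrier D"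
    and xr: "\<And>r. r \<in> carrier R \<Longrightarrow> x \<otimes>\<^bsub>D\<^esub> p r = p (\<tau> r) \<otimes>\<^bsub>D\<^esub> x"
    and yr: "\<And>r. r \<in> carrier R \<Longrightarrow> y \<otimes>\<^bsub>D\<^esub> p r = p (\<omega> r) \<otimes>\<^bsub>D\<^esub> y"
    and xy: "x \<otimes>\<^bsub>D\<^esub> y \<ominus>\<^bsub>D\<^esub> \<xi> \<odot>\<^bsub>D\<^esub> (y \<otimes>\<^bsub>D\<^esub> x) = p c"
  shows "\<exists>G\<in>alg_hom K A D. (\<forall>r\<in>carrier R. G (ain r) = p r) \<and> G (avar VX) = x \<and> G (avar VY) = y"
proof -
  have "(case u of VX \<Rightarrow> x | VY \<Rightarrow> y) \<in> carrier D" for u using x y by (cases u) auto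
  from L.free_lift[OF D this] obtain q where q: "q \<in> alg_hom K L D"
    and q0: "\<forall>u\<in>UNIV. q (basis_elem K [u]) = (case u of VX \<Rightarrow> x | VY \<Rightarrow> y)" by (rule bexE)
  note qx = bspec[OF q0 UNIV_I]
  from FP.free_product_lift[OF D p q] obtain G where G: "G \<in> alg_hom K FP.FP D"
    and G0: "(\<forall>r\<in>carrier R. G (FP.inl r) = p r) \<and> (\<forall>b\<in>carrier L. G (FP.inr b) = q b)" by (rule bexE)
  note Gl = bspec[OF conjunct1[OF G0]] and Gr = bspec[OF conjunct2[OF G0]]
  have Gv: "G (v VX) = x" "G (v VY) = y" using Gr L.letter_closed qx by auto
  note cl = alg_mult_closed[OF FP.k_algebra_FP] alg_smult_closed[OF FP.k_algebra_FP]
    alg_sub_closed[OF FP.k_algebra_FP] inl_closed v_closed c_closed xi_closed tau_closed omega_closed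
  note rules = lin_maps_minus[OF FP.k_algebra_FP D alg_hom_lin[OF G]] lin_maps_smult[OF alg_hom_lin[OF G]]
    alg_hom_mult[OF G] Gl Gv xr yr xy
  note Dcl = lin_maps_closed[OF alg_hom_lin[OF p]] alg_mult_closed[OF D]
  have "\<forall>z\<in>ambiskew_rels K R \<tau> \<omega> c \<xi>. G z = \<zero>\<^bsub>D\<^esub>"
    unfolding ambiskew_rels_def Let_def
    by (auto simp: rules cl Dcl x y intro!: k_algebra.sub_self[OF D])
  from AQ.factor_hom[OF D G this, folded ambiskew_def] obtain G' where G': "G' \<in> alg_hom K A D"
    and g0': "\<forall>z\<in>carrier FP.FP. G' (AQ.q z) = G z" by (rule bexE)
  note g' = bspec[OF g0']
  show ?thesis
    by (rule bexI[OF _ G']) (simp add: ain_def avar_def g' inl_closed v_closed Gl Gv)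
qed

text \<open>Takes the place of an induction over monomials: a property closed under the algebra
  operations has to be checked only on the image of R and on the two variables.\<close>

lemma ambiskew_generated:
  assumes Q: "sub_alg K A Q" and r: "\<And>r. r \<in> carrier R \<Longrightarrow> ain r \<in> Q"
    and X: "avar VX \<in> Q" and Y: "avar VY \<in> Q" and z: "z \<in> carrier A"
  shows "z \<in> Q"
proof -
  obtain y where y: "y \<in> carrier FP.FP" "z = AQ.q y" using z by (auto simp: ambiskew_def AQ.Q_carrier)
  have 1: "sub_alg K FP.FP {y. AQ.q y \<in> Q}"
    by (rule sub_alg_vimage[OF FP.k_algebra_FP AQ.q_hom]) (rule Q[unfolded ambiskew_def])
  have 2: "FP.inr b \<in> {y. AQ.q y \<in> Q}" if b: "b \<in> carrier L" for b
  proof -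
    have vQ: "AQ.q (v x) \<in> Q" for x using X Y by (cases x) (simp_all add: avar_def)
    have "b \<in> {b. FP.inr b \<in> {y. AQ.q y \<in> Q}}"
      by (rule L.free_generated[OF sub_alg_vimage[OF L.k_algebra_free FP.inr_hom 1] _ b]) (simp add: vQ)
    then show ?thesis by simp
  qed
  have "y \<in> {y. AQ.q y \<in> Q}"
    by (rule FP.free_product_generated[OF 1 _ 2 y(1)]) (use r in \<open>simp add: ain_def\<close>)
  then show ?thesis using y by simp
qed

lemma ambiskew_hom_ext:
  assumes D: "k_algebra K D" and F: "F \<in> alg_hom K A D" and G: "G \<in> alg_hom K A D"
    and r: "\<And>r. r \<in> carrier R \<Longrightarrow> F (ain r) = G (ain r)"
    and "F (avar VX) = G (avar VX)" "F (avar VY) = G (avar VY)" and z: "z \<in> carrier A"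
  shows "F z = G z"
proof -
  have "sub_alg K A {z. F z = G z}"
    by (rule sub_algI)
      (simp_all add: alg_hom_one[OF F] alg_hom_one[OF G] alg_hom_mult[OF F] alg_hom_mult[OF G]
        lin_maps_add[OF alg_hom_lin[OF F]] lin_maps_add[OF alg_hom_lin[OF G]]
        lin_maps_smult[OF alg_hom_lin[OF F]] lin_maps_smult[OF alg_hom_lin[OF G]])
  from ambiskew_generated[OF this _ _ _ z] assms show ?thesis by simp
qed

end

section \<open>Sweedler calculus in Hopf-Galois algebras\<close>

lemma bilin_opp [simp]: "bilin K (opp A) B D f = bilin K A B D f" "bilin K A (opp B) D f = bilin K A B D f"
  by (simp_all add: bilin_def)

section \<open>Trilinear maps and three-fold tensors\<close>

definition trilin :: "'k ring \<Rightarrow> ('k, 'a) module \<Rightarrow> ('k, 'd) module \<Rightarrow> ('a \<Rightarrow> 'a \<Rightarrow> 'a \<Rightarrow> 'd) \<Rightarrow> bool" where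
  "trilin K R D F \<longleftrightarrow> (\<forall>b\<in>carrier R. \<forall>c\<in>carrier R. (\<lambda>a. F a b c) \<in> lin_maps K R D)
    \<and> (\<forall>a\<in>carrier R. \<forall>c\<in>carrier R. (\<lambda>b. F a b c) \<in> lin_maps K R D)
    \<and> (\<forall>a\<in>carrier R. \<forall>b\<in>carrier R. (\<lambda>c. F a b c) \<in> lin_maps K R D)"

lemma trilinI [lin_intros]:
  assumes "\<And>b c. b \<in> carrier R \<Longrightarrow> c \<in> carrier R \<Longrightarrow> (\<lambda>a. F a b c) \<in> lin_maps K R D"
    and "\<And>a c. a \<in> carrier R \<Longrightarrow> c \<in> carrier R \<Longrightarrow> (\<lambda>b. F a b c) \<in> lin_maps K R D"
    and "\<And>a b. a \<in> carrier R \<Longrightarrow> b \<in> carrier R \<Longrightarrow> (\<lambda>c. F a b c) \<in> lin_maps K R D"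
  shows "trilin K R D F"
  using assms by (simp add: trilin_def)

lemma trilin1: "trilin K R D F \<Longrightarrow> b \<in> carrier R \<Longrightarrow> c \<in> carrier R \<Longrightarrow> (\<lambda>a. F a b c) \<in> lin_maps K R D"
  and trilin2: "trilin K R D F \<Longrightarrow> a \<in> carrier R \<Longrightarrow> c \<in> carrier R \<Longrightarrow> (\<lambda>b. F a b c) \<in> lin_maps K R D"
  and trilin3: "trilin K R D F \<Longrightarrow> a \<in> carrier R \<Longrightarrow> b \<in> carrier R \<Longrightarrow> (\<lambda>c. F a b c) \<in> lin_maps K R D"
  by (simp_all add: trilin_def)

lemma trilin_comp: "trilin K R D F \<Longrightarrow> G \<in> lin_maps K D E \<Longrightarrow> trilin K R E (\<lambda>a b c. G (F a b c))"
  by (rule trilinI; rule lin_maps_comp, assumption) (simp_all add: trilin_def)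

lemma trilin_cong:
  assumes R: "k_algebra K R" and F: "trilin K R D F"
    and eq: "\<And>a b c. a \<in> carrier R \<Longrightarrow> b \<in> carrier R \<Longrightarrow> c \<in> carrier R \<Longrightarrow> F a b c = G a b c"
  shows "trilin K R D G"
proof (rule trilinI)
  show "(\<lambda>a. G a b c) \<in> lin_maps K R D" if "b \<in> carrier R" "c \<in> carrier R" for b c
    by (rule lin_maps_cong[OF trilin1[OF F that] eq[OF _ that] R])
  show "(\<lambda>b. G a b c) \<in> lin_maps K R D" if "a \<in> carrier R" "c \<in> carrier R" for a c
    by (rule lin_maps_cong[OF trilin2[OF F that] eq[OF that(1) _ that(2)] R])
  show "(\<lambda>c. G a b c) \<in> lin_maps K R D" if "a \<in> carrier R" "b \<in> carrier R" for a b
    by (rule lin_maps_cong[OF trilin3[OF F that] eq[OF that] R])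
qed

text \<open>The three-fold lift is a lift in the first component around a lift in the other two. The
  second clause is what makes the outer lift legitimate, and \<open>tens_lift_param\<close> supplies
  it.\<close>

lemma bilin_of_trilin:
  assumes R: "k_algebra K R" and D: "k_algebra K D" and F: "trilin K R D F"
  shows "a \<in> carrier R \<Longrightarrow> bilin K R R D (\<lambda>b c. F a b c)"
    and "bilin K R (opR K R) D (\<lambda>a u. tens_lift K D (\<lambda>b c. F a b c) u)"
proof -
  show b: "bilin K R R D (\<lambda>b c. F a b c)" if "a \<in> carrier R" for a
    by (rule bilinI; rule trilin2[OF F that] trilin3[OF F that])
  show "bilin K R (opR K R) D (\<lambda>a u. tens_lift K D (\<lambda>b c. F a b c) u)"
  proof (rule bilinI)
    show "(\<lambda>u. tens_lift K D (\<lambda>b c. F a b c) u) \<in> lin_maps K (opR K R) D" if "a \<in> carrier R" for a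
      by (rule tens_lift_lin[OF k_algebra_opp[OF R] R D]) (simp add: b that)
    show "(\<lambda>a. tens_lift K D (\<lambda>b c. F a b c) u) \<in> lin_maps K R D" if "u \<in> carrier (opR K R)" for u
      by (rule tens_lift_param[OF k_algebra_opp[OF R] R D R _ _ that])
        (simp_all add: b trilin1[OF F])
  qed
qed

lemma k_algebra_tensor3 [lin_intros]: "k_algebra K R \<Longrightarrow> k_algebra K (tensor3 K R)"
  unfolding tensor3_def by (intro lin_intros)

lemma tens3_lift_lin:
  assumes R: "k_algebra K R" and D: "k_algebra K D" and F: "trilin K R D F"
  shows "tens3_lift K D F \<in> lin_maps K (tensor3 K R) D"
  unfolding tens3_lift_def[abs_def] tensor3_def
  by (rule tens_lift_lin[OF R _ D bilin_of_trilin(2)[OF R D F]]) (intro lin_intros R)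

lemma tens3_lift_tens3:
  assumes R: "k_algebra K R" and D: "k_algebra K D" and F: "trilin K R D F"
    and abc: "a \<in> carrier R" "b \<in> carrier R" "c \<in> carrier R"
  shows "tens3_lift K D F (tens3 K R a b c) = F a b c"
proof -
  have T: "k_algebra K (opR K R)" by (intro lin_intros R)
  have bc: "tens K (opp R) R b c \<in> carrier (opR K R)" by (intro lin_intros R) (simp_all add: abc)
  show ?thesis
    unfolding tens3_lift_def tens3_def
    by (subst tens_lift_tens[OF R T D bilin_of_trilin(2)[OF R D F] abc(1) bc],
        subst tens_lift_tens[OF k_algebra_opp[OF R] R D])
      (simp_all add: bilin_of_trilin[OF R D F] abc)
qed

lemma trilin_tens3: "k_algebra K R \<Longrightarrow> trilin K R (tensor3 K R) (tens3 K R)"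
  unfolding tens3_def[abs_def] tensor3_def by (assumption | rule lin_intros | simp)+

lemma tensor3_ext:
  assumes R: "k_algebra K R" and D: "k_algebra K D"
    and F: "F \<in> lin_maps K (tensor3 K R) D" and G: "G \<in> lin_maps K (tensor3 K R) D"
    and eq: "\<And>a b c. a \<in> carrier R \<Longrightarrow> b \<in> carrier R \<Longrightarrow> c \<in> carrier R \<Longrightarrow>
      F (tens3 K R a b c) = G (tens3 K R a b c)"
    and x: "x \<in> carrier (tensor3 K R)"
  shows "F x = G x"
proof -
  have T: "k_algebra K (opR K R)" by (intro lin_intros R)
  show ?thesis
  proof (rule tensor_ext[OF R T D F[unfolded tensor3_def] G[unfolded tensor3_def] _ x[unfolded tensor3_def]])
    fix a u assume a: "a \<in> carrier R" and u: "u \<in> carrier (opR K R)"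
    have l: "(\<lambda>u. H (tens K R (opR K R) a u)) \<in> lin_maps K (opR K R) D"
      if "H \<in> lin_maps K (tensor3 K R) D" for H
      by (rule lin_maps_comp[OF that[unfolded tensor3_def]]) (intro lin_intros R a)
    show "F (tens K R (opR K R) a u) = G (tens K R (opR K R) a u)"
      by (rule tensor_ext[OF k_algebra_opp[OF R] R D l[OF F] l[OF G] _ u])
        (use eq a in \<open>simp add: tens3_def\<close>)
  qed
qed

text \<open>The middle factor belongs to the opposite algebra; written with the product of R, its
  two entries therefore appear in reversed order.\<close>

lemma tens3_lift_mult:
  assumes R: "k_algebra K R" and D: "k_algebra K D" and F: "trilin K R D F"
    and u: "u \<in> carrier (tensor3 K R)" and v: "v \<in> carrier (tensor3 K R)"
  shows "tens3_lift K D F (u \<otimes>\<^bsub>tensor3 K R\<^esub> v) = tens3_lift K D (\<lambda>a b c.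
    tens3_lift K D (\<lambda>a' b' c'. F (a \<otimes>\<^bsub>R\<^esub> a') (b' \<otimes>\<^bsub>R\<^esub> b) (c \<otimes>\<^bsub>R\<^esub> c')) v) u"
proof -
  have T: "k_algebra K (opR K R)" by (intro lin_intros R)
  have T3: "k_algebra K (tensor3 K R)" by (intro lin_intros R)
  note Fl = tens3_lift_lin[OF R D F]
  note F1 = lin_maps_comp[OF trilin1[OF F]] and F2 = lin_maps_comp[OF trilin2[OF F]]
    and F3 = lin_maps_comp[OF trilin3[OF F]]
  have tri: "trilin K R D (\<lambda>a' b' c'. F (a \<otimes>\<^bsub>R\<^esub> a') (b' \<otimes>\<^bsub>R\<^esub> b) (c \<otimes>\<^bsub>R\<^esub> c'))"
    if "a \<in> carrier R" "b \<in> carrier R" "c \<in> carrier R" for a b c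
    by (rule trilinI; rule F1 F2 F3) (assumption | rule lin_intros R that)+
  have tri': "trilin K R D (\<lambda>a b c. F (a \<otimes>\<^bsub>R\<^esub> a') (b' \<otimes>\<^bsub>R\<^esub> b) (c \<otimes>\<^bsub>R\<^esub> c'))"
    if "a' \<in> carrier R" "b' \<in> carrier R" "c' \<in> carrier R" for a' b' c'
    by (rule trilinI; rule F1 F2 F3) (assumption | rule lin_intros R that)+
  have m: "tens3 K R a b c \<otimes>\<^bsub>tensor3 K R\<^esub> tens3 K R a' b' c'
      = tens3 K R (a \<otimes>\<^bsub>R\<^esub> a') (b' \<otimes>\<^bsub>R\<^esub> b) (c \<otimes>\<^bsub>R\<^esub> c')"
    if "a \<in> carrier R" "b \<in> carrier R" "c \<in> carrier R" "a' \<in> carrier R" "b' \<in> carrier R" "c' \<in> carrier R"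
    for a b c a' b' c'
    unfolding tens3_def tensor3_def using that
    by (simp add: tens_mult[OF R T] tens_mult[OF k_algebra_opp[OF R] R] tens_closed[OF k_algebra_opp[OF R] R])
  have 1: "tens3_lift K D F (tens3 K R a b c \<otimes>\<^bsub>tensor3 K R\<^esub> v)
      = tens3_lift K D (\<lambda>a' b' c'. F (a \<otimes>\<^bsub>R\<^esub> a') (b' \<otimes>\<^bsub>R\<^esub> b) (c \<otimes>\<^bsub>R\<^esub> c')) v"
    if abc: "a \<in> carrier R" "b \<in> carrier R" "c \<in> carrier R" and v: "v \<in> carrier (tensor3 K R)" for a b c v
  proof (rule tensor3_ext[OF R D _ tens3_lift_lin[OF R D tri[OF abc]] _ v])
    have "tens3 K R a b c \<in> carrier (tensor3 K R)"
      by (rule lin_maps_closed[OF trilin1[OF trilin_tens3[OF R]]]) (rule abc)+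
    then show "(\<lambda>v. tens3_lift K D F (tens3 K R a b c \<otimes>\<^bsub>tensor3 K R\<^esub> v)) \<in> lin_maps K (tensor3 K R) D"
      by (intro lin_maps_comp[OF Fl] lin_intros T3)
  qed (simp add: m abc tens3_lift_tens3[OF R D F] tens3_lift_tens3[OF R D tri[OF abc]] alg_mult_closed[OF R])
  have tri2: "trilin K R D (\<lambda>a b c.
    tens3_lift K D (\<lambda>a' b' c'. F (a \<otimes>\<^bsub>R\<^esub> a') (b' \<otimes>\<^bsub>R\<^esub> b) (c \<otimes>\<^bsub>R\<^esub> c')) v)"
  proof (rule trilin_cong[OF R _ 1[OF _ _ _ v]])
    show "trilin K R D (\<lambda>a b c. tens3_lift K D F (tens3 K R a b c \<otimes>\<^bsub>tensor3 K R\<^esub> v))"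
      by (rule trilin_comp[OF trilin_tens3[OF R]])
        (intro lin_maps_comp[OF Fl] lin_intros T3 v)
  qed
  show ?thesis
  proof (rule tensor3_ext[OF R D _ tens3_lift_lin[OF R D tri2] _ u])
    show "(\<lambda>u. tens3_lift K D F (u \<otimes>\<^bsub>tensor3 K R\<^esub> v)) \<in> lin_maps K (tensor3 K R) D"
      by (intro lin_maps_comp[OF Fl] lin_intros T3 v)
  qed (simp add: tens3_lift_tens3[OF R D tri2] 1 v)
qed

text \<open>A functional with value 1 at the unit is carried as a parameter, so that the projection
  onto H, its comultiplication, counit and antipode can be written as closed formulas.
  \<open>functional_exists\<close> supplies it in the final theorem.\<close>

locale hopf_gal =
  fixes K :: "'k ring" and R :: "('k, 'a) module" (structure) and \<mu> :: "'a \<Rightarrow> ('k, 'a) tens3" and f :: "'a \<Rightarrow> 'k"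
  assumes hg: "hopf_galois K R \<mu>" and f_lin: "f \<in> lin_maps K R (base_alg K)" and f_one: "f \<one> = \<one>\<^bsub>K\<^esub>"
begin

abbreviation "T \<equiv> opR K R"
abbreviation "T3 \<equiv> tensor3 K R"
abbreviation "t \<equiv> tens K (opp R) R"
text \<open>\<open>M D F r\<close> stands for F(r1, r2, r3) in Sweedler notation, with values in D.
  The companion \<open>L D F u\<close> stands for F(x, y) where u = x \<otimes> y is a general
  element of R^op \<otimes> R.\<close>

definition "M D F r = tens3_lift K D F (\<mu> r)"
abbreviation "L \<equiv> tens_lift K"

lemma R_alg [lin_intros]: "k_algebra K R" using hg by (simp add: hopf_galois_def)
lemma K_field: "field K" by (rule k_algebraD(1)[OF R_alg])
lemma base_alg [lin_intros]: "k_algebra K (base_alg K)" by (rule k_algebra_base[OF K_field])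
lemma T_alg: "k_algebra K T" by (intro lin_intros)
lemma mu_hom: "\<mu> \<in> alg_hom K R T3" using hg by (simp add: hopf_galois_def)
lemma mu_lin: "\<mu> \<in> lin_maps K R T3" by (rule alg_hom_lin[OF mu_hom])
lemma mu_closed: "r \<in> carrier R \<Longrightarrow> \<mu> r \<in> carrier T3" by (rule lin_maps_closed[OF mu_lin])

lemma lin_f [lin_intros]: "G \<in> lin_maps K C R \<Longrightarrow> (\<lambda>z. f (G z)) \<in> lin_maps K C (base_alg K)"
  by (rule lin_maps_comp[OF f_lin])

lemma f_closed [lin_intros]: "x \<in> carrier R \<Longrightarrow> f x \<in> carrier K"
  using lin_maps_closed[OF f_lin] by simp

lemma lin_M [lin_intros]:
  "k_algebra K D \<Longrightarrow> G \<in> lin_maps K C R \<Longrightarrow> trilin K R D F \<Longrightarrow> (\<lambda>z. M D F (G z)) \<in> lin_maps K C D"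
  unfolding M_def
  by (rule lin_maps_comp[OF tens3_lift_lin[OF R_alg] lin_maps_comp[OF mu_lin]])

lemma M_closed [lin_intros]:
  "k_algebra K D \<Longrightarrow> r \<in> carrier R \<Longrightarrow> trilin K R D F \<Longrightarrow> M D F r \<in> carrier D"
  by (rule lin_maps_closed[OF lin_M[OF _ lin_maps_id]])

lemma M_comm:
  assumes D: "k_algebra K D" and E: "k_algebra K E" and G: "G \<in> lin_maps K D E"
    and F: "trilin K R D F" and r: "r \<in> carrier R"
  shows "G (M D F r) = M E (\<lambda>a b c. G (F a b c)) r"
  unfolding M_def
  by (rule tensor3_ext[OF R_alg E lin_maps_comp[OF G tens3_lift_lin[OF R_alg D F]]
        tens3_lift_lin[OF R_alg E trilin_comp[OF F G]] _ mu_closed[OF r]])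
    (simp add: tens3_lift_tens3[OF R_alg D F] tens3_lift_tens3[OF R_alg E trilin_comp[OF F G]])

lemma M_cong:
  assumes D: "k_algebra K D" and F: "trilin K R D F" and r: "r \<in> carrier R"
    and eq: "\<And>a b c. a \<in> carrier R \<Longrightarrow> b \<in> carrier R \<Longrightarrow> c \<in> carrier R \<Longrightarrow> F a b c = G a b c"
  shows "M D F r = M D G r"
proof -
  have G: "trilin K R D G" by (rule trilin_cong[OF R_alg F eq])
  show ?thesis unfolding M_def
    by (rule tensor3_ext[OF R_alg D tens3_lift_lin[OF R_alg D F] tens3_lift_lin[OF R_alg D G] _ mu_closed[OF r]])
      (simp add: tens3_lift_tens3[OF R_alg D F] tens3_lift_tens3[OF R_alg D G] eq)
qed

lemma M_tens3: "r \<in> carrier R \<Longrightarrow> M T3 (tens3 K R) r = \<mu> r"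
  unfolding M_def
  by (rule tensor3_ext[OF R_alg _ tens3_lift_lin[OF R_alg _ trilin_tens3[OF R_alg]] lin_maps_id _ mu_closed])
    (simp_all add: k_algebra_tensor3[OF R_alg] tens3_lift_tens3[OF R_alg _ trilin_tens3[OF R_alg]])

text \<open>The counterpart of \<open>tens_lift_param\<close> for three components: it is what
  allows a bracket over a fixed r to stand inside a bracket over another element.\<close>

lemma lin_M_param [lin_intros]:
  assumes D: "k_algebra K D" and C: "k_algebra K C"
    and F: "\<And>z. z \<in> carrier C \<Longrightarrow> trilin K R D (F z)"
    and z: "\<And>a b c. a \<in> carrier R \<Longrightarrow> b \<in> carrier R \<Longrightarrow> c \<in> carrier R \<Longrightarrow> (\<lambda>z. F z a b c) \<in> lin_maps K C D"
    and r: "r \<in> carrier R"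
  shows "(\<lambda>z. M D (F z) r) \<in> lin_maps K C D"
  unfolding M_def tens3_lift_def
proof (rule tens_lift_param[OF R_alg T_alg D C bilin_of_trilin(2)[OF R_alg D F] _ mu_closed[OF r, unfolded tensor3_def]])
  fix a u assume a: "a \<in> carrier R" and u: "u \<in> carrier T"
  show "(\<lambda>z. tens_lift K D (F z a) u) \<in> lin_maps K C D"
    by (rule tens_lift_param[OF k_algebra_opp[OF R_alg] R_alg D C _ _ u])
      (simp_all add: bilin_of_trilin(1)[OF R_alg D F a] z a)
qed

lemma M_mult:
  assumes D: "k_algebra K D" and F: "trilin K R D F" and r: "r \<in> carrier R" and s: "s \<in> carrier R"
  shows "M D F (r \<otimes> s) =
    M D (\<lambda>a b c. M D (\<lambda>a' b' c'. F (a \<otimes> a') (b' \<otimes> b) (c \<otimes> c')) s) r"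
  unfolding M_def alg_hom_mult[OF mu_hom r s]
  by (rule tens3_lift_mult[OF R_alg D F mu_closed[OF r] mu_closed[OF s]])

lemma M_one:
  assumes D: "k_algebra K D" and F: "trilin K R D F"
  shows "M D F \<one> = F \<one> \<one> \<one>"
proof -
  have "\<mu> \<one> = tens3 K R \<one> \<one> \<one>"
    unfolding alg_hom_one[OF mu_hom] unfolding tensor3_def tens3_def
    by (simp add: tensor_one[OF R_alg T_alg] tensor_one[OF k_algebra_opp[OF R_alg] R_alg])
  then show ?thesis
    by (simp add: M_def tens3_lift_tens3[OF R_alg D F] alg_one_closed[OF R_alg])
qed

text \<open>The axiom is one identity in R \<otimes> R. Applying the linear map induced by F turns
  it into a rewrite rule for any bracket that depends on the first two components only through their
  product.\<close>

lemma M_counit_left: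
  assumes D: "k_algebra K D" and F: "bilin K R R D F" and r: "r \<in> carrier R"
  shows "M D (\<lambda>a b c. F (a \<otimes> b) c) r = F \<one> r"
proof -
  have RR: "k_algebra K (tensor K R R)" by (intro lin_intros)
  have tri: "trilin K R (tensor K R R) (\<lambda>a b c. tens K R R (a \<otimes> b) c)"
    by (assumption | rule lin_intros)+
  have "tens_lift K D F (M (tensor K R R) (\<lambda>a b c. tens K R R (a \<otimes> b) c) r)
    = M D (\<lambda>a b c. tens_lift K D F (tens K R R (a \<otimes> b) c)) r"
    by (rule M_comm[OF RR D tens_lift_lin[OF R_alg R_alg D F] tri r])
  also have "\<dots> = M D (\<lambda>a b c. F (a \<otimes> b) c) r"
    by (rule M_cong[OF D trilin_comp[OF tri tens_lift_lin[OF R_alg R_alg D F]] r])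
      (simp add: tens_lift_tens[OF R_alg R_alg D F] alg_mult_closed[OF R_alg])
  moreover have "M (tensor K R R) (\<lambda>a b c. tens K R R (a \<otimes> b) c) r = tens K R R \<one> r"
    using hg r by (simp add: hopf_galois_def M_def)
  ultimately show ?thesis
    using r by (simp add: tens_lift_tens[OF R_alg R_alg D F] alg_one_closed[OF R_alg])
qed

lemma M_counit_right:
  assumes D: "k_algebra K D" and F: "bilin K R R D F" and r: "r \<in> carrier R"
  shows "M D (\<lambda>a b c. F a (b \<otimes> c)) r = F r \<one>"
proof -
  have RR: "k_algebra K (tensor K R R)" by (intro lin_intros)
  have tri: "trilin K R (tensor K R R) (\<lambda>a b c. tens K R R a (b \<otimes> c))"
    by (assumption | rule lin_intros)+
  have "tens_lift K D F (M (tensor K R R) (\<lambda>a b c. tens K R R a (b \<otimes> c)) r)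
    = M D (\<lambda>a b c. tens_lift K D F (tens K R R a (b \<otimes> c))) r"
    by (rule M_comm[OF RR D tens_lift_lin[OF R_alg R_alg D F] tri r])
  also have "\<dots> = M D (\<lambda>a b c. F a (b \<otimes> c)) r"
    by (rule M_cong[OF D trilin_comp[OF tri tens_lift_lin[OF R_alg R_alg D F]] r])
      (simp add: tens_lift_tens[OF R_alg R_alg D F] alg_mult_closed[OF R_alg])
  moreover have "M (tensor K R R) (\<lambda>a b c. tens K R R a (b \<otimes> c)) r = tens K R R r \<one>"
    using hg r by (simp add: hopf_galois_def M_def)
  ultimately show ?thesis
    using r by (simp add: tens_lift_tens[OF R_alg R_alg D F] alg_one_closed[OF R_alg])
qed

text \<open>The axiom is an identity in the five-fold tensor product; the linear map induced by a
  five-linear F carries it to D. Multilinearity is spelled out in five hypotheses so that each can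
  be discharged by \<open>lin_intros\<close>.\<close>

lemma M_coassoc:
  assumes D: "k_algebra K D"
    and F1: "\<And>b c d e. b \<in> carrier R \<Longrightarrow> c \<in> carrier R \<Longrightarrow> d \<in> carrier R \<Longrightarrow> e \<in> carrier R \<Longrightarrow>
      (\<lambda>a. F a b c d e) \<in> lin_maps K R D"
    and F2: "\<And>a c d e. a \<in> carrier R \<Longrightarrow> c \<in> carrier R \<Longrightarrow> d \<in> carrier R \<Longrightarrow> e \<in> carrier R \<Longrightarrow>
      (\<lambda>b. F a b c d e) \<in> lin_maps K R D"
    and F3: "\<And>a b d e. a \<in> carrier R \<Longrightarrow> b \<in> carrier R \<Longrightarrow> d \<in> carrier R \<Longrightarrow> e \<in> carrier R \<Longrightarrow>
      (\<lambda>c. F a b c d e) \<in> lin_maps K R D"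
    and F4: "\<And>a b c e. a \<in> carrier R \<Longrightarrow> b \<in> carrier R \<Longrightarrow> c \<in> carrier R \<Longrightarrow> e \<in> carrier R \<Longrightarrow>
      (\<lambda>d. F a b c d e) \<in> lin_maps K R D"
    and F5: "\<And>a b c d. a \<in> carrier R \<Longrightarrow> b \<in> carrier R \<Longrightarrow> c \<in> carrier R \<Longrightarrow> d \<in> carrier R \<Longrightarrow>
      (\<lambda>e. F a b c d e) \<in> lin_maps K R D"
    and r: "r \<in> carrier R"
  shows "M D (\<lambda>a b c. M D (\<lambda>u v w. F u v w b c) a) r = M D (\<lambda>a b c. M D (\<lambda>u v w. F a b u v w) c) r"
proof -
  let ?T5 = "tensor5 K R"
  have T3: "k_algebra K T3" by (intro lin_intros)
  have T4: "k_algebra K (tensor K (opp R) T3)" by (intro lin_intros)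
  have T5: "k_algebra K ?T5" unfolding tensor5_def by (intro lin_intros)
  have tri: "trilin K R D (F a b)" if "a \<in> carrier R" "b \<in> carrier R" for a b
    by (rule trilinI) (use that F3 F4 F5 in simp_all)
  have tri1: "trilin K R D (\<lambda>u v w. F u v w b c)" if "b \<in> carrier R" "c \<in> carrier R" for b c
    by (rule trilinI) (use that F1 F2 F3 in simp_all)
  have param: "(\<lambda>z. tens3_lift K D (G z) u) \<in> lin_maps K R D"
    if "\<And>z. z \<in> carrier R \<Longrightarrow> trilin K R D (G z)"
      "\<And>a b c. a \<in> carrier R \<Longrightarrow> b \<in> carrier R \<Longrightarrow> c \<in> carrier R \<Longrightarrow> (\<lambda>z. G z a b c) \<in> lin_maps K R D"
      "u \<in> carrier T3" for G u
    unfolding tens3_lift_def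
  proof (rule tens_lift_param[OF R_alg T_alg D R_alg bilin_of_trilin(2)[OF R_alg D that(1)] _
        that(3)[unfolded tensor3_def]])
    fix a v assume a: "a \<in> carrier R" and v: "v \<in> carrier T"
    show "(\<lambda>z. tens_lift K D (G z a) v) \<in> lin_maps K R D"
      by (rule tens_lift_param[OF k_algebra_opp[OF R_alg] R_alg D R_alg _ _ v])
        (simp_all add: bilin_of_trilin(1)[OF R_alg D that(1) a] that(2) a)
  qed
  have b4: "bilin K (opp R) T3 D (\<lambda>b u. tens3_lift K D (F a b) u)" if a: "a \<in> carrier R" for a
  proof (rule bilinI)
    show "(\<lambda>u. tens3_lift K D (F a b) u) \<in> lin_maps K T3 D" if "b \<in> carrier (opp R)" for b
      by (rule tens3_lift_lin[OF R_alg D tri]) (use a that in simp_all)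
    show "(\<lambda>b. tens3_lift K D (F a b) u) \<in> lin_maps K (opp R) D" if "u \<in> carrier T3" for u
      unfolding lin_maps_opp by (rule param[OF tri _ that]) (simp_all add: a F2)
  qed
  have b5: "bilin K R (tensor K (opp R) T3) D (\<lambda>a w. tens_lift K D (\<lambda>b u. tens3_lift K D (F a b) u) w)"
  proof (rule bilinI)
    show "(\<lambda>w. tens_lift K D (\<lambda>b u. tens3_lift K D (F a b) u) w) \<in> lin_maps K (tensor K (opp R) T3) D"
      if "a \<in> carrier R" for a
      by (rule tens_lift_lin[OF k_algebra_opp[OF R_alg] T3 D b4[OF that]])
    show "(\<lambda>a. tens_lift K D (\<lambda>b u. tens3_lift K D (F a b) u) w) \<in> lin_maps K R D"
      if w: "w \<in> carrier (tensor K (opp R) T3)" for w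
      by (rule tens_lift_param[OF k_algebra_opp[OF R_alg] T3 D R_alg b4 _ w], assumption)
        (rule param[OF tri], simp_all add: F1)
  qed
  \<comment> \<open>The map on the five-fold tensor product induced by F, bracketed to the right as
    in \<open>tensor5\<close>.\<close>
  define G where "G = tens_lift K D (\<lambda>a w. tens_lift K D (\<lambda>b u. tens3_lift K D (F a b) u) w)"
  have G: "G \<in> lin_maps K ?T5 D"
    unfolding G_def tensor5_def by (rule tens_lift_lin[OF R_alg T4 D b5])
  have t5: "tens5 K R a b u \<in> carrier ?T5" if "a \<in> carrier R" "b \<in> carrier R" "u \<in> carrier T3" for a b u
    unfolding tens5_def tensor5_def by (intro lin_intros T3) (use that in simp_all)
  have Gt: "G (tens5 K R a b u) = tens3_lift K D (F a b) u"
    if ab: "a \<in> carrier R" "b \<in> carrier R" and u: "u \<in> carrier T3" for a b u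
    unfolding G_def tens5_def
    by (subst tens_lift_tens[OF R_alg T4 D b5], rule ab, rule tens_closed[OF k_algebra_opp[OF R_alg] T3],
        (simp add: ab u)+)
      (subst tens_lift_tens[OF k_algebra_opp[OF R_alg] T3 D b4[OF ab(1)]], simp_all add: ab u)
  have tc: "tens3 K R a b c \<in> carrier T3" if "a \<in> carrier R" "b \<in> carrier R" "c \<in> carrier R" for a b c
    by (rule lin_maps_closed[OF trilin1[OF trilin_tens3[OF R_alg]]]) (rule that)+
  have s1: "trilin K R ?T5 (\<lambda>u v w. tens5 K R u v (tens3 K R w b c))" if "b \<in> carrier R" "c \<in> carrier R" for b c
    unfolding tens5_def tensor5_def
    by (intro lin_intros T3 trilin1[OF trilin_tens3[OF R_alg]] tc) (use that in simp_all)
  have s2: "trilin K R ?T5 (\<lambda>a b c. M ?T5 (\<lambda>u v w. tens5 K R u v (tens3 K R w b c)) a)"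
    by (intro lin_intros T5 s1 lin_maps_id)
      (simp_all, unfold tens5_def tensor5_def,
        (intro lin_intros T3 trilin2[OF trilin_tens3[OF R_alg]] trilin3[OF trilin_tens3[OF R_alg]]; simp)+)
  have s3: "trilin K R ?T5 (\<lambda>a b c. tens5 K R a b (\<mu> c))"
    unfolding tens5_def tensor5_def
    by (intro lin_intros T3 mu_lin mu_closed) simp_all
  have "M ?T5 (\<lambda>a b c. M ?T5 (\<lambda>u v w. tens5 K R u v (tens3 K R w b c)) a) r
    = M ?T5 (\<lambda>a b c. tens5 K R a b (\<mu> c)) r"
    using hg r by (simp add: hopf_galois_def M_def)
  then have "G (M ?T5 (\<lambda>a b c. M ?T5 (\<lambda>u v w. tens5 K R u v (tens3 K R w b c)) a) r)
    = G (M ?T5 (\<lambda>a b c. tens5 K R a b (\<mu> c)) r)" by simp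
  also have "\<dots> = M D (\<lambda>a b c. G (tens5 K R a b (\<mu> c))) r" by (rule M_comm[OF T5 D G s3 r])
  also have "\<dots> = M D (\<lambda>a b c. M D (\<lambda>u v w. F a b u v w) c) r"
    by (rule M_cong[OF D trilin_comp[OF s3 G] r]) (simp add: Gt mu_closed M_def)
  finally have E: "G (M ?T5 (\<lambda>a b c. M ?T5 (\<lambda>u v w. tens5 K R u v (tens3 K R w b c)) a) r)
    = M D (\<lambda>a b c. M D (\<lambda>u v w. F a b u v w) c) r" .
  have "G (M ?T5 (\<lambda>a b c. M ?T5 (\<lambda>u v w. tens5 K R u v (tens3 K R w b c)) a) r)
    = M D (\<lambda>a b c. G (M ?T5 (\<lambda>u v w. tens5 K R u v (tens3 K R w b c)) a)) r"
    by (rule M_comm[OF T5 D G s2 r])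
  also have "\<dots> = M D (\<lambda>a b c. M D (\<lambda>u v w. F u v w b c) a) r"
  proof (rule M_cong[OF D trilin_comp[OF s2 G] r])
    fix a b c assume abc: "a \<in> carrier R" "b \<in> carrier R" "c \<in> carrier R"
    have "G (M ?T5 (\<lambda>u v w. tens5 K R u v (tens3 K R w b c)) a)
      = M D (\<lambda>u v w. G (tens5 K R u v (tens3 K R w b c))) a"
      by (rule M_comm[OF T5 D G s1[OF abc(2,3)] abc(1)])
    also have "\<dots> = M D (\<lambda>u v w. F u v w b c) a"
      by (rule M_cong[OF D trilin_comp[OF s1[OF abc(2,3)] G] abc(1)])
        (simp add: Gt tc abc tens3_lift_tens3[OF R_alg D tri])
    finally show "G (M ?T5 (\<lambda>u v w. tens5 K R u v (tens3 K R w b c)) a) = M D (\<lambda>u v w. F u v w b c) a" .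
  qed
  finally show ?thesis using E by simp
qed

lemma lin_L [lin_intros]:
  "k_algebra K D \<Longrightarrow> G \<in> lin_maps K C T \<Longrightarrow> bilin K R R D F \<Longrightarrow> (\<lambda>z. L D F (G z)) \<in> lin_maps K C D"
  by (rule lin_maps_comp[OF tens_lift_lin[OF k_algebra_opp[OF R_alg] R_alg]]) simp_all

lemma lin_L_param [lin_intros]:
  assumes "k_algebra K D" "k_algebra K C" "\<And>z. z \<in> carrier C \<Longrightarrow> bilin K R R D (F z)"
    and "\<And>a b. a \<in> carrier R \<Longrightarrow> b \<in> carrier R \<Longrightarrow> (\<lambda>z. F z a b) \<in> lin_maps K C D"
    and "u \<in> carrier T"
  shows "(\<lambda>z. L D (F z) u) \<in> lin_maps K C D"
  by (rule tens_lift_param[OF k_algebra_opp[OF R_alg] R_alg assms(1,2) _ _ assms(5)])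
    (use assms in simp_all)

lemma L_comm:
  "k_algebra K D \<Longrightarrow> k_algebra K E \<Longrightarrow> G \<in> lin_maps K D E \<Longrightarrow> bilin K R R D F \<Longrightarrow> u \<in> carrier T \<Longrightarrow>
    G (L D F u) = L E (\<lambda>a b. G (F a b)) u"
  by (rule tens_lift_comm[OF k_algebra_opp[OF R_alg] R_alg]) simp_all

lemma L_cong:
  "k_algebra K D \<Longrightarrow> bilin K R R D F \<Longrightarrow> u \<in> carrier T \<Longrightarrow>
    (\<And>a b. a \<in> carrier R \<Longrightarrow> b \<in> carrier R \<Longrightarrow> F a b = G a b) \<Longrightarrow> L D F u = L D G u"
  by (rule tens_lift_cong[OF k_algebra_opp[OF R_alg] R_alg]) simp_all

lemma L_tens:
  "k_algebra K D \<Longrightarrow> bilin K R R D F \<Longrightarrow> a \<in> carrier R \<Longrightarrow> b \<in> carrier R \<Longrightarrow> L D F (t a b) = F a b"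
  by (rule tens_lift_tens[OF k_algebra_opp[OF R_alg] R_alg]) simp_all

lemma L_self: "u \<in> carrier T \<Longrightarrow> L T t u = u"
  by (rule tens_lift_self[OF k_algebra_opp[OF R_alg] R_alg])

text \<open>The first tensor factor is multiplied in the opposite algebra, hence the order of x' and
  x.\<close>

lemma L_mult:
  assumes "k_algebra K D" "bilin K R R D F" "u \<in> carrier T" "v \<in> carrier T"
  shows "L D F (u \<otimes>\<^bsub>T\<^esub> v) = L D (\<lambda>x y. L D (\<lambda>x' y'. F (x' \<otimes> x) (y \<otimes> y')) v) u"
  using tens_lift_mult[OF k_algebra_opp[OF R_alg] R_alg assms(1) _ assms(3,4), of F] assms(2) by simp

lemma t_mult:
  "a \<in> carrier R \<Longrightarrow> b \<in> carrier R \<Longrightarrow> a' \<in> carrier R \<Longrightarrow> b' \<in> carrier R \<Longrightarrow>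
    t a b \<otimes>\<^bsub>T\<^esub> t a' b' = t (a' \<otimes> a) (b \<otimes> b')"
  using tens_mult[OF k_algebra_opp[OF R_alg] R_alg, of a b a' b'] by simp

lemma T_one: "\<one>\<^bsub>T\<^esub> = t \<one> \<one>"
  using tensor_one[OF k_algebra_opp[OF R_alg] R_alg] by simp

lemma t_closed: "a \<in> carrier R \<Longrightarrow> b \<in> carrier R \<Longrightarrow> t a b \<in> carrier T"
  using tens_closed[OF k_algebra_opp[OF R_alg] R_alg] by simp

end

section \<open>The Hopf algebra of a Hopf-Galois algebra\<close>

lemma k_algebra_sub:
  assumes A: "k_algebra K A" and S: "S \<subseteq> carrier A" and one: "\<one>\<^bsub>A\<^esub> \<in> S"
    and add: "\<And>x y. x \<in> S \<Longrightarrow> y \<in> S \<Longrightarrow> x \<oplus>\<^bsub>A\<^esub> y \<in> S"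
    and mult: "\<And>x y. x \<in> S \<Longrightarrow> y \<in> S \<Longrightarrow> x \<otimes>\<^bsub>A\<^esub> y \<in> S"
    and smult: "\<And>s x. s \<in> carrier K \<Longrightarrow> x \<in> S \<Longrightarrow> s \<odot>\<^bsub>A\<^esub> x \<in> S"
  shows "k_algebra K (A\<lparr>carrier := S\<rparr>)"
proof -
  interpret A: k_algebra K A by fact
  have c: "x \<in> S \<Longrightarrow> x \<in> carrier A" for x using S by blast
  have z: "\<zero>\<^bsub>A\<^esub> \<in> S" using smult[OF A.K.zero_closed one] by simp
  have inv: "\<ominus>\<^bsub>A\<^esub> x \<in> S" if "x \<in> S" for x
    using smult[of "\<ominus>\<^bsub>K\<^esub> \<one>\<^bsub>K\<^esub>" x] that c by (simp add: A.smult_l_minus)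
  have ab: "abelian_group (A\<lparr>carrier := S\<rparr>)"
  proof (rule abelian_groupI)
    fix x assume "x \<in> carrier (A\<lparr>carrier := S\<rparr>)"
    then show "\<exists>y\<in>carrier (A\<lparr>carrier := S\<rparr>). y \<oplus>\<^bsub>A\<lparr>carrier := S\<rparr>\<^esub> x = \<zero>\<^bsub>A\<lparr>carrier := S\<rparr>\<^esub>"
      by (intro bexI[of _ "\<ominus>\<^bsub>A\<^esub> x"]) (auto simp: A.A.l_neg c inv)
  qed (auto simp: add z c A.A.a_ac)
  moreover have "monoid (A\<lparr>carrier := S\<rparr>)" by (rule monoidI) (auto simp: one mult c A.A.m_assoc)
  ultimately have "ring (A\<lparr>carrier := S\<rparr>)" by (rule ringI) (auto simp: c A.A.l_distr A.A.r_distr)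
  then show ?thesis
    by (rule k_algebraI[OF A.K.field_axioms])
      (auto simp: smult c A.smult_l_distr A.smult_r_distr A.smult_assoc1 A.smult_mult_left A.smult_mult_right)
qed

lemma lin_tens3 [lin_intros]:
  "k_algebra K R \<Longrightarrow> F \<in> lin_maps K C R \<Longrightarrow> b \<in> carrier R \<Longrightarrow> c \<in> carrier R \<Longrightarrow>
    (\<lambda>z. tens3 K R (F z) b c) \<in> lin_maps K C (tensor3 K R)"
  "k_algebra K R \<Longrightarrow> F \<in> lin_maps K C R \<Longrightarrow> a \<in> carrier R \<Longrightarrow> c \<in> carrier R \<Longrightarrow>
    (\<lambda>z. tens3 K R a (F z) c) \<in> lin_maps K C (tensor3 K R)"
  "k_algebra K R \<Longrightarrow> F \<in> lin_maps K C R \<Longrightarrow> a \<in> carrier R \<Longrightarrow> b \<in> carrier R \<Longrightarrow>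
    (\<lambda>z. tens3 K R a b (F z)) \<in> lin_maps K C (tensor3 K R)"
  by (rule lin_maps_comp[OF trilin1[OF trilin_tens3]] lin_maps_comp[OF trilin2[OF trilin_tens3]]
      lin_maps_comp[OF trilin3[OF trilin_tens3]]; assumption)+

lemma tens3_closed [lin_intros]:
  "k_algebra K R \<Longrightarrow> a \<in> carrier R \<Longrightarrow> b \<in> carrier R \<Longrightarrow> c \<in> carrier R \<Longrightarrow>
    tens3 K R a b c \<in> carrier (tensor3 K R)"
  by (rule lin_maps_closed[OF trilin1[OF trilin_tens3]])

section \<open>Interchange of independent brackets\<close>

context hopf_gal begin

text \<open>The two brackets run over unrelated tensors. The element \<open>\<mu> r\<close> is
  generalised to an arbitrary three-fold tensor w, both sides are linear in w, and on a pure w the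
  outer bracket disappears.\<close>

lemma Fubini_ML:
  assumes D: "k_algebra K D"
    and F1: "\<And>x y. x \<in> carrier R \<Longrightarrow> y \<in> carrier R \<Longrightarrow> trilin K R D (\<lambda>a b c. F a b c x y)"
    and F2: "\<And>a b c. a \<in> carrier R \<Longrightarrow> b \<in> carrier R \<Longrightarrow> c \<in> carrier R \<Longrightarrow> bilin K R R D (\<lambda>x y. F a b c x y)"
    and v: "v \<in> carrier T" and r: "r \<in> carrier R"
  shows "M D (\<lambda>a b c. L D (\<lambda>x y. F a b c x y) v) r = L D (\<lambda>x y. M D (\<lambda>a b c. F a b c x y) r) v"
proof -
  have tri: "trilin K R D (\<lambda>a b c. L D (\<lambda>x y. F a b c x y) v)"
    by (intro trilinI lin_L_param D R_alg v) (simp_all add: F2 trilin1[OF F1] trilin2[OF F1] trilin3[OF F1])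
  have bil: "bilin K R R D (\<lambda>x y. tens3_lift K D (\<lambda>a b c. F a b c x y) w)" if "w \<in> carrier T3" for w
  proof (rule bilinI)
    show "(\<lambda>y. tens3_lift K D (\<lambda>a b c. F a b c x y) w) \<in> lin_maps K R D" if x: "x \<in> carrier R" for x
      unfolding tens3_lift_def
      by (rule tens_lift_param[OF R_alg T_alg D R_alg bilin_of_trilin(2)[OF R_alg D F1[OF x]] _
            \<open>w \<in> carrier T3\<close>[unfolded tensor3_def]])
        (auto intro!: lin_L_param D R_alg bilin_of_trilin(1)[OF R_alg D F1] bilin_right[OF F2] simp: x)
    show "(\<lambda>x. tens3_lift K D (\<lambda>a b c. F a b c x y) w) \<in> lin_maps K R D" if y: "y \<in> carrier R" for y
      unfolding tens3_lift_def
      by (rule tens_lift_param[OF R_alg T_alg D R_alg bilin_of_trilin(2)[OF R_alg D F1[OF _ y]] _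
            \<open>w \<in> carrier T3\<close>[unfolded tensor3_def]])
        (auto intro!: lin_L_param D R_alg bilin_of_trilin(1)[OF R_alg D F1] bilin_left[OF F2] simp: y)
  qed
  show ?thesis
    unfolding M_def
  proof (rule tensor3_ext[OF R_alg D tens3_lift_lin[OF R_alg D tri] _ _ mu_closed[OF r]])
    show "(\<lambda>w. L D (\<lambda>x y. tens3_lift K D (\<lambda>a b c. F a b c x y) w) v) \<in> lin_maps K T3 D"
      by (rule lin_L_param[OF D k_algebra_tensor3[OF R_alg] bil tens3_lift_lin[OF R_alg D F1] v])
    fix a b c assume abc: "a \<in> carrier R" "b \<in> carrier R" "c \<in> carrier R"
    have "L D (\<lambda>x y. tens3_lift K D (\<lambda>a b c. F a b c x y) (tens3 K R a b c)) v = L D (\<lambda>x y. F a b c x y) v"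
      by (rule L_cong[OF D bil v]) (use abc in \<open>auto intro: tens3_closed R_alg simp: tens3_lift_tens3[OF R_alg D F1]\<close>)
    then show "tens3_lift K D (\<lambda>a b c. L D (F a b c) v) (tens3 K R a b c)
        = L D (\<lambda>x y. tens3_lift K D (\<lambda>a b c. F a b c x y) (tens3 K R a b c)) v"
      by (simp add: tens3_lift_tens3[OF R_alg D tri] abc)
  qed
qed

lemma Fubini_MM:
  assumes D: "k_algebra K D"
    and F1: "\<And>x y z. x \<in> carrier R \<Longrightarrow> y \<in> carrier R \<Longrightarrow> z \<in> carrier R \<Longrightarrow> trilin K R D (\<lambda>a b c. F a b c x y z)"
    and F2: "\<And>a b c. a \<in> carrier R \<Longrightarrow> b \<in> carrier R \<Longrightarrow> c \<in> carrier R \<Longrightarrow> trilin K R D (\<lambda>x y z. F a b c x y z)"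
    and r: "r \<in> carrier R" and s: "s \<in> carrier R"
  shows "M D (\<lambda>a b c. M D (\<lambda>x y z. F a b c x y z) s) r = M D (\<lambda>x y z. M D (\<lambda>a b c. F a b c x y z) r) s"
proof -
  have T3: "k_algebra K T3" by (assumption | rule lin_intros)+
  have tri: "trilin K R D (\<lambda>a b c. M D (\<lambda>x y z. F a b c x y z) s)"
    by (intro trilinI lin_M_param D R_alg s) (simp_all add: trilin1[OF F1] trilin2[OF F1] trilin3[OF F1] trilin1[OF F2] trilin2[OF F2] trilin3[OF F2])
  have param: "(\<lambda>z. tens3_lift K D (G z) w) \<in> lin_maps K R D"
    if G: "\<And>z. z \<in> carrier R \<Longrightarrow> trilin K R D (G z)"
      "\<And>a b c. a \<in> carrier R \<Longrightarrow> b \<in> carrier R \<Longrightarrow> c \<in> carrier R \<Longrightarrow> (\<lambda>z. G z a b c) \<in> lin_maps K R D"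
      and w: "w \<in> carrier T3" for G w
    unfolding tens3_lift_def
    by (rule tens_lift_param[OF R_alg T_alg D R_alg bilin_of_trilin(2)[OF R_alg D G(1)] _ w[unfolded tensor3_def]])
      (auto intro!: lin_L_param D R_alg bilin_of_trilin(1)[OF R_alg D G(1)] G(2))
  have tri2: "trilin K R D (\<lambda>x y z. tens3_lift K D (\<lambda>a b c. F a b c x y z) w)" if w: "w \<in> carrier T3" for w
    by (rule trilinI; rule param[OF F1 _ w]) (simp_all add: trilin1[OF F2] trilin2[OF F2] trilin3[OF F2])
  show ?thesis
    unfolding M_def[of _ _ r]
  proof (rule tensor3_ext[OF R_alg D tens3_lift_lin[OF R_alg D tri] _ _ mu_closed[OF r]])
    show "(\<lambda>w. M D (\<lambda>x y z. tens3_lift K D (\<lambda>a b c. F a b c x y z) w) s) \<in> lin_maps K T3 D"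
      by (rule lin_M_param[OF D T3 tri2 tens3_lift_lin[OF R_alg D F1] s])
    fix a b c assume abc: "a \<in> carrier R" "b \<in> carrier R" "c \<in> carrier R"
    have "M D (\<lambda>x y z. tens3_lift K D (\<lambda>a b c. F a b c x y z) (tens3 K R a b c)) s = M D (\<lambda>x y z. F a b c x y z) s"
      by (rule M_cong[OF D tri2 s]) (use abc in \<open>auto intro: tens3_closed R_alg simp: tens3_lift_tens3[OF R_alg D F1]\<close>)
    then show "tens3_lift K D (\<lambda>a b c. M D (F a b c) s) (tens3 K R a b c)
        = M D (\<lambda>x y z. tens3_lift K D (\<lambda>a b c. F a b c x y z) (tens3 K R a b c)) s"
      by (simp add: tens3_lift_tens3[OF R_alg D tri] abc)
  qed
qed

section \<open>The subalgebra H\<close>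

abbreviation "H \<equiv> H_alg K R \<mu>"
abbreviation "t3 \<equiv> tens3 K R"

definition "\<delta> u = L T3 (\<lambda>x y. M T3 (\<lambda>a b c. t3 (x \<otimes> a) b c) y) u"

lemma H_carrier: "u \<in> carrier H \<longleftrightarrow> u \<in> carrier T \<and> \<delta> u = tens K R T \<one> u"
  by (simp add: H_alg_def \<delta>_def M_def)

lemma H_simps [simp]:
  "mult H = mult T" "one H = one T" "zero H = zero T" "add H = add T" "smult H = smult T"
  by (simp_all add: H_alg_def)

lemma H_T [simp]: "u \<in> carrier H \<Longrightarrow> u \<in> carrier T" by (simp add: H_carrier)

lemma H_sub: "carrier H \<subseteq> carrier T" by auto

lemma \<delta>_lin: "\<delta> \<in> lin_maps K T T3"
  unfolding \<delta>_def[abs_def] by (assumption | rule lin_intros | simp)+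

lemma \<delta>_rule:
  assumes D: "k_algebra K D" and F: "trilin K R D F" and u: "u \<in> carrier T"
  shows "tens3_lift K D F (\<delta> u) = L D (\<lambda>x y. M D (\<lambda>a b c. F (x \<otimes> a) b c) y) u"
proof -
  have T3: "k_algebra K T3" by (assumption | rule lin_intros)+
  note Fl = tens3_lift_lin[OF R_alg D F]
  have b1: "bilin K R R T3 (\<lambda>x y. M T3 (\<lambda>a b c. t3 (x \<otimes> a) b c) y)"
    by (assumption | rule lin_intros | simp)+
  have tri: "trilin K R T3 (\<lambda>a b c. t3 (x \<otimes> a) b c)" if "x \<in> carrier R" for x
    using that by - (assumption | rule lin_intros | simp)+
  have "tens3_lift K D F (\<delta> u) = L D (\<lambda>x y. tens3_lift K D F (M T3 (\<lambda>a b c. t3 (x \<otimes> a) b c) y)) u"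
    unfolding \<delta>_def by (rule L_comm[OF T3 D Fl b1 u])
  also have "\<dots> = L D (\<lambda>x y. M D (\<lambda>a b c. F (x \<otimes> a) b c) y) u"
  proof (rule L_cong[OF D bilin_comp[OF b1 Fl] u])
    fix x y assume xy: "x \<in> carrier R" "y \<in> carrier R"
    have "tens3_lift K D F (M T3 (\<lambda>a b c. t3 (x \<otimes> a) b c) y)
      = M D (\<lambda>a b c. tens3_lift K D F (t3 (x \<otimes> a) b c)) y"
      by (rule M_comm[OF T3 D Fl tri[OF xy(1)] xy(2)])
    also have "\<dots> = M D (\<lambda>a b c. F (x \<otimes> a) b c) y"
      by (rule M_cong[OF D trilin_comp[OF tri[OF xy(1)] Fl] xy(2)])
        (simp add: tens3_lift_tens3[OF R_alg D F] alg_mult_closed[OF R_alg] xy)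
    finally show "tens3_lift K D F (M T3 (\<lambda>a b c. t3 (x \<otimes> a) b c) y) = M D (\<lambda>a b c. F (x \<otimes> a) b c) y" .
  qed
  finally show ?thesis .
qed

text \<open>This is the working form of membership in H: an expression that sees x and y only
  through x y1, y2 and y3 may be evaluated at 1, x and y.\<close>

lemma H_rule:
  assumes D: "k_algebra K D" and F: "trilin K R D F" and u: "u \<in> carrier H"
  shows "L D (\<lambda>x y. M D (\<lambda>a b c. F (x \<otimes> a) b c) y) u = L D (\<lambda>x y. F \<one> x y) u"
proof -
  have "L D (\<lambda>x y. M D (\<lambda>a b c. F (x \<otimes> a) b c) y) u = tens3_lift K D F (tens K R T \<one> u)"
    using u by (simp add: \<delta>_rule[OF D F, symmetric] H_carrier)
  also have "\<dots> = L D (\<lambda>x y. F \<one> x y) u"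
    unfolding tens3_lift_def using u
    by (simp add: tens_lift_tens[OF R_alg T_alg D bilin_of_trilin(2)[OF R_alg D F]] alg_one_closed[OF R_alg])
  finally show ?thesis .
qed

lemma H_I:
  assumes u: "u \<in> carrier T"
    and eq: "L T3 (\<lambda>x y. M T3 (\<lambda>a b c. t3 (x \<otimes> a) b c) y) u = L T3 (\<lambda>x y. t3 \<one> x y) u"
  shows "u \<in> carrier H"
proof -
  have l: "(\<lambda>w. tens K R T \<one> w) \<in> lin_maps K T (tensor K R T)" by (assumption | rule lin_intros)+
  have b: "bilin K R R T t" using tens_bilin[OF k_algebra_opp[OF R_alg] R_alg] by simp
  have "tens K R T \<one> (L T t u) = L (tensor K R T) (\<lambda>x y. tens K R T \<one> (t x y)) u"
    by (rule L_comm[OF T_alg _ l b u]) (intro lin_intros)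
  then show ?thesis
    using u eq by (simp add: H_carrier \<delta>_def L_self tens3_def tensor3_def)
qed

lemma H_one: "\<one>\<^bsub>T\<^esub> \<in> carrier H"
proof (rule H_I)
  show 1: "\<one>\<^bsub>T\<^esub> \<in> carrier T" by (assumption | rule lin_intros)+
  have b: "bilin K R R T3 (\<lambda>x y. M T3 (\<lambda>a b c. t3 (x \<otimes> a) b c) y)"
    "bilin K R R T3 (\<lambda>x y. t3 \<one> x y)" "trilin K R T3 (\<lambda>a b c. t3 (\<one> \<otimes> a) b c)"
    by (assumption | rule lin_intros | simp)+
  interpret k_algebra K R by (rule R_alg)
  show "L T3 (\<lambda>x y. M T3 (\<lambda>a b c. t3 (x \<otimes> a) b c) y) \<one>\<^bsub>T\<^esub> = L T3 (\<lambda>x y. t3 \<one> x y) \<one>\<^bsub>T\<^esub>"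
    unfolding T_one
    by (simp add: L_tens[OF k_algebra_tensor3[OF R_alg] b(1)] L_tens[OF k_algebra_tensor3[OF R_alg] b(2)]
        M_one[OF k_algebra_tensor3[OF R_alg] b(3)])
qed

text \<open>The first component for the product is x' x (y y')1 = x' (x y1) y'1. Membership of u
  replaces the inner x y1 by 1, and then membership of v replaces x' y'1 by 1.\<close>

lemma H_mult:
  assumes u: "u \<in> carrier H" and v: "v \<in> carrier H"
  shows "u \<otimes>\<^bsub>T\<^esub> v \<in> carrier H"
proof (rule H_I)
  interpret RR: k_algebra K R by (rule R_alg)
  have T3: "k_algebra K T3" by (assumption | rule lin_intros)+
  have uT: "u \<in> carrier T" and vT: "v \<in> carrier T" using u v by simp_all
  show "u \<otimes>\<^bsub>T\<^esub> v \<in> carrier T" by (assumption | rule lin_intros uT vT)+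
  note auto = T3 uT vT
  let ?F = "\<lambda>x y x' y' a b c a' b' c'. t3 (x' \<otimes> (x \<otimes> a) \<otimes> a') (b' \<otimes> b) (c \<otimes> c')"
  have "L T3 (\<lambda>x y. M T3 (\<lambda>a b c. t3 (x \<otimes> a) b c) y) (u \<otimes>\<^bsub>T\<^esub> v)
    = L T3 (\<lambda>x y. L T3 (\<lambda>x' y'. M T3 (\<lambda>a b c. t3 (x' \<otimes> x \<otimes> a) b c) (y \<otimes> y')) v) u"
    by (rule L_mult) (assumption | rule lin_intros auto | simp)+
  also have "\<dots> = L T3 (\<lambda>x y. M T3 (\<lambda>a b c. L T3 (\<lambda>x' y'. M T3 (\<lambda>a' b' c'.
      t3 (x' \<otimes> (x \<otimes> a) \<otimes> a') (b' \<otimes> b) (c \<otimes> c')) y') v) y) u"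
  proof (rule L_cong)
    fix x y assume xy: "x \<in> carrier R" "y \<in> carrier R"
    have "L T3 (\<lambda>x' y'. M T3 (\<lambda>a b c. t3 (x' \<otimes> x \<otimes> a) b c) (y \<otimes> y')) v
      = L T3 (\<lambda>x' y'. M T3 (\<lambda>a b c. M T3 (\<lambda>a' b' c'.
          t3 (x' \<otimes> (x \<otimes> a) \<otimes> a') (b' \<otimes> b) (c \<otimes> c')) y') y) v"
    proof (rule L_cong)
      fix x' y' assume xy': "x' \<in> carrier R" "y' \<in> carrier R"
      have "M T3 (\<lambda>a b c. t3 (x' \<otimes> x \<otimes> a) b c) (y \<otimes> y')
        = M T3 (\<lambda>a b c. M T3 (\<lambda>a' b' c'. t3 (x' \<otimes> x \<otimes> (a \<otimes> a')) (b' \<otimes> b) (c \<otimes> c')) y') y"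
        by (rule M_mult) (assumption | rule lin_intros auto xy xy' | simp)+
      also have "\<dots> = M T3 (\<lambda>a b c. M T3 (\<lambda>a' b' c'.
          t3 (x' \<otimes> (x \<otimes> a) \<otimes> a') (b' \<otimes> b) (c \<otimes> c')) y') y"
        by (rule M_cong; (rule M_cong)?) (assumption | rule lin_intros auto xy xy' | simp add: RR.A.m_assoc xy xy')+
      finally show "M T3 (\<lambda>a b c. t3 (x' \<otimes> x \<otimes> a) b c) (y \<otimes> y')
        = M T3 (\<lambda>a b c. M T3 (\<lambda>a' b' c'.
          t3 (x' \<otimes> (x \<otimes> a) \<otimes> a') (b' \<otimes> b) (c \<otimes> c')) y') y" .
    qed (assumption | rule lin_intros auto xy | simp)+
    \<comment> \<open>\<open>H_rule\<close> needs the bracket over y directly below the one over u,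
      so the bracket over v is moved inside.\<close>
    also have "\<dots> = M T3 (\<lambda>a b c. L T3 (\<lambda>x' y'. M T3 (\<lambda>a' b' c'.
      t3 (x' \<otimes> (x \<otimes> a) \<otimes> a') (b' \<otimes> b) (c \<otimes> c')) y') v) y"
      by (rule Fubini_ML[symmetric]) (assumption | rule lin_intros auto xy | simp)+
    finally show "L T3 (\<lambda>x' y'. M T3 (\<lambda>a b c. t3 (x' \<otimes> x \<otimes> a) b c) (y \<otimes> y')) v
      = M T3 (\<lambda>a b c. L T3 (\<lambda>x' y'. M T3 (\<lambda>a' b' c'.
      t3 (x' \<otimes> (x \<otimes> a) \<otimes> a') (b' \<otimes> b) (c \<otimes> c')) y') v) y" .
  qed (assumption | rule lin_intros auto | simp)+
  also have "\<dots> = L T3 (\<lambda>x y. L T3 (\<lambda>x' y'. M T3 (\<lambda>a' b' c'.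
      t3 (x' \<otimes> \<one> \<otimes> a') (b' \<otimes> x) (y \<otimes> c')) y') v) u"
    by (rule H_rule[OF T3 _ u, of "\<lambda>z b c. L T3 (\<lambda>x' y'. M T3 (\<lambda>a' b' c'.
      t3 (x' \<otimes> z \<otimes> a') (b' \<otimes> b) (c \<otimes> c')) y') v"])
      (assumption | rule lin_intros auto | simp)+
  also have "\<dots> = L T3 (\<lambda>x y. L T3 (\<lambda>x' y'. t3 \<one> (x' \<otimes> x) (y \<otimes> y')) v) u"
  proof (rule L_cong)
    fix x y assume xy: "x \<in> carrier R" "y \<in> carrier R"
    have "L T3 (\<lambda>x' y'. M T3 (\<lambda>a' b' c'.
      t3 (x' \<otimes> \<one> \<otimes> a') (b' \<otimes> x) (y \<otimes> c')) y') v
      = L T3 (\<lambda>x' y'. M T3 (\<lambda>a' b' c'. t3 (x' \<otimes> a') (b' \<otimes> x) (y \<otimes> c')) y') v"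
      by (rule L_cong; (rule M_cong)?) (assumption | rule lin_intros auto xy | simp)+
    also have "\<dots> = L T3 (\<lambda>x' y'. t3 \<one> (x' \<otimes> x) (y \<otimes> y')) v"
      by (rule H_rule[OF T3 _ v, of "\<lambda>z b c. t3 z (b \<otimes> x) (y \<otimes> c)"])
        (assumption | rule lin_intros auto xy | simp)+
    finally show "L T3 (\<lambda>x' y'. M T3 (\<lambda>a' b' c'.
      t3 (x' \<otimes> \<one> \<otimes> a') (b' \<otimes> x) (y \<otimes> c')) y') v
      = L T3 (\<lambda>x' y'. t3 \<one> (x' \<otimes> x) (y \<otimes> y')) v" .
  qed (assumption | rule lin_intros auto | simp)+
  also have "\<dots> = L T3 (\<lambda>x y. t3 \<one> x y) (u \<otimes>\<^bsub>T\<^esub> v)"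
    by (rule L_mult[symmetric]) (assumption | rule lin_intros auto | simp)+
  finally show "L T3 (\<lambda>x y. M T3 (\<lambda>a b c. t3 (x \<otimes> a) b c) y) (u \<otimes>\<^bsub>T\<^esub> v)
    = L T3 (\<lambda>x y. t3 \<one> x y) (u \<otimes>\<^bsub>T\<^esub> v)" .
qed

lemma H_alg [lin_intros]: "k_algebra K H"
proof -
  have l: "(\<lambda>w. tens K R T \<one> w) \<in> lin_maps K T T3" unfolding tensor3_def by (assumption | rule lin_intros)+
  have Hd: "\<delta> x = tens K R T \<one> x" if "x \<in> carrier H" for x
    using that unfolding H_carrier by (rule conjunct2)
  have "k_algebra K (T\<lparr>carrier := carrier H\<rparr>)"
  proof (rule k_algebra_sub[OF T_alg H_sub H_one _ H_mult])
    fix x y assume x: "x \<in> carrier H" and y: "y \<in> carrier H"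
    have "\<delta> (x \<oplus>\<^bsub>T\<^esub> y) = \<delta> x \<oplus>\<^bsub>T3\<^esub> \<delta> y"
      by (rule lin_maps_add[OF \<delta>_lin H_T[OF x] H_T[OF y]])
    also have "\<dots> = tens K R T \<one> x \<oplus>\<^bsub>T3\<^esub> tens K R T \<one> y"
      unfolding Hd[OF x] Hd[OF y] ..
    also have "\<dots> = tens K R T \<one> (x \<oplus>\<^bsub>T\<^esub> y)"
      by (rule lin_maps_add[OF l H_T[OF x] H_T[OF y], symmetric])
    finally show "x \<oplus>\<^bsub>T\<^esub> y \<in> carrier H"
      unfolding H_carrier by (intro conjI alg_add_closed[OF T_alg] H_T x y)
  next
    fix s x assume s: "s \<in> carrier K" and x: "x \<in> carrier H"
    have "\<delta> (s \<odot>\<^bsub>T\<^esub> x) = s \<odot>\<^bsub>T3\<^esub> \<delta> x"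
      by (rule lin_maps_smult[OF \<delta>_lin s H_T[OF x]])
    also have "\<dots> = s \<odot>\<^bsub>T3\<^esub> tens K R T \<one> x"
      unfolding Hd[OF x] ..
    also have "\<dots> = tens K R T \<one> (s \<odot>\<^bsub>T\<^esub> x)"
      by (rule lin_maps_smult[OF l s H_T[OF x], symmetric])
    finally show "s \<odot>\<^bsub>T\<^esub> x \<in> carrier H"
      unfolding H_carrier by (intro conjI alg_smult_closed[OF T_alg] H_T s x)
  qed
  \<comment> \<open>H is by definition a carrier update of \<open>T\<close>, so the algebra obtained
    on the subset is H itself.\<close>
  moreover have "\<exists>S. H = T\<lparr>carrier := S\<rparr>" unfolding H_alg_def by (rule exI) (rule refl)
  then have "T\<lparr>carrier := carrier H\<rparr> = H" by (elim exE) simp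
  ultimately show ?thesis by (simp only:)
qed

lemma lin_H: "F \<in> lin_maps K T D \<Longrightarrow> F \<in> lin_maps K H D"
  by (rule lin_mapsI) (simp_all only: H_simps H_T lin_maps_closed lin_maps_add lin_maps_smult)

lemma bilin_H: "bilin K T T D F \<Longrightarrow> bilin K H H D F"
  by (simp add: bilin_def lin_H)

lemma lin_into_H: "F \<in> lin_maps K C T \<Longrightarrow> (\<And>z. z \<in> carrier C \<Longrightarrow> F z \<in> carrier H) \<Longrightarrow> F \<in> lin_maps K C H"
  by (simp add: lin_maps_def)

lemma lin_H_T: "F \<in> lin_maps K C H \<Longrightarrow> F \<in> lin_maps K C T"
  by (simp add: lin_maps_def Pi_iff)

text \<open>A linear projection onto \<open>H\<close>; it also splits the map \<open>H \<otimes> H \<rightarrow> T \<otimes> T\<close> induced by the inclusion.\<close>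

definition "P u = L T (\<lambda>x y. M T (\<lambda>a b c. f (x \<otimes> a) \<odot>\<^bsub>T\<^esub> t b c) y) u"

lemma P_lin: "P \<in> lin_maps K T T"
  unfolding P_def[abs_def] by (assumption | rule lin_intros | simp)+

lemma lin_P [lin_intros]: "G \<in> lin_maps K C T \<Longrightarrow> (\<lambda>z. P (G z)) \<in> lin_maps K C T"
  by (rule lin_maps_comp[OF P_lin])

lemma P_tens: "x \<in> carrier R \<Longrightarrow> y \<in> carrier R \<Longrightarrow>
    P (t x y) = M T (\<lambda>a b c. f (x \<otimes> a) \<odot>\<^bsub>T\<^esub> t b c) y"
  unfolding P_def by (rule L_tens) (assumption | rule lin_intros | simp)+

text \<open>Applying \<delta> to f(x y1) y2 \<otimes> y3 splits y3 and multiplies y2 by its first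
  part. Coassociativity moves the splitting to y1, where the counit axiom contracts the product of
  the two inner parts to 1; this is the 1 that characterises H.\<close>

lemma P_H:
  assumes u: "u \<in> carrier T"
  shows "P u \<in> carrier H"
proof -
  have T3: "k_algebra K T3" by (assumption | rule lin_intros)+
  have RT: "k_algebra K (tensor K R T)" by (assumption | rule lin_intros)+
  have l: "(\<lambda>w. tens K R T \<one> w) \<in> lin_maps K T T3" unfolding tensor3_def by (assumption | rule lin_intros)+
  interpret RR: k_algebra K R by (rule R_alg)
  have 1: "\<delta> (t b c) = M T3 (\<lambda>p q r. t3 (b \<otimes> p) q r) c" if "b \<in> carrier R" "c \<in> carrier R" for b c
    unfolding \<delta>_def by (rule L_tens) (assumption | rule lin_intros that | simp)+
  have "\<delta> (P u) = L T3 (\<lambda>x y. \<delta> (M T (\<lambda>a b c. f (x \<otimes> a) \<odot>\<^bsub>T\<^esub> t b c) y)) u"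
    unfolding P_def by (rule L_comm[OF T_alg T3 \<delta>_lin]) (assumption | rule lin_intros u | simp)+
  also have "\<dots> = L T3 (\<lambda>x y. tens K R T \<one> (M T (\<lambda>a b c. f (x \<otimes> a) \<odot>\<^bsub>T\<^esub> t b c) y)) u"
  proof (rule L_cong[OF T3 _ u])
    show "bilin K R R T3 (\<lambda>x y. \<delta> (M T (\<lambda>a b c. f (x \<otimes> a) \<odot>\<^bsub>T\<^esub> t b c) y))"
      by (rule bilin_comp[OF _ \<delta>_lin]) (assumption | rule lin_intros | simp)+
    fix x y assume xy: "x \<in> carrier R" "y \<in> carrier R"
    have tri: "trilin K R T (\<lambda>a b c. f (x \<otimes> a) \<odot>\<^bsub>T\<^esub> t b c)"
      by (assumption | rule lin_intros xy | simp)+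
    have "\<delta> (M T (\<lambda>a b c. f (x \<otimes> a) \<odot>\<^bsub>T\<^esub> t b c) y)
      = M T3 (\<lambda>a b c. \<delta> (f (x \<otimes> a) \<odot>\<^bsub>T\<^esub> t b c)) y"
      by (rule M_comm[OF T_alg T3 \<delta>_lin tri xy(2)])
    also have "\<dots> = M T3 (\<lambda>a b c. M T3 (\<lambda>p q r. f (x \<otimes> a) \<odot>\<^bsub>T3\<^esub> t3 (b \<otimes> p) q r) c) y"
    proof (rule M_cong[OF T3 trilin_comp[OF tri \<delta>_lin] xy(2)])
      fix a b c assume abc: "a \<in> carrier R" "b \<in> carrier R" "c \<in> carrier R"
      have fx: "f (x \<otimes> a) \<in> carrier K" by (assumption | rule lin_intros xy abc)+
      have "\<delta> (f (x \<otimes> a) \<odot>\<^bsub>T\<^esub> t b c) = f (x \<otimes> a) \<odot>\<^bsub>T3\<^esub> M T3 (\<lambda>p q r. t3 (b \<otimes> p) q r) c"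
        using abc fx by (simp add: lin_maps_smult[OF \<delta>_lin] 1 t_closed)
      also have "\<dots> = M T3 (\<lambda>p q r. f (x \<otimes> a) \<odot>\<^bsub>T3\<^esub> t3 (b \<otimes> p) q r) c"
        by (rule M_comm[OF T3 T3]) (assumption | rule lin_intros fx abc | simp)+
      finally show "\<delta> (f (x \<otimes> a) \<odot>\<^bsub>T\<^esub> t b c)
        = M T3 (\<lambda>p q r. f (x \<otimes> a) \<odot>\<^bsub>T3\<^esub> t3 (b \<otimes> p) q r) c" .
    qed
    also have "\<dots> = M T3 (\<lambda>a b c. M T3 (\<lambda>p q r. f (x \<otimes> p) \<odot>\<^bsub>T3\<^esub> t3 (q \<otimes> r) b c) a) y"
      by (rule M_coassoc[symmetric]) (assumption | rule lin_intros xy | simp)+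
    also have "\<dots> = M T3 (\<lambda>a b c. f (x \<otimes> a) \<odot>\<^bsub>T3\<^esub> t3 \<one> b c) y"
    proof (rule M_cong)
      fix a b c assume abc: "a \<in> carrier R" "b \<in> carrier R" "c \<in> carrier R"
      show "M T3 (\<lambda>p q r. f (x \<otimes> p) \<odot>\<^bsub>T3\<^esub> t3 (q \<otimes> r) b c) a = f (x \<otimes> a) \<odot>\<^bsub>T3\<^esub> t3 \<one> b c"
        by (rule M_counit_right[OF T3 _ abc(1), of "\<lambda>p q. f (x \<otimes> p) \<odot>\<^bsub>T3\<^esub> t3 q b c"])
          (assumption | rule lin_intros xy abc | simp)+
    qed (assumption | rule lin_intros xy | simp)+
    also have "\<dots> = M T3 (\<lambda>a b c. tens K R T \<one> (f (x \<otimes> a) \<odot>\<^bsub>T\<^esub> t b c)) y"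
      by (rule M_cong) (assumption | rule lin_intros xy |
          simp add: tens3_def lin_maps_smult[OF l] f_closed alg_mult_closed[OF R_alg] t_closed xy)+
    also have "\<dots> = tens K R T \<one> (M T (\<lambda>a b c. f (x \<otimes> a) \<odot>\<^bsub>T\<^esub> t b c) y)"
      by (rule M_comm[OF T_alg T3 l tri xy(2), symmetric])
    finally show "\<delta> (M T (\<lambda>a b c. f (x \<otimes> a) \<odot>\<^bsub>T\<^esub> t b c) y)
      = tens K R T \<one> (M T (\<lambda>a b c. f (x \<otimes> a) \<odot>\<^bsub>T\<^esub> t b c) y)" .
  qed
  also have "\<dots> = tens K R T \<one> (P u)"
    unfolding P_def by (rule L_comm[OF T_alg T3 l, symmetric]) (assumption | rule lin_intros u | simp)+
  finally show ?thesis using lin_maps_closed[OF P_lin u] by (simp add: H_carrier)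
qed

lemma P_closed [lin_intros]: "u \<in> carrier T \<Longrightarrow> P u \<in> carrier H" "u \<in> carrier T \<Longrightarrow> P u \<in> carrier T"
  using P_H lin_maps_closed[OF P_lin] by auto

lemma lin_P_H [lin_intros]: "G \<in> lin_maps K C T \<Longrightarrow> (\<lambda>z. P (G z)) \<in> lin_maps K C H"
  by (rule lin_into_H[OF lin_P]) (auto intro: P_H lin_maps_closed)

text \<open>On H the factor x y1 may be read as 1, and f takes the value 1 there.\<close>

lemma P_id:
  assumes u: "u \<in> carrier H"
  shows "P u = u"
proof -
  interpret T: k_algebra K T by (rule T_alg)
  have "P u = L T (\<lambda>x y. f \<one> \<odot>\<^bsub>T\<^esub> t x y) u"
    unfolding P_def by (rule H_rule[OF T_alg _ u, of "\<lambda>a b c. f a \<odot>\<^bsub>T\<^esub> t b c"])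
      (assumption | rule lin_intros | simp)+
  also have "\<dots> = L T t u"
    by (rule L_cong) (assumption | rule lin_intros | simp add: f_one t_closed u)+
  finally show ?thesis using u by (simp add: L_self)
qed

text \<open>Expresses that r1 \<otimes> (r2 \<otimes> r3) lies in R \<otimes> H, which is the
  coaction of H on R. Coassociativity brings the argument of f next to r1, where the counit axiom
  makes it 1.\<close>

lemma M_P:
  assumes D: "k_algebra K D" and F: "bilin K R T D F" and r: "r \<in> carrier R"
  shows "M D (\<lambda>a b c. F a (P (t b c))) r = M D (\<lambda>a b c. F a (t b c)) r"
proof -
  interpret T: k_algebra K T by (rule T_alg)
  have lF1: "(\<lambda>z. F (G z) w) \<in> lin_maps K C D" if "G \<in> lin_maps K C R" "w \<in> carrier T" for G C w
    using lin_maps_comp[OF bilin_left[OF F]] that by blast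
  have lF2: "(\<lambda>z. F a (G z)) \<in> lin_maps K C D" if "G \<in> lin_maps K C T" "a \<in> carrier R" for G C a
    using lin_maps_comp[OF bilin_right[OF F]] that by blast
  have "M D (\<lambda>a b c. F a (P (t b c))) r = M D (\<lambda>a b c. M D (\<lambda>u v w. F a (f (b \<otimes> u) \<odot>\<^bsub>T\<^esub> t v w)) c) r"
  proof (rule M_cong)
    fix a b c assume abc: "a \<in> carrier R" "b \<in> carrier R" "c \<in> carrier R"
    show "F a (P (t b c)) = M D (\<lambda>u v w. F a (f (b \<otimes> u) \<odot>\<^bsub>T\<^esub> t v w)) c"
      unfolding P_tens[OF abc(2,3)]
      by (rule M_comm[OF T_alg D]) (assumption | rule lin_intros bilin_right[OF F] abc | simp)+
  qed (assumption | rule lin_intros D lF1 lF2 r | simp)+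
  also have "\<dots> = M D (\<lambda>a b c. M D (\<lambda>u v w. F u (f (v \<otimes> w) \<odot>\<^bsub>T\<^esub> t b c)) a) r"
    by (rule M_coassoc[symmetric]) (assumption | rule lin_intros D lF1 lF2 r | simp)+
  also have "\<dots> = M D (\<lambda>a b c. F a (f \<one> \<odot>\<^bsub>T\<^esub> t b c)) r"
  proof (rule M_cong)
    fix a b c assume abc: "a \<in> carrier R" "b \<in> carrier R" "c \<in> carrier R"
    show "M D (\<lambda>u v w. F u (f (v \<otimes> w) \<odot>\<^bsub>T\<^esub> t b c)) a = F a (f \<one> \<odot>\<^bsub>T\<^esub> t b c)"
      by (rule M_counit_right[OF D _ abc(1), of "\<lambda>p q. F p (f q \<odot>\<^bsub>T\<^esub> t b c)"])
        (assumption | rule lin_intros D lF1 lF2 abc | simp)+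
  qed (assumption | rule lin_intros D lF1 lF2 r | simp)+
  also have "\<dots> = M D (\<lambda>a b c. F a (t b c)) r"
    by (rule M_cong) (assumption | rule lin_intros D lF1 lF2 r | simp add: f_one t_closed)+
  finally show ?thesis .
qed

end

section \<open>Independence of the Hopf axioms from values off the carrier\<close>

lemma alg_hom_cong:
  assumes A: "k_algebra K A" and F: "F \<in> alg_hom K A B" and eq: "\<And>x. x \<in> carrier A \<Longrightarrow> F x = G x"
  shows "G \<in> alg_hom K A B"
proof (rule alg_homI[OF lin_maps_cong[OF alg_hom_lin[OF F] eq A]])
  show "G \<one>\<^bsub>A\<^esub> = \<one>\<^bsub>B\<^esub>" using alg_hom_one[OF F] eq[OF alg_one_closed[OF A]] by simp
  show "G (x \<otimes>\<^bsub>A\<^esub> y) = G x \<otimes>\<^bsub>B\<^esub> G y" if "x \<in> carrier A" "y \<in> carrier A" for x y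
    using alg_hom_mult[OF F that] eq[OF that(1)] eq[OF that(2)] eq[OF alg_mult_closed[OF A that]] by simp
qed

text \<open>\<open>H_\<Delta>\<close> and \<open>H_\<epsilon>\<close> are definite descriptions,
  shown to agree with explicit formulas only on H. The axioms are proved for the formulas and
  carried over by this rule.\<close>

lemma hopf_algebra_cong:
  assumes H: "hopf_algebra K A \<Delta> \<epsilon>" and d: "\<And>x. x \<in> carrier A \<Longrightarrow> \<Delta>' x = \<Delta> x"
    and e: "\<And>x. x \<in> carrier A \<Longrightarrow> \<epsilon>' x = \<epsilon> x"
  shows "hopf_algebra K A \<Delta>' \<epsilon>'"
proof -
  let ?T3 = "tensor K A (tensor K A A)"
  have A: "k_algebra K A" and dh: "\<Delta> \<in> alg_hom K A (tensor K A A)" and eh: "\<epsilon> \<in> alg_hom K A (base_alg K)"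
    using H by (simp_all add: hopf_algebra_def)
  have A2: "k_algebra K (tensor K A A)" and A3: "k_algebra K ?T3" by (assumption | rule lin_intros A)+
  note dl = alg_hom_lin[OF dh] and el = alg_hom_lin[OF eh]
  note dc = lin_maps_closed[OF dl]
  have ec: "\<epsilon> x \<in> carrier K" if "x \<in> carrier A" for x using lin_maps_closed[OF el that] by simp
  have b1: "bilin K A A ?T3 (\<lambda>u v. tens K A (tensor K A A) u (tens K A A v b))" if "b \<in> carrier A" for b
    by (assumption | rule lin_intros A A2 that)+
  have b2: "bilin K A A ?T3 (\<lambda>a b. tens_lift K ?T3 (\<lambda>u v. tens K A (tensor K A A) u (tens K A A v b)) (\<Delta> a))"
  proof (rule bilinI)
    show "(\<lambda>b. tens_lift K ?T3 (\<lambda>u v. tens K A (tensor K A A) u (tens K A A v b)) (\<Delta> a)) \<in> lin_maps K A ?T3"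
      if "a \<in> carrier A" for a
      by (rule tens_lift_param[OF A A A3 A b1 _ dc[OF that]]) (assumption | rule lin_intros A A2)+
    show "(\<lambda>a. tens_lift K ?T3 (\<lambda>u v. tens K A (tensor K A A) u (tens K A A v b)) (\<Delta> a)) \<in> lin_maps K A ?T3"
      if "b \<in> carrier A" for b
      by (rule lin_maps_comp[OF tens_lift_lin[OF A A A3 b1[OF that]] dl])
  qed
  have b3: "bilin K A A ?T3 (\<lambda>a b. tens K A (tensor K A A) a (\<Delta> b))"
    by (assumption | rule lin_intros A A2 dl dc)+
  have b4: "bilin K A A A (\<lambda>a b. \<epsilon> a \<odot>\<^bsub>A\<^esub> b)" and b5: "bilin K A A A (\<lambda>a b. \<epsilon> b \<odot>\<^bsub>A\<^esub> a)"
    by (assumption | rule lin_intros A el ec)+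
  have "tens_lift K ?T3 (\<lambda>a b. tens_lift K ?T3 (\<lambda>u v. tens K A (tensor K A A) u (tens K A A v b)) (\<Delta>' a)) (\<Delta> x)
      = tens_lift K ?T3 (\<lambda>a b. tens_lift K ?T3 (\<lambda>u v. tens K A (tensor K A A) u (tens K A A v b)) (\<Delta> a)) (\<Delta> x)"
    "tens_lift K ?T3 (\<lambda>a b. tens K A (tensor K A A) a (\<Delta>' b)) (\<Delta> x)
      = tens_lift K ?T3 (\<lambda>a b. tens K A (tensor K A A) a (\<Delta> b)) (\<Delta> x)"
    "tens_lift K A (\<lambda>a b. \<epsilon>' a \<odot>\<^bsub>A\<^esub> b) (\<Delta> x) = tens_lift K A (\<lambda>a b. \<epsilon> a \<odot>\<^bsub>A\<^esub> b) (\<Delta> x)"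
    "tens_lift K A (\<lambda>a b. \<epsilon>' b \<odot>\<^bsub>A\<^esub> a) (\<Delta> x) = tens_lift K A (\<lambda>a b. \<epsilon> b \<odot>\<^bsub>A\<^esub> a) (\<Delta> x)"
    if x: "x \<in> carrier A" for x
    by (rule tens_lift_cong[symmetric, OF A A A3 b2 _ dc[OF x]] tens_lift_cong[symmetric, OF A A A3 b3 _ dc[OF x]]
        tens_lift_cong[symmetric, OF A A A b4 _ dc[OF x]] tens_lift_cong[symmetric, OF A A A b5 _ dc[OF x]];
        simp only: d e)+
  note this[simp]
  have "\<Delta>' \<in> alg_hom K A (tensor K A A)" "\<epsilon>' \<in> alg_hom K A (base_alg K)"
    by (rule alg_hom_cong[OF A dh] alg_hom_cong[OF A eh]; simp only: d e)+
  then show ?thesis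
    using H unfolding hopf_algebra_def Let_def by (simp add: d e)
qed

section \<open>The comultiplication of H\<close>

context hopf_gal begin

abbreviation "TT \<equiv> tensor K T T"
abbreviation "HH \<equiv> tensor K H H"
abbreviation "tT \<equiv> tens K T T"
abbreviation "tH \<equiv> tens K H H"

text \<open>\<open>D2 D F u\<close> is F(x \<otimes> y1, y2 \<otimes> y3), that is, a bracket over
  the comultiplication formula read in the ambient algebra R^op \<otimes> R.\<close>

definition "D2 D F u = L D (\<lambda>x y. M D (\<lambda>a b c. F (t x a) (t b c)) y) u"

lemma TT_alg: "k_algebra K TT" and HH_alg: "k_algebra K HH" and T3_alg: "k_algebra K T3"
  by (assumption | rule lin_intros)+

lemma lin_bilin:
  assumes "bilin K A B D F"
  shows "G \<in> lin_maps K C A \<Longrightarrow> w \<in> carrier B \<Longrightarrow> (\<lambda>z. F (G z) w) \<in> lin_maps K C D"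
    and "G \<in> lin_maps K C B \<Longrightarrow> w \<in> carrier A \<Longrightarrow> (\<lambda>z. F w (G z)) \<in> lin_maps K C D"
  by (rule lin_maps_comp[OF bilin_left[OF assms]] lin_maps_comp[OF bilin_right[OF assms]]; assumption)+

lemma D2_lin: "k_algebra K D \<Longrightarrow> bilin K T T D F \<Longrightarrow> D2 D F \<in> lin_maps K T D"
  unfolding D2_def[abs_def] by (assumption | rule lin_intros | erule lin_bilin | simp)+

lemma D2_comm:
  assumes D: "k_algebra K D" and E: "k_algebra K E" and G: "G \<in> lin_maps K D E"
    and F: "bilin K T T D F" and u: "u \<in> carrier T"
  shows "G (D2 D F u) = D2 E (\<lambda>p q. G (F p q)) u"
proof -
  note a = lin_bilin[OF F] D u E
  have b: "bilin K R R D (\<lambda>x y. M D (\<lambda>a b c. F (t x a) (t b c)) y)"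
    by (assumption | rule lin_intros a | simp)+
  have "G (D2 D F u) = L E (\<lambda>x y. G (M D (\<lambda>a b c. F (t x a) (t b c)) y)) u"
    unfolding D2_def by (rule L_comm[OF D E G b u])
  also have "\<dots> = D2 E (\<lambda>p q. G (F p q)) u"
    unfolding D2_def
    by (rule L_cong[OF E bilin_comp[OF b G] u], rule M_comm[OF D E G])
      (assumption | rule lin_intros a | simp)+
  finally show ?thesis .
qed

lemma D2_cong:
  assumes D: "k_algebra K D" and F: "bilin K T T D F" and u: "u \<in> carrier T"
    and eq: "\<And>x a b c. x \<in> carrier R \<Longrightarrow> a \<in> carrier R \<Longrightarrow> b \<in> carrier R \<Longrightarrow> c \<in> carrier R \<Longrightarrow>
      F (t x a) (t b c) = G (t x a) (t b c)"
  shows "D2 D F u = D2 D G u"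
  unfolding D2_def
  by (rule L_cong, (assumption | rule lin_intros lin_bilin[OF F] D u | simp)+,
      rule M_cong, (assumption | rule lin_intros lin_bilin[OF F] D u eq | simp)+)

text \<open>Shows that (x \<otimes> y1) \<otimes> (y2 \<otimes> y3) already lies in H \<otimes> H.
  The right leg is covered by \<open>M_P\<close>. For the left leg the projection splits y1;
  coassociativity moves the splitting to y3, and membership of u turns the argument of f into
  1.\<close>

lemma D2_P:
  assumes D: "k_algebra K D" and F: "bilin K T T D F" and u: "u \<in> carrier H"
  shows "D2 D (\<lambda>p q. F (P p) (P q)) u = D2 D F u"
proof -
  interpret T: k_algebra K T by (rule T_alg)
  note uT = H_T[OF u]
  note a = lin_bilin[OF F] D uT
  have "D2 D (\<lambda>p q. F (P p) (P q)) u = D2 D (\<lambda>p q. F (P p) q) u"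
    unfolding D2_def
    by (rule L_cong, (assumption | rule lin_intros a | simp)+, rule M_P[OF D])
      (assumption | rule lin_intros a | simp)+
  also have "\<dots> = L D (\<lambda>x y. M D (\<lambda>a b c. M D (\<lambda>p q r. F (f (x \<otimes> p) \<odot>\<^bsub>T\<^esub> t q r) (t b c)) a) y) u"
    unfolding D2_def
  proof (rule L_cong, (assumption | rule lin_intros a | simp)+, rule M_cong, (assumption | rule lin_intros a | simp)+)
    fix x y p b c assume xy: "x \<in> carrier R" "y \<in> carrier R" "p \<in> carrier R" "b \<in> carrier R" "c \<in> carrier R"
    show "F (P (t x p)) (t b c) = M D (\<lambda>p q r. F (f (x \<otimes> p) \<odot>\<^bsub>T\<^esub> t q r) (t b c)) p"
      unfolding P_tens[OF xy(1,3)]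
      by (rule M_comm[OF T_alg D bilin_left[OF F]]) (assumption | rule lin_intros xy | simp add: xy)+
  qed
  also have "\<dots> = L D (\<lambda>x y. M D (\<lambda>a b c. M D (\<lambda>p q r. F (f (x \<otimes> a) \<odot>\<^bsub>T\<^esub> t b p) (t q r)) c) y) u"
    by (rule L_cong, (assumption | rule lin_intros a | simp)+, rule M_coassoc)
      (assumption | rule lin_intros a | simp)+
  also have "\<dots> = L D (\<lambda>x y. M D (\<lambda>p q r. F (f \<one> \<odot>\<^bsub>T\<^esub> t x p) (t q r)) y) u"
    by (rule H_rule[OF D _ u, of "\<lambda>z b c. M D (\<lambda>p q r. F (f z \<odot>\<^bsub>T\<^esub> t b p) (t q r)) c"])
      (assumption | rule lin_intros a | simp)+
  also have "\<dots> = D2 D F u"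
    unfolding D2_def
    by (rule L_cong, (assumption | rule lin_intros a | simp)+, rule M_cong)
      (assumption | rule lin_intros a | simp add: f_one t_closed)+
  finally show ?thesis .
qed

lemma bilin_tTH: "bilin K H H TT tT"
  by (rule bilin_H[OF tens_bilin[OF T_alg T_alg]])

lemma H_incl2_lin: "H_incl2 K R \<in> lin_maps K HH TT"
  unfolding H_incl2_def by (rule tens_lift_lin[OF H_alg H_alg TT_alg bilin_tTH])

lemma H_incl2_tens: "a \<in> carrier H \<Longrightarrow> b \<in> carrier H \<Longrightarrow> H_incl2 K R (tH a b) = tT a b"
  unfolding H_incl2_def by (rule tens_lift_tens[OF H_alg H_alg TT_alg bilin_tTH])

lemma bilin_tHP: "bilin K T T HH (\<lambda>a b. tH (P a) (P b))"
  by (assumption | rule lin_intros | simp)+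

lemma H_incl2_inverse:
  assumes u: "u \<in> carrier HH"
  shows "tens_lift K HH (\<lambda>a b. tH (P a) (P b)) (H_incl2 K R u) = u"
proof (rule tensor_ext[OF H_alg H_alg HH_alg lin_maps_comp[OF tens_lift_lin[OF T_alg T_alg HH_alg bilin_tHP] H_incl2_lin]
        lin_maps_id _ u])
  fix a b assume ab: "a \<in> carrier H" "b \<in> carrier H"
  then show "tens_lift K HH (\<lambda>a b. tH (P a) (P b)) (H_incl2 K R (tH a b)) = tH a b"
    by (simp add: H_incl2_tens tens_lift_tens[OF T_alg T_alg HH_alg bilin_tHP] P_id)
qed

lemma H_incl2_inj: "u \<in> carrier HH \<Longrightarrow> v \<in> carrier HH \<Longrightarrow> H_incl2 K R u = H_incl2 K R v \<Longrightarrow> u = v"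
  by (metis H_incl2_inverse)

lemma bilin_tT: "bilin K T T TT tT" by (rule tens_bilin[OF T_alg T_alg])

text \<open>Projecting both legs gives an element of H \<otimes> H outright.
  \<open>incl_\<Delta>\<close> then identifies it as the preimage that \<open>H_\<Delta>\<close>
  asks for.\<close>

definition "\<Delta> u = D2 HH (\<lambda>p q. tH (P p) (P q)) u"

lemma \<Delta>_lin: "\<Delta> \<in> lin_maps K T HH"
  unfolding \<Delta>_def[abs_def] by (rule D2_lin[OF HH_alg bilin_tHP])

lemma \<Delta>_closed: "u \<in> carrier H \<Longrightarrow> \<Delta> u \<in> carrier HH"
  using lin_maps_closed[OF \<Delta>_lin] by simp

lemma incl_\<Delta>:
  assumes u: "u \<in> carrier H"
  shows "H_incl2 K R (\<Delta> u) = D2 TT tT u"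
proof -
  have "H_incl2 K R (\<Delta> u) = D2 TT (\<lambda>p q. H_incl2 K R (tH (P p) (P q))) u"
    unfolding \<Delta>_def by (rule D2_comm[OF HH_alg TT_alg H_incl2_lin bilin_tHP H_T[OF u]])
  also have "\<dots> = D2 TT (\<lambda>p q. tT (P p) (P q)) u"
    by (rule D2_cong[OF TT_alg bilin_comp[OF bilin_tHP H_incl2_lin] H_T[OF u]])
      (simp add: H_incl2_tens P_H t_closed)
  also have "\<dots> = D2 TT tT u" by (rule D2_P[OF TT_alg bilin_tT u])
  finally show ?thesis .
qed

lemma H_\<Delta>_eq:
  assumes u: "u \<in> carrier H"
  shows "H_\<Delta> K R \<mu> u = \<Delta> u"
proof -
  have "H_\<Delta> K R \<mu> u = (THE v. v \<in> carrier HH \<and> H_incl2 K R v = D2 TT tT u)"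
    by (simp only: H_\<Delta>_def Let_def D2_def M_def)
  also have "\<dots> = \<Delta> u"
  proof (rule the_equality)
    show "\<Delta> u \<in> carrier HH \<and> H_incl2 K R (\<Delta> u) = D2 TT tT u"
      by (simp add: \<Delta>_closed u incl_\<Delta>)
    show "v = \<Delta> u" if "v \<in> carrier HH \<and> H_incl2 K R v = D2 TT tT u" for v
      by (rule H_incl2_inj) (use that in \<open>simp_all add: \<Delta>_closed u incl_\<Delta>\<close>)
  qed
  finally show ?thesis .
qed

text \<open>F makes sense on H only, whereas the Sweedler formula produces elements of the ambient
  algebra. F' is an extension on which the formula can be evaluated, and the projections disappear
  by \<open>D2_P\<close>.\<close>

lemma \<Delta>_lift:
  assumes D: "k_algebra K D" and F: "bilin K H H D F" and F': "bilin K T T D F'" and u: "u \<in> carrier H"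
    and eq: "\<And>a b. a \<in> carrier H \<Longrightarrow> b \<in> carrier H \<Longrightarrow> F a b = F' a b"
  shows "tens_lift K D F (\<Delta> u) = D2 D F' u"
proof -
  have "tens_lift K D F (\<Delta> u) = D2 D (\<lambda>p q. tens_lift K D F (tH (P p) (P q))) u"
    unfolding \<Delta>_def
    by (rule D2_comm[OF HH_alg D tens_lift_lin[OF H_alg H_alg D F] bilin_tHP H_T[OF u]])
  also have "\<dots> = D2 D (\<lambda>p q. F' (P p) (P q)) u"
    by (rule D2_cong[OF D bilin_comp[OF bilin_tHP tens_lift_lin[OF H_alg H_alg D F]] H_T[OF u]])
      (simp add: tens_lift_tens[OF H_alg H_alg D F] P_H t_closed eq)
  also have "\<dots> = D2 D F' u" by (rule D2_P[OF D F' u])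
  finally show ?thesis .
qed

lemma lin_D2: "k_algebra K D \<Longrightarrow> bilin K T T D F \<Longrightarrow> G \<in> lin_maps K C T \<Longrightarrow> (\<lambda>z. D2 D F (G z)) \<in> lin_maps K C D"
  by (rule lin_maps_comp[OF D2_lin])

lemma D2_mult:
  assumes u: "u \<in> carrier T" and v: "v \<in> carrier T"
  shows "D2 TT tT (u \<otimes>\<^bsub>T\<^esub> v) = D2 TT tT u \<otimes>\<^bsub>TT\<^esub> D2 TT tT v"
proof -
  interpret TT: k_algebra K TT by (rule TT_alg)
  note a = TT_alg u v
  have Dv: "D2 TT tT v \<in> carrier TT" by (rule lin_maps_closed[OF D2_lin[OF TT_alg bilin_tT] v])
  have "D2 TT tT (u \<otimes>\<^bsub>T\<^esub> v)
    = L TT (\<lambda>x y. L TT (\<lambda>x' y'. M TT (\<lambda>a b c. tT (t (x' \<otimes> x) a) (t b c)) (y \<otimes> y')) v) u"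
    unfolding D2_def by (rule L_mult) (assumption | rule lin_intros a | simp)+
  also have "\<dots> = L TT (\<lambda>x y. L TT (\<lambda>x' y'. M TT (\<lambda>a b c. M TT (\<lambda>a' b' c'.
      tT (t (x' \<otimes> x) (a \<otimes> a')) (t (b' \<otimes> b) (c \<otimes> c'))) y') y) v) u"
    by (rule L_cong, (assumption | rule lin_intros a | simp)+, rule L_cong,
        (assumption | rule lin_intros a | simp)+, rule M_mult)
      (assumption | rule lin_intros a | simp)+
  also have "\<dots> = L TT (\<lambda>x y. M TT (\<lambda>a b c. L TT (\<lambda>x' y'. M TT (\<lambda>a' b' c'.
      tT (t (x' \<otimes> x) (a \<otimes> a')) (t (b' \<otimes> b) (c \<otimes> c'))) y') v) y) u"
    by (rule L_cong, (assumption | rule lin_intros a | simp)+, rule Fubini_ML[symmetric])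
      (assumption | rule lin_intros a | simp)+
  also have "\<dots> = L TT (\<lambda>x y. M TT (\<lambda>a b c. tT (t x a) (t b c) \<otimes>\<^bsub>TT\<^esub> D2 TT tT v) y) u"
  proof (rule L_cong, (assumption | rule lin_intros a | simp)+, rule M_cong, (assumption | rule lin_intros a | simp)+)
    fix x y a b c assume xy: "x \<in> carrier R" "y \<in> carrier R" "a \<in> carrier R" "b \<in> carrier R" "c \<in> carrier R"
    have "tT (t x a) (t b c) \<otimes>\<^bsub>TT\<^esub> D2 TT tT v = D2 TT (\<lambda>p q. tT (t x a) (t b c) \<otimes>\<^bsub>TT\<^esub> tT p q) v"
      by (rule D2_comm[OF TT_alg TT_alg _ bilin_tT v]) (assumption | rule lin_intros TT_alg xy | simp)+
    also have "\<dots> = L TT (\<lambda>x' y'. M TT (\<lambda>a' b' c'.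
      tT (t (x' \<otimes> x) (a \<otimes> a')) (t (b' \<otimes> b) (c \<otimes> c'))) y') v"
      unfolding D2_def
      by (rule L_cong, (assumption | rule lin_intros TT_alg xy v | simp)+, rule M_cong)
        (assumption | rule lin_intros TT_alg xy v | simp add: tens_mult[OF T_alg T_alg] t_mult t_closed xy)+
    finally show "L TT (\<lambda>x' y'. M TT (\<lambda>a' b' c'.
      tT (t (x' \<otimes> x) (a \<otimes> a')) (t (b' \<otimes> b) (c \<otimes> c'))) y') v
      = tT (t x a) (t b c) \<otimes>\<^bsub>TT\<^esub> D2 TT tT v" by simp
  qed
  also have "\<dots> = D2 TT tT u \<otimes>\<^bsub>TT\<^esub> D2 TT tT v"
    using D2_comm[OF TT_alg TT_alg TT.mult_left_lin[OF Dv] bilin_tT u] by (simp only: D2_def)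
  finally show ?thesis .
qed

lemma H_incl2_mult:
  assumes u: "u \<in> carrier HH" and v: "v \<in> carrier HH"
  shows "H_incl2 K R (u \<otimes>\<^bsub>HH\<^esub> v) = H_incl2 K R u \<otimes>\<^bsub>TT\<^esub> H_incl2 K R v"
proof -
  interpret TT: k_algebra K TT by (rule TT_alg)
  interpret HH: k_algebra K HH by (rule HH_alg)
  note cl = lin_maps_closed[OF H_incl2_lin]
  show ?thesis
  proof (rule tensor_ext[OF H_alg H_alg TT_alg lin_maps_comp[OF H_incl2_lin HH.mult_left_lin[OF v]]
          lin_maps_comp[OF TT.mult_left_lin[OF cl[OF v]] H_incl2_lin] _ u])
    fix a b assume ab: "a \<in> carrier H" "b \<in> carrier H"
    have abH: "tH a b \<in> carrier HH" by (rule tens_closed[OF H_alg H_alg ab])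
    show "H_incl2 K R (tH a b \<otimes>\<^bsub>HH\<^esub> v) = H_incl2 K R (tH a b) \<otimes>\<^bsub>TT\<^esub> H_incl2 K R v"
    proof (rule tensor_ext[OF H_alg H_alg TT_alg lin_maps_comp[OF H_incl2_lin HH.mult_right_lin[OF abH]]
            lin_maps_comp[OF TT.mult_right_lin[OF cl[OF abH]] H_incl2_lin] _ v])
      fix a' b' assume ab': "a' \<in> carrier H" "b' \<in> carrier H"
      show "H_incl2 K R (tH a b \<otimes>\<^bsub>HH\<^esub> tH a' b') = H_incl2 K R (tH a b) \<otimes>\<^bsub>TT\<^esub> H_incl2 K R (tH a' b')"
        using ab ab' alg_mult_closed[OF H_alg]
        by (simp add: tens_mult[OF H_alg H_alg] H_incl2_tens tens_mult[OF T_alg T_alg] H_mult)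
    qed
  qed
qed

text \<open>Multiplicativity is checked after the inclusion into the ambient tensor square, where it
  is a statement about \<mu>, and reflected back by injectivity.\<close>

lemma \<Delta>_hom: "\<Delta> \<in> alg_hom K H HH"
proof (rule alg_homI[OF lin_H[OF \<Delta>_lin]])
  fix u v assume u: "u \<in> carrier H" and v: "v \<in> carrier H"
  have uv: "u \<otimes>\<^bsub>T\<^esub> v \<in> carrier H" by (rule H_mult[OF u v])
  have "\<Delta> (u \<otimes>\<^bsub>T\<^esub> v) = \<Delta> u \<otimes>\<^bsub>HH\<^esub> \<Delta> v"
    by (rule H_incl2_inj)
      (simp_all add: uv u v \<Delta>_closed alg_mult_closed[OF HH_alg] incl_\<Delta> H_incl2_mult D2_mult)
  then show "\<Delta> (u \<otimes>\<^bsub>H\<^esub> v) = \<Delta> u \<otimes>\<^bsub>HH\<^esub> \<Delta> v" by simp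
next
  have b: "bilin K R R HH (\<lambda>x y. M HH (\<lambda>a b c. tH (P (t x a)) (P (t b c))) y)"
    "trilin K R HH (\<lambda>a b c. tH (P (t \<one> a)) (P (t b c)))"
    by (assumption | rule lin_intros HH_alg | simp)+
  have P1: "P (t \<one> \<one>) = t \<one> \<one>" using P_id[OF H_one] by (simp add: T_one)
  have "\<Delta> (t \<one> \<one>) = tH (t \<one> \<one>) (t \<one> \<one>)"
    unfolding \<Delta>_def D2_def
    by (simp add: L_tens[OF HH_alg b(1)] M_one[OF HH_alg b(2)] alg_one_closed[OF R_alg] P1)
  then show "\<Delta> \<one>\<^bsub>H\<^esub> = \<one>\<^bsub>HH\<^esub>"
    by (simp add: tensor_one[OF H_alg H_alg] T_one)
qed

section \<open>The counit of H\<close>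

definition "\<epsilon> u = L (base_alg K) (\<lambda>x y. f (x \<otimes> y)) u"

abbreviation "mm \<equiv> L R (\<lambda>x y. x \<otimes> y)"

lemma mm_bilin: "bilin K R R R (\<lambda>x y. x \<otimes> y)" and \<epsilon>_lin: "\<epsilon> \<in> lin_maps K T (base_alg K)"
  unfolding \<epsilon>_def[abs_def] by (assumption | rule lin_intros | simp)+

lemma \<epsilon>_closed: "u \<in> carrier T \<Longrightarrow> \<epsilon> u \<in> carrier K"
  using lin_maps_closed[OF \<epsilon>_lin] by simp

lemma lin_\<epsilon>: "G \<in> lin_maps K C T \<Longrightarrow> (\<lambda>z. \<epsilon> (G z)) \<in> lin_maps K C (base_alg K)"
  by (rule lin_maps_comp[OF \<epsilon>_lin])

lemma \<epsilon>_tens: "x \<in> carrier R \<Longrightarrow> y \<in> carrier R \<Longrightarrow> \<epsilon> (t x y) = f (x \<otimes> y)"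
  unfolding \<epsilon>_def by (rule L_tens) (assumption | rule lin_intros | simp)+

text \<open>The counit axiom gives f(x y) 1 = f(x y1) y2 y3, and membership in H turns the
  right-hand side into f(1) x y = x y. So x y is a multiple of the unit, and f reads off the
  scalar.\<close>

lemma mm_scalar:
  assumes u: "u \<in> carrier H"
  shows "mm u = \<epsilon> u \<odot> \<one>"
proof -
  interpret RR: k_algebra K R by (rule R_alg)
  note uT = H_T[OF u]
  have "\<epsilon> u \<odot> \<one> = L R (\<lambda>x y. f (x \<otimes> y) \<odot> \<one>) u"
    unfolding \<epsilon>_def by (rule L_comm[of "base_alg K" R "\<lambda>s. s \<odot> \<one>"])
      (assumption | rule lin_intros uT | simp)+
  also have "\<dots> = L R (\<lambda>x y. M R (\<lambda>a b c. f (x \<otimes> a) \<odot> (b \<otimes> c)) y) u"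
  proof (rule L_cong)
    fix x y assume xy: "x \<in> carrier R" "y \<in> carrier R"
    show "f (x \<otimes> y) \<odot> \<one> = M R (\<lambda>a b c. f (x \<otimes> a) \<odot> (b \<otimes> c)) y"
      by (rule M_counit_right[symmetric, OF R_alg _ xy(2), of "\<lambda>p q. f (x \<otimes> p) \<odot> q"])
        (assumption | rule lin_intros xy | simp)+
  qed (assumption | rule lin_intros uT | simp)+
  also have "\<dots> = L R (\<lambda>x y. f \<one> \<odot> (x \<otimes> y)) u"
    by (rule H_rule[OF R_alg _ u, of "\<lambda>a b c. f a \<odot> (b \<otimes> c)"])
      (assumption | rule lin_intros | simp)+
  also have "\<dots> = mm u"
    by (rule L_cong) (assumption | rule lin_intros uT | simp add: f_one)+
  finally show ?thesis by simp
qed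

lemma f_scalar: "s \<in> carrier K \<Longrightarrow> f (s \<odot> \<one>) = s"
proof -
  interpret RR: k_algebra K R by (rule R_alg)
  assume "s \<in> carrier K"
  then show ?thesis using lin_maps_smult[OF f_lin, of s "\<one>"] by (simp add: f_one)
qed

lemma H_\<epsilon>_eq:
  assumes u: "u \<in> carrier H"
  shows "H_\<epsilon> K R u = \<epsilon> u"
  unfolding H_\<epsilon>_def mm_scalar[OF u]
proof (rule the_equality)
  show "\<epsilon> u \<in> carrier K \<and> \<epsilon> u \<odot> \<one> = \<epsilon> u \<odot> \<one>"
    by (simp add: \<epsilon>_closed u)
  show "s = \<epsilon> u" if "s \<in> carrier K \<and> s \<odot> \<one> = \<epsilon> u \<odot> \<one>" for s
    using that f_scalar[of s] f_scalar[OF \<epsilon>_closed[OF H_T[OF u]]] by metis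
qed

lemma \<epsilon>_hom: "\<epsilon> \<in> alg_hom K H (base_alg K)"
proof (rule alg_homI[OF lin_H[OF \<epsilon>_lin]])
  interpret RR: k_algebra K R by (rule R_alg)
  show "\<epsilon> \<one>\<^bsub>H\<^esub> = \<one>\<^bsub>base_alg K\<^esub>" by (simp add: T_one \<epsilon>_tens f_one)
  fix u v assume u: "u \<in> carrier H" and v: "v \<in> carrier H"
  note uT = H_T[OF u] and vT = H_T[OF v]
  note eu = \<epsilon>_closed[OF uT] and ev = \<epsilon>_closed[OF vT]
  note a = uT vT
  \<comment> \<open>In the product x' x y y' the part x y is a scalar. G wraps v around an argument,
    so that this scalar can be pulled out by linearity.\<close>
  define G where "G z = L R (\<lambda>x' y'. x' \<otimes> z \<otimes> y') v" for z
  have G: "G \<in> lin_maps K R R" unfolding G_def[abs_def] by (assumption | rule lin_intros a | simp)+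
  have "mm (u \<otimes>\<^bsub>T\<^esub> v) = L R (\<lambda>x y. L R (\<lambda>x' y'. (x' \<otimes> x) \<otimes> (y \<otimes> y')) v) u"
    by (rule L_mult[OF R_alg mm_bilin uT vT])
  also have "\<dots> = L R (\<lambda>x y. G (x \<otimes> y)) u"
    unfolding G_def
    by (rule L_cong, (assumption | rule lin_intros a | simp)+, rule L_cong)
      (assumption | rule lin_intros a | simp add: RR.A.m_assoc)+
  also have "\<dots> = G (mm u)" by (rule L_comm[OF R_alg R_alg G mm_bilin uT, symmetric])
  also have "\<dots> = \<epsilon> u \<odot> G \<one>"
    unfolding mm_scalar[OF u] by (rule lin_maps_smult[OF G eu]) simp
  also have "G \<one> = mm v"
    unfolding G_def by (rule L_cong) (assumption | rule lin_intros a | simp)+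
  also have "\<epsilon> u \<odot> mm v = (\<epsilon> u \<otimes>\<^bsub>K\<^esub> \<epsilon> v) \<odot> \<one>"
    unfolding mm_scalar[OF v] using eu ev by (simp add: RR.smult_assoc1)
  finally have "\<epsilon> (u \<otimes>\<^bsub>T\<^esub> v) \<odot> \<one> = (\<epsilon> u \<otimes>\<^bsub>K\<^esub> \<epsilon> v) \<odot> \<one>"
    by (simp add: mm_scalar[OF H_mult[OF u v]])
  then have "f (\<epsilon> (u \<otimes>\<^bsub>T\<^esub> v) \<odot> \<one>) = f ((\<epsilon> u \<otimes>\<^bsub>K\<^esub> \<epsilon> v) \<odot> \<one>)" by simp
  moreover have "\<epsilon> (u \<otimes>\<^bsub>T\<^esub> v) \<in> carrier K" by (rule \<epsilon>_closed[OF H_T[OF H_mult[OF u v]]])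
  ultimately show "\<epsilon> (u \<otimes>\<^bsub>H\<^esub> v) = \<epsilon> u \<otimes>\<^bsub>base_alg K\<^esub> \<epsilon> v"
    using eu ev by (simp add: f_scalar)
qed

text \<open>Lifts with values in H and in \<open>T\<close> sum in different records and are
  different terms. The inclusion is linear, so they agree, and later computations may take values in
  the ambient algebra.\<close>

lemma lift_H_T:
  assumes F: "bilin K H H H F" and w: "w \<in> carrier HH"
  shows "tens_lift K H F w = tens_lift K T F w"
  using tens_lift_comm[OF H_alg H_alg H_alg T_alg lin_H_T[OF lin_maps_id] F w] .

lemma bilin_H_T: "bilin K A B H F \<Longrightarrow> bilin K A B T F"
  by (simp add: bilin_def lin_H_T)

lemma \<Delta>_lift_H:
  assumes F: "bilin K H H H F" and F': "bilin K T T T F'" and u: "u \<in> carrier H"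
    and eq: "\<And>a b. a \<in> carrier H \<Longrightarrow> b \<in> carrier H \<Longrightarrow> F a b = F' a b"
  shows "tens_lift K H F (\<Delta> u) = D2 T F' u"
  unfolding lift_H_T[OF F \<Delta>_closed[OF u]]
  by (rule \<Delta>_lift[OF T_alg bilin_H_T[OF F] F' u eq])

text \<open>The first formula evaluates to f(x y1) y2 \<otimes> y3, which is the projection of u,
  hence u. The second contracts y2 y3 by the counit axiom of \<mu>.\<close>

lemma counit:
  assumes u: "u \<in> carrier H"
  shows "tens_lift K H (\<lambda>a b. \<epsilon> a \<odot>\<^bsub>H\<^esub> b) (\<Delta> u) = u" "tens_lift K H (\<lambda>a b. \<epsilon> b \<odot>\<^bsub>H\<^esub> a) (\<Delta> u) = u"
proof -
  interpret T: k_algebra K T by (rule T_alg)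
  note uT = H_T[OF u]
  have b: "bilin K H H H (\<lambda>a b. \<epsilon> a \<odot>\<^bsub>H\<^esub> b)" "bilin K H H H (\<lambda>a b. \<epsilon> b \<odot>\<^bsub>H\<^esub> a)"
    by (rule bilinI; (rule lin_smult_const[OF H_alg lin_maps_id] lin_smult_var[OF H_alg lin_H[OF \<epsilon>_lin]];
          simp add: \<epsilon>_closed))+
  have b': "bilin K T T T (\<lambda>a b. \<epsilon> a \<odot>\<^bsub>T\<^esub> b)" "bilin K T T T (\<lambda>a b. \<epsilon> b \<odot>\<^bsub>T\<^esub> a)"
    by (rule bilinI; (rule lin_smult_const[OF T_alg lin_maps_id] lin_smult_var[OF T_alg \<epsilon>_lin];
          simp add: \<epsilon>_closed))+
  have "tens_lift K H (\<lambda>a b. \<epsilon> a \<odot>\<^bsub>H\<^esub> b) (\<Delta> u) = D2 T (\<lambda>a b. \<epsilon> a \<odot>\<^bsub>T\<^esub> b) u"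
    by (rule \<Delta>_lift_H[OF b(1) b'(1) u]) simp
  also have "\<dots> = P u"
    unfolding D2_def P_def
    by (rule L_cong, (assumption | rule lin_intros lin_\<epsilon> \<epsilon>_closed uT | simp)+, rule M_cong)
      (assumption | rule lin_intros lin_\<epsilon> \<epsilon>_closed uT | simp add: \<epsilon>_tens)+
  finally show "tens_lift K H (\<lambda>a b. \<epsilon> a \<odot>\<^bsub>H\<^esub> b) (\<Delta> u) = u" by (simp add: P_id u)
  have "tens_lift K H (\<lambda>a b. \<epsilon> b \<odot>\<^bsub>H\<^esub> a) (\<Delta> u) = D2 T (\<lambda>a b. \<epsilon> b \<odot>\<^bsub>T\<^esub> a) u"
    by (rule \<Delta>_lift_H[OF b(2) b'(2) u]) simp
  also have "\<dots> = L T (\<lambda>x y. M T (\<lambda>a b c. f (b \<otimes> c) \<odot>\<^bsub>T\<^esub> t x a) y) u"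
    unfolding D2_def
    by (rule L_cong, (assumption | rule lin_intros lin_\<epsilon> \<epsilon>_closed uT | simp)+, rule M_cong)
      (assumption | rule lin_intros lin_\<epsilon> \<epsilon>_closed uT | simp add: \<epsilon>_tens)+
  also have "\<dots> = L T (\<lambda>x y. f \<one> \<odot>\<^bsub>T\<^esub> t x y) u"
  proof (rule L_cong)
    fix x y assume xy: "x \<in> carrier R" "y \<in> carrier R"
    show "M T (\<lambda>a b c. f (b \<otimes> c) \<odot>\<^bsub>T\<^esub> t x a) y = f \<one> \<odot>\<^bsub>T\<^esub> t x y"
      by (rule M_counit_right[OF T_alg _ xy(2), of "\<lambda>p q. f q \<odot>\<^bsub>T\<^esub> t x p"])
        (assumption | rule lin_intros xy | simp)+
  qed (assumption | rule lin_intros uT | simp)+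
  also have "\<dots> = L T t u"
    by (rule L_cong) (assumption | rule lin_intros uT | simp add: f_one t_closed)+
  finally show "tens_lift K H (\<lambda>a b. \<epsilon> b \<odot>\<^bsub>H\<^esub> a) (\<Delta> u) = u" by (simp add: L_self uT)
qed

text \<open>Once both sides are expressed by \<open>\<Delta>_lift\<close>, they are brackets over x
  and the five components of y that differ only by coassociativity of \<mu>.\<close>

lemma coassoc:
  assumes u: "u \<in> carrier H"
  defines "HHH \<equiv> tensor K H HH"
  shows "tens_lift K HHH (\<lambda>a b. tens_lift K HHH (\<lambda>u v. tens K H HH u (tH v b)) (\<Delta> a)) (\<Delta> u)
    = tens_lift K HHH (\<lambda>a b. tens K H HH a (\<Delta> b)) (\<Delta> u)"
proof -
  have HHH: "k_algebra K HHH" unfolding HHH_def by (assumption | rule lin_intros)+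
  let ?h = "tens K H HH"
  have lh: "(\<lambda>z. ?h (G z) w) \<in> lin_maps K C HHH" if "G \<in> lin_maps K C H" "w \<in> carrier HH" for G C w
    unfolding HHH_def using that by - (assumption | rule lin_intros HH_alg)+
  have rh: "(\<lambda>z. ?h w (G z)) \<in> lin_maps K C HHH" if "G \<in> lin_maps K C HH" "w \<in> carrier H" for G C w
    unfolding HHH_def using that by - (assumption | rule lin_intros HH_alg)+
  note uT = H_T[OF u]
  note a = lh rh HHH HH_alg uT
  have b1: "bilin K H H HHH (\<lambda>u v. ?h u (tH v b))" if "b \<in> carrier H" for b
    by (assumption | rule lin_intros a that)+
  have E1: "tens_lift K HHH (\<lambda>u v. ?h u (tH v b)) (\<Delta> a) = D2 HHH (\<lambda>p q. ?h (P p) (tH (P q) (P b))) a"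
    if ab: "a \<in> carrier H" "b \<in> carrier H" for a b
    by (rule \<Delta>_lift[OF HHH b1[OF ab(2)] _ ab(1)]) (assumption | rule lin_intros a | simp add: P_id ab)+
  have b2: "bilin K T T HHH (\<lambda>a b. D2 HHH (\<lambda>p q. ?h (P p) (tH (P q) (P b))) a)"
    unfolding D2_def by (assumption | rule lin_intros a | simp)+
  have "tens_lift K HHH (\<lambda>a b. tens_lift K HHH (\<lambda>u v. ?h u (tH v b)) (\<Delta> a)) (\<Delta> u)
    = D2 HHH (\<lambda>a b. D2 HHH (\<lambda>p q. ?h (P p) (tH (P q) (P b))) a) u"
  proof (rule \<Delta>_lift[OF HHH _ b2 u E1])
    show "bilin K H H HHH (\<lambda>a b. tens_lift K HHH (\<lambda>u v. ?h u (tH v b)) (\<Delta> a))"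
    proof (rule bilinI)
      show "(\<lambda>b. tens_lift K HHH (\<lambda>u v. ?h u (tH v b)) (\<Delta> a)) \<in> lin_maps K H HHH" if "a \<in> carrier H" for a
        by (rule tens_lift_param[OF H_alg H_alg HHH H_alg b1 _ \<Delta>_closed[OF that]])
          (assumption | rule lin_intros a)+
      show "(\<lambda>a. tens_lift K HHH (\<lambda>u v. ?h u (tH v b)) (\<Delta> a)) \<in> lin_maps K H HHH" if "b \<in> carrier H" for b
        by (rule lin_maps_comp[OF tens_lift_lin[OF H_alg H_alg HHH b1[OF that]] lin_H[OF \<Delta>_lin]])
    qed
  qed
  also have "\<dots> = L HHH (\<lambda>x y. M HHH (\<lambda>a b c. M HHH (\<lambda>p q r.
      ?h (P (t x p)) (tH (P (t q r)) (P (t b c)))) a) y) u"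
  proof -
    have "D2 HHH (\<lambda>p q. ?h (P p) (tH (P q) (P w))) (t x a)
      = M HHH (\<lambda>p q r. ?h (P (t x p)) (tH (P (t q r)) (P w))) a"
      if "w \<in> carrier T" "x \<in> carrier R" "a \<in> carrier R" for w x a
      unfolding D2_def by (rule L_tens) (assumption | rule lin_intros lh rh HHH HH_alg that | simp)+
    note this[simp]
    show ?thesis
      unfolding D2_def[of _ _ u]
      by (rule L_cong, (assumption | rule lin_intros lin_D2 a lin_bilin[OF b2] | simp)+, rule M_cong)
        (assumption | rule lin_intros lin_D2 a lin_bilin[OF b2] | simp add: t_closed)+
  qed
  also have "\<dots> = L HHH (\<lambda>x y. M HHH (\<lambda>a b c. M HHH (\<lambda>p q r.
      ?h (P (t x a)) (tH (P (t b p)) (P (t q r)))) c) y) u"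
    by (rule L_cong, (assumption | rule lin_intros a | simp)+, rule M_coassoc)
      (assumption | rule lin_intros a | simp)+
  also have "\<dots> = D2 HHH (\<lambda>a b. ?h (P a) (\<Delta> b)) u"
  proof -
    have b3: "bilin K T T HHH (\<lambda>a b. ?h (P a) (\<Delta> b))"
      by (assumption | rule lin_intros a lin_maps_closed[OF \<Delta>_lin] \<Delta>_lin)+
    have "?h (P w) (\<Delta> (t b c)) = M HHH (\<lambda>p q r. ?h (P w) (tH (P (t b p)) (P (t q r)))) c"
      if "w \<in> carrier T" "b \<in> carrier R" "c \<in> carrier R" for w b c
    proof -
      have 1: "\<Delta> (t b c) = M HH (\<lambda>p q r. tH (P (t b p)) (P (t q r))) c"
        unfolding \<Delta>_def D2_def by (rule L_tens) (assumption | rule lin_intros HH_alg that | simp)+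
      show ?thesis unfolding 1
        by (rule M_comm[OF HH_alg HHH]) (assumption | rule lin_intros lh rh HH_alg that | simp)+
    qed
    note this[simp]
    show ?thesis
      unfolding D2_def
      by (rule sym, rule L_cong, (assumption | rule lin_intros a lin_bilin[OF b3] | simp)+, rule M_cong)
        (assumption | rule lin_intros a lin_bilin[OF b3] | simp add: t_closed)+
  qed
  also have "\<dots> = tens_lift K HHH (\<lambda>a b. ?h a (\<Delta> b)) (\<Delta> u)"
    by (rule \<Delta>_lift[symmetric, OF HHH])
      (assumption | rule lin_intros a \<Delta>_closed lin_H[OF \<Delta>_lin] \<Delta>_lin lin_maps_closed[OF \<Delta>_lin] u | simp add: P_id)+
  finally show ?thesis .
qed

text \<open>Writing \<open>x \<otimes> y\<close> as \<open>S h\<^sub>1 \<otimes> h\<^sub>2\<close>, the element \<open>x\<^sub>1 y \<otimes> (x\<^sub>2 \<otimes> x\<^sub>3)\<close> is \<open>1 \<otimes> S h\<close>.\<close>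

definition "antipode u = L T (\<lambda>x y. M T (\<lambda>a b c. f (a \<otimes> y) \<odot>\<^bsub>T\<^esub> t b c) x) u"

lemma antipode_lin: "antipode \<in> lin_maps K T T"
  unfolding antipode_def[abs_def] by (assumption | rule lin_intros | simp)+

text \<open>The value is fixed by the projection onto H, because x2 \<otimes> x3 is fixed by it
  inside the bracket over x, as in \<open>M_P\<close>.\<close>

lemma antipode_H:
  assumes u: "u \<in> carrier T"
  shows "antipode u \<in> carrier H"
proof -
  have "P (antipode u) = L T (\<lambda>x y. P (M T (\<lambda>a b c. f (a \<otimes> y) \<odot>\<^bsub>T\<^esub> t b c) x)) u"
    unfolding antipode_def by (rule L_comm[OF T_alg T_alg P_lin]) (assumption | rule lin_intros u | simp)+
  also have "\<dots> = L T (\<lambda>x y. M T (\<lambda>a b c. f (a \<otimes> y) \<odot>\<^bsub>T\<^esub> P (t b c)) x) u"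
  proof (rule L_cong)
    fix x y assume xy: "x \<in> carrier R" "y \<in> carrier R"
    have "P (M T (\<lambda>a b c. f (a \<otimes> y) \<odot>\<^bsub>T\<^esub> t b c) x) = M T (\<lambda>a b c. P (f (a \<otimes> y) \<odot>\<^bsub>T\<^esub> t b c)) x"
      by (rule M_comm[OF T_alg T_alg P_lin]) (assumption | rule lin_intros xy | simp)+
    also have "\<dots> = M T (\<lambda>a b c. f (a \<otimes> y) \<odot>\<^bsub>T\<^esub> P (t b c)) x"
      by (rule M_cong) (assumption | rule lin_intros xy |
          simp add: lin_maps_smult[OF P_lin] f_closed alg_mult_closed[OF R_alg] t_closed xy)+
    finally show "P (M T (\<lambda>a b c. f (a \<otimes> y) \<odot>\<^bsub>T\<^esub> t b c) x)
      = M T (\<lambda>a b c. f (a \<otimes> y) \<odot>\<^bsub>T\<^esub> P (t b c)) x" .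
  qed (assumption | rule lin_intros u | simp)+
  also have "\<dots> = antipode u"
    unfolding antipode_def
  proof (rule L_cong)
    fix x y assume xy: "x \<in> carrier R" "y \<in> carrier R"
    show "M T (\<lambda>a b c. f (a \<otimes> y) \<odot>\<^bsub>T\<^esub> P (t b c)) x = M T (\<lambda>a b c. f (a \<otimes> y) \<odot>\<^bsub>T\<^esub> t b c) x"
      by (rule M_P[OF T_alg _ xy(1), of "\<lambda>p w. f (p \<otimes> y) \<odot>\<^bsub>T\<^esub> w"])
        (assumption | rule lin_intros xy | simp)+
  qed (assumption | rule lin_intros u | simp)+
  finally show ?thesis using P_H[OF lin_maps_closed[OF antipode_lin u]] by simp
qed

lemma antipode_tens:
  "x \<in> carrier R \<Longrightarrow> y \<in> carrier R \<Longrightarrow> antipode (t x y) = M T (\<lambda>a b c. f (a \<otimes> y) \<odot>\<^bsub>T\<^esub> t b c) x"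
  unfolding antipode_def by (rule L_tens) (assumption | rule lin_intros | simp)+

text \<open>The brackets over x and y combine, by multiplicativity of \<mu>, into one over x y. That
  product is the scalar \<open>\<epsilon> u\<close>, so \<mu> is evaluated at the unit.\<close>

lemma antipode_left:
  assumes u: "u \<in> carrier H"
  shows "tens_lift K H (\<lambda>a b. antipode a \<otimes>\<^bsub>H\<^esub> b) (\<Delta> u) = \<epsilon> u \<odot>\<^bsub>H\<^esub> \<one>\<^bsub>H\<^esub>"
proof -
  interpret T: k_algebra K T by (rule T_alg)
  interpret RR: k_algebra K R by (rule R_alg)
  note uT = H_T[OF u]
  have lA: "(\<lambda>z. antipode (G z)) \<in> lin_maps K C T" if "G \<in> lin_maps K C T" for G C
    by (rule lin_maps_comp[OF antipode_lin that])
  note Ac = lin_maps_closed[OF antipode_lin]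
  have lA': "antipode \<in> lin_maps K H H" by (rule lin_into_H[OF lin_H[OF antipode_lin]]) (simp add: antipode_H)
  have b: "bilin K H H H (\<lambda>a b. antipode a \<otimes>\<^bsub>H\<^esub> b)"
    by (rule bilinI; rule lin_mult_right[OF H_alg lin_maps_id] lin_mult_left[OF H_alg lA'])
      (simp_all add: antipode_H)
  have b': "bilin K T T T (\<lambda>a b. antipode a \<otimes>\<^bsub>T\<^esub> b)"
    by (assumption | rule lin_intros lA Ac)+
  have "tens_lift K H (\<lambda>a b. antipode a \<otimes>\<^bsub>H\<^esub> b) (\<Delta> u) = D2 T (\<lambda>a b. antipode a \<otimes>\<^bsub>T\<^esub> b) u"
    by (rule \<Delta>_lift_H[OF b b' u]) simp
  also have "\<dots> = L T (\<lambda>x y. M T (\<lambda>a b c. M T (\<lambda>p q r. f (p \<otimes> a) \<odot>\<^bsub>T\<^esub> t (b \<otimes> q) (r \<otimes> c)) x) y) u"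
    unfolding D2_def
  proof (rule L_cong, (assumption | rule lin_intros lA Ac uT | simp)+, rule M_cong,
      (assumption | rule lin_intros lA Ac uT | simp)+)
    fix x y a b c assume xy: "x \<in> carrier R" "y \<in> carrier R" "a \<in> carrier R" "b \<in> carrier R" "c \<in> carrier R"
    have "antipode (t x a) \<otimes>\<^bsub>T\<^esub> t b c = M T (\<lambda>p q r. (f (p \<otimes> a) \<odot>\<^bsub>T\<^esub> t q r) \<otimes>\<^bsub>T\<^esub> t b c) x"
      unfolding antipode_tens[OF xy(1,3)]
      by (rule M_comm[OF T_alg T_alg T.mult_left_lin[OF t_closed[OF xy(4,5)]]])
        (assumption | rule lin_intros xy | simp)+
    also have "\<dots> = M T (\<lambda>p q r. f (p \<otimes> a) \<odot>\<^bsub>T\<^esub> t (b \<otimes> q) (r \<otimes> c)) x"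
      by (rule M_cong) (assumption | rule lin_intros xy |
          simp add: T.smult_mult_left t_mult t_closed f_closed xy)+
    finally show "antipode (t x a) \<otimes>\<^bsub>T\<^esub> t b c
      = M T (\<lambda>p q r. f (p \<otimes> a) \<odot>\<^bsub>T\<^esub> t (b \<otimes> q) (r \<otimes> c)) x" .
  qed
  also have "\<dots> = L T (\<lambda>x y. M T (\<lambda>p q r. M T (\<lambda>a b c. f (p \<otimes> a) \<odot>\<^bsub>T\<^esub> t (b \<otimes> q) (r \<otimes> c)) y) x) u"
    by (rule L_cong, (assumption | rule lin_intros uT | simp)+, rule Fubini_MM)
      (assumption | rule lin_intros uT | simp)+
  also have "\<dots> = L T (\<lambda>x y. M T (\<lambda>a b c. f a \<odot>\<^bsub>T\<^esub> t b c) (x \<otimes> y)) u"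
    by (rule L_cong, (assumption | rule lin_intros uT | simp)+, rule M_mult[symmetric])
      (assumption | rule lin_intros uT | simp)+
  also have "\<dots> = M T (\<lambda>a b c. f a \<odot>\<^bsub>T\<^esub> t b c) (mm u)"
    by (rule L_comm[OF R_alg T_alg _ mm_bilin uT, symmetric]) (assumption | rule lin_intros | simp)+
  also have "\<dots> = \<epsilon> u \<odot>\<^bsub>T\<^esub> M T (\<lambda>a b c. f a \<odot>\<^bsub>T\<^esub> t b c) \<one>"
    unfolding mm_scalar[OF u]
    by (rule lin_maps_smult[OF lin_M[OF T_alg lin_maps_id] \<epsilon>_closed[OF uT]])
      (assumption | rule lin_intros | simp)+
  also have "M T (\<lambda>a b c. f a \<odot>\<^bsub>T\<^esub> t b c) \<one> = f \<one> \<odot>\<^bsub>T\<^esub> t \<one> \<one>"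
    by (rule M_one[OF T_alg]) (assumption | rule lin_intros | simp)+
  also have "\<dots> = \<one>\<^bsub>T\<^esub>" by (simp add: f_one T_one t_closed)
  finally show ?thesis by simp
qed

lemma antipode_right:
  assumes u: "u \<in> carrier H"
  shows "tens_lift K H (\<lambda>a b. a \<otimes>\<^bsub>H\<^esub> antipode b) (\<Delta> u) = \<epsilon> u \<odot>\<^bsub>H\<^esub> \<one>\<^bsub>H\<^esub>"
proof -
  interpret T: k_algebra K T by (rule T_alg)
  interpret RR: k_algebra K R by (rule R_alg)
  note uT = H_T[OF u]
  have lA: "(\<lambda>z. antipode (G z)) \<in> lin_maps K C T" if "G \<in> lin_maps K C T" for G C
    by (rule lin_maps_comp[OF antipode_lin that])
  note Ac = lin_maps_closed[OF antipode_lin]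
  have lA': "antipode \<in> lin_maps K H H" by (rule lin_into_H[OF lin_H[OF antipode_lin]]) (simp add: antipode_H)
  have b: "bilin K H H H (\<lambda>a b. a \<otimes>\<^bsub>H\<^esub> antipode b)"
    by (rule bilinI; rule lin_mult_left[OF H_alg lin_maps_id] lin_mult_right[OF H_alg lA'])
      (simp_all add: antipode_H)
  have b': "bilin K T T T (\<lambda>a b. a \<otimes>\<^bsub>T\<^esub> antipode b)"
    by (assumption | rule lin_intros lA Ac)+
  have "tens_lift K H (\<lambda>a b. a \<otimes>\<^bsub>H\<^esub> antipode b) (\<Delta> u) = D2 T (\<lambda>a b. a \<otimes>\<^bsub>T\<^esub> antipode b) u"
    by (rule \<Delta>_lift_H[OF b b' u]) simp
  \<comment> \<open>The factor \<open>\<one>\<close> is inserted for the next step, which reads it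
    as x y1 by using \<open>H_rule\<close> from right to left.\<close>
  also have "\<dots> = L T (\<lambda>x y. M T (\<lambda>a b c. M T (\<lambda>p q r.
      f (\<one> \<otimes> p \<otimes> c) \<odot>\<^bsub>T\<^esub> t (q \<otimes> x) (a \<otimes> r)) b) y) u"
    unfolding D2_def
  proof (rule L_cong, (assumption | rule lin_intros lA Ac uT | simp)+, rule M_cong,
      (assumption | rule lin_intros lA Ac uT | simp)+)
    fix x y a b c assume xy: "x \<in> carrier R" "y \<in> carrier R" "a \<in> carrier R" "b \<in> carrier R" "c \<in> carrier R"
    have "t x a \<otimes>\<^bsub>T\<^esub> antipode (t b c) = M T (\<lambda>p q r. t x a \<otimes>\<^bsub>T\<^esub> (f (p \<otimes> c) \<odot>\<^bsub>T\<^esub> t q r)) b"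
      unfolding antipode_tens[OF xy(4,5)]
      by (rule M_comm[OF T_alg T_alg T.mult_right_lin[OF t_closed[OF xy(1,3)]]])
        (assumption | rule lin_intros xy | simp)+
    also have "\<dots> = M T (\<lambda>p q r. f (\<one> \<otimes> p \<otimes> c) \<odot>\<^bsub>T\<^esub> t (q \<otimes> x) (a \<otimes> r)) b"
      by (rule M_cong) (assumption | rule lin_intros xy |
          simp add: T.smult_mult_right t_mult t_closed f_closed xy)+
    finally show "t x a \<otimes>\<^bsub>T\<^esub> antipode (t b c)
      = M T (\<lambda>p q r. f (\<one> \<otimes> p \<otimes> c) \<odot>\<^bsub>T\<^esub> t (q \<otimes> x) (a \<otimes> r)) b" .
  qed
  also have "\<dots> = L T (\<lambda>x y. M T (\<lambda>A B C. M T (\<lambda>a b c. M T (\<lambda>p q r.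
      f (x \<otimes> A \<otimes> p \<otimes> c) \<odot>\<^bsub>T\<^esub> t (q \<otimes> B) (a \<otimes> r)) b) C) y) u"
    by (rule H_rule[symmetric, OF T_alg _ u, of "\<lambda>z B C. M T (\<lambda>a b c. M T (\<lambda>p q r.
      f (z \<otimes> p \<otimes> c) \<odot>\<^bsub>T\<^esub> t (q \<otimes> B) (a \<otimes> r)) b) C"])
      (assumption | rule lin_intros | simp)+
  also have "\<dots> = L T (\<lambda>x y. f (x \<otimes> y) \<odot>\<^bsub>T\<^esub> \<one>\<^bsub>T\<^esub>) u"
  proof (rule L_cong)
    fix x y assume xy: "x \<in> carrier R" "y \<in> carrier R"
    have "M T (\<lambda>A B C. M T (\<lambda>a b c. M T (\<lambda>p q r.
        f (x \<otimes> A \<otimes> p \<otimes> c) \<odot>\<^bsub>T\<^esub> t (q \<otimes> B) (a \<otimes> r)) b) C) y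
      = M T (\<lambda>a b c. M T (\<lambda>A B C. M T (\<lambda>p q r.
        f (x \<otimes> A \<otimes> p \<otimes> c) \<odot>\<^bsub>T\<^esub> t (q \<otimes> B) (C \<otimes> r)) b) a) y"
      by (rule M_coassoc[symmetric]) (assumption | rule lin_intros xy | simp)+
    \<comment> \<open>Multiplicativity of \<mu> joins the two inner brackets into one over the
      product y1 y2, and y1 y2 \<otimes> y3 = 1 \<otimes> y then evaluates it at the unit.\<close>
    also have "\<dots> = M T (\<lambda>a b c. M T (\<lambda>p q r. f (x \<otimes> p \<otimes> c) \<odot>\<^bsub>T\<^esub> t q r) (a \<otimes> b)) y"
    proof (rule M_cong, (assumption | rule lin_intros xy | simp)+)
      fix a b c assume abc: "a \<in> carrier R" "b \<in> carrier R" "c \<in> carrier R"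
      have "M T (\<lambda>p q r. f (x \<otimes> p \<otimes> c) \<odot>\<^bsub>T\<^esub> t q r) (a \<otimes> b)
        = M T (\<lambda>A B C. M T (\<lambda>p q r. f (x \<otimes> (A \<otimes> p) \<otimes> c) \<odot>\<^bsub>T\<^esub> t (q \<otimes> B) (C \<otimes> r)) b) a"
        by (rule M_mult) (assumption | rule lin_intros xy abc | simp)+
      also have "\<dots> = M T (\<lambda>A B C. M T (\<lambda>p q r.
        f (x \<otimes> A \<otimes> p \<otimes> c) \<odot>\<^bsub>T\<^esub> t (q \<otimes> B) (C \<otimes> r)) b) a"
        by (rule M_cong, (assumption | rule lin_intros xy abc | simp)+, rule M_cong)
          (assumption | rule lin_intros xy abc | simp add: RR.A.m_assoc xy abc)+
      finally show "M T (\<lambda>A B C. M T (\<lambda>p q r.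
        f (x \<otimes> A \<otimes> p \<otimes> c) \<odot>\<^bsub>T\<^esub> t (q \<otimes> B) (C \<otimes> r)) b) a
        = M T (\<lambda>p q r. f (x \<otimes> p \<otimes> c) \<odot>\<^bsub>T\<^esub> t q r) (a \<otimes> b)" by simp
    qed
    also have "\<dots> = M T (\<lambda>p q r. f (x \<otimes> p \<otimes> y) \<odot>\<^bsub>T\<^esub> t q r) \<one>"
      by (rule M_counit_left[OF T_alg _ xy(2), of "\<lambda>z c. M T (\<lambda>p q r. f (x \<otimes> p \<otimes> c) \<odot>\<^bsub>T\<^esub> t q r) z"])
        (assumption | rule lin_intros xy | simp)+
    also have "\<dots> = f (x \<otimes> \<one> \<otimes> y) \<odot>\<^bsub>T\<^esub> t \<one> \<one>"
      by (rule M_one[OF T_alg]) (assumption | rule lin_intros xy | simp)+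
    finally show "M T (\<lambda>A B C. M T (\<lambda>a b c. M T (\<lambda>p q r.
        f (x \<otimes> A \<otimes> p \<otimes> c) \<odot>\<^bsub>T\<^esub> t (q \<otimes> B) (a \<otimes> r)) b) C) y
      = f (x \<otimes> y) \<odot>\<^bsub>T\<^esub> \<one>\<^bsub>T\<^esub>" using xy by (simp add: T_one)
  qed (assumption | rule lin_intros uT | simp)+
  also have "\<dots> = \<epsilon> u \<odot>\<^bsub>T\<^esub> \<one>\<^bsub>T\<^esub>"
    unfolding \<epsilon>_def by (rule L_comm[symmetric, of "base_alg K" T "\<lambda>s. s \<odot>\<^bsub>T\<^esub> \<one>\<^bsub>T\<^esub>"])
      (assumption | rule lin_intros uT | simp)+
  finally show ?thesis by simp
qed

theorem hopf_algebra_H: "hopf_algebra K H (H_\<Delta> K R \<mu>) (H_\<epsilon> K R)"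
proof (rule hopf_algebra_cong[OF _ H_\<Delta>_eq H_\<epsilon>_eq])
  have "antipode \<in> lin_maps K H H" by (rule lin_into_H[OF lin_H[OF antipode_lin]]) (simp add: antipode_H)
  then show "hopf_algebra K H \<Delta> \<epsilon>"
    unfolding hopf_algebra_def Let_def
    by (intro conjI H_alg \<Delta>_hom \<epsilon>_hom ballI coassoc counit bexI[of _ antipode] antipode_left antipode_right)
qed

end

section \<open>Group-like and skew-primitive elements\<close>

definition tens_map :: "'k ring \<Rightarrow> ('k, 'a) module \<Rightarrow> ('k, 'b) module \<Rightarrow> ('c \<Rightarrow> 'a) \<Rightarrow> ('d \<Rightarrow> 'b)
    \<Rightarrow> ('k, 'c, 'd) tens \<Rightarrow> ('k, 'a, 'b) tens" where
  "tens_map K A B p q = tens_lift K (tensor K A B) (\<lambda>a b. tens K A B (p a) (q b))"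

lemma tens_map_bilin:
  assumes "k_algebra K A" "k_algebra K B" "p \<in> lin_maps K C A" "q \<in> lin_maps K D B"
  shows "bilin K C D (tensor K A B) (\<lambda>a b. tens K A B (p a) (q b))"
  by (rule bilinI; rule lin_tens_left lin_tens_right)
    (simp_all add: assms lin_maps_closed[OF assms(3)] lin_maps_closed[OF assms(4)])

lemma tens_map_lin:
  assumes "k_algebra K A" "k_algebra K B" "k_algebra K C" "k_algebra K D"
    "p \<in> lin_maps K C A" "q \<in> lin_maps K D B"
  shows "tens_map K A B p q \<in> lin_maps K (tensor K C D) (tensor K A B)"
  unfolding tens_map_def
  by (rule tens_lift_lin[OF assms(3,4) k_algebra_tensor[OF assms(1,2)] tens_map_bilin[OF assms(1,2,5,6)]])

lemma tens_map_tens: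
  assumes "k_algebra K A" "k_algebra K B" "k_algebra K C" "k_algebra K D"
    "p \<in> lin_maps K C A" "q \<in> lin_maps K D B" "c \<in> carrier C" "d \<in> carrier D"
  shows "tens_map K A B p q (tens K C D c d) = tens K A B (p c) (q d)"
  unfolding tens_map_def
  by (rule tens_lift_tens[OF assms(3,4) k_algebra_tensor[OF assms(1,2)] tens_map_bilin[OF assms(1,2,5,6)] assms(7,8)])

lemma tensor_mult_ext:
  assumes A: "k_algebra K A" and B: "k_algebra K B" and D: "k_algebra K D"
    and F: "F \<in> lin_maps K (tensor K A B) D"
    and eq: "\<And>a b a' b'. a \<in> carrier A \<Longrightarrow> b \<in> carrier B \<Longrightarrow> a' \<in> carrier A \<Longrightarrow> b' \<in> carrier B \<Longrightarrow>
      F (tens K A B (a \<otimes>\<^bsub>A\<^esub> a') (b \<otimes>\<^bsub>B\<^esub> b')) = F (tens K A B a b) \<otimes>\<^bsub>D\<^esub> F (tens K A B a' b')"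
    and u: "u \<in> carrier (tensor K A B)" and v: "v \<in> carrier (tensor K A B)"
  shows "F (u \<otimes>\<^bsub>tensor K A B\<^esub> v) = F u \<otimes>\<^bsub>D\<^esub> F v"
proof -
  interpret T: k_algebra K "tensor K A B" by (rule k_algebra_tensor[OF A B])
  interpret D: k_algebra K D by fact
  note cl = lin_maps_closed[OF F]
  show ?thesis
  proof (rule tensor_ext[OF A B D lin_maps_comp[OF F T.mult_left_lin[OF v]]
        lin_maps_comp[OF D.mult_left_lin[OF cl[OF v]] F] _ u])
    fix a b assume ab: "a \<in> carrier A" "b \<in> carrier B"
    have abT: "tens K A B a b \<in> carrier (tensor K A B)" by (rule tens_closed[OF A B ab])
    show "F (tens K A B a b \<otimes>\<^bsub>tensor K A B\<^esub> v) = F (tens K A B a b) \<otimes>\<^bsub>D\<^esub> F v"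
      by (rule tensor_ext[OF A B D lin_maps_comp[OF F T.mult_right_lin[OF abT]]
            lin_maps_comp[OF D.mult_right_lin[OF cl[OF abT]] F] _ v])
        (simp only: tens_mult[OF A B ab] eq ab)
  qed
qed

lemma tens_map_hom:
  assumes A: "k_algebra K A" and B: "k_algebra K B" and C: "k_algebra K C" and D: "k_algebra K D"
    and p: "p \<in> alg_hom K C A" and q: "q \<in> alg_hom K D B"
  shows "tens_map K A B p q \<in> alg_hom K (tensor K C D) (tensor K A B)"
proof -
  note pl = alg_hom_lin[OF p] and ql = alg_hom_lin[OF q]
  note tt = tens_map_tens[OF A B C D pl ql]
  note l = tens_map_lin[OF A B C D pl ql]
  show ?thesis
  proof (rule alg_homI[OF l])
    show "tens_map K A B p q \<one>\<^bsub>tensor K C D\<^esub> = \<one>\<^bsub>tensor K A B\<^esub>"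
      by (simp add: tensor_one[OF C D] tensor_one[OF A B] tt alg_one_closed[OF C] alg_one_closed[OF D]
          alg_hom_one[OF p] alg_hom_one[OF q])
    fix u v assume uv: "u \<in> carrier (tensor K C D)" "v \<in> carrier (tensor K C D)"
    show "tens_map K A B p q (u \<otimes>\<^bsub>tensor K C D\<^esub> v) = tens_map K A B p q u \<otimes>\<^bsub>tensor K A B\<^esub> tens_map K A B p q v"
      by (rule tensor_mult_ext[OF C D k_algebra_tensor[OF A B] l _ uv])
        (simp add: tt alg_mult_closed[OF C] alg_mult_closed[OF D] tens_mult[OF A B]
          lin_maps_closed[OF pl] lin_maps_closed[OF ql] alg_hom_mult[OF p] alg_hom_mult[OF q])
  qed
qed

lemma tens_map_inverse:
  assumes A: "k_algebra K A" and B: "k_algebra K B" and C: "k_algebra K C" and D: "k_algebra K D"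
    and p: "p \<in> lin_maps K C A" and q: "q \<in> lin_maps K D B"
    and p': "p' \<in> lin_maps K A C" and q': "q' \<in> lin_maps K B D"
    and pp: "\<And>x. x \<in> carrier C \<Longrightarrow> p' (p x) = x" and qq: "\<And>x. x \<in> carrier D \<Longrightarrow> q' (q x) = x"
    and u: "u \<in> carrier (tensor K C D)"
  shows "tens_map K C D p' q' (tens_map K A B p q u) = u"
  by (rule tensor_ext[OF C D k_algebra_tensor[OF C D]
        lin_maps_comp[OF tens_map_lin[OF C D A B p' q'] tens_map_lin[OF A B C D p q]] lin_maps_id _ u])
    (simp add: tens_map_tens[OF A B C D p q] tens_map_tens[OF C D A B p' q']
      lin_maps_closed[OF p] lin_maps_closed[OF q] pp qq)

lemma alg_auto_inverse:
  assumes A: "k_algebra K A" and r: "\<rho> \<in> alg_auto K A"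
  obtains \<rho>' where "\<rho>' \<in> alg_auto K A" "\<And>x. x \<in> carrier A \<Longrightarrow> \<rho>' (\<rho> x) = x"
    "\<And>x. x \<in> carrier A \<Longrightarrow> \<rho> (\<rho>' x) = x"
proof -
  have h: "\<rho> \<in> alg_hom K A A" and b: "bij_betw \<rho> (carrier A) (carrier A)"
    using r by (auto simp: alg_iso_def)
  note l = alg_hom_lin[OF h]
  define \<rho>' where "\<rho>' = inv_into (carrier A) \<rho>"
  have b': "bij_betw \<rho>' (carrier A) (carrier A)" unfolding \<rho>'_def by (rule bij_betw_inv_into[OF b])
  have c: "\<rho>' x \<in> carrier A" if "x \<in> carrier A" for x using b' that by (auto simp: bij_betw_def)
  have 1: "\<rho> (\<rho>' x) = x" if "x \<in> carrier A" for x
    unfolding \<rho>'_def by (rule bij_betw_inv_into_right[OF b that])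
  have 2: "\<rho>' (\<rho> x) = x" if "x \<in> carrier A" for x
    unfolding \<rho>'_def by (rule bij_betw_inv_into_left[OF b that])
  have u: "\<rho>' y = x" if "\<rho> x = y" "x \<in> carrier A" for x y using 2[OF that(2)] that(1) by simp
  have "\<rho>' \<in> alg_hom K A A"
  proof (intro alg_homI lin_mapsI)
    fix x y assume xy: "x \<in> carrier A" "y \<in> carrier A"
    show "\<rho>' (x \<oplus>\<^bsub>A\<^esub> y) = \<rho>' x \<oplus>\<^bsub>A\<^esub> \<rho>' y"
      by (rule u) (simp_all add: lin_maps_add[OF l] c xy 1 alg_add_closed[OF A])
    show "\<rho>' (x \<otimes>\<^bsub>A\<^esub> y) = \<rho>' x \<otimes>\<^bsub>A\<^esub> \<rho>' y"
      by (rule u) (simp_all add: alg_hom_mult[OF h] c xy 1 alg_mult_closed[OF A])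
  next
    fix s x assume sx: "s \<in> carrier K" "x \<in> carrier A"
    show "\<rho>' (s \<odot>\<^bsub>A\<^esub> x) = s \<odot>\<^bsub>A\<^esub> \<rho>' x"
      by (rule u) (simp_all add: lin_maps_smult[OF l] c sx 1 alg_smult_closed[OF A])
  next
    show "\<rho>' \<one>\<^bsub>A\<^esub> = \<one>\<^bsub>A\<^esub>" by (rule u) (simp_all add: alg_hom_one[OF h] alg_one_closed[OF A])
  qed (rule c)
  with b' have "\<rho>' \<in> alg_auto K A" by (simp add: alg_iso_def)
  then show ?thesis using 1 2 that by blast
qed

lemma (in k_algebra) sub_cancel:
  assumes "a \<in> carrier A" "b \<in> carrier A" "c \<in> carrier A"
  shows "((a \<ominus>\<^bsub>A\<^esub> b) \<oplus>\<^bsub>A\<^esub> c) \<ominus>\<^bsub>A\<^esub> a = c \<ominus>\<^bsub>A\<^esub> b"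
proof -
  have "((a \<ominus>\<^bsub>A\<^esub> b) \<oplus>\<^bsub>A\<^esub> c) \<ominus>\<^bsub>A\<^esub> a = (c \<ominus>\<^bsub>A\<^esub> b) \<oplus>\<^bsub>A\<^esub> (a \<oplus>\<^bsub>A\<^esub> \<ominus>\<^bsub>A\<^esub> a)"
    using assms by (simp add: a_minus_def A.a_ac)
  then show ?thesis using assms by (simp add: A.r_neg sub_closed)
qed

context hopf_gal begin

text \<open>The hypotheses on the automorphisms are identities between elements of the three-fold
  tensor product. This lemma turns such identities into rewrite rules for brackets.\<close>

lemma lift3_comm:
  assumes D: "k_algebra K D" and F: "trilin K R D F" and p: "p \<in> lin_maps K R R"
    and q: "q \<in> lin_maps K R R" and s: "s \<in> lin_maps K R R" and r: "r \<in> carrier R"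
  shows "tens3_lift K D F (tens3_lift K T3 (\<lambda>a b c. t3 (p a) (q b) (s c)) (\<mu> r))
    = M D (\<lambda>a b c. F (p a) (q b) (s c)) r"
proof -
  note cl = lin_maps_closed[OF p] lin_maps_closed[OF q] lin_maps_closed[OF s]
  have tri: "trilin K R T3 (\<lambda>a b c. t3 (p a) (q b) (s c))"
    by (assumption | rule lin_intros p q s cl)+
  note Fl = tens3_lift_lin[OF R_alg D F]
  have "tens3_lift K D F (M T3 (\<lambda>a b c. t3 (p a) (q b) (s c)) r)
    = M D (\<lambda>a b c. tens3_lift K D F (t3 (p a) (q b) (s c))) r"
    by (rule M_comm[OF T3_alg D Fl tri r])
  also have "\<dots> = M D (\<lambda>a b c. F (p a) (q b) (s c)) r"
    by (rule M_cong[OF D trilin_comp[OF tri Fl] r]) (simp add: tens3_lift_tens3[OF R_alg D F] cl)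
  finally show ?thesis by (simp add: M_def)
qed

text \<open>The inverse is an explicit argument, so products of group-like elements and their images
  under homomorphisms need no computation of \<open>inv\<close>.\<close>

definition grouplike :: "'a \<Rightarrow> 'a \<Rightarrow> bool" where
  "grouplike g g' \<longleftrightarrow> g \<in> carrier R \<and> g' \<in> carrier R \<and> g \<otimes> g' = \<one> \<and> g' \<otimes> g = \<one>
    \<and> \<mu> g = t3 g g' g"

text \<open>This shape is shared by X relative to g, by Y relative to h, and by c relative to
  gh.\<close>

definition skew_primitive :: "'a \<Rightarrow> 'a \<Rightarrow> 'a \<Rightarrow> bool" where
  "skew_primitive g g' x \<longleftrightarrow> x \<in> carrier R
    \<and> \<mu> x = (t3 x \<one> \<one> \<ominus>\<^bsub>T3\<^esub> t3 g (g' \<otimes> x) \<one>) \<oplus>\<^bsub>T3\<^esub> t3 g g' x"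

lemma M_grouplike:
  assumes "k_algebra K D" "grouplike g g'" "trilin K R D F"
  shows "M D F g = F g g' g"
  using assms(2) by (simp add: grouplike_def M_def tens3_lift_tens3[OF R_alg assms(1,3)])

lemma M_skew_primitive:
  assumes D: "k_algebra K D" and g: "grouplike g g'" and x: "skew_primitive g g' x" and F: "trilin K R D F"
  shows "M D F x = (F x \<one> \<one> \<ominus>\<^bsub>D\<^esub> F g (g' \<otimes> x) \<one>) \<oplus>\<^bsub>D\<^esub> F g g' x"
proof -
  note l = tens3_lift_lin[OF R_alg D F]
  have c: "g \<in> carrier R" "g' \<in> carrier R" "x \<in> carrier R" "g' \<otimes> x \<in> carrier R" "\<one> \<in> carrier R"
    using g x by (auto simp: grouplike_def skew_primitive_def alg_mult_closed[OF R_alg] alg_one_closed[OF R_alg])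
  then show ?thesis
    using x by (simp add: M_def skew_primitive_def lin_maps_add[OF l] lin_maps_minus[OF T3_alg D l]
        tens3_closed[OF R_alg] alg_sub_closed[OF T3_alg] tens3_lift_tens3[OF R_alg D F])
qed

lemma D2_tens:
  assumes D: "k_algebra K D" and F: "bilin K T T D F" and p: "p \<in> carrier R" and q: "q \<in> carrier R"
  shows "D2 D F (t p q) = M D (\<lambda>a b c. F (t p a) (t b c)) q"
  unfolding D2_def by (rule L_tens) (assumption | rule lin_intros lin_bilin[OF F] D p q | simp)+

lemma \<delta>_tens: "p \<in> carrier R \<Longrightarrow> q \<in> carrier R \<Longrightarrow> \<delta> (t p q) = M T3 (\<lambda>a b c. t3 (p \<otimes> a) b c) q"
  unfolding \<delta>_def by (rule L_tens) (assumption | rule lin_intros | simp)+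

lemma grouplike_H:
  assumes g: "grouplike g g'"
  shows "t g' g \<in> carrier H" "\<Delta> (t g' g) = tH (t g' g) (t g' g)" "\<epsilon> (t g' g) = \<one>\<^bsub>K\<^esub>"
proof -
  have c: "g \<in> carrier R" "g' \<in> carrier R" "g' \<otimes> g = \<one>" using g by (auto simp: grouplike_def)
  have "\<delta> (t g' g) = t3 (g' \<otimes> g) g' g"
    unfolding \<delta>_tens[OF c(2,1)] by (rule M_grouplike[OF T3_alg g]) (assumption | rule lin_intros c)+
  then show H: "t g' g \<in> carrier H"
    using c by (simp add: H_carrier t_closed tens3_def)
  have "\<Delta> (t g' g) = tH (P (t g' g)) (P (t g' g))"
    unfolding \<Delta>_def D2_tens[OF HH_alg bilin_tHP c(2,1)]
    by (rule M_grouplike[OF HH_alg g]) (assumption | rule lin_intros c HH_alg | simp)+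
  then show "\<Delta> (t g' g) = tH (t g' g) (t g' g)" by (simp add: P_id[OF H])
  show "\<epsilon> (t g' g) = \<one>\<^bsub>K\<^esub>" using c by (simp add: \<epsilon>_tens f_one)
qed

text \<open>In \<delta>(g' \<otimes> x) the term g' x \<otimes> 1 \<otimes> 1 is the only one that
  does not begin with 1. It equals \<delta>(g' x \<otimes> 1), so subtracting g' x \<otimes> 1
  yields an element of H. The same correction term completes the legs of the comultiplication to
  e.\<close>

lemma skew_primitive_H:
  assumes g: "grouplike g g'" and x: "skew_primitive g g' x"
  defines "e \<equiv> t g' x \<ominus>\<^bsub>T\<^esub> t (g' \<otimes> x) \<one>"
  shows "e \<in> carrier H" "\<Delta> e = tH e \<one>\<^bsub>H\<^esub> \<oplus>\<^bsub>HH\<^esub> tH (t g' g) e"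
proof -
  interpret RR: k_algebra K R by (rule R_alg)
  interpret T3: k_algebra K T3 by (rule T3_alg)
  interpret HH: k_algebra K HH by (rule HH_alg)
  have c: "g \<in> carrier R" "g' \<in> carrier R" "g' \<otimes> g = \<one>" "x \<in> carrier R" "g' \<otimes> x \<in> carrier R"
    using g x by (auto simp: grouplike_def skew_primitive_def)
  have eT: "e \<in> carrier T" unfolding e_def by (assumption | rule lin_intros c)+
  have "\<delta> (t g' x) = (t3 (g' \<otimes> x) \<one> \<one> \<ominus>\<^bsub>T3\<^esub> t3 (g' \<otimes> g) (g' \<otimes> x) \<one>)
      \<oplus>\<^bsub>T3\<^esub> t3 (g' \<otimes> g) g' x"
    unfolding \<delta>_tens[OF c(2,4)]
    by (rule M_skew_primitive[OF T3_alg g x]) (assumption | rule lin_intros c)+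
  moreover have "\<delta> (t (g' \<otimes> x) \<one>) = t3 (g' \<otimes> x \<otimes> \<one>) \<one> \<one>"
    unfolding \<delta>_tens[OF c(5) RR.A.one_closed]
    by (rule M_one[OF T3_alg]) (assumption | rule lin_intros c)+
  moreover have "\<delta> e = \<delta> (t g' x) \<ominus>\<^bsub>T3\<^esub> \<delta> (t (g' \<otimes> x) \<one>)"
    unfolding e_def by (rule lin_maps_minus[OF T_alg T3_alg \<delta>_lin]) (assumption | rule lin_intros c)+
  ultimately have "\<delta> e = t3 \<one> g' x \<ominus>\<^bsub>T3\<^esub> t3 \<one> (g' \<otimes> x) \<one>"
    using c by (simp add: T3.sub_cancel tens3_closed[OF R_alg])
  also have "\<dots> = tens K R T \<one> e"
  proof -
    have l: "(\<lambda>w. tens K R T \<one> w) \<in> lin_maps K T T3" unfolding tensor3_def by (assumption | rule lin_intros)+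
    show ?thesis unfolding e_def using c t_closed
      by (simp add: lin_maps_minus[OF T_alg T3_alg l] tens3_def)
  qed
  finally show eH: "e \<in> carrier H" using eT by (simp add: H_carrier)
  let ?F = "\<lambda>a b. tH (P a) (P b)"
  note Fc = bilin_closed[OF bilin_tHP]
  have "D2 HH ?F (t g' x) = (?F (t g' x) (t \<one> \<one>) \<ominus>\<^bsub>HH\<^esub> ?F (t g' g) (t (g' \<otimes> x) \<one>))
      \<oplus>\<^bsub>HH\<^esub> ?F (t g' g) (t g' x)"
    unfolding D2_tens[OF HH_alg bilin_tHP c(2,4)]
    by (rule M_skew_primitive[OF HH_alg g x]) (assumption | rule lin_intros c HH_alg | simp)+
  moreover have "D2 HH ?F (t (g' \<otimes> x) \<one>) = ?F (t (g' \<otimes> x) \<one>) (t \<one> \<one>)"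
    unfolding D2_tens[OF HH_alg bilin_tHP c(5) RR.A.one_closed]
    by (rule M_one[OF HH_alg]) (assumption | rule lin_intros c HH_alg | simp)+
  ultimately have "\<Delta> e = ((?F (t g' x) (t \<one> \<one>) \<ominus>\<^bsub>HH\<^esub> ?F (t g' g) (t (g' \<otimes> x) \<one>))
      \<oplus>\<^bsub>HH\<^esub> ?F (t g' g) (t g' x)) \<ominus>\<^bsub>HH\<^esub> ?F (t (g' \<otimes> x) \<one>) (t \<one> \<one>)"
    using c t_closed unfolding \<Delta>_def e_def
    by (simp add: lin_maps_minus[OF T_alg HH_alg D2_lin[OF HH_alg bilin_tHP]])
  also have "\<dots> = (?F (t g' x) (t \<one> \<one>) \<ominus>\<^bsub>HH\<^esub> ?F (t (g' \<otimes> x) \<one>) (t \<one> \<one>))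
      \<oplus>\<^bsub>HH\<^esub> (?F (t g' g) (t g' x) \<ominus>\<^bsub>HH\<^esub> ?F (t g' g) (t (g' \<otimes> x) \<one>))"
    using c Fc t_closed by (simp add: a_minus_def HH.A.a_ac)
  also have "\<dots> = ?F e (t \<one> \<one>) \<oplus>\<^bsub>HH\<^esub> ?F (t g' g) e"
    using c t_closed unfolding e_def
    by (simp add: lin_maps_minus[OF T_alg HH_alg bilin_left[OF bilin_tHP]]
        lin_maps_minus[OF T_alg HH_alg bilin_right[OF bilin_tHP]])
  finally show "\<Delta> e = tH e \<one>\<^bsub>H\<^esub> \<oplus>\<^bsub>HH\<^esub> tH (t g' g) e"
    using P_id[OF H_one] by (simp add: P_id[OF eH] P_id[OF grouplike_H(1)[OF g]] T_one)
qed

lemma grouplike_mult: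
  assumes g: "grouplike g g'" and h: "grouplike h h'"
  shows "grouplike (g \<otimes> h) (h' \<otimes> g')"
proof -
  interpret RR: k_algebra K R by (rule R_alg)
  have c: "g \<in> carrier R" "g' \<in> carrier R" "h \<in> carrier R" "h' \<in> carrier R"
    and i: "g \<otimes> g' = \<one>" "g' \<otimes> g = \<one>" "h \<otimes> h' = \<one>" "h' \<otimes> h = \<one>"
    using g h by (auto simp: grouplike_def)
  have "g \<otimes> h \<otimes> (h' \<otimes> g') = g \<otimes> (h \<otimes> h') \<otimes> g'"
    using c by (simp add: RR.A.m_assoc)
  moreover have "h' \<otimes> g' \<otimes> (g \<otimes> h) = h' \<otimes> (g' \<otimes> g) \<otimes> h"
    using c by (simp add: RR.A.m_assoc)
  moreover have "M T3 t3 (g \<otimes> h) = t3 (g \<otimes> h) (h' \<otimes> g') (g \<otimes> h)"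
  proof -
    have "M T3 (\<lambda>a b c. t3 a b c) (g \<otimes> h)
      = M T3 (\<lambda>a b c. M T3 (\<lambda>a' b' c'. t3 (a \<otimes> a') (b' \<otimes> b) (c \<otimes> c')) h) g"
      by (rule M_mult) (assumption | rule lin_intros c)+
    also have "\<dots> = M T3 (\<lambda>a' b' c'. t3 (g \<otimes> a') (b' \<otimes> g') (g \<otimes> c')) h"
      by (rule M_grouplike[OF T3_alg g]) (assumption | rule lin_intros c)+
    also have "\<dots> = t3 (g \<otimes> h) (h' \<otimes> g') (g \<otimes> h)"
      by (rule M_grouplike[OF T3_alg h]) (assumption | rule lin_intros c)+
    finally show ?thesis .
  qed
  ultimately show ?thesis using c i by (simp add: grouplike_def M_tens3)
qed

end

section \<open>Automorphisms attached to group-like elements\<close>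

text \<open>Collects what the pairs (\<tau>, g) and (\<omega>, h) have in common, so that each fact
  is proved once and instantiated twice.\<close>

locale hg_auto = hopf_gal K R \<mu> f for K :: "'k ring" and R :: "('k, 'a) module" (structure) and \<mu> f +
  fixes \<rho> :: "'a \<Rightarrow> 'a" and g g' :: 'a
  assumes rho: "\<rho> \<in> alg_auto K R"
    and rho_1: "\<And>r. r \<in> carrier R \<Longrightarrow> \<mu> (\<rho> r) = tens3_lift K T3 (\<lambda>a b d. t3 (\<rho> a) b d) (\<mu> r)"
    and rho_3: "\<And>r. r \<in> carrier R \<Longrightarrow> \<mu> (\<rho> r) = tens3_lift K T3 (\<lambda>a b d. t3 (\<rho> a) (\<rho> b) (\<rho> d)) (\<mu> r)"
    and gl: "grouplike g g'"
    and conj: "\<And>r. r \<in> carrier R \<Longrightarrow>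
      tens3_lift K T3 (\<lambda>a b d. t3 (g \<otimes> a \<otimes> g') (g \<otimes> b \<otimes> g') d) (\<mu> r)
        = tens3_lift K T3 (\<lambda>a b d. t3 (\<rho> a) (\<rho> b) d) (\<mu> r)"
begin

lemma rho_hom: "\<rho> \<in> alg_hom K R R" using rho by (simp add: alg_iso_def)
lemma rho_lin: "\<rho> \<in> lin_maps K R R" by (rule alg_hom_lin[OF rho_hom])
lemma lin_rho [lin_intros]: "G \<in> lin_maps K C R \<Longrightarrow> (\<lambda>z. \<rho> (G z)) \<in> lin_maps K C R"
  by (rule lin_maps_comp[OF rho_lin])
lemma rho_closed [lin_intros]: "r \<in> carrier R \<Longrightarrow> \<rho> r \<in> carrier R" by (rule lin_maps_closed[OF rho_lin])

lemma g_closed [lin_intros]: "g \<in> carrier R" "g' \<in> carrier R" using gl by (simp_all add: grouplike_def)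
lemma g_inv: "g \<otimes> g' = \<one>" "g' \<otimes> g = \<one>" using gl by (simp_all add: grouplike_def)

lemma cj_lin: "(\<lambda>r. g \<otimes> r \<otimes> g') \<in> lin_maps K R R" by (assumption | rule lin_intros)+

lemma M_rho_1: "k_algebra K D \<Longrightarrow> trilin K R D F \<Longrightarrow> r \<in> carrier R \<Longrightarrow>
    M D F (\<rho> r) = M D (\<lambda>a b c. F (\<rho> a) b c) r"
  using lift3_comm[of D F \<rho> "\<lambda>x. x" "\<lambda>x. x" r] rho_lin by (simp add: M_def[of _ _ "\<rho> r"] rho_1)

lemma M_rho_3: "k_algebra K D \<Longrightarrow> trilin K R D F \<Longrightarrow> r \<in> carrier R \<Longrightarrow>
    M D F (\<rho> r) = M D (\<lambda>a b c. F (\<rho> a) (\<rho> b) (\<rho> c)) r"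
  using lift3_comm[of D F \<rho> \<rho> \<rho> r] rho_lin by (simp add: M_def[of _ _ "\<rho> r"] rho_3)

lemma M_conj: "k_algebra K D \<Longrightarrow> trilin K R D F \<Longrightarrow> r \<in> carrier R \<Longrightarrow>
    M D (\<lambda>a b c. F (g \<otimes> a \<otimes> g') (g \<otimes> b \<otimes> g') c) r = M D (\<lambda>a b c. F (\<rho> a) (\<rho> b) c) r"
  using lift3_comm[of D F "\<lambda>r. g \<otimes> r \<otimes> g'" "\<lambda>r. g \<otimes> r \<otimes> g'" "\<lambda>x. x" r]
    lift3_comm[of D F \<rho> \<rho> "\<lambda>x. x" r] rho_lin cj_lin by (simp add: conj)

text \<open>The two expressions for \<mu>(\<rho>(r)) differ by \<rho> on the last two components.
  Cancelling \<rho> on the first one gives r1 \<otimes> \<rho>(r2) \<otimes> \<rho>(r3) = r1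
  \<otimes> r2 \<otimes> r3, and an element of H is built from such r2 \<otimes> r3 because the
  projection fixes it.\<close>

lemma rho_invariant:
  assumes u: "u \<in> carrier H"
  shows "L T (\<lambda>x y. t (\<rho> x) (\<rho> y)) u = u"
proof -
  note uT = H_T[OF u]
  obtain \<rho>' where r': "\<rho>' \<in> alg_auto K R" "\<And>x. x \<in> carrier R \<Longrightarrow> \<rho>' (\<rho> x) = x"
    using alg_auto_inverse[OF R_alg rho] by metis
  have r'l: "\<rho>' \<in> lin_maps K R R" using r'(1) by (simp add: alg_iso_def alg_hom_lin)
  note a = lin_maps_comp[OF r'l] lin_maps_closed[OF r'l] uT
  let ?G = "\<lambda>w. L T (\<lambda>x y. t (\<rho> x) (\<rho> y)) w"
  have Gl: "?G \<in> lin_maps K T T" by (assumption | rule lin_intros | simp)+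
  have Gt: "?G (t b c) = t (\<rho> b) (\<rho> c)" if "b \<in> carrier R" "c \<in> carrier R" for b c
    by (rule L_tens) (assumption | rule lin_intros that | simp)+
  have key: "M T (\<lambda>a b c. f (x \<otimes> a) \<odot>\<^bsub>T\<^esub> t b c) y = M T (\<lambda>a b c. f (x \<otimes> a) \<odot>\<^bsub>T\<^esub> t (\<rho> b) (\<rho> c)) y"
    if xy: "x \<in> carrier R" "y \<in> carrier R" for x y
  proof -
    \<comment> \<open>The inverse of \<rho> in the first slot cancels the \<rho> that both
      expressions for \<mu>(\<rho>(y)) carry there.\<close>
    let ?F = "\<lambda>a b c. f (x \<otimes> \<rho>' a) \<odot>\<^bsub>T\<^esub> t b c"
    have tri: "trilin K R T ?F" by (assumption | rule lin_intros a xy | simp)+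
    have "M T (\<lambda>a b c. f (x \<otimes> a) \<odot>\<^bsub>T\<^esub> t b c) y = M T (\<lambda>a b c. ?F (\<rho> a) b c) y"
      by (rule M_cong) (assumption | rule lin_intros a xy | simp add: r'(2))+
    also have "\<dots> = M T (\<lambda>a b c. ?F (\<rho> a) (\<rho> b) (\<rho> c)) y"
      using M_rho_1[OF T_alg tri xy(2)] M_rho_3[OF T_alg tri xy(2)] by simp
    also have "\<dots> = M T (\<lambda>a b c. f (x \<otimes> a) \<odot>\<^bsub>T\<^esub> t (\<rho> b) (\<rho> c)) y"
      by (rule M_cong) (assumption | rule lin_intros a xy | simp add: r'(2))+
    finally show ?thesis .
  qed
  have "?G (P u) = L T (\<lambda>x y. ?G (M T (\<lambda>a b c. f (x \<otimes> a) \<odot>\<^bsub>T\<^esub> t b c) y)) u"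
    unfolding P_def by (rule L_comm[OF T_alg T_alg Gl]) (assumption | rule lin_intros uT | simp)+
  also have "\<dots> = L T (\<lambda>x y. M T (\<lambda>a b c. f (x \<otimes> a) \<odot>\<^bsub>T\<^esub> t b c) y) u"
  proof (rule L_cong)
    fix x y assume xy: "x \<in> carrier R" "y \<in> carrier R"
    have "?G (M T (\<lambda>a b c. f (x \<otimes> a) \<odot>\<^bsub>T\<^esub> t b c) y) = M T (\<lambda>a b c. ?G (f (x \<otimes> a) \<odot>\<^bsub>T\<^esub> t b c)) y"
      by (rule M_comm[OF T_alg T_alg Gl]) (assumption | rule lin_intros xy | simp)+
    also have "\<dots> = M T (\<lambda>a b c. f (x \<otimes> a) \<odot>\<^bsub>T\<^esub> t (\<rho> b) (\<rho> c)) y"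
      by (rule M_cong) (assumption | rule lin_intros xy lin_maps_comp[OF Gl] |
          simp add: lin_maps_smult[OF Gl] Gt f_closed alg_mult_closed[OF R_alg] t_closed xy)+
    finally show "?G (M T (\<lambda>a b c. f (x \<otimes> a) \<odot>\<^bsub>T\<^esub> t b c) y) = M T (\<lambda>a b c. f (x \<otimes> a) \<odot>\<^bsub>T\<^esub> t b c) y"
      using key[OF xy] by simp
  qed (assumption | rule lin_intros uT | simp)+
  finally show ?thesis unfolding P_def[symmetric] P_id[OF u] .
qed

text \<open>Admissibility prescribes \<tau>(h) and \<omega>(g). That \<tau> also rescales g, and
  \<omega> also rescales h, is obtained here: \<mu>(\<rho>(g)) is both \<rho>(g) \<otimes> g'
  \<otimes> g and \<rho>(g) \<otimes> \<rho>(g') \<otimes> \<rho>(g), which forces g to be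
  proportional to \<rho>(g).\<close>

lemma rho_g: "\<exists>s\<in>carrier K. g = s \<odot> \<rho> g"
proof -
  interpret RR: k_algebra K R by (rule R_alg)
  \<comment> \<open>Contracts the first component against \<rho>(g') and the second against g, so
    that one expression leaves g and the other a multiple of \<rho>(g).\<close>
  let ?F = "\<lambda>a b c. f (\<rho> g' \<otimes> a) \<odot> (f (b \<otimes> g) \<odot> c)"
  have tri: "trilin K R R ?F" by (assumption | rule lin_intros)+
  have tri1: "trilin K R R (\<lambda>a b c. ?F (\<rho> a) b c)" by (assumption | rule lin_intros)+
  have tri3: "trilin K R R (\<lambda>a b c. ?F (\<rho> a) (\<rho> b) (\<rho> c))" by (assumption | rule lin_intros)+
  have gg: "\<rho> g' \<otimes> \<rho> g = \<one>"
    using alg_hom_mult[OF rho_hom g_closed(2,1)] by (simp add: g_inv alg_hom_one[OF rho_hom])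
  have "?F (\<rho> g) g' g = ?F (\<rho> g) (\<rho> g') (\<rho> g)"
    using M_rho_1[OF R_alg tri g_closed(1)] M_rho_3[OF R_alg tri g_closed(1)]
    by (simp only: M_grouplike[OF R_alg gl tri1] M_grouplike[OF R_alg gl tri3])
  then have "g = f (\<rho> g' \<otimes> g) \<odot> \<rho> g"
    by (simp add: gg g_inv f_one g_closed rho_closed f_closed alg_mult_closed[OF R_alg] alg_smult_closed[OF R_alg])
  moreover have "f (\<rho> g' \<otimes> g) \<in> carrier K" by (assumption | rule lin_intros)+
  ultimately show ?thesis by blast
qed

text \<open>The scalars by which \<rho> acts on g and on its inverse are inverse to each other and
  cancel in a conjugate.\<close>

lemma rho_conj:
  assumes r: "r \<in> carrier R"
  shows "\<rho> (g \<otimes> r \<otimes> g') = g \<otimes> \<rho> r \<otimes> g'"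
proof -
  interpret RR: k_algebra K R by (rule R_alg)
  note [simp] = g_closed rho_closed r
  obtain s where s: "s \<in> carrier K" "g = s \<odot> \<rho> g" using rho_g by blast
  have gg: "\<rho> g' \<otimes> \<rho> g = \<one>"
    using alg_hom_mult[OF rho_hom g_closed(2,1)] by (simp add: g_inv alg_hom_one[OF rho_hom])
  have "\<rho> g' = \<rho> g' \<otimes> (g \<otimes> g')" by (simp add: g_inv)
  also have "\<dots> = \<rho> g' \<otimes> ((s \<odot> \<rho> g) \<otimes> g')" using s(2) by simp
  also have "\<dots> = s \<odot> (\<rho> g' \<otimes> \<rho> g \<otimes> g')"
    using s(1) by (simp add: RR.smult_mult_left RR.smult_mult_right RR.A.m_assoc)
  finally have g': "\<rho> g' = s \<odot> g'" by (simp add: gg)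
  have "g \<otimes> \<rho> r \<otimes> g' = (s \<odot> \<rho> g) \<otimes> \<rho> r \<otimes> g'" using s(2) by simp
  also have "\<dots> = \<rho> g \<otimes> \<rho> r \<otimes> (s \<odot> g')"
    using s(1) by (simp add: RR.smult_mult_left RR.smult_mult_right)
  also have "\<dots> = \<rho> (g \<otimes> r \<otimes> g')"
    by (simp add: g'[symmetric] alg_hom_mult[OF rho_hom])
  finally show ?thesis by simp
qed

text \<open>This is \<tau>' for the pair (\<tau>, g) and \<omega>' for the pair (\<omega>, h),
  defined on the whole of R^op \<otimes> R.\<close>

definition "hat u = L T (\<lambda>r s. t (g \<otimes> r \<otimes> g') (\<rho> s)) u"

lemma hat_map: "hat = tens_map K (opp R) R (\<lambda>r. g \<otimes> r \<otimes> g') \<rho>"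
  by (simp add: hat_def[abs_def] tens_map_def)

lemma hat_tens: "r \<in> carrier R \<Longrightarrow> s \<in> carrier R \<Longrightarrow> hat (t r s) = t (g \<otimes> r \<otimes> g') (\<rho> s)"
  unfolding hat_def by (rule L_tens) (assumption | rule lin_intros | simp)+

lemma cj_hom: "(\<lambda>r. g \<otimes> r \<otimes> g') \<in> alg_hom K (opp R) (opp R)"
proof (rule alg_homI)
  interpret RR: k_algebra K R by (rule R_alg)
  note [simp] = g_closed
  show "(\<lambda>r. g \<otimes> r \<otimes> g') \<in> lin_maps K (opp R) (opp R)" using cj_lin by simp
  show "g \<otimes> \<one>\<^bsub>opp R\<^esub> \<otimes> g' = \<one>\<^bsub>opp R\<^esub>" by (simp add: g_inv)
  fix x y assume xy: "x \<in> carrier (opp R)" "y \<in> carrier (opp R)"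
  have "g \<otimes> y \<otimes> g' \<otimes> (g \<otimes> x \<otimes> g') = g \<otimes> y \<otimes> (g' \<otimes> g) \<otimes> x \<otimes> g'"
    using xy by (simp add: RR.A.m_assoc)
  then show "g \<otimes> (x \<otimes>\<^bsub>opp R\<^esub> y) \<otimes> g' = (g \<otimes> x \<otimes> g') \<otimes>\<^bsub>opp R\<^esub> (g \<otimes> y \<otimes> g')"
    using xy by (simp add: g_inv RR.A.m_assoc)
qed

lemma hat_hom: "hat \<in> alg_hom K T T"
  unfolding hat_map by (rule tens_map_hom[OF k_algebra_opp[OF R_alg] R_alg k_algebra_opp[OF R_alg] R_alg cj_hom rho_hom])

lemma hat_lin: "hat \<in> lin_maps K T T" by (rule alg_hom_lin[OF hat_hom])
lemma lin_hat [lin_intros]: "G \<in> lin_maps K C T \<Longrightarrow> (\<lambda>z. hat (G z)) \<in> lin_maps K C T"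
  by (rule lin_maps_comp[OF hat_lin])
lemma hat_closed [lin_intros]: "u \<in> carrier T \<Longrightarrow> hat u \<in> carrier T" by (rule lin_maps_closed[OF hat_lin])

lemma hat_inverse:
  obtains k where "k \<in> lin_maps K T T" "\<And>u. u \<in> carrier T \<Longrightarrow> k (hat u) = u" "\<And>u. u \<in> carrier T \<Longrightarrow> hat (k u) = u"
proof -
  interpret RR: k_algebra K R by (rule R_alg)
  obtain \<rho>' where r': "\<rho>' \<in> alg_auto K R" "\<And>x. x \<in> carrier R \<Longrightarrow> \<rho>' (\<rho> x) = x"
    "\<And>x. x \<in> carrier R \<Longrightarrow> \<rho> (\<rho>' x) = x"
    using alg_auto_inverse[OF R_alg rho] by metis
  have r'l: "\<rho>' \<in> lin_maps K R R" using r'(1) by (simp add: alg_iso_def alg_hom_lin)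
  note O = k_algebra_opp[OF R_alg]
  have l: "(\<lambda>r. g \<otimes> r \<otimes> g') \<in> lin_maps K (opp R) (opp R)"
    and l': "(\<lambda>r. g' \<otimes> r \<otimes> g) \<in> lin_maps K (opp R) (opp R)"
    by (assumption | rule lin_intros)+
  have "g' \<otimes> (g \<otimes> r \<otimes> g') \<otimes> g = (g' \<otimes> g) \<otimes> r \<otimes> (g' \<otimes> g)"
    "g \<otimes> (g' \<otimes> r \<otimes> g) \<otimes> g' = (g \<otimes> g') \<otimes> r \<otimes> (g \<otimes> g')"
    if "r \<in> carrier R" for r
    using that g_closed by (simp_all add: RR.A.m_assoc)
  then have i: "g' \<otimes> (g \<otimes> r \<otimes> g') \<otimes> g = r" "g \<otimes> (g' \<otimes> r \<otimes> g) \<otimes> g' = r"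
    if "r \<in> carrier R" for r
    using that by (simp_all add: g_inv)
  show ?thesis
  proof (rule that[of "tens_map K (opp R) R (\<lambda>r. g' \<otimes> r \<otimes> g) \<rho>'"])
    show "tens_map K (opp R) R (\<lambda>r. g' \<otimes> r \<otimes> g) \<rho>' \<in> lin_maps K T T"
      by (rule tens_map_lin[OF O R_alg O R_alg l' r'l])
    show "tens_map K (opp R) R (\<lambda>r. g' \<otimes> r \<otimes> g) \<rho>' (hat u) = u" if "u \<in> carrier T" for u
      unfolding hat_map by (rule tens_map_inverse[OF O R_alg O R_alg l rho_lin l' r'l _ _ that]) (simp_all add: i r')
    show "hat (tens_map K (opp R) R (\<lambda>r. g' \<otimes> r \<otimes> g) \<rho>' u) = u" if "u \<in> carrier T" for u
      unfolding hat_map by (rule tens_map_inverse[OF O R_alg O R_alg l' r'l l rho_lin _ _ that]) (simp_all add: i r')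
  qed
qed

text \<open>\<open>hat\<close> intertwines \<open>\<delta>\<close> and \<open>1 \<otimes> _\<close>, whose equalizer is \<open>H\<close>, with an injective map.\<close>

lemma hat_H_iff:
  assumes u: "u \<in> carrier T"
  shows "hat u \<in> carrier H \<longleftrightarrow> u \<in> carrier H"
proof -
  interpret RR: k_algebra K R by (rule R_alg)
  let ?c = "\<lambda>r. g \<otimes> r \<otimes> g'" and ?c' = "\<lambda>r. g' \<otimes> r \<otimes> g"
  obtain k where k: "k \<in> lin_maps K T T" "\<And>u. u \<in> carrier T \<Longrightarrow> k (hat u) = u"
    by (rule hat_inverse) blast
  have c': "?c' \<in> lin_maps K R R" by (assumption | rule lin_intros)+
  have "?c' (?c r) = (g' \<otimes> g) \<otimes> r \<otimes> (g' \<otimes> g)" if "r \<in> carrier R" for r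
    using that g_closed by (simp add: RR.A.m_assoc)
  then have i: "?c' (?c r) = r" if "r \<in> carrier R" for r using that by (simp add: g_inv)
  define \<Psi> where "\<Psi> = tens_map K R T ?c hat"
  have \<Psi>l: "\<Psi> \<in> lin_maps K (tensor K R T) (tensor K R T)"
    unfolding \<Psi>_def by (rule tens_map_lin[OF R_alg T_alg R_alg T_alg cj_lin hat_lin])
  have \<Psi>i: "tens_map K R T ?c' k (\<Psi> w) = w" if "w \<in> carrier (tensor K R T)" for w
    unfolding \<Psi>_def by (rule tens_map_inverse[OF R_alg T_alg R_alg T_alg cj_lin hat_lin c' k(1) i k(2) that])
  have \<Psi>t: "\<Psi> (tens K R T a w) = tens K R T (?c a) (hat w)" if "a \<in> carrier R" "w \<in> carrier T" for a w
    unfolding \<Psi>_def by (rule tens_map_tens[OF R_alg T_alg R_alg T_alg cj_lin hat_lin that])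
  have \<Psi>l': "\<Psi> \<in> lin_maps K T3 T3" using \<Psi>l by (simp add: tensor3_def)
  have \<Psi>3: "\<Psi> (t3 a b c) = t3 (?c a) (?c b) (\<rho> c)" if "a \<in> carrier R" "b \<in> carrier R" "c \<in> carrier R" for a b c
    using that by (simp add: tens3_def \<Psi>t t_closed hat_tens)
  have 1: "\<delta> (hat u) = \<Psi> (\<delta> u)"
  proof (rule tensor_ext[OF k_algebra_opp[OF R_alg] R_alg T3_alg lin_maps_comp[OF \<delta>_lin hat_lin]
        lin_maps_comp[OF \<Psi>l' \<delta>_lin] _ u])
    fix r s assume "r \<in> carrier (opp R)" and s: "s \<in> carrier R"
    then have r: "r \<in> carrier R" by simp
    note rs = r s
    have "\<delta> (hat (t r s)) = M T3 (\<lambda>a b c. t3 (?c r \<otimes> a) b c) (\<rho> s)"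
      unfolding hat_tens[OF rs] by (rule \<delta>_tens) (assumption | rule lin_intros rs)+
    \<comment> \<open>The expression with \<rho> on all three components is chosen, because
      \<open>M_conj\<close> can then trade \<rho> for conjugation on the first two, which is the
      form of \<Psi>.\<close>
    also have "\<dots> = M T3 (\<lambda>a b c. t3 (?c r \<otimes> \<rho> a) (\<rho> b) (\<rho> c)) s"
      by (rule M_rho_3) (assumption | rule lin_intros rs)+
    also have "\<dots> = M T3 (\<lambda>a b c. t3 (?c r \<otimes> ?c a) (?c b) (\<rho> c)) s"
      by (rule M_conj[symmetric, of T3 "\<lambda>a b c. t3 (?c r \<otimes> a) b (\<rho> c)"]) (assumption | rule lin_intros rs)+
    also have "\<dots> = M T3 (\<lambda>a b c. \<Psi> (t3 (r \<otimes> a) b c)) s"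
    proof (rule M_cong, (assumption | rule lin_intros rs)+)
      fix a b c assume abc: "a \<in> carrier R" "b \<in> carrier R" "c \<in> carrier R"
      have "?c r \<otimes> ?c a = ?c (r \<otimes> a)" using alg_hom_mult[OF cj_hom, of a r] rs abc by simp
      then show "t3 (?c r \<otimes> ?c a) (?c b) (\<rho> c) = \<Psi> (t3 (r \<otimes> a) b c)"
        using rs abc by (simp add: \<Psi>3)
    qed
    also have "\<dots> = \<Psi> (M T3 (\<lambda>a b c. t3 (r \<otimes> a) b c) s)"
      by (rule M_comm[symmetric, OF T3_alg T3_alg \<Psi>l']) (assumption | rule lin_intros rs)+
    also have "\<dots> = \<Psi> (\<delta> (t r s))" by (simp add: \<delta>_tens rs)
    finally show "\<delta> (hat (t r s)) = \<Psi> (\<delta> (t r s))" .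
  qed
  have 2: "tens K R T \<one> (hat u) = \<Psi> (tens K R T \<one> u)"
    using u g_closed by (simp add: \<Psi>t g_inv)
  have c1: "\<delta> u \<in> carrier (tensor K R T)" using lin_maps_closed[OF \<delta>_lin u] by (simp add: tensor3_def)
  have c2: "tens K R T \<one> u \<in> carrier (tensor K R T)" by (assumption | rule lin_intros u)+
  have "\<delta> u = tens K R T \<one> u \<longleftrightarrow> \<Psi> (\<delta> u) = \<Psi> (tens K R T \<one> u)"
    using \<Psi>i[OF c1] \<Psi>i[OF c2] by metis
  then show ?thesis using u by (simp add: H_carrier 1 2 hat_closed)
qed

text \<open>Bijectivity on H uses both directions of \<open>hat_H_iff\<close>: one keeps the map
  inside H, the other keeps its inverse there.\<close>

lemma hat_auto: "hat \<in> alg_auto K H"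
proof -
  obtain k where k: "k \<in> lin_maps K T T" "\<And>u. u \<in> carrier T \<Longrightarrow> k (hat u) = u"
    "\<And>u. u \<in> carrier T \<Longrightarrow> hat (k u) = u" by (rule hat_inverse) blast
  have hc: "hat u \<in> carrier H" if "u \<in> carrier H" for u using that by (simp add: hat_H_iff)
  have kc: "k u \<in> carrier H" if "u \<in> carrier H" for u
    using that hat_H_iff[OF lin_maps_closed[OF k(1) H_T[OF that]]] k(3) by simp
  have "hat \<in> alg_hom K H H"
    by (rule alg_homI[OF lin_into_H[OF lin_H[OF hat_lin] hc]])
      (use alg_hom_one[OF hat_hom] alg_hom_mult[OF hat_hom] in simp_all)
  moreover have "bij_betw hat (carrier H) (carrier H)"
    by (rule bij_betw_byWitness[of _ k]) (auto simp: k hc kc)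
  ultimately show ?thesis by (simp add: alg_iso_def)
qed

end

section \<open>Morphisms of Hopf-Galois algebras\<close>

lemma lin_maps_diff:
  assumes "k_algebra K A" "k_algebra K B" "f \<in> lin_maps K A B" "g \<in> lin_maps K A B"
  shows "(\<lambda>x. f x \<ominus>\<^bsub>B\<^esub> g x) \<in> lin_maps K A B"
proof -
  interpret B: k_algebra K B by fact
  have "(\<lambda>x. f x \<oplus>\<^bsub>B\<^esub> (\<ominus>\<^bsub>K\<^esub> \<one>\<^bsub>K\<^esub>) \<odot>\<^bsub>B\<^esub> g x) \<in> lin_maps K A B"
    by (intro lin_maps_sum[OF assms(1-3)] lin_maps_scale[OF assms(1,2) _ assms(4)]) simp
  then show ?thesis
    by (rule lin_maps_cong[OF _ _ assms(1)])
      (simp add: a_minus_def B.smult_l_minus lin_maps_closed[OF assms(4)])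
qed

lemma alg_hom_opp: "i \<in> alg_hom K A B \<Longrightarrow> i \<in> alg_hom K (opp A) (opp B)"
  by (auto simp: alg_hom_def ring_hom_def)

text \<open>An automorphism that rescales g rescales its inverse by the inverse scalar. The relation
  is stated with s on the side of \<rho>(g'), so no scalar has to be inverted, and a conjugate keeps
  no trace of s.\<close>

lemma (in k_algebra) scaled_conj:
  assumes r: "\<rho> \<in> alg_hom K A A" and c: "g \<in> carrier A" "g' \<in> carrier A" "x \<in> carrier A" "s \<in> carrier K"
    and inv: "g \<otimes>\<^bsub>A\<^esub> g' = \<one>\<^bsub>A\<^esub>" "g' \<otimes>\<^bsub>A\<^esub> g = \<one>\<^bsub>A\<^esub>" and s: "\<rho> g = s \<odot>\<^bsub>A\<^esub> g"
  shows "s \<odot>\<^bsub>A\<^esub> \<rho> g' = g'" "\<rho> (g \<otimes>\<^bsub>A\<^esub> x \<otimes>\<^bsub>A\<^esub> g') = g \<otimes>\<^bsub>A\<^esub> \<rho> x \<otimes>\<^bsub>A\<^esub> g'"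
proof -
  note rc[simp] = lin_maps_closed[OF alg_hom_lin[OF r]]
  note [simp] = c
  have "g' = \<rho> (g' \<otimes>\<^bsub>A\<^esub> g) \<otimes>\<^bsub>A\<^esub> g'" by (simp add: inv alg_hom_one[OF r])
  also have "\<dots> = \<rho> g' \<otimes>\<^bsub>A\<^esub> (s \<odot>\<^bsub>A\<^esub> g) \<otimes>\<^bsub>A\<^esub> g'" by (simp add: alg_hom_mult[OF r] s)
  also have "\<dots> = s \<odot>\<^bsub>A\<^esub> \<rho> g'"
    by (simp add: smult_mult_left smult_mult_right A.m_assoc inv)
  finally show g': "s \<odot>\<^bsub>A\<^esub> \<rho> g' = g'" by simp
  have "\<rho> (g \<otimes>\<^bsub>A\<^esub> x \<otimes>\<^bsub>A\<^esub> g') = g \<otimes>\<^bsub>A\<^esub> \<rho> x \<otimes>\<^bsub>A\<^esub> (s \<odot>\<^bsub>A\<^esub> \<rho> g')"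
    by (simp add: alg_hom_mult[OF r] s smult_mult_left smult_mult_right)
  then show "\<rho> (g \<otimes>\<^bsub>A\<^esub> x \<otimes>\<^bsub>A\<^esub> g') = g \<otimes>\<^bsub>A\<^esub> \<rho> x \<otimes>\<^bsub>A\<^esub> g'" by (simp add: g')
qed

text \<open>Negation is defined through the carrier of the record, so subtraction is not literally
  shared between H and \<open>T\<close>, unlike the operations in \<open>H_simps\<close>.\<close>

lemma (in hopf_gal) H_minus:
  assumes "x \<in> carrier H" "y \<in> carrier H"
  shows "x \<ominus>\<^bsub>H\<^esub> y = x \<ominus>\<^bsub>T\<^esub> y"
  by (rule lin_maps_minus[OF H_alg T_alg lin_H_T[OF lin_maps_id] assms])

text \<open>Morphisms of Hopf-Galois algebras. The main instance is the canonical map from R to A;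
  the identity of R is a second one, needed for the element c'.\<close>

locale hg_map = R: hopf_gal K R \<mu> f + A: hopf_gal K A \<mu>A fA
  for K :: "'k ring" and R :: "('k, 'a) module" (structure) and \<mu> f and A :: "('k, 'b) module" and \<mu>A fA +
  fixes i :: "'a \<Rightarrow> 'b"
  assumes i_hom: "i \<in> alg_hom K R A"
    and mu_i: "\<And>r. r \<in> carrier R \<Longrightarrow>
      \<mu>A (i r) = tens3_lift K (tensor3 K A) (\<lambda>a b c. tens3 K A (i a) (i b) (i c)) (\<mu> r)"
begin

lemma i_lin: "i \<in> lin_maps K R A" by (rule alg_hom_lin[OF i_hom])
lemma lin_i [lin_intros]: "G \<in> lin_maps K C R \<Longrightarrow> (\<lambda>z. i (G z)) \<in> lin_maps K C A"
  by (rule lin_maps_comp[OF i_lin])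
lemma i_closed [lin_intros]: "r \<in> carrier R \<Longrightarrow> i r \<in> carrier A" by (rule lin_maps_closed[OF i_lin])

lemma M_i:
  assumes D: "k_algebra K D" and F: "trilin K A D F" and r: "r \<in> carrier R"
  shows "A.M D F (i r) = R.M D (\<lambda>a b c. F (i a) (i b) (i c)) r"
proof -
  have tri: "trilin K R (tensor3 K A) (\<lambda>a b c. tens3 K A (i a) (i b) (i c))"
    by (assumption | rule lin_intros)+
  note Fl = tens3_lift_lin[OF A.R_alg D F]
  have "tens3_lift K D F (R.M (tensor3 K A) (\<lambda>a b c. tens3 K A (i a) (i b) (i c)) r)
    = R.M D (\<lambda>a b c. tens3_lift K D F (tens3 K A (i a) (i b) (i c))) r"
    by (rule R.M_comm[OF A.T3_alg D Fl tri r])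
  also have "\<dots> = R.M D (\<lambda>a b c. F (i a) (i b) (i c)) r"
    by (rule R.M_cong[OF D trilin_comp[OF tri Fl] r]) (simp add: tens3_lift_tens3[OF A.R_alg D F] i_closed)
  finally show ?thesis by (simp add: A.M_def mu_i r) (simp add: R.M_def)
qed

definition "j = tens_map K (opp A) A i i"

lemma j_hom: "j \<in> alg_hom K R.T A.T"
  unfolding j_def
  by (rule tens_map_hom[OF k_algebra_opp[OF A.R_alg] A.R_alg k_algebra_opp[OF R.R_alg] R.R_alg
        alg_hom_opp[OF i_hom] i_hom])

lemma j_lin: "j \<in> lin_maps K R.T A.T" by (rule alg_hom_lin[OF j_hom])
lemma lin_j [lin_intros]: "G \<in> lin_maps K C R.T \<Longrightarrow> (\<lambda>z. j (G z)) \<in> lin_maps K C A.T"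
  by (rule lin_maps_comp[OF j_lin])
lemma j_closed [lin_intros]: "u \<in> carrier R.T \<Longrightarrow> j u \<in> carrier A.T" by (rule lin_maps_closed[OF j_lin])

lemma j_tens: "x \<in> carrier R \<Longrightarrow> y \<in> carrier R \<Longrightarrow> j (R.t x y) = A.t (i x) (i y)"
  unfolding j_def
  using tens_map_tens[OF k_algebra_opp[OF A.R_alg] A.R_alg k_algebra_opp[OF R.R_alg] R.R_alg, of i i x y] i_lin
  by simp

lemma L_j:
  assumes D: "k_algebra K D" and F: "bilin K A A D F" and u: "u \<in> carrier R.T"
  shows "A.L D F (j u) = R.L D (\<lambda>x y. F (i x) (i y)) u"
proof (rule tensor_ext[OF k_algebra_opp[OF R.R_alg] R.R_alg D _ _ _ u])
  note a = A.lin_bilin[OF F]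
  show "(\<lambda>u. A.L D F (j u)) \<in> lin_maps K R.T D" by (assumption | rule lin_intros D F)+
  have b: "bilin K R R D (\<lambda>x y. F (i x) (i y))" by (assumption | rule lin_intros a D)+
  then show "R.L D (\<lambda>x y. F (i x) (i y)) \<in> lin_maps K R.T D" by (rule R.lin_L[OF D lin_maps_id])
  fix x y assume "x \<in> carrier (opp R)" and y: "y \<in> carrier R"
  then have x: "x \<in> carrier R" by simp
  show "A.L D F (j (R.t x y)) = R.L D (\<lambda>x y. F (i x) (i y)) (R.t x y)"
    using x y by (simp add: j_tens A.L_tens[OF D F] R.L_tens[OF D b] i_closed)
qed

lemma j_H:
  assumes u: "u \<in> carrier R.H"
  shows "j u \<in> carrier A.H"
proof (rule A.H_I)
  note uT = R.H_T[OF u]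
  note a = A.T3_alg uT
  show "j u \<in> carrier A.T" by (rule j_closed[OF uT])
  have "A.L A.T3 (\<lambda>x y. A.M A.T3 (\<lambda>a b c. A.t3 (x \<otimes>\<^bsub>A\<^esub> a) b c) y) (j u)
    = R.L A.T3 (\<lambda>x y. A.M A.T3 (\<lambda>a b c. A.t3 (i x \<otimes>\<^bsub>A\<^esub> a) b c) (i y)) u"
    by (rule L_j) (assumption | rule lin_intros a)+
  also have "\<dots> = R.L A.T3 (\<lambda>x y. R.M A.T3 (\<lambda>a b c. A.t3 (i (x \<otimes> a)) (i b) (i c)) y) u"
  proof (rule R.L_cong, (assumption | rule lin_intros a | simp)+)
    fix x y assume xy: "x \<in> carrier R" "y \<in> carrier R"
    have "A.M A.T3 (\<lambda>a b c. A.t3 (i x \<otimes>\<^bsub>A\<^esub> a) b c) (i y)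
      = R.M A.T3 (\<lambda>a b c. A.t3 (i x \<otimes>\<^bsub>A\<^esub> i a) (i b) (i c)) y"
      by (rule M_i) (assumption | rule lin_intros a xy)+
    also have "\<dots> = R.M A.T3 (\<lambda>a b c. A.t3 (i (x \<otimes> a)) (i b) (i c)) y"
      by (rule R.M_cong) (assumption | rule lin_intros a xy | simp add: alg_hom_mult[OF i_hom] xy)+
    finally show "A.M A.T3 (\<lambda>a b c. A.t3 (i x \<otimes>\<^bsub>A\<^esub> a) b c) (i y)
      = R.M A.T3 (\<lambda>a b c. A.t3 (i (x \<otimes> a)) (i b) (i c)) y" .
  qed
  also have "\<dots> = R.L A.T3 (\<lambda>x y. A.t3 (i \<one>) (i x) (i y)) u"
    by (rule R.H_rule[OF A.T3_alg _ u, of "\<lambda>a b c. A.t3 (i a) (i b) (i c)"]) (assumption | rule lin_intros a)+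
  also have "\<dots> = A.L A.T3 (\<lambda>x y. A.t3 (i \<one>) x y) (j u)"
    by (rule L_j[symmetric]) (assumption | rule lin_intros a)+
  finally show "A.L A.T3 (\<lambda>x y. A.M A.T3 (\<lambda>a b c. A.t3 (x \<otimes>\<^bsub>A\<^esub> a) b c) y) (j u)
    = A.L A.T3 (\<lambda>x y. A.t3 \<one>\<^bsub>A\<^esub> x y) (j u)" by (simp add: alg_hom_one[OF i_hom])
qed

lemma j_hom_H: "j \<in> alg_hom K R.H A.H"
  by (rule alg_homI[OF A.lin_into_H[OF R.lin_H[OF j_lin] j_H]])
    (use alg_hom_one[OF j_hom] alg_hom_mult[OF j_hom] in simp_all)

text \<open>\<open>M_i\<close> moves \<mu> along i, so the comultiplication formula for j u is the
  formula for u with i applied to every component.\<close>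

lemma j_\<Delta>:
  assumes u: "u \<in> carrier R.H"
  shows "A.\<Delta> (j u) = tens_map K A.H A.H j j (R.\<Delta> u)"
proof -
  note uT = R.H_T[OF u]
  note a = A.HH_alg uT
  note jl = alg_hom_lin[OF j_hom_H]
  let ?F = "\<lambda>p q. A.tH (A.P (j p)) (A.P (j q))"
  have b: "bilin K R.T R.T A.HH ?F" by (assumption | rule lin_intros a)+
  have "tens_map K A.H A.H j j (R.\<Delta> u) = R.D2 A.HH ?F u"
    unfolding tens_map_def
    by (rule R.\<Delta>_lift[OF A.HH_alg tens_map_bilin[OF A.H_alg A.H_alg jl jl] b u]) (simp add: A.P_id j_H)
  also have "\<dots> = R.L A.HH (\<lambda>x y. A.M A.HH (\<lambda>a b c. A.tH (A.P (A.t (i x) a)) (A.P (A.t b c))) (i y)) u"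
    unfolding R.D2_def
  proof (rule R.L_cong, (assumption | rule lin_intros a | simp)+)
    fix x y assume xy: "x \<in> carrier R" "y \<in> carrier R"
    have "A.M A.HH (\<lambda>a b c. A.tH (A.P (A.t (i x) a)) (A.P (A.t b c))) (i y)
      = R.M A.HH (\<lambda>a b c. A.tH (A.P (A.t (i x) (i a))) (A.P (A.t (i b) (i c)))) y"
      by (rule M_i) (assumption | rule lin_intros a xy)+
    also have "\<dots> = R.M A.HH (\<lambda>a b c. ?F (R.t x a) (R.t b c)) y"
      by (rule R.M_cong) (assumption | rule lin_intros a xy | simp add: j_tens xy)+
    finally show "R.M A.HH (\<lambda>a b c. ?F (R.t x a) (R.t b c)) y
      = A.M A.HH (\<lambda>a b c. A.tH (A.P (A.t (i x) a)) (A.P (A.t b c))) (i y)" by simp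
  qed
  also have "\<dots> = A.\<Delta> (j u)"
    unfolding A.\<Delta>_def A.D2_def by (rule L_j[symmetric]) (assumption | rule lin_intros a)+
  finally show ?thesis by simp
qed

text \<open>The map i preserves products and the unit, so x y is the same scalar in both algebras,
  and the functional on A recovers it.\<close>

lemma j_\<epsilon>:
  assumes u: "u \<in> carrier R.H"
  shows "A.\<epsilon> (j u) = R.\<epsilon> u"
proof -
  note uT = R.H_T[OF u]
  have "A.\<epsilon> (j u) \<odot>\<^bsub>A\<^esub> \<one>\<^bsub>A\<^esub> = A.mm (j u)" by (rule A.mm_scalar[OF j_H[OF u], symmetric])
  also have "\<dots> = R.L A (\<lambda>x y. i x \<otimes>\<^bsub>A\<^esub> i y) u" by (rule L_j[OF A.R_alg A.mm_bilin uT])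
  also have "\<dots> = R.L A (\<lambda>x y. i (x \<otimes> y)) u"
    by (rule R.L_cong) (assumption | rule lin_intros uT | simp add: alg_hom_mult[OF i_hom])+
  also have "\<dots> = i (R.mm u)" by (rule R.L_comm[OF R.R_alg A.R_alg i_lin R.mm_bilin uT, symmetric])
  also have "\<dots> = R.\<epsilon> u \<odot>\<^bsub>A\<^esub> \<one>\<^bsub>A\<^esub>"
    unfolding R.mm_scalar[OF u]
    by (simp add: lin_maps_smult[OF i_lin] R.\<epsilon>_closed[OF uT] alg_one_closed[OF R.R_alg] alg_hom_one[OF i_hom])
  finally have "fA (A.\<epsilon> (j u) \<odot>\<^bsub>A\<^esub> \<one>\<^bsub>A\<^esub>) = fA (R.\<epsilon> u \<odot>\<^bsub>A\<^esub> \<one>\<^bsub>A\<^esub>)" by simp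
  then show ?thesis
    by (simp add: A.f_scalar A.\<epsilon>_closed[OF j_closed[OF uT]] R.\<epsilon>_closed[OF uT])
qed

lemma grouplike_i:
  assumes g: "R.grouplike g g'"
  shows "A.grouplike (i g) (i g')"
proof -
  have c: "g \<in> carrier R" "g' \<in> carrier R" "g \<otimes> g' = \<one>" "g' \<otimes> g = \<one>"
    using g by (auto simp: R.grouplike_def)
  have "\<mu>A (i g) = A.t3 (i g) (i g') (i g)"
    unfolding mu_i[OF c(1)] R.M_def[symmetric]
    by (rule R.M_grouplike[OF A.T3_alg g]) (assumption | rule lin_intros)+
  then show ?thesis
    using alg_hom_mult[OF i_hom c(1,2)] alg_hom_mult[OF i_hom c(2,1)] c
    by (simp add: A.grouplike_def i_closed alg_hom_one[OF i_hom])
qed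

text \<open>For u = r \<otimes> s the left product is r g' \<otimes> x s - r g' x \<otimes> s.
  Pulling x to the right in the other product gives r g' \<otimes> x s - \<rho>(r) g' x \<otimes>
  \<rho>(s). The first terms coincide, and the second ones differ by \<rho> \<otimes> \<rho>, which
  is the identity on H.\<close>

lemma skew_commute:
  assumes r: "\<rho> \<in> alg_hom K R R"
    and inv: "\<And>u. u \<in> carrier R.H \<Longrightarrow> R.L R.T (\<lambda>x y. R.t (\<rho> x) (\<rho> y)) u = u"
    and g: "g \<in> carrier R" "g' \<in> carrier R" "g' \<otimes> g = \<one>"
    and conj: "\<And>r. r \<in> carrier R \<Longrightarrow> \<rho> (g \<otimes> r \<otimes> g') = g \<otimes> \<rho> r \<otimes> g'"
    and x: "x \<in> carrier A" and xr: "\<And>r. r \<in> carrier R \<Longrightarrow> x \<otimes>\<^bsub>A\<^esub> i r = i (\<rho> r) \<otimes>\<^bsub>A\<^esub> x"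
    and u: "u \<in> carrier R.H"
  defines "e \<equiv> A.t (i g') x \<ominus>\<^bsub>A.T\<^esub> A.t (i g' \<otimes>\<^bsub>A\<^esub> x) \<one>\<^bsub>A\<^esub>"
  shows "e \<otimes>\<^bsub>A.T\<^esub> j u = j (R.L R.T (\<lambda>r s. R.t (g \<otimes> r \<otimes> g') (\<rho> s)) u) \<otimes>\<^bsub>A.T\<^esub> e"
proof -
  interpret RR: k_algebra K R by (rule R.R_alg)
  interpret AA: k_algebra K A by (rule A.R_alg)
  interpret AT: k_algebra K A.T by (rule A.T_alg)
  note uT = R.H_T[OF u]
  note rl = lin_maps_comp[OF alg_hom_lin[OF r]] and rc = lin_maps_closed[OF alg_hom_lin[OF r]]
  have e: "e \<in> carrier A.T" unfolding e_def by (assumption | rule lin_intros g x)+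
  define k where "k w = R.L R.T (\<lambda>r s. R.t (g \<otimes> r \<otimes> g') (\<rho> s)) w" for w
  define G1 where "G1 w = R.L A.T (\<lambda>r s. A.t (i (r \<otimes> g')) (x \<otimes>\<^bsub>A\<^esub> i s)) w" for w
  define G2 where "G2 w = R.L A.T (\<lambda>r s. A.t (i (r \<otimes> g') \<otimes>\<^bsub>A\<^esub> x) (i s)) w" for w
  note a = g x rl rc
  have kl: "k \<in> lin_maps K R.T R.T" unfolding k_def[abs_def] by (assumption | rule lin_intros a | simp)+
  have G1l: "G1 \<in> lin_maps K R.T A.T" unfolding G1_def[abs_def] by (assumption | rule lin_intros a | simp)+
  have G2l: "G2 \<in> lin_maps K R.T A.T" unfolding G2_def[abs_def] by (assumption | rule lin_intros a | simp)+
  have kt: "k (R.t r s) = R.t (g \<otimes> r \<otimes> g') (\<rho> s)" if "r \<in> carrier R" "s \<in> carrier R" for r s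
    unfolding k_def by (rule R.L_tens) (assumption | rule lin_intros a that | simp)+
  have G1t: "G1 (R.t r s) = A.t (i (r \<otimes> g')) (x \<otimes>\<^bsub>A\<^esub> i s)" if "r \<in> carrier R" "s \<in> carrier R" for r s
    unfolding G1_def by (rule R.L_tens) (assumption | rule lin_intros a that | simp)+
  have G2t: "G2 (R.t r s) = A.t (i (r \<otimes> g') \<otimes>\<^bsub>A\<^esub> x) (i s)" if "r \<in> carrier R" "s \<in> carrier R" for r s
    unfolding G2_def by (rule R.L_tens) (assumption | rule lin_intros a that | simp)+
  note ml = lin_maps_minus[OF A.T_alg A.T_alg AT.mult_left_lin] lin_maps_minus[OF A.T_alg A.T_alg AT.mult_right_lin]
  have 1: "e \<otimes>\<^bsub>A.T\<^esub> j u = G1 u \<ominus>\<^bsub>A.T\<^esub> G2 u"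
  proof (rule tensor_ext[OF k_algebra_opp[OF R.R_alg] R.R_alg A.T_alg _ lin_maps_diff[OF R.T_alg A.T_alg G1l G2l] _ uT])
    show "(\<lambda>u. e \<otimes>\<^bsub>A.T\<^esub> j u) \<in> lin_maps K R.T A.T" by (assumption | rule lin_intros e)+
    fix r s assume "r \<in> carrier (opp R)" and s: "s \<in> carrier R"
    then have r: "r \<in> carrier R" by simp
    note rs = r s
    have "e \<otimes>\<^bsub>A.T\<^esub> j (R.t r s) = A.t (i r \<otimes>\<^bsub>A\<^esub> i g') (x \<otimes>\<^bsub>A\<^esub> i s) \<ominus>\<^bsub>A.T\<^esub>
        A.t (i r \<otimes>\<^bsub>A\<^esub> (i g' \<otimes>\<^bsub>A\<^esub> x)) (\<one>\<^bsub>A\<^esub> \<otimes>\<^bsub>A\<^esub> i s)"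
      unfolding e_def using rs g x by (simp add: j_tens ml A.t_closed A.t_mult i_closed)
    also have "\<dots> = G1 (R.t r s) \<ominus>\<^bsub>A.T\<^esub> G2 (R.t r s)"
      using rs g x by (simp add: G1t G2t alg_hom_mult[OF i_hom] i_closed AA.A.m_assoc)
    finally show "e \<otimes>\<^bsub>A.T\<^esub> j (R.t r s) = G1 (R.t r s) \<ominus>\<^bsub>A.T\<^esub> G2 (R.t r s)" .
  qed
  let ?rr = "\<lambda>u. R.L R.T (\<lambda>x y. R.t (\<rho> x) (\<rho> y)) u"
  have rrl: "?rr \<in> lin_maps K R.T R.T" by (assumption | rule lin_intros a | simp)+
  have rrt: "?rr (R.t r s) = R.t (\<rho> r) (\<rho> s)" if "r \<in> carrier R" "s \<in> carrier R" for r s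
    by (rule R.L_tens) (assumption | rule lin_intros a that | simp)+
  \<comment> \<open>Only the second term picks up \<open>?rr\<close>, the bracket form of \<rho>
    \<otimes> \<rho>. The hypothesis on H removes it at the end, so the comparison can be made on
    pure tensors of the ambient algebra.\<close>
  have 2: "j (k u) \<otimes>\<^bsub>A.T\<^esub> e = G1 u \<ominus>\<^bsub>A.T\<^esub> G2 (?rr u)"
  proof (rule tensor_ext[OF k_algebra_opp[OF R.R_alg] R.R_alg A.T_alg _
        lin_maps_diff[OF R.T_alg A.T_alg G1l lin_maps_comp[OF G2l rrl]] _ uT])
    show "(\<lambda>u. j (k u) \<otimes>\<^bsub>A.T\<^esub> e) \<in> lin_maps K R.T A.T" by (assumption | rule lin_intros kl e)+
    fix r s assume "r \<in> carrier (opp R)" and s: "s \<in> carrier R"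
    then have r: "r \<in> carrier R" by simp
    note rs = r s
    let ?c = "g \<otimes> r \<otimes> g'"
    have c: "?c \<in> carrier R" using rs g by simp
    have i1: "g' \<otimes> ?c = r \<otimes> g'"
      using rs g by (simp add: RR.A.m_assoc[symmetric])
    have "i g' \<otimes>\<^bsub>A\<^esub> x \<otimes>\<^bsub>A\<^esub> i ?c = i g' \<otimes>\<^bsub>A\<^esub> (i (g \<otimes> \<rho> r \<otimes> g') \<otimes>\<^bsub>A\<^esub> x)"
      using rs g x c by (simp add: AA.A.m_assoc i_closed xr conj)
    also have "\<dots> = i (g' \<otimes> (g \<otimes> \<rho> r \<otimes> g')) \<otimes>\<^bsub>A\<^esub> x"
      using rs g x rc by (simp add: alg_hom_mult[OF i_hom] i_closed AA.A.m_assoc)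
    also have "g' \<otimes> (g \<otimes> \<rho> r \<otimes> g') = \<rho> r \<otimes> g'"
      using rs g rc by (simp add: RR.A.m_assoc[symmetric])
    finally have i2: "i g' \<otimes>\<^bsub>A\<^esub> x \<otimes>\<^bsub>A\<^esub> i ?c = i (\<rho> r \<otimes> g') \<otimes>\<^bsub>A\<^esub> x" .
    have "j (k (R.t r s)) \<otimes>\<^bsub>A.T\<^esub> e = A.t (i g' \<otimes>\<^bsub>A\<^esub> i ?c) (i (\<rho> s) \<otimes>\<^bsub>A\<^esub> x) \<ominus>\<^bsub>A.T\<^esub>
        A.t (i g' \<otimes>\<^bsub>A\<^esub> x \<otimes>\<^bsub>A\<^esub> i ?c) (i (\<rho> s) \<otimes>\<^bsub>A\<^esub> \<one>\<^bsub>A\<^esub>)"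
      unfolding e_def kt[OF rs] using rs g x c rc by (simp add: j_tens ml A.t_closed A.t_mult i_closed)
    also have "\<dots> = A.t (i (r \<otimes> g')) (x \<otimes>\<^bsub>A\<^esub> i s) \<ominus>\<^bsub>A.T\<^esub>
        A.t (i (\<rho> r \<otimes> g') \<otimes>\<^bsub>A\<^esub> x) (i (\<rho> s))"
      unfolding i2 using rs g x c rc by (simp add: xr i_closed alg_hom_mult[OF i_hom, symmetric] i1)
    also have "\<dots> = G1 (R.t r s) \<ominus>\<^bsub>A.T\<^esub> G2 (?rr (R.t r s))"
      unfolding rrt[OF rs] using rs rc by (simp add: G1t G2t)
    finally show "j (k (R.t r s)) \<otimes>\<^bsub>A.T\<^esub> e = G1 (R.t r s) \<ominus>\<^bsub>A.T\<^esub> G2 (?rr (R.t r s))" .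
  qed
  show ?thesis using 1 2 unfolding inv[OF u] k_def by simp
qed

end

text \<open>Makes \<open>skew_commute\<close> applicable to c inside R itself.\<close>

lemma (in hopf_gal) hg_map_id: "hg_map K R \<mu> f R \<mu> f (\<lambda>x. x)"
proof -
  have "(\<lambda>x. x) \<in> alg_hom K R R" by (rule alg_homI) simp_all
  then show ?thesis
    by unfold_locales (simp_all add: M_tens3[unfolded M_def])
qed

section \<open>Transport of Hopf algebra structures\<close>

lemma transport_lift:
  assumes B: "k_algebra K B" and C: "k_algebra K C" and D: "k_algebra K D" and p: "\<phi> \<in> lin_maps K C B"
    and F: "bilin K B B D F" and u: "u \<in> carrier (tensor K C C)"
  shows "tens_lift K D F (tens_map K B B \<phi> \<phi> u) = tens_lift K D (\<lambda>a b. F (\<phi> a) (\<phi> b)) u"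
proof -
  have "tens_lift K D F (tens_map K B B \<phi> \<phi> u)
    = tens_lift K D (\<lambda>a b. tens_lift K D F (tens K B B (\<phi> a) (\<phi> b))) u"
    unfolding tens_map_def
    by (rule tens_lift_comm[OF C C k_algebra_tensor[OF B B] D tens_lift_lin[OF B B D F]
          tens_map_bilin[OF B B p p] u])
  also have "\<dots> = tens_lift K D (\<lambda>a b. F (\<phi> a) (\<phi> b)) u"
    by (rule tens_lift_cong[OF C C D bilin_comp[OF tens_map_bilin[OF B B p p] tens_lift_lin[OF B B D F]] _ u])
      (simp add: tens_lift_tens[OF B B D F] lin_maps_closed[OF p])
  finally show ?thesis .
qed

lemma bilin_pull:
  assumes "bilin K B B D F" "\<phi> \<in> lin_maps K C B"
  shows "bilin K C C D (\<lambda>a b. F (\<phi> a) (\<phi> b))"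
  by (rule bilinI)
    (use lin_maps_comp[OF bilin_right[OF assms(1)] assms(2)] lin_maps_comp[OF bilin_left[OF assms(1)] assms(2)]
      lin_maps_closed[OF assms(2)] in auto)

text \<open>A pair of mutually inverse algebra maps suffices to carry over all of the structure. No
  compatibility with coproducts is assumed: the structure on B is defined so that \<phi> respects
  it.\<close>

lemma hopf_algebra_transport:
  assumes B: "k_algebra K B" and H: "hopf_algebra K C \<Delta> \<epsilon>"
    and p: "\<phi> \<in> alg_hom K C B" and q: "\<psi> \<in> alg_hom K B C"
    and pq: "\<And>b. b \<in> carrier B \<Longrightarrow> \<phi> (\<psi> b) = b" and qp: "\<And>c. c \<in> carrier C \<Longrightarrow> \<psi> (\<phi> c) = c"
  defines "\<Delta>' \<equiv> \<lambda>b. tens_map K B B \<phi> \<phi> (\<Delta> (\<psi> b))" and "\<epsilon>' \<equiv> \<lambda>b. \<epsilon> (\<psi> b)"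
  shows "hopf_algebra K B \<Delta>' \<epsilon>'" "\<phi> \<in> hopf_iso K C \<Delta> \<epsilon> B \<Delta>' \<epsilon>'"
proof -
  note h = H[unfolded hopf_algebra_def Let_def]
  have C: "k_algebra K C" and d: "\<Delta> \<in> alg_hom K C (tensor K C C)" and e: "\<epsilon> \<in> alg_hom K C (base_alg K)"
    using h by simp_all
  note pl = alg_hom_lin[OF p] and ql = alg_hom_lin[OF q] and dl = alg_hom_lin[OF d] and el = alg_hom_lin[OF e]
  note pc = lin_maps_closed[OF pl] and qc = lin_maps_closed[OF ql] and dc = lin_maps_closed[OF dl]
  let ?C3 = "tensor K C (tensor K C C)" and ?B3 = "tensor K B (tensor K B B)"
  let ?pp = "tens_map K B B \<phi> \<phi>"
  let ?p3 = "tens_map K B (tensor K B B) \<phi> ?pp"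
  note CC = k_algebra_tensor[OF C C] and BB = k_algebra_tensor[OF B B]
  note C3 = k_algebra_tensor[OF C CC] and B3 = k_algebra_tensor[OF B BB]
  note ppl = tens_map_lin[OF B B C C pl pl] and ppt = tens_map_tens[OF B B C C pl pl]
  note p3l = tens_map_lin[OF B BB C CC pl ppl] and p3t = tens_map_tens[OF B BB C CC pl ppl]
  note basic = B C CC BB C3 B3
  have d': "\<Delta>' \<in> alg_hom K B (tensor K B B)" unfolding \<Delta>'_def
    by (rule alg_hom_comp[OF tens_map_hom[OF B B C C p p] alg_hom_comp[OF d q]])
  have e': "\<epsilon>' \<in> alg_hom K B (base_alg K)" unfolding \<epsilon>'_def by (rule alg_hom_comp[OF e q])
  note dl' = alg_hom_lin[OF d'] and el' = alg_hom_lin[OF e']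
  \<comment> \<open>Every bracket over the new comultiplication becomes one over the old with \<phi>
    inserted. Each axiom for B is then the axiom for C with \<phi>, or a tensor power of it, pulled
    out in front.\<close>
  have lift: "tens_lift K D F (\<Delta>' x) = tens_lift K D (\<lambda>a b. F (\<phi> a) (\<phi> b)) (\<Delta> (\<psi> x))"
    if "k_algebra K D" "bilin K B B D F" "x \<in> carrier B" for D F x
    unfolding \<Delta>'_def by (rule transport_lift[OF B C that(1) pl that(2) dc[OF qc[OF that(3)]]])
  have dp: "\<Delta>' (\<phi> c) = ?pp (\<Delta> c)" if "c \<in> carrier C" for c unfolding \<Delta>'_def by (simp add: qp that)
  have ep: "\<epsilon>' (\<phi> c) = \<epsilon> c" if "c \<in> carrier C" for c unfolding \<epsilon>'_def by (simp add: qp that)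
  have coassoc: "tens_lift K ?B3 (\<lambda>a b. tens_lift K ?B3 (\<lambda>u v. tens K B (tensor K B B) u (tens K B B v b)) (\<Delta>' a)) (\<Delta>' x)
      = tens_lift K ?B3 (\<lambda>a b. tens K B (tensor K B B) a (\<Delta>' b)) (\<Delta>' x)" if x: "x \<in> carrier B" for x
  proof -
    note dx = dc[OF qc[OF x]]
    let ?F = "\<lambda>b u v. tens K B (tensor K B B) u (tens K B B v b)"
    let ?G = "\<lambda>b u v. tens K C (tensor K C C) u (tens K C C v b)"
    have F: "bilin K B B ?B3 (?F b)" if "b \<in> carrier B" for b
      by (assumption | rule lin_intros basic that)+
    have F': "(\<lambda>b. ?F b u v) \<in> lin_maps K B ?B3" if "u \<in> carrier B" "v \<in> carrier B" for u v
      by (assumption | rule lin_intros basic that)+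
    have G: "bilin K C C ?C3 (?G b)" if "b \<in> carrier C" for b
      by (assumption | rule lin_intros basic that)+
    have G': "(\<lambda>b. ?G b u v) \<in> lin_maps K C ?C3" if "u \<in> carrier C" "v \<in> carrier C" for u v
      by (assumption | rule lin_intros basic that)+
    have FF: "bilin K B B ?B3 (\<lambda>a b. tens_lift K ?B3 (?F b) (\<Delta>' a))"
      by (rule bilinI, rule tens_lift_param[OF B B B3 B F F' lin_maps_closed[OF dl']],
          assumption+, rule lin_maps_comp[OF tens_lift_lin[OF B B B3 F] dl'])
    have GG: "bilin K C C ?C3 (\<lambda>a b. tens_lift K ?C3 (?G b) (\<Delta> a))"
      by (rule bilinI, rule tens_lift_param[OF C C C3 C G G' dc],
          assumption+, rule lin_maps_comp[OF tens_lift_lin[OF C C C3 G] dl])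
    have "tens_lift K ?B3 (\<lambda>a b. tens_lift K ?B3 (?F b) (\<Delta>' a)) (\<Delta>' x)
      = tens_lift K ?B3 (\<lambda>a b. tens_lift K ?B3 (?F (\<phi> b)) (\<Delta>' (\<phi> a))) (\<Delta> (\<psi> x))"
      by (rule lift[OF B3 FF x])
    also have "\<dots> = tens_lift K ?B3 (\<lambda>a b. ?p3 (tens_lift K ?C3 (?G b) (\<Delta> a))) (\<Delta> (\<psi> x))"
    proof (rule tens_lift_cong[OF C C B3 bilin_pull[OF FF pl] _ dx])
      fix a b assume ab: "a \<in> carrier C" "b \<in> carrier C"
      have "tens_lift K ?B3 (?F (\<phi> b)) (\<Delta>' (\<phi> a)) = tens_lift K ?B3 (\<lambda>u v. ?F (\<phi> b) (\<phi> u) (\<phi> v)) (\<Delta> a)"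
        unfolding lift[OF B3 F[OF pc[OF ab(2)]] pc[OF ab(1)]] qp[OF ab(1)] ..
      also have "\<dots> = tens_lift K ?B3 (\<lambda>u v. ?p3 (?G b u v)) (\<Delta> a)"
        by (rule tens_lift_cong[OF C C B3 bilin_pull[OF F[OF pc[OF ab(2)]] pl] _ dc[OF ab(1)]])
          (simp add: p3t ppt ab tens_closed[OF C C])
      also have "\<dots> = ?p3 (tens_lift K ?C3 (?G b) (\<Delta> a))"
        by (rule tens_lift_comm[OF C C C3 B3 p3l G[OF ab(2)] dc[OF ab(1)], symmetric])
      finally show "tens_lift K ?B3 (?F (\<phi> b)) (\<Delta>' (\<phi> a)) = ?p3 (tens_lift K ?C3 (?G b) (\<Delta> a))" .
    qed
    also have "\<dots> = ?p3 (tens_lift K ?C3 (\<lambda>a b. tens_lift K ?C3 (?G b) (\<Delta> a)) (\<Delta> (\<psi> x)))"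
      by (rule tens_lift_comm[OF C C C3 B3 p3l GG dx, symmetric])
    also have "tens_lift K ?C3 (\<lambda>a b. tens_lift K ?C3 (?G b) (\<Delta> a)) (\<Delta> (\<psi> x))
      = tens_lift K ?C3 (\<lambda>a b. tens K C (tensor K C C) a (\<Delta> b)) (\<Delta> (\<psi> x))"
      using h qc[OF x] by simp
    also have "?p3 \<dots> = tens_lift K ?B3 (\<lambda>a b. ?p3 (tens K C (tensor K C C) a (\<Delta> b))) (\<Delta> (\<psi> x))"
      by (rule tens_lift_comm[OF C C C3 B3 p3l _ dx])
        (assumption | rule lin_intros basic dl dc)+
    also have "\<dots> = tens_lift K ?B3 (\<lambda>a b. tens K B (tensor K B B) (\<phi> a) (\<Delta>' (\<phi> b))) (\<Delta> (\<psi> x))"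
      by (rule tens_lift_cong[OF C C B3 _ _ dx])
        (assumption | rule lin_intros basic dl dc lin_maps_comp[OF p3l] | simp add: p3t dp dc)+
    also have "\<dots> = tens_lift K ?B3 (\<lambda>a b. tens K B (tensor K B B) a (\<Delta>' b)) (\<Delta>' x)"
      by (rule lift[OF B3 _ x, symmetric]) (assumption | rule lin_intros basic dl' lin_maps_closed[OF dl'])+
    finally show ?thesis .
  qed
  have counit: "tens_lift K B (\<lambda>a b. \<epsilon>' a \<odot>\<^bsub>B\<^esub> b) (\<Delta>' x) = x" "tens_lift K B (\<lambda>a b. \<epsilon>' b \<odot>\<^bsub>B\<^esub> a) (\<Delta>' x) = x"
    if x: "x \<in> carrier B" for x
  proof -
    note dx = dc[OF qc[OF x]]
    have ec: "\<epsilon> a \<in> carrier K" if "a \<in> carrier C" for a using lin_maps_closed[OF el that] by simp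
    have ec': "\<epsilon>' a \<in> carrier K" if "a \<in> carrier B" for a using lin_maps_closed[OF el' that] by simp
    note a = basic el el' ec ec' lin_maps_comp[OF pl]
    have "tens_lift K B (\<lambda>a b. \<epsilon>' a \<odot>\<^bsub>B\<^esub> b) (\<Delta>' x) = tens_lift K B (\<lambda>a b. \<epsilon>' (\<phi> a) \<odot>\<^bsub>B\<^esub> \<phi> b) (\<Delta> (\<psi> x))"
      by (rule lift[OF B _ x]) (assumption | rule lin_intros a)+
    also have "\<dots> = tens_lift K B (\<lambda>a b. \<phi> (\<epsilon> a \<odot>\<^bsub>C\<^esub> b)) (\<Delta> (\<psi> x))"
      by (rule tens_lift_cong[OF C C B _ _ dx])
        (assumption | rule lin_intros a pl pc lin_maps_comp[OF el'] | simp add: ep ec lin_maps_smult[OF pl])+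
    also have "\<dots> = \<phi> (tens_lift K C (\<lambda>a b. \<epsilon> a \<odot>\<^bsub>C\<^esub> b) (\<Delta> (\<psi> x)))"
      by (rule tens_lift_comm[OF C C C B pl _ dx, symmetric]) (assumption | rule lin_intros a)+
    also have "\<dots> = x" using h qc[OF x] by (simp add: pq x)
    finally show "tens_lift K B (\<lambda>a b. \<epsilon>' a \<odot>\<^bsub>B\<^esub> b) (\<Delta>' x) = x" .
    have "tens_lift K B (\<lambda>a b. \<epsilon>' b \<odot>\<^bsub>B\<^esub> a) (\<Delta>' x) = tens_lift K B (\<lambda>a b. \<epsilon>' (\<phi> b) \<odot>\<^bsub>B\<^esub> \<phi> a) (\<Delta> (\<psi> x))"
      by (rule lift[OF B _ x]) (assumption | rule lin_intros a)+
    also have "\<dots> = tens_lift K B (\<lambda>a b. \<phi> (\<epsilon> b \<odot>\<^bsub>C\<^esub> a)) (\<Delta> (\<psi> x))"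
      by (rule tens_lift_cong[OF C C B _ _ dx])
        (assumption | rule lin_intros a pl pc lin_maps_comp[OF el'] | simp add: ep ec lin_maps_smult[OF pl])+
    also have "\<dots> = \<phi> (tens_lift K C (\<lambda>a b. \<epsilon> b \<odot>\<^bsub>C\<^esub> a) (\<Delta> (\<psi> x)))"
      by (rule tens_lift_comm[OF C C C B pl _ dx, symmetric]) (assumption | rule lin_intros a)+
    also have "\<dots> = x" using h qc[OF x] by (simp add: pq x)
    finally show "tens_lift K B (\<lambda>a b. \<epsilon>' b \<odot>\<^bsub>B\<^esub> a) (\<Delta>' x) = x" .
  qed
  obtain S where S: "S \<in> lin_maps K C C" and S1: "\<And>x. x \<in> carrier C \<Longrightarrow>
      tens_lift K C (\<lambda>a b. S a \<otimes>\<^bsub>C\<^esub> b) (\<Delta> x) = \<epsilon> x \<odot>\<^bsub>C\<^esub> \<one>\<^bsub>C\<^esub>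
      \<and> tens_lift K C (\<lambda>a b. a \<otimes>\<^bsub>C\<^esub> S b) (\<Delta> x) = \<epsilon> x \<odot>\<^bsub>C\<^esub> \<one>\<^bsub>C\<^esub>"
    using h by blast
  note Sc = lin_maps_closed[OF S]
  define S' where "S' b = \<phi> (S (\<psi> b))" for b
  have Sl': "S' \<in> lin_maps K B B" unfolding S'_def[abs_def]
    by (rule lin_maps_comp[OF pl lin_maps_comp[OF S ql]])
  have Sp: "S' (\<phi> c) = \<phi> (S c)" if "c \<in> carrier C" for c by (simp add: S'_def qp that)
  have antipode: "tens_lift K B (\<lambda>a b. S' a \<otimes>\<^bsub>B\<^esub> b) (\<Delta>' x) = \<epsilon>' x \<odot>\<^bsub>B\<^esub> \<one>\<^bsub>B\<^esub>"
    "tens_lift K B (\<lambda>a b. a \<otimes>\<^bsub>B\<^esub> S' b) (\<Delta>' x) = \<epsilon>' x \<odot>\<^bsub>B\<^esub> \<one>\<^bsub>B\<^esub>" if x: "x \<in> carrier B" for x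
  proof -
    note dx = dc[OF qc[OF x]]
    note a = basic S Sl' Sc lin_maps_closed[OF Sl'] lin_maps_comp[OF pl]
    have fin: "\<phi> (\<epsilon> (\<psi> x) \<odot>\<^bsub>C\<^esub> \<one>\<^bsub>C\<^esub>) = \<epsilon>' x \<odot>\<^bsub>B\<^esub> \<one>\<^bsub>B\<^esub>"
      using lin_maps_closed[OF el qc[OF x]]
      by (simp add: \<epsilon>'_def lin_maps_smult[OF pl] alg_one_closed[OF C] alg_hom_one[OF p])
    have "tens_lift K B (\<lambda>a b. S' a \<otimes>\<^bsub>B\<^esub> b) (\<Delta>' x) = tens_lift K B (\<lambda>a b. S' (\<phi> a) \<otimes>\<^bsub>B\<^esub> \<phi> b) (\<Delta> (\<psi> x))"
      by (rule lift[OF B _ x]) (assumption | rule lin_intros a)+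
    also have "\<dots> = tens_lift K B (\<lambda>a b. \<phi> (S a \<otimes>\<^bsub>C\<^esub> b)) (\<Delta> (\<psi> x))"
      by (rule tens_lift_cong[OF C C B _ _ dx])
        (assumption | rule lin_intros a pl pc lin_maps_comp[OF Sl'] | simp add: Sp Sc alg_hom_mult[OF p])+
    also have "\<dots> = \<phi> (tens_lift K C (\<lambda>a b. S a \<otimes>\<^bsub>C\<^esub> b) (\<Delta> (\<psi> x)))"
      by (rule tens_lift_comm[OF C C C B pl _ dx, symmetric]) (assumption | rule lin_intros a)+
    finally show "tens_lift K B (\<lambda>a b. S' a \<otimes>\<^bsub>B\<^esub> b) (\<Delta>' x) = \<epsilon>' x \<odot>\<^bsub>B\<^esub> \<one>\<^bsub>B\<^esub>"
      using S1[OF qc[OF x]] fin by simp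
    have "tens_lift K B (\<lambda>a b. a \<otimes>\<^bsub>B\<^esub> S' b) (\<Delta>' x) = tens_lift K B (\<lambda>a b. \<phi> a \<otimes>\<^bsub>B\<^esub> S' (\<phi> b)) (\<Delta> (\<psi> x))"
      by (rule lift[OF B _ x]) (assumption | rule lin_intros a)+
    also have "\<dots> = tens_lift K B (\<lambda>a b. \<phi> (a \<otimes>\<^bsub>C\<^esub> S b)) (\<Delta> (\<psi> x))"
      by (rule tens_lift_cong[OF C C B _ _ dx])
        (assumption | rule lin_intros a pl pc lin_maps_comp[OF Sl'] | simp add: Sp Sc alg_hom_mult[OF p])+
    also have "\<dots> = \<phi> (tens_lift K C (\<lambda>a b. a \<otimes>\<^bsub>C\<^esub> S b) (\<Delta> (\<psi> x)))"
      by (rule tens_lift_comm[OF C C C B pl _ dx, symmetric]) (assumption | rule lin_intros a)+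
    finally show "tens_lift K B (\<lambda>a b. a \<otimes>\<^bsub>B\<^esub> S' b) (\<Delta>' x) = \<epsilon>' x \<odot>\<^bsub>B\<^esub> \<one>\<^bsub>B\<^esub>"
      using S1[OF qc[OF x]] fin by simp
  qed
  show "hopf_algebra K B \<Delta>' \<epsilon>'"
    unfolding hopf_algebra_def Let_def
    by (intro conjI ballI bexI[OF _ Sl'] B d' e' coassoc counit antipode)
  have "bij_betw \<phi> (carrier C) (carrier B)"
    by (rule bij_betw_byWitness[of _ \<psi>]) (auto simp: pq qp pc qc)
  then show "\<phi> \<in> hopf_iso K C \<Delta> \<epsilon> B \<Delta>' \<epsilon>'"
    unfolding hopf_iso_def hopf_hom_def by (simp add: p dp ep tens_map_def)
qed

section \<open>The coaction of \<open>H\<close>\<close>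

context hopf_gal begin

text \<open>The coaction r1 \<otimes> (r2 \<otimes> r3), pushed forward along i and j. The
  projection makes the second leg an element of H, where j is linear; by \<open>M_P\<close> it does
  not change the tensor.\<close>

definition "coact A B i j r = M (tensor K A B) (\<lambda>a b c. tens K A B (i a) (j (P (t b c)))) r"

lemma coact_trilin:
  assumes A: "k_algebra K A" and B: "k_algebra K B" and i: "i \<in> lin_maps K R A" and j: "j \<in> lin_maps K H B"
  shows "trilin K R (tensor K A B) (\<lambda>a b c. tens K A B (i a) (j (P (t b c))))"
  by (assumption | rule lin_intros A B i lin_maps_comp[OF j] lin_maps_closed[OF i] lin_maps_closed[OF j])+

lemma coact_hom:
  assumes A: "k_algebra K A" and B: "k_algebra K B" and i: "i \<in> alg_hom K R A" and j: "j \<in> alg_hom K H B"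
  shows "coact A B i j \<in> alg_hom K R (tensor K A B)"
proof (rule alg_homI)
  interpret A: k_algebra K A by fact
  interpret B: k_algebra K B by fact
  let ?AB = "tensor K A B"
  let ?F = "\<lambda>a b c. tens K A B (i a) (j (P (t b c)))"
  have AB: "k_algebra K ?AB" by (rule k_algebra_tensor[OF A B])
  note il = alg_hom_lin[OF i] and jl = alg_hom_lin[OF j]
  note ic = lin_maps_closed[OF il] and jc = lin_maps_closed[OF jl]
  note tri = coact_trilin[OF A B il jl]
  note a = A B AB lin_maps_comp[OF il] lin_maps_comp[OF jl] ic jc
  show "coact A B i j \<in> lin_maps K R ?AB"
    unfolding coact_def[abs_def] by (rule lin_M[OF AB lin_maps_id tri])
  have "coact A B i j \<one> = ?F \<one> \<one> \<one>" unfolding coact_def by (rule M_one[OF AB tri])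
  then show "coact A B i j \<one> = \<one>\<^bsub>?AB\<^esub>"
    using alg_hom_one[OF j] P_id[OF H_one] by (simp add: alg_hom_one[OF i] T_one tensor_one[OF A B])
  fix r s assume rs: "r \<in> carrier R" "s \<in> carrier R"
  have "coact A B i j (r \<otimes> s)
    = M ?AB (\<lambda>a b c. M ?AB (\<lambda>a' b' c'. ?F (a \<otimes> a') (b' \<otimes> b) (c \<otimes> c')) s) r"
    unfolding coact_def by (rule M_mult[OF AB tri rs])
  also have "\<dots> = M ?AB (\<lambda>a b c. M ?AB (\<lambda>a' b' c'. tens K A B (i (a \<otimes> a')) (j (P (t b c \<otimes>\<^bsub>T\<^esub> t b' c')))) s) r"
    by (rule M_cong, (assumption | rule lin_intros a rs)+, rule M_cong, (assumption | rule lin_intros a rs | simp add: t_mult)+)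
  also have "\<dots> = M ?AB (\<lambda>a b c. M ?AB (\<lambda>a' b' c'. tens K A B (i (a \<otimes> a')) (j (P (P (t b c) \<otimes>\<^bsub>T\<^esub> t b' c')))) s) r"
    by (rule M_P[symmetric, OF AB _ rs(1), of "\<lambda>a u. M ?AB (\<lambda>a' b' c'. tens K A B (i (a \<otimes> a')) (j (P (u \<otimes>\<^bsub>T\<^esub> t b' c')))) s"])
      (assumption | rule lin_intros a rs)+
  also have "\<dots> = M ?AB (\<lambda>a b c. M ?AB (\<lambda>a' b' c'. tens K A B (i (a \<otimes> a')) (j (P (P (t b c) \<otimes>\<^bsub>T\<^esub> P (t b' c'))))) s) r"
  proof (rule M_cong, (assumption | rule lin_intros a rs)+)
    fix x y z assume xyz: "x \<in> carrier R" "y \<in> carrier R" "z \<in> carrier R"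
    show "M ?AB (\<lambda>a' b' c'. tens K A B (i (x \<otimes> a')) (j (P (P (t y z) \<otimes>\<^bsub>T\<^esub> t b' c')))) s
      = M ?AB (\<lambda>a' b' c'. tens K A B (i (x \<otimes> a')) (j (P (P (t y z) \<otimes>\<^bsub>T\<^esub> P (t b' c'))))) s"
      by (rule M_P[symmetric, OF AB _ rs(2), of "\<lambda>a' u. tens K A B (i (x \<otimes> a')) (j (P (P (t y z) \<otimes>\<^bsub>T\<^esub> u)))"])
        (assumption | rule lin_intros a rs xyz)+
  qed
  also have "\<dots> = M ?AB (\<lambda>a b c. M ?AB (\<lambda>a' b' c'. ?F a b c \<otimes>\<^bsub>?AB\<^esub> ?F a' b' c') s) r"
  proof (rule M_cong, (assumption | rule lin_intros a rs)+, rule M_cong, (assumption | rule lin_intros a rs)+)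
    fix x y z x' y' z' assume h: "x \<in> carrier R" "y \<in> carrier R" "z \<in> carrier R" "x' \<in> carrier R" "y' \<in> carrier R" "z' \<in> carrier R"
    have p: "P (t y z) \<in> carrier H" "P (t y' z') \<in> carrier H" by (rule P_H, rule t_closed, fact, fact)+
    show "tens K A B (i (x \<otimes> x')) (j (P (P (t y z) \<otimes>\<^bsub>T\<^esub> P (t y' z')))) = ?F x y z \<otimes>\<^bsub>?AB\<^esub> ?F x' y' z'"
      unfolding P_id[OF H_mult[OF p]]
      using alg_hom_mult[OF j p] alg_hom_mult[OF i h(1,4)] by (simp add: tens_mult[OF A B] ic jc p h)
  qed
  also have "\<dots> = M ?AB (\<lambda>a b c. ?F a b c \<otimes>\<^bsub>?AB\<^esub> M ?AB ?F s) r"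
    by (rule M_cong, (assumption | rule lin_intros a rs)+,
        rule M_comm[symmetric, OF AB AB k_algebra.mult_right_lin[OF AB] tri rs(2)], (assumption | rule lin_intros a)+)
  also have "\<dots> = coact A B i j r \<otimes>\<^bsub>?AB\<^esub> coact A B i j s"
    unfolding coact_def
    by (rule M_comm[symmetric, OF AB AB k_algebra.mult_left_lin[OF AB] tri rs(1)]) (assumption | rule lin_intros a rs tri)+
  finally show "coact A B i j (r \<otimes> s) = coact A B i j r \<otimes>\<^bsub>?AB\<^esub> coact A B i j s" .
qed

end

context hg_auto begin

text \<open>The two summands of w use different expressions for \<mu>(\<rho>(r)). For x \<otimes> 1
  it is the one with \<rho> on the first component alone. For i g \<otimes> e it is the one with
  \<rho> on all three, where conjugation replaces \<rho> on the first two: the first conjugation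
  moves g past r1, and the rest is \<open>hat\<close> on the H part.\<close>

lemma coact_skew:
  assumes A: "k_algebra K A" and B: "k_algebra K B" and i: "i \<in> alg_hom K R A" and j: "j \<in> alg_hom K H B"
    and x: "x \<in> carrier A" and e: "e \<in> carrier B"
    and xr: "\<And>r. r \<in> carrier R \<Longrightarrow> x \<otimes>\<^bsub>A\<^esub> i r = i (\<rho> r) \<otimes>\<^bsub>A\<^esub> x"
    and eu: "\<And>u. u \<in> carrier H \<Longrightarrow> e \<otimes>\<^bsub>B\<^esub> j u = j (hat u) \<otimes>\<^bsub>B\<^esub> e"
    and r: "r \<in> carrier R"
  defines "AB \<equiv> tensor K A B"
  defines "w \<equiv> tens K A B x \<one>\<^bsub>B\<^esub> \<oplus>\<^bsub>AB\<^esub> tens K A B (i g) e"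
  shows "w \<otimes>\<^bsub>AB\<^esub> coact A B i j r = coact A B i j (\<rho> r) \<otimes>\<^bsub>AB\<^esub> w"
proof -
  interpret A: k_algebra K A by fact
  interpret B: k_algebra K B by fact
  have AB: "k_algebra K AB" unfolding AB_def by (rule k_algebra_tensor[OF A B])
  interpret AB: k_algebra K AB by (rule AB)
  interpret RR: k_algebra K R by (rule R_alg)
  let ?F = "\<lambda>a b c. tens K A B (i a) (j (P (t b c)))"
  note il = alg_hom_lin[OF i] and jl = alg_hom_lin[OF j]
  note ic = lin_maps_closed[OF il] and jc = lin_maps_closed[OF jl]
  note tri = coact_trilin[OF A B il jl, folded AB_def]
  have tl: "(\<lambda>z. tens K A B (G z) b) \<in> lin_maps K C AB" if "G \<in> lin_maps K C A" "b \<in> carrier B" for G C b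
    unfolding AB_def by (rule lin_tens_left[OF A B that])
  have tr: "(\<lambda>z. tens K A B b (G z)) \<in> lin_maps K C AB" if "G \<in> lin_maps K C B" "b \<in> carrier A" for G C b
    unfolding AB_def by (rule lin_tens_right[OF A B that])
  have tc: "tens K A B b c \<in> carrier AB" if "b \<in> carrier A" "c \<in> carrier B" for b c
    unfolding AB_def by (rule tens_closed[OF A B that])
  have tm: "tens K A B b c \<otimes>\<^bsub>AB\<^esub> tens K A B b' c' = tens K A B (b \<otimes>\<^bsub>A\<^esub> b') (c \<otimes>\<^bsub>B\<^esub> c')"
    if "b \<in> carrier A" "c \<in> carrier B" "b' \<in> carrier A" "c' \<in> carrier B" for b c b' c'
    unfolding AB_def by (rule tens_mult[OF A B that])
  have cd: "coact A B i j q = M AB ?F q" for q by (simp add: coact_def AB_def)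
  note a = A B AB lin_maps_comp[OF il] lin_maps_comp[OF jl] ic jc tl tr tc x e
  have pH: "P (t b c) \<in> carrier H" if "b \<in> carrier R" "c \<in> carrier R" for b c
    by (rule P_H[OF t_closed[OF that]])
  have hH: "hat u \<in> carrier H" if "u \<in> carrier H" for u using that by (simp add: hat_H_iff)
  have cc: "coact A B i j q \<in> carrier AB" if "q \<in> carrier R" for q
    unfolding cd by (rule M_closed[OF AB that tri])
  have 1: "tens K A B x \<one>\<^bsub>B\<^esub> \<otimes>\<^bsub>AB\<^esub> coact A B i j r = coact A B i j (\<rho> r) \<otimes>\<^bsub>AB\<^esub> tens K A B x \<one>\<^bsub>B\<^esub>"
  proof -
    have "tens K A B x \<one>\<^bsub>B\<^esub> \<otimes>\<^bsub>AB\<^esub> coact A B i j r = M AB (\<lambda>a b c. tens K A B x \<one>\<^bsub>B\<^esub> \<otimes>\<^bsub>AB\<^esub> ?F a b c) r"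
      unfolding cd by (rule M_comm[OF AB AB AB.mult_right_lin tri r]) (simp add: tc x)
    also have "\<dots> = M AB (\<lambda>a b c. ?F (\<rho> a) b c \<otimes>\<^bsub>AB\<^esub> tens K A B x \<one>\<^bsub>B\<^esub>) r"
    proof (rule M_cong[OF AB _ r])
      show "trilin K R AB (\<lambda>a b c. tens K A B x \<one>\<^bsub>B\<^esub> \<otimes>\<^bsub>AB\<^esub> ?F a b c)"
        by (assumption | rule lin_intros a)+
      show "tens K A B x \<one>\<^bsub>B\<^esub> \<otimes>\<^bsub>AB\<^esub> ?F a b c = ?F (\<rho> a) b c \<otimes>\<^bsub>AB\<^esub> tens K A B x \<one>\<^bsub>B\<^esub>"
        if "a \<in> carrier R" "b \<in> carrier R" "c \<in> carrier R" for a b c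
        using that by (simp add: tm x ic jc pH xr rho_closed)
    qed
    also have "\<dots> = M AB (\<lambda>a b c. ?F (\<rho> a) b c) r \<otimes>\<^bsub>AB\<^esub> tens K A B x \<one>\<^bsub>B\<^esub>"
      by (rule M_comm[symmetric, OF AB AB AB.mult_left_lin _ r]) (assumption | rule lin_intros a)+
    also have "M AB (\<lambda>a b c. ?F (\<rho> a) b c) r = coact A B i j (\<rho> r)"
      unfolding cd by (rule M_rho_1[symmetric, OF AB tri r])
    finally show ?thesis .
  qed
  let ?c = "\<lambda>a. g \<otimes> a \<otimes> g'"
  have 2: "coact A B i j (\<rho> r) = M AB (\<lambda>a b c. tens K A B (i (?c a)) (j (hat (P (t b c))))) r"
  proof -
    have "coact A B i j (\<rho> r) = M AB (\<lambda>a b c. ?F (\<rho> a) (\<rho> b) (\<rho> c)) r"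
      unfolding cd by (rule M_rho_3[OF AB tri r])
    also have "\<dots> = M AB (\<lambda>a b c. ?F (?c a) (?c b) (\<rho> c)) r"
      by (rule M_conj[symmetric, OF AB _ r, of "\<lambda>a b c. ?F a b (\<rho> c)"]) (assumption | rule lin_intros a)+
    also have "\<dots> = M AB (\<lambda>a b c. tens K A B (i (?c a)) (j (P (hat (t b c))))) r"
      by (rule M_cong[OF AB _ r]) (assumption | rule lin_intros a | simp add: hat_tens)+
    also have "\<dots> = M AB (\<lambda>a b c. tens K A B (i (?c a)) (j (P (hat (P (t b c)))))) r"
      by (rule M_P[symmetric, OF AB _ r, of "\<lambda>a u. tens K A B (i (?c a)) (j (P (hat u)))"])
        (assumption | rule lin_intros a)+
    also have "\<dots> = M AB (\<lambda>a b c. tens K A B (i (?c a)) (j (hat (P (t b c))))) r"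
      by (rule M_cong[OF AB _ r], (assumption | rule lin_intros a)+) (simp add: P_id hH pH)
    finally show ?thesis .
  qed
  have hl: "trilin K R AB (\<lambda>a b c. tens K A B (i (?c a)) (j (hat (P (t b c)))))"
    by (assumption | rule lin_intros a lin_into_H hH)+
  have 3: "tens K A B (i g) e \<otimes>\<^bsub>AB\<^esub> coact A B i j r = coact A B i j (\<rho> r) \<otimes>\<^bsub>AB\<^esub> tens K A B (i g) e"
  proof -
    have ge: "tens K A B (i g) e \<in> carrier AB" by (simp add: tc ic g_closed e)
    have "tens K A B (i g) e \<otimes>\<^bsub>AB\<^esub> coact A B i j r = M AB (\<lambda>a b c. tens K A B (i g) e \<otimes>\<^bsub>AB\<^esub> ?F a b c) r"
      unfolding cd by (rule M_comm[OF AB AB AB.mult_right_lin[OF ge] tri r])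
    also have "\<dots> = M AB (\<lambda>a b c. tens K A B (i (?c a)) (j (hat (P (t b c)))) \<otimes>\<^bsub>AB\<^esub> tens K A B (i g) e) r"
    proof (rule M_cong[OF AB _ r])
      show "trilin K R AB (\<lambda>a b c. tens K A B (i g) e \<otimes>\<^bsub>AB\<^esub> ?F a b c)"
        by (assumption | rule lin_intros a)+
      fix a b c assume h: "a \<in> carrier R" "b \<in> carrier R" "c \<in> carrier R"
      have "i g \<otimes>\<^bsub>A\<^esub> i a = i (?c a) \<otimes>\<^bsub>A\<^esub> i g"
        using h g_closed by (simp flip: alg_hom_mult[OF i] add: RR.A.m_assoc g_inv)
      then show "tens K A B (i g) e \<otimes>\<^bsub>AB\<^esub> ?F a b c
        = tens K A B (i (?c a)) (j (hat (P (t b c)))) \<otimes>\<^bsub>AB\<^esub> tens K A B (i g) e"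
        using h by (simp add: tm ic jc pH hH eu g_closed e)
    qed
    also have "\<dots> = coact A B i j (\<rho> r) \<otimes>\<^bsub>AB\<^esub> tens K A B (i g) e"
      unfolding 2 by (rule M_comm[symmetric, OF AB AB AB.mult_left_lin[OF ge] hl r])
    finally show ?thesis .
  qed
  show ?thesis unfolding w_def
    using 1 3 cc[OF r] cc[OF rho_closed[OF r]]
    by (simp add: AB.A.l_distr AB.A.r_distr tc x ic g_closed e)
qed

end

section \<open>The Hopf algebra of an ambiskew polynomial algebra\<close>

text \<open>The scalar \<lambda> of the theorem is called \<kappa>. The functional \<open>fA\<close>
  plays for the ambiskew algebra the part that \<open>f\<close> plays for R.\<close>

locale ambiskew_hopf = R: hopf_gal K R \<mu> f
  for K :: "'k ring" and R :: "('k, 'a) module" (structure) and \<mu> f +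
  fixes \<tau> \<omega> :: "'a \<Rightarrow> 'a" and g h c :: 'a and \<xi> \<kappa> :: 'k
    and \<mu>A :: "('k, 'a) amb \<Rightarrow> ('k, ('k, 'a) amb) tens3" and fA :: "('k, 'a) amb \<Rightarrow> 'k"
  assumes adm: "admissible K R \<mu> \<tau> \<omega> g h c \<xi>"
    and assoc: "associated_hopf_galois K R \<mu> \<tau> \<omega> g h c \<xi> \<mu>A"
    and kappa: "\<kappa> \<in> carrier K - {\<zero>\<^bsub>K\<^esub>}" and gh: "g \<otimes> h = \<kappa> \<odot> (h \<otimes> g)"
    and fA_lin: "fA \<in> lin_maps K (ambiskew K R \<tau> \<omega> c \<xi>) (base_alg K)"
    and fA_one: "fA \<one>\<^bsub>ambiskew K R \<tau> \<omega> c \<xi>\<^esub> = \<one>\<^bsub>K\<^esub>"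
begin

sublocale RR: k_algebra K R by (rule R.R_alg)

sublocale AM: ambiskew_alg K R \<tau> \<omega> c \<xi>
  by unfold_locales (use adm in \<open>simp add: admissible_def Let_def\<close>)

abbreviation "AA \<equiv> AM.A"
abbreviation "X \<equiv> AM.avar VX"
abbreviation "Y \<equiv> AM.avar VY"
abbreviation "i \<equiv> AM.ain"
abbreviation "g' \<equiv> inv\<^bsub>R\<^esub> g"
abbreviation "h' \<equiv> inv\<^bsub>R\<^esub> h"
abbreviation "gh' \<equiv> inv\<^bsub>R\<^esub> (g \<otimes> h)"

sublocale A: hopf_gal K AA \<mu>A fA
  using assoc fA_lin fA_one by unfold_locales (simp_all add: associated_hopf_galois_def Let_def)

sublocale i: hg_map K R \<mu> f AA \<mu>A fA i
  by unfold_locales (use assoc AM.ain_hom in \<open>simp_all add: associated_hopf_galois_def Let_def\<close>)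

sublocale RA: k_algebra K AA by (rule A.R_alg)

section \<open>Consequences of admissibility\<close>

lemma g_Units: "g \<in> Units R" "h \<in> Units R" and mu_g: "\<mu> g = R.t3 g g' g" "\<mu> h = R.t3 h h' h"
  using adm by (simp_all add: admissible_def Let_def quasi_central_def G0_def)

lemma gl_g: "R.grouplike g g'" and gl_h: "R.grouplike h h'"
  using g_Units mu_g RR.A.Units_closed by (simp_all add: R.grouplike_def)

lemma gh_inv: "gh' = h' \<otimes> g'"
proof (rule sym, rule RR.A.inv_unique[of _ "g \<otimes> h"])
  have gl: "R.grouplike (g \<otimes> h) (h' \<otimes> g')" by (rule R.grouplike_mult[OF gl_g gl_h])
  show "g \<otimes> h \<in> carrier R" "h' \<otimes> g' \<in> carrier R" "g \<otimes> h \<otimes> gh' = \<one>"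
    "h' \<otimes> g' \<otimes> (g \<otimes> h) = \<one>" "gh' \<in> carrier R"
    using gl RR.A.Units_r_inv[OF RR.A.Units_m_closed[OF g_Units]]
      RR.A.Units_inv_closed[OF RR.A.Units_m_closed[OF g_Units]]
    unfolding R.grouplike_def by simp_all
qed

lemma gl_gh: "R.grouplike (g \<otimes> h) gh'"
  unfolding gh_inv by (rule R.grouplike_mult[OF gl_g gl_h])

lemma sp_c: "R.skew_primitive (g \<otimes> h) gh' c"
  using adm AM.c_closed by (simp add: admissible_def Let_def R.skew_primitive_def)

lemma sp_X: "A.skew_primitive (i g) (i g') X" and sp_Y: "A.skew_primitive (i h) (i h') Y"
  using assoc AM.avar_closed by (simp_all add: associated_hopf_galois_def Let_def A.skew_primitive_def)

sublocale T1: hg_auto K R \<mu> f \<tau> g g'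
  by unfold_locales
    (use adm AM.tau_auto gl_g in \<open>auto simp: admissible_def Let_def conj_by_def\<close>)

sublocale T2: hg_auto K R \<mu> f \<omega> h h'
  by unfold_locales
    (use adm AM.omega_auto gl_h in \<open>auto simp: admissible_def Let_def conj_by_def\<close>)

lemma tau_h: "\<tau> h = \<xi> \<odot> h" and omega_g: "\<omega> g = inv\<^bsub>K\<^esub> \<xi> \<odot> g"
  using adm by (simp_all add: admissible_def Let_def)

lemma xi_inv: "inv\<^bsub>K\<^esub> \<xi> \<in> carrier K" "inv\<^bsub>K\<^esub> \<xi> \<otimes>\<^bsub>K\<^esub> \<xi> = \<one>\<^bsub>K\<^esub>" "\<xi> \<otimes>\<^bsub>K\<^esub> inv\<^bsub>K\<^esub> \<xi> = \<one>\<^bsub>K\<^esub>"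
proof -
  have "\<xi> \<in> Units K" using AM.xi_closed AM.xi_nz by (simp add: RR.K.field_Units)
  then show "inv\<^bsub>K\<^esub> \<xi> \<in> carrier K" "inv\<^bsub>K\<^esub> \<xi> \<otimes>\<^bsub>K\<^esub> \<xi> = \<one>\<^bsub>K\<^esub>" "\<xi> \<otimes>\<^bsub>K\<^esub> inv\<^bsub>K\<^esub> \<xi> = \<one>\<^bsub>K\<^esub>" by simp_all
qed

lemma kappa_inv: "\<kappa> \<in> carrier K" "inv\<^bsub>K\<^esub> \<kappa> \<in> carrier K" "inv\<^bsub>K\<^esub> \<kappa> \<otimes>\<^bsub>K\<^esub> \<kappa> = \<one>\<^bsub>K\<^esub>" "\<kappa> \<otimes>\<^bsub>K\<^esub> inv\<^bsub>K\<^esub> \<kappa> = \<one>\<^bsub>K\<^esub>"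
proof -
  have "\<kappa> \<in> Units K" using kappa by (simp add: RR.K.field_Units)
  then show "\<kappa> \<in> carrier K" "inv\<^bsub>K\<^esub> \<kappa> \<in> carrier K" "inv\<^bsub>K\<^esub> \<kappa> \<otimes>\<^bsub>K\<^esub> \<kappa> = \<one>\<^bsub>K\<^esub>" "\<kappa> \<otimes>\<^bsub>K\<^esub> inv\<^bsub>K\<^esub> \<kappa> = \<one>\<^bsub>K\<^esub>"
    using kappa by simp_all
qed

lemma omega_g': "\<omega> g' = \<xi> \<odot> g'"
proof -
  have *: "inv\<^bsub>K\<^esub> \<xi> \<odot> \<omega> g' = g'"
    by (rule RR.scaled_conj(1)[OF AM.omega_hom T1.g_closed(1,2,1) xi_inv(1) T1.g_inv omega_g])
  have "\<omega> g' = (\<xi> \<otimes>\<^bsub>K\<^esub> inv\<^bsub>K\<^esub> \<xi>) \<odot> \<omega> g'"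
    unfolding xi_inv(3) by (simp add: AM.omega_closed T1.g_closed)
  also have "\<dots> = \<xi> \<odot> (inv\<^bsub>K\<^esub> \<xi> \<odot> \<omega> g')"
    by (rule RR.smult_assoc1) (simp_all add: AM.xi_closed xi_inv(1) AM.omega_closed T1.g_closed)
  finally show ?thesis unfolding * .
qed

lemma tau_h': "\<tau> h' = inv\<^bsub>K\<^esub> \<xi> \<odot> h'"
proof -
  have *: "\<xi> \<odot> \<tau> h' = h'"
    by (rule RR.scaled_conj(1)[OF AM.tau_hom T2.g_closed(1,2,1) AM.xi_closed T2.g_inv tau_h])
  have "\<tau> h' = (inv\<^bsub>K\<^esub> \<xi> \<otimes>\<^bsub>K\<^esub> \<xi>) \<odot> \<tau> h'"
    unfolding xi_inv(2) by (simp add: AM.tau_closed T2.g_closed)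
  also have "\<dots> = inv\<^bsub>K\<^esub> \<xi> \<odot> (\<xi> \<odot> \<tau> h')"
    by (rule RR.smult_assoc1) (simp_all add: AM.xi_closed xi_inv(1) AM.tau_closed T2.g_closed)
  finally show ?thesis unfolding * .
qed

text \<open>Multiplying by (g h)(h' g') = 1 brings in gh = \<kappa> hg, so the inverses satisfy a
  relation with the same scalar rather than its inverse.\<close>

lemma g'h': "g' \<otimes> h' = \<kappa> \<odot> (h' \<otimes> g')"
proof -
  note [simp] = T1.g_closed T2.g_closed kappa_inv(1) T1.g_inv T2.g_inv
  have "g' \<otimes> h' = g' \<otimes> h' \<otimes> ((g \<otimes> h) \<otimes> (h' \<otimes> g'))"
    using gl_gh unfolding gh_inv by (simp add: R.grouplike_def)
  also have "\<dots> = \<kappa> \<odot> (g' \<otimes> (h' \<otimes> h) \<otimes> g \<otimes> (h' \<otimes> g'))"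
    unfolding gh by (simp add: RR.smult_mult_left RR.smult_mult_right RR.A.m_assoc del: T2.g_inv)
  also have "\<dots> = \<kappa> \<odot> (h' \<otimes> g')" by simp
  finally show ?thesis .
qed

text \<open>Conjugations by g and h commute although g and h do not: the scalar from gh = \<kappa>
  hg is absorbed by the one from the inverses.\<close>

lemma hat_commute:
  assumes u: "u \<in> carrier R.T"
  shows "T1.hat (T2.hat u) = T2.hat (T1.hat u)"
proof (rule tensor_ext[OF k_algebra_opp[OF R.R_alg] R.R_alg R.T_alg lin_maps_comp[OF T1.hat_lin T2.hat_lin]
      lin_maps_comp[OF T2.hat_lin T1.hat_lin] _ u])
  note [simp] = T1.g_closed T2.g_closed kappa_inv(1) AM.tau_closed AM.omega_closed
  fix r s assume "r \<in> carrier (opp R)" and s: "s \<in> carrier R"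
  then have r: "r \<in> carrier R" by simp
  note [simp] = r s
  have "g \<otimes> (h \<otimes> r \<otimes> h') \<otimes> g' = (g \<otimes> h) \<otimes> r \<otimes> (h' \<otimes> g')"
    by (simp add: RR.A.m_assoc)
  also have "\<dots> = (h \<otimes> g) \<otimes> r \<otimes> (\<kappa> \<odot> (h' \<otimes> g'))"
    unfolding gh by (simp add: RR.smult_mult_left RR.smult_mult_right)
  also have "\<dots> = h \<otimes> (g \<otimes> r \<otimes> g') \<otimes> h'"
    unfolding g'h'[symmetric] by (simp add: RR.A.m_assoc)
  finally have "g \<otimes> (h \<otimes> r \<otimes> h') \<otimes> g' = h \<otimes> (g \<otimes> r \<otimes> g') \<otimes> h'" .
  moreover have "\<tau> (\<omega> s) = \<omega> (\<tau> s)" using AM.data s by (simp add: ambiskew_data_def)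
  ultimately show "T1.hat (T2.hat (R.t r s)) = T2.hat (T1.hat (R.t r s))"
    by (simp add: T1.hat_tens T2.hat_tens)
qed

section \<open>The ambiskew data over H\<close>

abbreviation "H \<equiv> R.H"
abbreviation "c' \<equiv> R.t gh' c \<ominus>\<^bsub>R.T\<^esub> R.t (gh' \<otimes> c) \<one>"
abbreviation "\<xi>' \<equiv> \<xi> \<otimes>\<^bsub>K\<^esub> inv\<^bsub>K\<^esub> \<kappa>"

lemma c'_H: "c' \<in> carrier H"
  by (rule R.skew_primitive_H(1)[OF gl_gh sp_c])

lemma xi'_closed: "\<xi>' \<in> carrier K" by (simp add: AM.xi_closed kappa_inv)

lemma xi'_nz: "\<xi>' \<noteq> \<zero>\<^bsub>K\<^esub>"
proof
  assume "\<xi>' = \<zero>\<^bsub>K\<^esub>"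
  then have "\<xi>' \<otimes>\<^bsub>K\<^esub> \<kappa> = \<zero>\<^bsub>K\<^esub>" using kappa_inv by simp
  then have "\<xi> = \<zero>\<^bsub>K\<^esub>" using AM.xi_closed kappa_inv by (simp add: RR.K.m_assoc)
  then show False using AM.xi_nz by simp
qed

text \<open>Conjugation by gh together with \<tau>\<omega> is the form in which
  \<open>skew_commute\<close> describes the twist of c'. Here it is matched with the composite of
  the two automorphisms of H.\<close>

lemma hat_hat:
  assumes that: "u \<in> carrier R.T"
  shows "R.L R.T (\<lambda>r s. R.t (g \<otimes> h \<otimes> r \<otimes> gh') (\<tau> (\<omega> s))) u = T1.hat (T2.hat u)"
proof -
  note [simp] = T1.g_closed T2.g_closed AM.tau_closed AM.omega_closed
  show ?thesis
  proof (rule tensor_ext[OF k_algebra_opp[OF R.R_alg] R.R_alg R.T_alg _ lin_maps_comp[OF T1.hat_lin T2.hat_lin] _ that])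
    have b: "bilin K R R R.T (\<lambda>r s. R.t (g \<otimes> h \<otimes> r \<otimes> gh') (\<tau> (\<omega> s)))"
      unfolding gh_inv by (assumption | rule lin_intros | simp)+
    then show "R.L R.T (\<lambda>r s. R.t (g \<otimes> h \<otimes> r \<otimes> gh') (\<tau> (\<omega> s))) \<in> lin_maps K R.T R.T"
      by (rule R.lin_L[OF R.T_alg lin_maps_id])
    fix r s assume "r \<in> carrier (opp R)" "s \<in> carrier R"
    then show "R.L R.T (\<lambda>r s. R.t (g \<otimes> h \<otimes> r \<otimes> gh') (\<tau> (\<omega> s))) (R.t r s) = T1.hat (T2.hat (R.t r s))"
      by (simp add: R.L_tens[OF R.T_alg b[unfolded gh_inv]] T1.hat_tens T2.hat_tens gh_inv RR.A.m_assoc)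
  qed
qed

lemma sigma_invariant:
  assumes u: "u \<in> carrier H"
  shows "R.L R.T (\<lambda>x y. R.t (\<tau> (\<omega> x)) (\<tau> (\<omega> y))) u = u"
proof -
  let ?t = "\<lambda>w. R.L R.T (\<lambda>x y. R.t (\<tau> x) (\<tau> y)) w"
  have tl: "?t \<in> lin_maps K R.T R.T" by (assumption | rule lin_intros)+
  have tt: "?t (R.t x y) = R.t (\<tau> x) (\<tau> y)" if "x \<in> carrier R" "y \<in> carrier R" for x y
    by (rule R.L_tens) (assumption | rule lin_intros that)+
  have "?t (R.L R.T (\<lambda>x y. R.t (\<omega> x) (\<omega> y)) u) = R.L R.T (\<lambda>x y. ?t (R.t (\<omega> x) (\<omega> y))) u"
    by (rule R.L_comm[OF R.T_alg R.T_alg tl _ R.H_T[OF u]]) (assumption | rule lin_intros)+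
  also have "\<dots> = R.L R.T (\<lambda>x y. R.t (\<tau> (\<omega> x)) (\<tau> (\<omega> y))) u"
    by (rule R.L_cong) (assumption | rule lin_intros tt lin_maps_comp[OF tl] R.H_T[OF u])+
  finally show ?thesis unfolding T2.rho_invariant[OF u] T1.rho_invariant[OF u] by simp
qed

text \<open>The element c is skew-primitive relative to gh and moves past R by \<tau>\<omega>, so it
  is treated exactly as X is, with the identity of R as the morphism.\<close>

lemma c'_commute:
  assumes u: "u \<in> carrier H"
  shows "c' \<otimes>\<^bsub>R.T\<^esub> u = T1.hat (T2.hat u) \<otimes>\<^bsub>R.T\<^esub> c'"
proof -
  interpret I: hg_map K R \<mu> f R \<mu> f "\<lambda>x. x" by (rule R.hg_map_id)
  note [simp] = T1.g_closed T2.g_closed AM.tau_closed AM.omega_closed AM.c_closed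
  note uT = R.H_T[OF u]
  have jid: "I.j u = u" if "u \<in> carrier R.T" for u
    by (rule tensor_ext[OF k_algebra_opp[OF R.R_alg] R.R_alg R.T_alg I.j_lin lin_maps_id _ that])
      (simp add: I.j_tens)
  have "c' \<otimes>\<^bsub>R.T\<^esub> I.j u = I.j (R.L R.T (\<lambda>r s. R.t (g \<otimes> h \<otimes> r \<otimes> gh') (\<tau> (\<omega> s))) u) \<otimes>\<^bsub>R.T\<^esub> c'"
  proof (rule I.skew_commute[of "\<lambda>r. \<tau> (\<omega> r)"])
    show "(\<lambda>r. \<tau> (\<omega> r)) \<in> alg_hom K R R" by (rule alg_hom_comp[OF AM.tau_hom AM.omega_hom])
    show "R.L R.T (\<lambda>x y. R.t (\<tau> (\<omega> x)) (\<tau> (\<omega> y))) u = u" if u: "u \<in> carrier H" for u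
      by (rule sigma_invariant[OF u])
    show "g \<otimes> h \<in> carrier R" "gh' \<in> carrier R" "gh' \<otimes> (g \<otimes> h) = \<one>"
      using gl_gh by (simp_all add: R.grouplike_def)
    show "\<tau> (\<omega> (g \<otimes> h \<otimes> r \<otimes> gh')) = g \<otimes> h \<otimes> \<tau> (\<omega> r) \<otimes> gh'"
      if r: "r \<in> carrier R" for r
    proof -
      \<comment> \<open>Of the four compatibilities of \<tau>, \<omega> with conjugation by g, h,
        the mixed ones follow from the prescribed values of \<omega>(g) and \<tau>(h); the other two
        are \<open>rho_conj\<close>.\<close>
      have 1: "\<omega> (g \<otimes> s \<otimes> g') = g \<otimes> \<omega> s \<otimes> g'" if "s \<in> carrier R" for s
        by (rule RR.scaled_conj(2)[OF AM.omega_hom T1.g_closed that xi_inv(1) T1.g_inv omega_g])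
      have 2: "\<tau> (h \<otimes> s \<otimes> h') = h \<otimes> \<tau> s \<otimes> h'" if "s \<in> carrier R" for s
        by (rule RR.scaled_conj(2)[OF AM.tau_hom T2.g_closed that AM.xi_closed T2.g_inv tau_h])
      have e: "g \<otimes> h \<otimes> s \<otimes> gh' = g \<otimes> (h \<otimes> s \<otimes> h') \<otimes> g'" if "s \<in> carrier R" for s
        using that by (simp add: gh_inv RR.A.m_assoc)
      have "\<tau> (\<omega> (g \<otimes> (h \<otimes> r \<otimes> h') \<otimes> g')) = \<tau> (g \<otimes> \<omega> (h \<otimes> r \<otimes> h') \<otimes> g')"
        using r by (simp only: 1 RR.A.m_closed T2.g_closed)
      also have "\<dots> = \<tau> (g \<otimes> (h \<otimes> \<omega> r \<otimes> h') \<otimes> g')"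
        using r by (simp only: T2.rho_conj)
      also have "\<dots> = g \<otimes> \<tau> (h \<otimes> \<omega> r \<otimes> h') \<otimes> g'"
        using r by (simp only: T1.rho_conj RR.A.m_closed T2.g_closed AM.omega_closed)
      also have "\<dots> = g \<otimes> (h \<otimes> \<tau> (\<omega> r) \<otimes> h') \<otimes> g'"
        using r by (simp only: 2 AM.omega_closed)
      finally show ?thesis using r by (simp only: e AM.tau_closed AM.omega_closed)
    qed
    show "c \<otimes> r = \<tau> (\<omega> r) \<otimes> c" if "r \<in> carrier R" for r
      using AM.data that by (simp add: ambiskew_data_def)
  qed (simp_all add: u)
  then show ?thesis using uT by (simp add: jid hat_hat T1.hat_closed T2.hat_closed)
qed

lemma B_data: "ambiskew_data K H T1.hat T2.hat c' \<xi>'"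
  using xi'_closed xi'_nz c'_commute c'_H hat_commute
  by (simp add: ambiskew_data_def R.H_alg T1.hat_auto T2.hat_auto)

section \<open>The algebra B over H and its map to H(A)\<close>

sublocale BM: ambiskew_alg K H T1.hat T2.hat c' \<xi>'
  by unfold_locales (rule B_data)

abbreviation "BB \<equiv> BM.A"
abbreviation "EE \<equiv> BM.avar VX"
abbreviation "FF \<equiv> BM.avar VY"
abbreviation "iB \<equiv> BM.ain"

abbreviation "E0 \<equiv> A.t (i g') X \<ominus>\<^bsub>A.T\<^esub> A.t (i g' \<otimes>\<^bsub>AA\<^esub> X) \<one>\<^bsub>AA\<^esub>"
abbreviation "F0 \<equiv> A.t (i h') Y \<ominus>\<^bsub>A.T\<^esub> A.t (i h' \<otimes>\<^bsub>AA\<^esub> Y) \<one>\<^bsub>AA\<^esub>"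

lemma E0_H: "E0 \<in> carrier A.H" and E0_\<Delta>: "A.\<Delta> E0 = A.tH E0 \<one>\<^bsub>A.H\<^esub> \<oplus>\<^bsub>A.HH\<^esub> A.tH (A.t (i g') (i g)) E0"
  by (rule A.skew_primitive_H[OF i.grouplike_i[OF gl_g] sp_X])+

lemma F0_H: "F0 \<in> carrier A.H" and F0_\<Delta>: "A.\<Delta> F0 = A.tH F0 \<one>\<^bsub>A.H\<^esub> \<oplus>\<^bsub>A.HH\<^esub> A.tH (A.t (i h') (i h)) F0"
  by (rule A.skew_primitive_H[OF i.grouplike_i[OF gl_h] sp_Y])+

lemma E0_commute: "u \<in> carrier H \<Longrightarrow> E0 \<otimes>\<^bsub>A.T\<^esub> i.j u = i.j (T1.hat u) \<otimes>\<^bsub>A.T\<^esub> E0"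
  unfolding T1.hat_def
  by (rule i.skew_commute[OF AM.tau_hom T1.rho_invariant T1.g_closed T1.g_inv(2) T1.rho_conj AM.avar_closed AM.X_rel])

lemma F0_commute: "u \<in> carrier H \<Longrightarrow> F0 \<otimes>\<^bsub>A.T\<^esub> i.j u = i.j (T2.hat u) \<otimes>\<^bsub>A.T\<^esub> F0"
  unfolding T2.hat_def
  by (rule i.skew_commute[OF AM.omega_hom T2.rho_invariant T2.g_closed T2.g_inv(2) T2.rho_conj AM.avar_closed AM.Y_rel])

lemma XY: "X \<in> carrier AA" "Y \<in> carrier AA" by (rule AM.avar_closed)+

lemma Yg': "Y \<otimes>\<^bsub>AA\<^esub> i g' = \<xi> \<odot>\<^bsub>AA\<^esub> (i g' \<otimes>\<^bsub>AA\<^esub> Y)"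
  using AM.Y_rel[OF T1.g_closed(2)]
  by (simp add: omega_g' lin_maps_smult[OF i.i_lin] T1.g_closed AM.xi_closed RA.smult_mult_left i.i_closed XY)

lemma Xh': "X \<otimes>\<^bsub>AA\<^esub> i h' = inv\<^bsub>K\<^esub> \<xi> \<odot>\<^bsub>AA\<^esub> (i h' \<otimes>\<^bsub>AA\<^esub> X)"
  using AM.X_rel[OF T2.g_closed(2)]
  by (simp add: tau_h' lin_maps_smult[OF i.i_lin] T2.g_closed xi_inv RA.smult_mult_left i.i_closed XY)

text \<open>Both products are normalised to monomials with the common left factor W = h^{-1} g^{-1}.
  The constant \<xi>' is such that the mixed terms, those with X and Y on different sides of the
  tensor, cancel. The remaining four combine by the relation for XY into W \<otimes> c - W c
  \<otimes> 1.\<close>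

lemma EF0: "E0 \<otimes>\<^bsub>A.T\<^esub> F0 \<ominus>\<^bsub>A.T\<^esub> \<xi>' \<odot>\<^bsub>A.T\<^esub> (F0 \<otimes>\<^bsub>A.T\<^esub> E0) = i.j c'"
proof -
  interpret AT: k_algebra K A.T by (rule A.T_alg)
  define G where "G = i g'"
  define N where "N = i h'"
  define W where "W = N \<otimes>\<^bsub>AA\<^esub> G"
  have [simp]: "G \<in> carrier AA" "N \<in> carrier AA" "W \<in> carrier AA" "X \<in> carrier AA" "Y \<in> carrier AA"
    by (simp_all add: G_def N_def W_def i.i_closed T1.g_closed T2.g_closed XY)
  note [simp] = AM.xi_closed xi_inv(1) kappa_inv(1,2) A.t_closed
  have GN: "G \<otimes>\<^bsub>AA\<^esub> N = \<kappa> \<odot>\<^bsub>AA\<^esub> W"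
    unfolding G_def N_def W_def
    using arg_cong[OF g'h', of i] T1.g_closed T2.g_closed
    by (simp add: alg_hom_mult[OF i.i_hom] lin_maps_smult[OF i.i_lin])
  have YG: "Y \<otimes>\<^bsub>AA\<^esub> G = \<xi> \<odot>\<^bsub>AA\<^esub> (G \<otimes>\<^bsub>AA\<^esub> Y)" unfolding G_def by (rule Yg')
  have XN: "X \<otimes>\<^bsub>AA\<^esub> N = inv\<^bsub>K\<^esub> \<xi> \<odot>\<^bsub>AA\<^esub> (N \<otimes>\<^bsub>AA\<^esub> X)" unfolding N_def by (rule Xh')
  note tl = lin_maps_smult[OF bilin_left[OF tens_bilin[OF k_algebra_opp[OF A.R_alg] A.R_alg]]]
    lin_maps_smult[OF bilin_right[OF tens_bilin[OF k_algebra_opp[OF A.R_alg] A.R_alg]]]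
    lin_maps_minus[OF k_algebra_opp[OF A.R_alg] A.T_alg bilin_left[OF tens_bilin[OF k_algebra_opp[OF A.R_alg] A.R_alg]]]
    lin_maps_minus[OF A.R_alg A.T_alg bilin_right[OF tens_bilin[OF k_algebra_opp[OF A.R_alg] A.R_alg]]]
  have tsl: "A.t (s \<odot>\<^bsub>AA\<^esub> a) b = s \<odot>\<^bsub>A.T\<^esub> A.t a b" "A.t a (s \<odot>\<^bsub>AA\<^esub> b) = s \<odot>\<^bsub>A.T\<^esub> A.t a b"
    if "s \<in> carrier K" "a \<in> carrier AA" "b \<in> carrier AA" for s a b
    using tl(1)[of b s a] tl(2)[of a s b] that by simp_all
  have tml: "A.t a (b \<ominus>\<^bsub>AA\<^esub> b') = A.t a b \<ominus>\<^bsub>A.T\<^esub> A.t a b'"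
    if "a \<in> carrier AA" "b \<in> carrier AA" "b' \<in> carrier AA" for a b b'
    using tl(4)[of a b b'] that by simp
  have tmr: "A.t (a \<ominus>\<^bsub>AA\<^esub> a') b = A.t a b \<ominus>\<^bsub>A.T\<^esub> A.t a' b"
    if "a \<in> carrier AA" "a' \<in> carrier AA" "b \<in> carrier AA" for a a' b
    using lin_maps_minus[OF A.R_alg A.T_alg, of "\<lambda>a. A.t a b" a a']
      bilin_left[OF tens_bilin[OF k_algebra_opp[OF A.R_alg] A.R_alg]] that by simp
  \<comment> \<open>The normal forms after W has been collected. The mixed ones are p2 and p3; they
    have to disappear.\<close>
  define p1 where "p1 = A.t W (X \<otimes>\<^bsub>AA\<^esub> Y)"
  define p2 where "p2 = A.t (W \<otimes>\<^bsub>AA\<^esub> Y) X"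
  define p3 where "p3 = A.t (W \<otimes>\<^bsub>AA\<^esub> X) Y"
  define p4 where "p4 = A.t (W \<otimes>\<^bsub>AA\<^esub> (Y \<otimes>\<^bsub>AA\<^esub> X)) \<one>\<^bsub>AA\<^esub>"
  define p5 where "p5 = A.t W (Y \<otimes>\<^bsub>AA\<^esub> X)"
  define p6 where "p6 = A.t (W \<otimes>\<^bsub>AA\<^esub> (X \<otimes>\<^bsub>AA\<^esub> Y)) \<one>\<^bsub>AA\<^esub>"
  note pd = p1_def p2_def p3_def p4_def p5_def p6_def
  have pc[simp]: "p1 \<in> carrier A.T" "p2 \<in> carrier A.T" "p3 \<in> carrier A.T" "p4 \<in> carrier A.T"
    "p5 \<in> carrier A.T" "p6 \<in> carrier A.T" by (simp_all add: pd)
  have dist: "(a \<ominus>\<^bsub>A.T\<^esub> b) \<otimes>\<^bsub>A.T\<^esub> (a' \<ominus>\<^bsub>A.T\<^esub> b')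
      = a \<otimes>\<^bsub>A.T\<^esub> a' \<ominus>\<^bsub>A.T\<^esub> b \<otimes>\<^bsub>A.T\<^esub> a' \<ominus>\<^bsub>A.T\<^esub> (a \<otimes>\<^bsub>A.T\<^esub> b' \<ominus>\<^bsub>A.T\<^esub> b \<otimes>\<^bsub>A.T\<^esub> b')"
    if "a \<in> carrier A.T" "b \<in> carrier A.T" "a' \<in> carrier A.T" "b' \<in> carrier A.T" for a b a' b'
    using that
    by (simp add: lin_maps_minus[OF A.T_alg A.T_alg AT.mult_left_lin] lin_maps_minus[OF A.T_alg A.T_alg AT.mult_right_lin]
        AT.sub_closed)
  have NYG: "N \<otimes>\<^bsub>AA\<^esub> Y \<otimes>\<^bsub>AA\<^esub> G = \<xi> \<odot>\<^bsub>AA\<^esub> (W \<otimes>\<^bsub>AA\<^esub> Y)"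
    by (simp add: RA.A.m_assoc YG RA.smult_mult_right W_def)
  have GXN: "G \<otimes>\<^bsub>AA\<^esub> X \<otimes>\<^bsub>AA\<^esub> N = (inv\<^bsub>K\<^esub> \<xi> \<otimes>\<^bsub>K\<^esub> \<kappa>) \<odot>\<^bsub>AA\<^esub> (W \<otimes>\<^bsub>AA\<^esub> X)"
  proof -
    have "G \<otimes>\<^bsub>AA\<^esub> X \<otimes>\<^bsub>AA\<^esub> N = inv\<^bsub>K\<^esub> \<xi> \<odot>\<^bsub>AA\<^esub> (G \<otimes>\<^bsub>AA\<^esub> N \<otimes>\<^bsub>AA\<^esub> X)"
      by (simp add: RA.A.m_assoc XN RA.smult_mult_right)
    then show ?thesis unfolding GN by (simp add: RA.smult_mult_left RA.smult_assoc1)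
  qed
  have "E0 \<otimes>\<^bsub>A.T\<^esub> F0 = A.t W (X \<otimes>\<^bsub>AA\<^esub> Y) \<ominus>\<^bsub>A.T\<^esub> A.t (N \<otimes>\<^bsub>AA\<^esub> (G \<otimes>\<^bsub>AA\<^esub> X)) (\<one>\<^bsub>AA\<^esub> \<otimes>\<^bsub>AA\<^esub> Y) \<ominus>\<^bsub>A.T\<^esub>
      (A.t (N \<otimes>\<^bsub>AA\<^esub> Y \<otimes>\<^bsub>AA\<^esub> G) (X \<otimes>\<^bsub>AA\<^esub> \<one>\<^bsub>AA\<^esub>) \<ominus>\<^bsub>A.T\<^esub> A.t (N \<otimes>\<^bsub>AA\<^esub> Y \<otimes>\<^bsub>AA\<^esub> (G \<otimes>\<^bsub>AA\<^esub> X)) (\<one>\<^bsub>AA\<^esub> \<otimes>\<^bsub>AA\<^esub> \<one>\<^bsub>AA\<^esub>))"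
    unfolding G_def[symmetric] N_def[symmetric] by (simp add: dist A.t_mult W_def)
  also have "N \<otimes>\<^bsub>AA\<^esub> Y \<otimes>\<^bsub>AA\<^esub> (G \<otimes>\<^bsub>AA\<^esub> X) = \<xi> \<odot>\<^bsub>AA\<^esub> (W \<otimes>\<^bsub>AA\<^esub> (Y \<otimes>\<^bsub>AA\<^esub> X))"
    using NYG by (simp add: RA.A.m_assoc[symmetric] RA.smult_mult_left)
  also have "N \<otimes>\<^bsub>AA\<^esub> (G \<otimes>\<^bsub>AA\<^esub> X) = W \<otimes>\<^bsub>AA\<^esub> X" by (simp add: W_def RA.A.m_assoc)
  finally have EF: "E0 \<otimes>\<^bsub>A.T\<^esub> F0 = p1 \<ominus>\<^bsub>A.T\<^esub> p3 \<ominus>\<^bsub>A.T\<^esub> (\<xi> \<odot>\<^bsub>A.T\<^esub> p2 \<ominus>\<^bsub>A.T\<^esub> \<xi> \<odot>\<^bsub>A.T\<^esub> p4)"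
    unfolding NYG by (simp add: pd tsl)
  have "F0 \<otimes>\<^bsub>A.T\<^esub> E0 = A.t (G \<otimes>\<^bsub>AA\<^esub> N) (Y \<otimes>\<^bsub>AA\<^esub> X) \<ominus>\<^bsub>A.T\<^esub> A.t (G \<otimes>\<^bsub>AA\<^esub> (N \<otimes>\<^bsub>AA\<^esub> Y)) (\<one>\<^bsub>AA\<^esub> \<otimes>\<^bsub>AA\<^esub> X) \<ominus>\<^bsub>A.T\<^esub>
      (A.t (G \<otimes>\<^bsub>AA\<^esub> X \<otimes>\<^bsub>AA\<^esub> N) (Y \<otimes>\<^bsub>AA\<^esub> \<one>\<^bsub>AA\<^esub>) \<ominus>\<^bsub>A.T\<^esub> A.t (G \<otimes>\<^bsub>AA\<^esub> X \<otimes>\<^bsub>AA\<^esub> (N \<otimes>\<^bsub>AA\<^esub> Y)) (\<one>\<^bsub>AA\<^esub> \<otimes>\<^bsub>AA\<^esub> \<one>\<^bsub>AA\<^esub>))"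
    unfolding G_def[symmetric] N_def[symmetric] by (simp add: dist A.t_mult)
  also have "G \<otimes>\<^bsub>AA\<^esub> X \<otimes>\<^bsub>AA\<^esub> (N \<otimes>\<^bsub>AA\<^esub> Y) = (inv\<^bsub>K\<^esub> \<xi> \<otimes>\<^bsub>K\<^esub> \<kappa>) \<odot>\<^bsub>AA\<^esub> (W \<otimes>\<^bsub>AA\<^esub> (X \<otimes>\<^bsub>AA\<^esub> Y))"
    using GXN by (simp add: RA.A.m_assoc[symmetric] RA.smult_mult_left)
  also have "G \<otimes>\<^bsub>AA\<^esub> (N \<otimes>\<^bsub>AA\<^esub> Y) = \<kappa> \<odot>\<^bsub>AA\<^esub> (W \<otimes>\<^bsub>AA\<^esub> Y)"
    using GN by (simp add: RA.A.m_assoc[symmetric] RA.smult_mult_left)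
  finally have FE: "F0 \<otimes>\<^bsub>A.T\<^esub> E0 = \<kappa> \<odot>\<^bsub>A.T\<^esub> p5 \<ominus>\<^bsub>A.T\<^esub> \<kappa> \<odot>\<^bsub>A.T\<^esub> p2 \<ominus>\<^bsub>A.T\<^esub>
      ((inv\<^bsub>K\<^esub> \<xi> \<otimes>\<^bsub>K\<^esub> \<kappa>) \<odot>\<^bsub>A.T\<^esub> p3 \<ominus>\<^bsub>A.T\<^esub> (inv\<^bsub>K\<^esub> \<xi> \<otimes>\<^bsub>K\<^esub> \<kappa>) \<odot>\<^bsub>A.T\<^esub> p6)"
    unfolding GXN GN by (simp add: pd tsl)
  \<comment> \<open>This and \<open>s2\<close> are the two identities behind the constant: \<xi>'
    \<kappa> = \<xi> matches p2, and \<xi>' \<xi>^{-1} \<kappa> = 1 matches p3.\<close>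
  have s1: "\<xi>' \<odot>\<^bsub>A.T\<^esub> (\<kappa> \<odot>\<^bsub>A.T\<^esub> p) = \<xi> \<odot>\<^bsub>A.T\<^esub> p" if "p \<in> carrier A.T" for p
    using that by (simp add: AT.smult_assoc1[symmetric] RR.K.m_assoc kappa_inv)
  have s2: "\<xi>' \<odot>\<^bsub>A.T\<^esub> ((inv\<^bsub>K\<^esub> \<xi> \<otimes>\<^bsub>K\<^esub> \<kappa>) \<odot>\<^bsub>A.T\<^esub> p) = p" if "p \<in> carrier A.T" for p
  proof -
    have "\<xi>' \<otimes>\<^bsub>K\<^esub> (inv\<^bsub>K\<^esub> \<xi> \<otimes>\<^bsub>K\<^esub> \<kappa>) = (\<xi> \<otimes>\<^bsub>K\<^esub> inv\<^bsub>K\<^esub> \<xi>) \<otimes>\<^bsub>K\<^esub> (inv\<^bsub>K\<^esub> \<kappa> \<otimes>\<^bsub>K\<^esub> \<kappa>)"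
      by (simp add: RR.K.m_ac)
    also have "\<dots> = \<one>\<^bsub>K\<^esub>" by (simp add: xi_inv kappa_inv)
    finally show ?thesis using that by (simp add: AT.smult_assoc1[symmetric])
  qed
  have sl: "(\<lambda>p. \<xi>' \<odot>\<^bsub>A.T\<^esub> p) \<in> lin_maps K A.T A.T"
    by (rule lin_smult_const[OF A.T_alg lin_maps_id xi'_closed])
  have FE': "\<xi>' \<odot>\<^bsub>A.T\<^esub> (F0 \<otimes>\<^bsub>A.T\<^esub> E0) = \<xi> \<odot>\<^bsub>A.T\<^esub> p5 \<ominus>\<^bsub>A.T\<^esub> \<xi> \<odot>\<^bsub>A.T\<^esub> p2 \<ominus>\<^bsub>A.T\<^esub> (p3 \<ominus>\<^bsub>A.T\<^esub> p6)"
    unfolding FE by (simp add: lin_maps_minus[OF A.T_alg A.T_alg sl] s1 s2 AT.sub_closed)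
  have ag: "(a1 \<ominus>\<^bsub>A.T\<^esub> a3 \<ominus>\<^bsub>A.T\<^esub> (a2 \<ominus>\<^bsub>A.T\<^esub> a4)) \<ominus>\<^bsub>A.T\<^esub> (a5 \<ominus>\<^bsub>A.T\<^esub> a2 \<ominus>\<^bsub>A.T\<^esub> (a3 \<ominus>\<^bsub>A.T\<^esub> a6))
      = (a1 \<ominus>\<^bsub>A.T\<^esub> a5) \<ominus>\<^bsub>A.T\<^esub> (a6 \<ominus>\<^bsub>A.T\<^esub> a4)"
    if c: "a1 \<in> carrier A.T" "a2 \<in> carrier A.T" "a3 \<in> carrier A.T" "a4 \<in> carrier A.T" "a5 \<in> carrier A.T"
      "a6 \<in> carrier A.T" for a1 a2 a3 a4 a5 a6
  proof -
    have "(a1 \<ominus>\<^bsub>A.T\<^esub> a3 \<ominus>\<^bsub>A.T\<^esub> (a2 \<ominus>\<^bsub>A.T\<^esub> a4)) \<ominus>\<^bsub>A.T\<^esub> (a5 \<ominus>\<^bsub>A.T\<^esub> a2 \<ominus>\<^bsub>A.T\<^esub> (a3 \<ominus>\<^bsub>A.T\<^esub> a6))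
      = ((a1 \<ominus>\<^bsub>A.T\<^esub> a5) \<ominus>\<^bsub>A.T\<^esub> (a6 \<ominus>\<^bsub>A.T\<^esub> a4)) \<oplus>\<^bsub>A.T\<^esub> ((a3 \<ominus>\<^bsub>A.T\<^esub> a3) \<oplus>\<^bsub>A.T\<^esub> (a2 \<ominus>\<^bsub>A.T\<^esub> a2))"
      using c by (simp add: a_minus_def AT.A.minus_add AT.A.a_ac)
    also have "\<dots> = (a1 \<ominus>\<^bsub>A.T\<^esub> a5) \<ominus>\<^bsub>A.T\<^esub> (a6 \<ominus>\<^bsub>A.T\<^esub> a4)"
      using c by (simp add: AT.sub_self AT.sub_closed)
    finally show ?thesis .
  qed
  have Xc: "X \<otimes>\<^bsub>AA\<^esub> Y \<ominus>\<^bsub>AA\<^esub> \<xi> \<odot>\<^bsub>AA\<^esub> (Y \<otimes>\<^bsub>AA\<^esub> X) = i c" by (rule AM.XY_rel)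
  have "E0 \<otimes>\<^bsub>A.T\<^esub> F0 \<ominus>\<^bsub>A.T\<^esub> \<xi>' \<odot>\<^bsub>A.T\<^esub> (F0 \<otimes>\<^bsub>A.T\<^esub> E0)
    = (p1 \<ominus>\<^bsub>A.T\<^esub> \<xi> \<odot>\<^bsub>A.T\<^esub> p5) \<ominus>\<^bsub>A.T\<^esub> (p6 \<ominus>\<^bsub>A.T\<^esub> \<xi> \<odot>\<^bsub>A.T\<^esub> p4)"
    unfolding EF FE' by (rule ag) simp_all
  also have "p1 \<ominus>\<^bsub>A.T\<^esub> \<xi> \<odot>\<^bsub>A.T\<^esub> p5 = A.t W (i c)"
    unfolding Xc[symmetric] by (simp add: pd tml tsl)
  also have "p6 \<ominus>\<^bsub>A.T\<^esub> \<xi> \<odot>\<^bsub>A.T\<^esub> p4 = A.t (W \<otimes>\<^bsub>AA\<^esub> i c) \<one>\<^bsub>AA\<^esub>"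
  proof -
    have "W \<otimes>\<^bsub>AA\<^esub> i c = W \<otimes>\<^bsub>AA\<^esub> (X \<otimes>\<^bsub>AA\<^esub> Y) \<ominus>\<^bsub>AA\<^esub> \<xi> \<odot>\<^bsub>AA\<^esub> (W \<otimes>\<^bsub>AA\<^esub> (Y \<otimes>\<^bsub>AA\<^esub> X))"
      unfolding Xc[symmetric]
      by (simp add: lin_maps_minus[OF A.R_alg A.R_alg RA.mult_right_lin] RA.smult_mult_right)
    then show ?thesis by (simp add: pd tmr tsl)
  qed
  also have "A.t W (i c) \<ominus>\<^bsub>A.T\<^esub> A.t (W \<otimes>\<^bsub>AA\<^esub> i c) \<one>\<^bsub>AA\<^esub> = i.j c'"
    using AM.c_closed T1.g_closed T2.g_closed R.t_closed
    by (simp add: lin_maps_minus[OF R.T_alg A.T_alg i.j_lin] i.j_tens gh_inv W_def G_def N_def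
        alg_hom_mult[OF i.i_hom] alg_hom_one[OF i.i_hom])
  finally show ?thesis .
qed

lemma psi_exists: "\<exists>\<psi>\<in>alg_hom K BB A.H. (\<forall>u\<in>carrier H. \<psi> (iB u) = i.j u) \<and> \<psi> EE = E0 \<and> \<psi> FF = F0"
proof (rule BM.ambiskew_lift[OF A.H_alg i.j_hom_H E0_H F0_H])
  \<comment> \<open>The relation was computed in the ambient algebra, while the universal property
    asks for a difference in \<open>A.H\<close>; \<open>H_minus\<close> needs both terms to lie
    there.\<close>
  have c: "E0 \<otimes>\<^bsub>A.T\<^esub> F0 \<in> carrier A.H" "\<xi>' \<odot>\<^bsub>A.T\<^esub> (F0 \<otimes>\<^bsub>A.T\<^esub> E0) \<in> carrier A.H"
    using alg_mult_closed[OF A.H_alg E0_H F0_H] alg_smult_closed[OF A.H_alg xi'_closed alg_mult_closed[OF A.H_alg F0_H E0_H]]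
    by simp_all
  show "E0 \<otimes>\<^bsub>A.H\<^esub> F0 \<ominus>\<^bsub>A.H\<^esub> \<xi>' \<odot>\<^bsub>A.H\<^esub> (F0 \<otimes>\<^bsub>A.H\<^esub> E0) = i.j c'"
    using EF0 A.H_minus[OF c] by simp
qed (simp_all add: E0_commute F0_commute)

definition "\<psi> = (SOME \<psi>. \<psi> \<in> alg_hom K BB A.H \<and> (\<forall>u\<in>carrier H. \<psi> (iB u) = i.j u) \<and> \<psi> EE = E0 \<and> \<psi> FF = F0)"

lemma psi: "\<psi> \<in> alg_hom K BB A.H" "\<And>u. u \<in> carrier H \<Longrightarrow> \<psi> (iB u) = i.j u" "\<psi> EE = E0" "\<psi> FF = F0"
proof -
  have "\<exists>\<psi>. \<psi> \<in> alg_hom K BB A.H \<and> (\<forall>u\<in>carrier H. \<psi> (iB u) = i.j u) \<and> \<psi> EE = E0 \<and> \<psi> FF = F0"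
    using psi_exists by (simp only: Bex_def)
  from someI_ex[OF this, folded \<psi>_def]
  show "\<psi> \<in> alg_hom K BB A.H" "\<And>u. u \<in> carrier H \<Longrightarrow> \<psi> (iB u) = i.j u" "\<psi> EE = E0" "\<psi> FF = F0"
    by simp_all
qed

end

section \<open>The isomorphism\<close>

lemma (in k_algebra) sub_add_swap:
  "a \<in> carrier A \<Longrightarrow> b \<in> carrier A \<Longrightarrow> c \<in> carrier A \<Longrightarrow> (a \<ominus>\<^bsub>A\<^esub> b) \<oplus>\<^bsub>A\<^esub> c = a \<oplus>\<^bsub>A\<^esub> (c \<ominus>\<^bsub>A\<^esub> b)"
  by (simp add: a_minus_def A.a_ac)

lemma (in k_algebra) sub_regroup:
  assumes c: "a \<in> carrier A" "b \<in> carrier A" "d \<in> carrier A" "e \<in> carrier A" "a' \<in> carrier A" "e' \<in> carrier A"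
  shows "(a \<oplus>\<^bsub>A\<^esub> b \<oplus>\<^bsub>A\<^esub> (d \<oplus>\<^bsub>A\<^esub> e)) \<ominus>\<^bsub>A\<^esub> (a' \<oplus>\<^bsub>A\<^esub> d \<oplus>\<^bsub>A\<^esub> (b \<oplus>\<^bsub>A\<^esub> e'))
    = (a \<ominus>\<^bsub>A\<^esub> a') \<oplus>\<^bsub>A\<^esub> (e \<ominus>\<^bsub>A\<^esub> e')"
proof -
  have "(a \<oplus>\<^bsub>A\<^esub> b \<oplus>\<^bsub>A\<^esub> (d \<oplus>\<^bsub>A\<^esub> e)) \<ominus>\<^bsub>A\<^esub> (a' \<oplus>\<^bsub>A\<^esub> d \<oplus>\<^bsub>A\<^esub> (b \<oplus>\<^bsub>A\<^esub> e'))
    = ((a \<ominus>\<^bsub>A\<^esub> a') \<oplus>\<^bsub>A\<^esub> (e \<ominus>\<^bsub>A\<^esub> e')) \<oplus>\<^bsub>A\<^esub> ((b \<ominus>\<^bsub>A\<^esub> b) \<oplus>\<^bsub>A\<^esub> (d \<ominus>\<^bsub>A\<^esub> d))"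
    using c by (simp add: a_minus_def A.minus_add A.a_ac)
  then show ?thesis using c by (simp add: sub_self sub_closed)
qed

section \<open>The coaction of B on A\<close>

context ambiskew_hopf begin

abbreviation "AB \<equiv> tensor K AA BB"
abbreviation "tAB \<equiv> tens K AA BB"
abbreviation "XX \<equiv> tAB X \<one>\<^bsub>BB\<^esub> \<oplus>\<^bsub>AB\<^esub> tAB (i g) EE"
abbreviation "YY \<equiv> tAB Y \<one>\<^bsub>BB\<^esub> \<oplus>\<^bsub>AB\<^esub> tAB (i h) FF"
abbreviation "p \<equiv> R.coact AA BB i iB"

lemma BB_alg: "k_algebra K BB" by (rule BM.A_alg)
lemma AB_alg: "k_algebra K AB" by (rule k_algebra_tensor[OF A.R_alg BB_alg])
lemma iB_hom: "iB \<in> alg_hom K H BB" by (rule BM.ain_hom)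
lemma iB_closed: "u \<in> carrier H \<Longrightarrow> iB u \<in> carrier BB" by (rule lin_maps_closed[OF alg_hom_lin[OF iB_hom]])
lemma EF: "EE \<in> carrier BB" "FF \<in> carrier BB" by (rule BM.avar_closed)+
lemma p_hom: "p \<in> alg_hom K R AB" by (rule R.coact_hom[OF A.R_alg BB_alg i.i_hom iB_hom])
lemma gh_closed: "g \<in> carrier R" "h \<in> carrier R" "g' \<in> carrier R" "h' \<in> carrier R"
  using T1.g_closed T2.g_closed by simp_all

lemma tAB_closed: "a \<in> carrier AA \<Longrightarrow> b \<in> carrier BB \<Longrightarrow> tAB a b \<in> carrier AB"
  by (rule tens_closed[OF A.R_alg BB_alg])

lemma tAB_mult: "a \<in> carrier AA \<Longrightarrow> b \<in> carrier BB \<Longrightarrow> a' \<in> carrier AA \<Longrightarrow> b' \<in> carrier BB \<Longrightarrow>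
    tAB a b \<otimes>\<^bsub>AB\<^esub> tAB a' b' = tAB (a \<otimes>\<^bsub>AA\<^esub> a') (b \<otimes>\<^bsub>BB\<^esub> b')"
  by (rule tens_mult[OF A.R_alg BB_alg])

lemma tAB_lin: "b \<in> carrier BB \<Longrightarrow> (\<lambda>a. tAB a b) \<in> lin_maps K AA AB" "a \<in> carrier AA \<Longrightarrow> tAB a \<in> lin_maps K BB AB"
  using bilin_left[OF tens_bilin[OF A.R_alg BB_alg]] bilin_right[OF tens_bilin[OF A.R_alg BB_alg]] by simp_all

lemma XX_p: "r \<in> carrier R \<Longrightarrow> XX \<otimes>\<^bsub>AB\<^esub> p r = p (\<tau> r) \<otimes>\<^bsub>AB\<^esub> XX"
  by (rule T1.coact_skew[OF A.R_alg BB_alg i.i_hom iB_hom XY(1) EF(1) AM.X_rel BM.X_rel])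

lemma YY_p: "r \<in> carrier R \<Longrightarrow> YY \<otimes>\<^bsub>AB\<^esub> p r = p (\<omega> r) \<otimes>\<^bsub>AB\<^esub> YY"
  by (rule T2.coact_skew[OF A.R_alg BB_alg i.i_hom iB_hom XY(2) EF(2) AM.Y_rel BM.Y_rel])

text \<open>c is skew-primitive relative to gh, so its coaction has three terms. The last two share
  the leg gh and merge into c'.\<close>

lemma p_c: "p c = tAB (i c) \<one>\<^bsub>BB\<^esub> \<oplus>\<^bsub>AB\<^esub> tAB (i (g \<otimes> h)) (iB c')"
proof -
  interpret AB: k_algebra K AB by (rule AB_alg)
  interpret BB: k_algebra K BB by (rule BB_alg)
  interpret RT: k_algebra K R.T by (rule R.T_alg)
  let ?F = "\<lambda>a b c. tAB (i a) (iB (R.P (R.t b c)))"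
  let ?gh = "g \<otimes> h"
  note cc = AM.c_closed
  have ghc: "?gh \<in> carrier R" "gh' \<in> carrier R" using gl_gh by (simp_all add: R.grouplike_def)
  have Pc: "R.P (R.t x y) \<in> carrier H" if "x \<in> carrier R" "y \<in> carrier R" for x y
    by (rule R.P_H[OF R.t_closed[OF that]])
  have Gl: "(\<lambda>u. tAB (i ?gh) (iB (R.P u))) \<in> lin_maps K R.T AB"
    by (rule lin_maps_comp[OF tAB_lin(2) lin_maps_comp[OF alg_hom_lin[OF iB_hom] R.lin_P_H[OF lin_maps_id]]])
      (simp add: i.i_closed ghc)
  have "p c = (?F c \<one> \<one> \<ominus>\<^bsub>AB\<^esub> ?F ?gh (gh' \<otimes> c) \<one>) \<oplus>\<^bsub>AB\<^esub> ?F ?gh gh' c"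
    unfolding R.coact_def
    by (rule R.M_skew_primitive[OF AB_alg gl_gh sp_c R.coact_trilin[OF A.R_alg BB_alg i.i_lin alg_hom_lin[OF iB_hom]]])
  also have "?F c \<one> \<one> = tAB (i c) \<one>\<^bsub>BB\<^esub>"
    using R.P_id[OF R.H_one] alg_hom_one[OF iB_hom] by (simp add: R.T_one)
  also have "(tAB (i c) \<one>\<^bsub>BB\<^esub> \<ominus>\<^bsub>AB\<^esub> ?F ?gh (gh' \<otimes> c) \<one>) \<oplus>\<^bsub>AB\<^esub> ?F ?gh gh' c
    = tAB (i c) \<one>\<^bsub>BB\<^esub> \<oplus>\<^bsub>AB\<^esub> (?F ?gh gh' c \<ominus>\<^bsub>AB\<^esub> ?F ?gh (gh' \<otimes> c) \<one>)"
    using cc ghc by (intro AB.sub_add_swap) (simp_all add: tAB_closed i.i_closed iB_closed Pc)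
  also have "?F ?gh gh' c \<ominus>\<^bsub>AB\<^esub> ?F ?gh (gh' \<otimes> c) \<one> = tAB (i ?gh) (iB (R.P c'))"
    by (rule lin_maps_minus[OF R.T_alg AB_alg Gl, symmetric]) (simp_all add: R.t_closed cc ghc)
  finally show ?thesis unfolding R.P_id[OF c'_H] .
qed

lemma Yg: "Y \<otimes>\<^bsub>AA\<^esub> i g = inv\<^bsub>K\<^esub> \<xi> \<odot>\<^bsub>AA\<^esub> (i g \<otimes>\<^bsub>AA\<^esub> Y)"
  using AM.Y_rel[OF gh_closed(1)]
  by (simp add: omega_g lin_maps_smult[OF i.i_lin] gh_closed xi_inv RA.smult_mult_left i.i_closed XY)

lemma Xh: "X \<otimes>\<^bsub>AA\<^esub> i h = \<xi> \<odot>\<^bsub>AA\<^esub> (i h \<otimes>\<^bsub>AA\<^esub> X)"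
  using AM.X_rel[OF gh_closed(2)]
  by (simp add: tau_h lin_maps_smult[OF i.i_lin] gh_closed AM.xi_closed RA.smult_mult_left i.i_closed XY)

text \<open>X passes h with factor \<xi> and Y passes g with factor \<xi>^{-1}, so the cross terms
  q2 and q3 occur equally in both products. What is left is the relation of A tensored with 1 and gh
  tensored with the relation of B.\<close>

lemma XX_YY: "XX \<otimes>\<^bsub>AB\<^esub> YY \<ominus>\<^bsub>AB\<^esub> \<xi> \<odot>\<^bsub>AB\<^esub> (YY \<otimes>\<^bsub>AB\<^esub> XX) = p c"
proof -
  interpret AB: k_algebra K AB by (rule AB_alg)
  interpret BB: k_algebra K BB by (rule BB_alg)
  define G where "G = i g"
  define N where "N = i h"
  have [simp]: "G \<in> carrier AA" "N \<in> carrier AA" by (simp_all add: G_def N_def i.i_closed gh_closed)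
  note [simp] = XY EF AM.xi_closed xi_inv(1) kappa_inv(1,2) tAB_closed xi'_closed
  have ts: "tAB (s \<odot>\<^bsub>AA\<^esub> a) b = s \<odot>\<^bsub>AB\<^esub> tAB a b" "tAB a (s \<odot>\<^bsub>BB\<^esub> b) = s \<odot>\<^bsub>AB\<^esub> tAB a b"
    if "s \<in> carrier K" "a \<in> carrier AA" "b \<in> carrier BB" for s a b
    using lin_maps_smult[OF tAB_lin(1) that(1,2)] lin_maps_smult[OF tAB_lin(2) that(1,3)] that by simp_all
  have GN: "G \<otimes>\<^bsub>AA\<^esub> N = \<kappa> \<odot>\<^bsub>AA\<^esub> (N \<otimes>\<^bsub>AA\<^esub> G)"
    unfolding G_def N_def using arg_cong[OF gh, of i] gh_closed
    by (simp add: alg_hom_mult[OF i.i_hom] lin_maps_smult[OF i.i_lin])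
  define q1 where "q1 = tAB (X \<otimes>\<^bsub>AA\<^esub> Y) \<one>\<^bsub>BB\<^esub>"
  define q2 where "q2 = tAB (N \<otimes>\<^bsub>AA\<^esub> X) FF"
  define q3 where "q3 = tAB (G \<otimes>\<^bsub>AA\<^esub> Y) EE"
  define q4 where "q4 = tAB (G \<otimes>\<^bsub>AA\<^esub> N) (EE \<otimes>\<^bsub>BB\<^esub> FF)"
  define q5 where "q5 = tAB (Y \<otimes>\<^bsub>AA\<^esub> X) \<one>\<^bsub>BB\<^esub>"
  define q6 where "q6 = tAB (N \<otimes>\<^bsub>AA\<^esub> G) (FF \<otimes>\<^bsub>BB\<^esub> EE)"
  note qd = q1_def q2_def q3_def q4_def q5_def q6_def
  have [simp]: "q1 \<in> carrier AB" "q2 \<in> carrier AB" "q3 \<in> carrier AB" "q4 \<in> carrier AB" "q5 \<in> carrier AB" "q6 \<in> carrier AB"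
    by (simp_all add: qd)
  have Yg: "Y \<otimes>\<^bsub>AA\<^esub> G = inv\<^bsub>K\<^esub> \<xi> \<odot>\<^bsub>AA\<^esub> (G \<otimes>\<^bsub>AA\<^esub> Y)" unfolding G_def by (rule Yg)
  have Xh: "X \<otimes>\<^bsub>AA\<^esub> N = \<xi> \<odot>\<^bsub>AA\<^esub> (N \<otimes>\<^bsub>AA\<^esub> X)" unfolding N_def by (rule Xh)
  have 1: "XX \<otimes>\<^bsub>AB\<^esub> YY = q1 \<oplus>\<^bsub>AB\<^esub> \<xi> \<odot>\<^bsub>AB\<^esub> q2 \<oplus>\<^bsub>AB\<^esub> (q3 \<oplus>\<^bsub>AB\<^esub> q4)"
    unfolding G_def[symmetric] N_def[symmetric]
    by (simp add: AB.A.l_distr AB.A.r_distr tAB_mult Xh ts qd AB.A.a_ac)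
  have 2: "YY \<otimes>\<^bsub>AB\<^esub> XX = q5 \<oplus>\<^bsub>AB\<^esub> inv\<^bsub>K\<^esub> \<xi> \<odot>\<^bsub>AB\<^esub> q3 \<oplus>\<^bsub>AB\<^esub> (q2 \<oplus>\<^bsub>AB\<^esub> q6)"
    unfolding G_def[symmetric] N_def[symmetric]
    by (simp add: AB.A.l_distr AB.A.r_distr tAB_mult Yg ts qd AB.A.a_ac)
  have s: "\<xi> \<odot>\<^bsub>AB\<^esub> (inv\<^bsub>K\<^esub> \<xi> \<odot>\<^bsub>AB\<^esub> q) = q" if "q \<in> carrier AB" for q
    using that by (simp add: AB.smult_assoc1[symmetric] xi_inv)
  have 3: "\<xi> \<odot>\<^bsub>AB\<^esub> (YY \<otimes>\<^bsub>AB\<^esub> XX) = \<xi> \<odot>\<^bsub>AB\<^esub> q5 \<oplus>\<^bsub>AB\<^esub> q3 \<oplus>\<^bsub>AB\<^esub> (\<xi> \<odot>\<^bsub>AB\<^esub> q2 \<oplus>\<^bsub>AB\<^esub> \<xi> \<odot>\<^bsub>AB\<^esub> q6)"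
    unfolding 2 by (simp add: AB.smult_r_distr s)
  have "XX \<otimes>\<^bsub>AB\<^esub> YY \<ominus>\<^bsub>AB\<^esub> \<xi> \<odot>\<^bsub>AB\<^esub> (YY \<otimes>\<^bsub>AB\<^esub> XX) = (q1 \<ominus>\<^bsub>AB\<^esub> \<xi> \<odot>\<^bsub>AB\<^esub> q5) \<oplus>\<^bsub>AB\<^esub> (q4 \<ominus>\<^bsub>AB\<^esub> \<xi> \<odot>\<^bsub>AB\<^esub> q6)"
    unfolding 1 3 by (rule AB.sub_regroup) simp_all
  also have "q1 \<ominus>\<^bsub>AB\<^esub> \<xi> \<odot>\<^bsub>AB\<^esub> q5 = tAB (i c) \<one>\<^bsub>BB\<^esub>"
    unfolding AM.XY_rel[symmetric]
    by (simp add: lin_maps_minus[OF A.R_alg AB_alg tAB_lin(1)] qd ts)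
  \<comment> \<open>Rewriting hg as \<kappa>^{-1} gh is the point where \<xi> becomes
    \<xi>'.\<close>
  also have "\<xi> \<odot>\<^bsub>AB\<^esub> q6 = \<xi>' \<odot>\<^bsub>AB\<^esub> tAB (G \<otimes>\<^bsub>AA\<^esub> N) (FF \<otimes>\<^bsub>BB\<^esub> EE)"
    unfolding GN by (simp add: qd ts AB.smult_assoc1[symmetric] RR.K.m_assoc kappa_inv)
  also have "q4 \<ominus>\<^bsub>AB\<^esub> \<dots> = tAB (G \<otimes>\<^bsub>AA\<^esub> N) (iB c')"
    unfolding BM.XY_rel[symmetric]
    by (simp add: lin_maps_minus[OF BB_alg AB_alg tAB_lin(2)] qd ts)
  also have "G \<otimes>\<^bsub>AA\<^esub> N = i (g \<otimes> h)"
    by (simp add: G_def N_def alg_hom_mult[OF i.i_hom] gh_closed)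
  finally show ?thesis unfolding p_c .
qed

lemma coaction_exists: "\<exists>\<rho>\<in>alg_hom K AA AB. (\<forall>r\<in>carrier R. \<rho> (i r) = p r) \<and> \<rho> X = XX \<and> \<rho> Y = YY"
  by (rule AM.ambiskew_lift[OF AB_alg p_hom _ _ XX_p YY_p XX_YY])
    (simp_all add: alg_add_closed[OF AB_alg] tAB_closed XY EF i.i_closed gh_closed alg_one_closed[OF BB_alg])

definition "coaction = (SOME \<rho>. \<rho> \<in> alg_hom K AA AB \<and> (\<forall>r\<in>carrier R. \<rho> (i r) = p r) \<and> \<rho> X = XX \<and> \<rho> Y = YY)"

lemma coaction: "coaction \<in> alg_hom K AA AB" "\<And>r. r \<in> carrier R \<Longrightarrow> coaction (i r) = p r"
  "coaction X = XX" "coaction Y = YY"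
proof -
  have "\<exists>\<rho>. \<rho> \<in> alg_hom K AA AB \<and> (\<forall>r\<in>carrier R. \<rho> (i r) = p r) \<and> \<rho> X = XX \<and> \<rho> Y = YY"
    using coaction_exists by (simp only: Bex_def)
  from someI_ex[OF this, folded coaction_def]
  show "coaction \<in> alg_hom K AA AB" "\<And>r. r \<in> carrier R \<Longrightarrow> coaction (i r) = p r"
    "coaction X = XX" "coaction Y = YY" by simp_all
qed

end

lemma (in k_algebra) add_sub_cancel:
  "a \<in> carrier A \<Longrightarrow> b \<in> carrier A \<Longrightarrow> (a \<oplus>\<^bsub>A\<^esub> b) \<ominus>\<^bsub>A\<^esub> a = b"
  using A.r_neg1[of a b] by (simp add: a_minus_def A.a_ac)

section \<open>Comparison of the coaction with the Hopf-Galois structure of A\<close>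

context ambiskew_hopf begin

lemma psi_T: "\<psi> \<in> alg_hom K BB A.T"
  by (rule alg_homI[OF A.lin_H_T[OF alg_hom_lin[OF psi(1)]]])
    (use alg_hom_one[OF psi(1)] alg_hom_mult[OF psi(1)] in simp_all)

lemma psi_closed: "b \<in> carrier BB \<Longrightarrow> \<psi> b \<in> carrier A.T"
  by (rule lin_maps_closed[OF alg_hom_lin[OF psi_T]])

definition "push = tens_map K AA A.T (\<lambda>x. x) \<psi>"

lemma push_hom: "push \<in> alg_hom K AB A.T3"
proof -
  have "(\<lambda>x. x) \<in> alg_hom K AA AA" by (rule alg_homI) simp_all
  then show ?thesis
    unfolding push_def tensor3_def by (rule tens_map_hom[OF A.R_alg A.T_alg A.R_alg BB_alg _ psi_T])
qed

lemma push_tens: "a \<in> carrier AA \<Longrightarrow> b \<in> carrier BB \<Longrightarrow> push (tAB a b) = tens K AA A.T a (\<psi> b)"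
  unfolding push_def
  by (rule tens_map_tens[OF A.R_alg A.T_alg A.R_alg BB_alg lin_maps_id alg_hom_lin[OF psi_T]])

text \<open>With \<psi>(b) of this form, \<gamma> \<otimes> \<psi>(b) supplies the last two terms in
  the formula for \<mu> of a skew-primitive element. It is used for the pairs (X, E) and (Y,
  F).\<close>

lemma push_skew:
  assumes g: "\<gamma> \<in> carrier AA" "\<gamma>' \<in> carrier AA" and x: "x \<in> carrier AA" and b: "b \<in> carrier BB"
    and psi_b: "\<psi> b = A.t \<gamma>' x \<ominus>\<^bsub>A.T\<^esub> A.t (\<gamma>' \<otimes>\<^bsub>AA\<^esub> x) \<one>\<^bsub>AA\<^esub>"
  shows "push (tAB x \<one>\<^bsub>BB\<^esub> \<oplus>\<^bsub>AB\<^esub> tAB \<gamma> b) = (A.t3 x \<one>\<^bsub>AA\<^esub> \<one>\<^bsub>AA\<^esub> \<ominus>\<^bsub>A.T3\<^esub> A.t3 \<gamma> (\<gamma>' \<otimes>\<^bsub>AA\<^esub> x) \<one>\<^bsub>AA\<^esub>) \<oplus>\<^bsub>A.T3\<^esub> A.t3 \<gamma> \<gamma>' x"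
proof -
  interpret T3: k_algebra K A.T3 by (rule A.T3_alg)
  note one = alg_one_closed[OF BB_alg]
  note c = alg_mult_closed[OF A.R_alg g(2) x] RA.A.one_closed
  have "push (tAB x \<one>\<^bsub>BB\<^esub> \<oplus>\<^bsub>AB\<^esub> tAB \<gamma> b) = tens K AA A.T x (A.t \<one>\<^bsub>AA\<^esub> \<one>\<^bsub>AA\<^esub>) \<oplus>\<^bsub>A.T3\<^esub>
      tens K AA A.T \<gamma> (A.t \<gamma>' x \<ominus>\<^bsub>A.T\<^esub> A.t (\<gamma>' \<otimes>\<^bsub>AA\<^esub> x) \<one>\<^bsub>AA\<^esub>)"
    using alg_hom_one[OF psi_T] x g b one
    by (simp add: lin_maps_add[OF alg_hom_lin[OF push_hom]] tAB_closed push_tens psi_b A.T_one)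
  also have "tens K AA A.T \<gamma> (A.t \<gamma>' x \<ominus>\<^bsub>A.T\<^esub> A.t (\<gamma>' \<otimes>\<^bsub>AA\<^esub> x) \<one>\<^bsub>AA\<^esub>)
    = A.t3 \<gamma> \<gamma>' x \<ominus>\<^bsub>A.T3\<^esub> A.t3 \<gamma> (\<gamma>' \<otimes>\<^bsub>AA\<^esub> x) \<one>\<^bsub>AA\<^esub>"
    unfolding tens3_def tensor3_def
    by (rule lin_maps_minus[OF A.T_alg k_algebra_tensor[OF A.R_alg A.T_alg] lin_tens_right[OF A.R_alg A.T_alg lin_maps_id g(1)]])
      (simp_all add: A.t_closed g x c)
  also have "tens K AA A.T x (A.t \<one>\<^bsub>AA\<^esub> \<one>\<^bsub>AA\<^esub>) = A.t3 x \<one>\<^bsub>AA\<^esub> \<one>\<^bsub>AA\<^esub>" by (simp add: tens3_def)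
  finally show ?thesis
    using T3.sub_add_swap[of "A.t3 x \<one>\<^bsub>AA\<^esub> \<one>\<^bsub>AA\<^esub>" "A.t3 \<gamma> (\<gamma>' \<otimes>\<^bsub>AA\<^esub> x) \<one>\<^bsub>AA\<^esub>" "A.t3 \<gamma> \<gamma>' x"]
    by (simp add: tens3_closed[OF A.R_alg] g x c)
qed

text \<open>On the image of H the map \<psi> is \<open>i.j\<close>, which is defined on all of R^op
  \<otimes> R. The projection in the coaction can therefore be removed by \<open>M_P\<close>, and
  what remains is \<mu> carried along i.\<close>

lemma push_p:
  assumes r: "r \<in> carrier R"
  shows "push (p r) = \<mu>A (i r)"
proof -
  let ?j = "\<lambda>a u. tens K AA A.T (i a) (i.j u)"
  note AB = AB_alg and T3 = k_algebra_tensor[OF A.R_alg A.T_alg]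
  have pl: "push \<in> lin_maps K AB (tensor K AA A.T)" using alg_hom_lin[OF push_hom] by (simp add: tensor3_def)
  note tri = R.coact_trilin[OF A.R_alg BB_alg i.i_lin alg_hom_lin[OF iB_hom]]
  have jb: "bilin K R R.T (tensor K AA A.T) ?j"
    by (rule bilinI; rule lin_tens_left lin_tens_right; (assumption | rule A.R_alg A.T_alg i.i_lin i.j_lin i.i_closed i.j_closed)+)
  have Pc: "R.P (R.t x y) \<in> carrier H" if "x \<in> carrier R" "y \<in> carrier R" for x y
    by (rule R.P_H[OF R.t_closed[OF that]])
  have "push (p r) = R.M (tensor K AA A.T) (\<lambda>a b c. push (tAB (i a) (iB (R.P (R.t b c))))) r"
    unfolding R.coact_def by (rule R.M_comm[OF AB T3 pl tri r])
  also have "\<dots> = R.M (tensor K AA A.T) (\<lambda>a b c. ?j a (R.P (R.t b c))) r"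
    by (rule R.M_cong[OF T3 trilin_comp[OF tri pl] r]) (simp add: push_tens i.i_closed iB_closed Pc psi(2))
  also have "\<dots> = R.M (tensor K AA A.T) (\<lambda>a b c. ?j a (R.t b c)) r" by (rule R.M_P[OF T3 jb r])
  also have "\<dots> = A.M (tensor K AA A.T) (tens3 K AA) (i r)"
  proof -
    have t: "trilin K AA (tensor K AA A.T) (tens3 K AA)" using trilin_tens3[OF A.R_alg] by (simp add: tensor3_def)
    have t': "trilin K R (tensor K AA A.T) (\<lambda>a b c. A.t3 (i a) (i b) (i c))"
      unfolding tensor3_def[symmetric] by (assumption | rule lin_intros)+
    have "R.M (tensor K AA A.T) (\<lambda>a b c. A.t3 (i a) (i b) (i c)) r = R.M (tensor K AA A.T) (\<lambda>a b c. ?j a (R.t b c)) r"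
      by (rule R.M_cong[OF T3 t' r]) (simp add: tens3_def i.j_tens)
    then show ?thesis unfolding i.M_i[OF T3 t r] by simp
  qed
  also have "\<dots> = \<mu>A (i r)"
    using A.M_tens3[OF i.i_closed[OF r]] by (simp add: tensor3_def)
  finally show ?thesis .
qed

lemma push_coaction:
  assumes z: "z \<in> carrier AA"
  shows "push (coaction z) = \<mu>A z"
proof (rule AM.ambiskew_hom_ext[OF A.T3_alg alg_hom_comp[OF push_hom coaction(1)] A.mu_hom _ _ _ z])
  show "push (coaction (i r)) = \<mu>A (i r)" if "r \<in> carrier R" for r
    unfolding coaction(2)[OF that] by (rule push_p[OF that])
  show "push (coaction X) = \<mu>A X"
    unfolding coaction(3) push_skew[OF i.i_closed[OF gh_closed(1)] i.i_closed[OF gh_closed(3)] XY(1) EF(1) psi(3)]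
    using sp_X by (simp add: A.skew_primitive_def)
  show "push (coaction Y) = \<mu>A Y"
    unfolding coaction(4) push_skew[OF i.i_closed[OF gh_closed(2)] i.i_closed[OF gh_closed(4)] XY(2) EF(2) psi(4)]
    using sp_Y by (simp add: A.skew_primitive_def)
qed

section \<open>The map m on R^op \<otimes> R and on the image of \<psi>\<close>

definition "m u = A.L AB (\<lambda>y z. tAB y \<one>\<^bsub>BB\<^esub> \<otimes>\<^bsub>AB\<^esub> coaction z) u"

lemma coaction_closed: "z \<in> carrier AA \<Longrightarrow> coaction z \<in> carrier AB"
  by (rule lin_maps_closed[OF alg_hom_lin[OF coaction(1)]])

lemma tA_closed: "y \<in> carrier AA \<Longrightarrow> tAB y \<one>\<^bsub>BB\<^esub> \<in> carrier AB"
  by (rule tAB_closed[OF _ alg_one_closed[OF BB_alg]])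

lemma m_bilin: "bilin K AA AA AB (\<lambda>y z. tAB y \<one>\<^bsub>BB\<^esub> \<otimes>\<^bsub>AB\<^esub> coaction z)"
  by (rule bilinI)
    (rule lin_mult_left lin_mult_right, rule AB_alg,
      simp_all add: alg_hom_lin[OF coaction(1)] tAB_lin coaction_closed tA_closed alg_one_closed[OF BB_alg])+

lemma m_lin: "m \<in> lin_maps K A.T AB"
  unfolding m_def[abs_def] by (rule A.lin_L[OF AB_alg lin_maps_id m_bilin])

lemma m_tens: "y \<in> carrier AA \<Longrightarrow> z \<in> carrier AA \<Longrightarrow> m (A.t y z) = tAB y \<one>\<^bsub>BB\<^esub> \<otimes>\<^bsub>AB\<^esub> coaction z"
  unfolding m_def by (rule A.L_tens[OF AB_alg m_bilin])

text \<open>m is not multiplicative in general, because the left factor y' y is formed in the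
  opposite order. If m u lies in 1 \<otimes> B, it commutes with y' \<otimes> 1 and the discrepancy
  vanishes.\<close>

lemma m_mult:
  assumes u: "u \<in> carrier A.T" and v: "v \<in> carrier A.T" and b: "b \<in> carrier BB" and mu: "m u = tAB \<one>\<^bsub>AA\<^esub> b"
  shows "m (u \<otimes>\<^bsub>A.T\<^esub> v) = tAB \<one>\<^bsub>AA\<^esub> b \<otimes>\<^bsub>AB\<^esub> m v"
proof -
  interpret AB: k_algebra K AB by (rule AB_alg)
  interpret BB: k_algebra K BB by (rule BB_alg)
  interpret AT: k_algebra K A.T by (rule A.T_alg)
  have bc: "tAB \<one>\<^bsub>AA\<^esub> b \<in> carrier AB" by (simp add: tAB_closed b)
  show ?thesis
  proof (rule tensor_ext[OF k_algebra_opp[OF A.R_alg] A.R_alg AB_alg lin_maps_comp[OF m_lin AT.mult_right_lin[OF u]]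
        lin_maps_comp[OF AB.mult_right_lin[OF bc] m_lin] _ v])
    fix y' z' assume "y' \<in> carrier (opp AA)" and z': "z' \<in> carrier AA"
    then have y': "y' \<in> carrier AA" by simp
    let ?G = "\<lambda>w. tAB y' \<one>\<^bsub>BB\<^esub> \<otimes>\<^bsub>AB\<^esub> (w \<otimes>\<^bsub>AB\<^esub> coaction z')"
    note cl = tA_closed[OF y'] coaction_closed[OF z']
    have Gl: "?G \<in> lin_maps K AB AB"
      by (rule lin_maps_comp[OF AB.mult_right_lin[OF cl(1)] AB.mult_left_lin[OF cl(2)]])
    have "m (u' \<otimes>\<^bsub>A.T\<^esub> A.t y' z') = ?G (m u')" if u': "u' \<in> carrier A.T" for u'
    proof (rule tensor_ext[OF k_algebra_opp[OF A.R_alg] A.R_alg AB_alg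
          lin_maps_comp[OF m_lin AT.mult_left_lin[OF A.t_closed[OF y' z']]] lin_maps_comp[OF Gl m_lin] _ u'])
      fix y z assume "y \<in> carrier (opp AA)" and z: "z \<in> carrier AA"
      then have y: "y \<in> carrier AA" by simp
      note c2 = tA_closed[OF y] coaction_closed[OF z]
      have "m (A.t y z \<otimes>\<^bsub>A.T\<^esub> A.t y' z') = tAB (y' \<otimes>\<^bsub>AA\<^esub> y) \<one>\<^bsub>BB\<^esub> \<otimes>\<^bsub>AB\<^esub> (coaction z \<otimes>\<^bsub>AB\<^esub> coaction z')"
        using y z y' z' by (simp add: A.t_mult m_tens alg_hom_mult[OF coaction(1)])
      also have "tAB (y' \<otimes>\<^bsub>AA\<^esub> y) \<one>\<^bsub>BB\<^esub> = tAB y' \<one>\<^bsub>BB\<^esub> \<otimes>\<^bsub>AB\<^esub> tAB y \<one>\<^bsub>BB\<^esub>"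
        using y y' by (simp add: tAB_mult)
      finally show "m (A.t y z \<otimes>\<^bsub>A.T\<^esub> A.t y' z') = ?G (m (A.t y z))"
        using cl c2 by (simp add: m_tens y z AB.A.m_assoc)
    qed
    from this[OF u] have "m (u \<otimes>\<^bsub>A.T\<^esub> A.t y' z') = tAB y' \<one>\<^bsub>BB\<^esub> \<otimes>\<^bsub>AB\<^esub> tAB \<one>\<^bsub>AA\<^esub> b \<otimes>\<^bsub>AB\<^esub> coaction z'"
      unfolding mu using cl bc by (simp add: AB.A.m_assoc)
    also have "tAB y' \<one>\<^bsub>BB\<^esub> \<otimes>\<^bsub>AB\<^esub> tAB \<one>\<^bsub>AA\<^esub> b = tAB \<one>\<^bsub>AA\<^esub> b \<otimes>\<^bsub>AB\<^esub> tAB y' \<one>\<^bsub>BB\<^esub>"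
      using y' b by (simp add: tAB_mult)
    finally show "m (u \<otimes>\<^bsub>A.T\<^esub> A.t y' z') = tAB \<one>\<^bsub>AA\<^esub> b \<otimes>\<^bsub>AB\<^esub> m (A.t y' z')"
      using cl bc by (simp add: m_tens y' z' AB.A.m_assoc)
  qed
qed

text \<open>For u in H the first leg is x y1, which \<open>H_rule\<close> replaces by 1. The second
  leg then is the projection of u, and it equals u.\<close>

lemma m_j:
  assumes u: "u \<in> carrier H"
  shows "m (i.j u) = tAB \<one>\<^bsub>AA\<^esub> (iB u)"
proof -
  note uT = R.H_T[OF u]
  let ?F = "\<lambda>a b c. tAB (i a) (iB (R.P (R.t b c)))"
  note il = i.i_lin and jl = alg_hom_lin[OF iB_hom]
  note tri = R.coact_trilin[OF A.R_alg BB_alg il jl]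
  have cl: "?F a b c \<in> carrier AB" if "a \<in> carrier R" "b \<in> carrier R" "c \<in> carrier R" for a b c
    using that by (simp add: tAB_closed i.i_closed iB_closed R.P_H R.t_closed)
  have pb: "bilin K R R AB (\<lambda>x y. tAB (i x) \<one>\<^bsub>BB\<^esub> \<otimes>\<^bsub>AB\<^esub> coaction (i y))"
    by (rule bilin_pull[OF m_bilin il])
  have Gl: "(\<lambda>v. tAB \<one>\<^bsub>AA\<^esub> (iB (R.P v))) \<in> lin_maps K R.T AB"
    by (rule lin_maps_comp[OF tAB_lin(2)[OF RA.A.one_closed] lin_maps_comp[OF jl R.lin_P_H[OF lin_maps_id]]])
  have "m (i.j u) = R.L AB (\<lambda>x y. tAB (i x) \<one>\<^bsub>BB\<^esub> \<otimes>\<^bsub>AB\<^esub> coaction (i y)) u"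
    unfolding m_def by (rule i.L_j[OF AB_alg m_bilin uT])
  also have "\<dots> = R.L AB (\<lambda>x y. R.M AB (\<lambda>a b c. ?F (x \<otimes> a) b c) y) u"
  proof (rule R.L_cong[OF AB_alg pb uT])
    fix x y assume xy: "x \<in> carrier R" "y \<in> carrier R"
    have xc: "tAB (i x) \<one>\<^bsub>BB\<^esub> \<in> carrier AB" by (rule tA_closed[OF i.i_closed[OF xy(1)]])
    note ml = k_algebra.mult_right_lin[OF AB_alg xc]
    have "tAB (i x) \<one>\<^bsub>BB\<^esub> \<otimes>\<^bsub>AB\<^esub> coaction (i y) = R.M AB (\<lambda>a b c. tAB (i x) \<one>\<^bsub>BB\<^esub> \<otimes>\<^bsub>AB\<^esub> ?F a b c) y"
      unfolding coaction(2)[OF xy(2)] R.coact_def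
      by (rule R.M_comm[OF AB_alg AB_alg ml tri xy(2)])
    also have "\<dots> = R.M AB (\<lambda>a b c. ?F (x \<otimes> a) b c) y"
    proof (rule R.M_cong[OF AB_alg trilin_comp[OF tri ml] xy(2)])
      interpret BB: k_algebra K BB by (rule BB_alg)
      fix a b c assume abc: "a \<in> carrier R" "b \<in> carrier R" "c \<in> carrier R"
      have "iB (R.P (R.t b c)) \<in> carrier BB" by (rule iB_closed[OF R.P_H[OF R.t_closed[OF abc(2,3)]]])
      then show "tAB (i x) \<one>\<^bsub>BB\<^esub> \<otimes>\<^bsub>AB\<^esub> ?F a b c = ?F (x \<otimes> a) b c"
        using abc xy by (simp add: tAB_mult i.i_closed alg_hom_mult[OF i.i_hom])
    qed
    finally show "tAB (i x) \<one>\<^bsub>BB\<^esub> \<otimes>\<^bsub>AB\<^esub> coaction (i y) = R.M AB (\<lambda>a b c. ?F (x \<otimes> a) b c) y" .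
  qed
  also have "\<dots> = R.L AB (\<lambda>x y. ?F \<one> x y) u" by (rule R.H_rule[OF AB_alg tri u])
  also have "\<dots> = R.L AB (\<lambda>x y. tAB \<one>\<^bsub>AA\<^esub> (iB (R.P (R.t x y)))) u" by (simp add: alg_hom_one[OF i.i_hom])
  also have "\<dots> = tAB \<one>\<^bsub>AA\<^esub> (iB (R.P (R.L R.T R.t u)))"
  proof (rule R.L_comm[OF R.T_alg AB_alg Gl _ uT, symmetric])
    show "bilin K R R R.T R.t" by (assumption | rule lin_intros)+
  qed
  finally show ?thesis unfolding R.L_self[OF uT] R.P_id[OF u] .
qed

text \<open>The term \<gamma>' x \<otimes> 1 coming from the coaction of x is cancelled by the
  correction term, and \<gamma>' \<gamma> = 1 leaves only b.\<close>

lemma m_skew: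
  assumes g: "\<gamma> \<in> carrier AA" "\<gamma>' \<in> carrier AA" "\<gamma>' \<otimes>\<^bsub>AA\<^esub> \<gamma> = \<one>\<^bsub>AA\<^esub>" and x: "x \<in> carrier AA" and b: "b \<in> carrier BB"
    and \<rho>: "coaction x = tAB x \<one>\<^bsub>BB\<^esub> \<oplus>\<^bsub>AB\<^esub> tAB \<gamma> b"
  shows "m (A.t \<gamma>' x \<ominus>\<^bsub>A.T\<^esub> A.t (\<gamma>' \<otimes>\<^bsub>AA\<^esub> x) \<one>\<^bsub>AA\<^esub>) = tAB \<one>\<^bsub>AA\<^esub> b"
proof -
  interpret AB: k_algebra K AB by (rule AB_alg)
  interpret BB: k_algebra K BB by (rule BB_alg)
  note c = alg_mult_closed[OF A.R_alg g(2) x]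
  have "m (A.t \<gamma>' x \<ominus>\<^bsub>A.T\<^esub> A.t (\<gamma>' \<otimes>\<^bsub>AA\<^esub> x) \<one>\<^bsub>AA\<^esub>) = m (A.t \<gamma>' x) \<ominus>\<^bsub>AB\<^esub> m (A.t (\<gamma>' \<otimes>\<^bsub>AA\<^esub> x) \<one>\<^bsub>AA\<^esub>)"
    by (rule lin_maps_minus[OF A.T_alg AB_alg m_lin]) (simp_all add: A.t_closed g x c)
  also have "m (A.t \<gamma>' x) = tAB (\<gamma>' \<otimes>\<^bsub>AA\<^esub> x) \<one>\<^bsub>BB\<^esub> \<oplus>\<^bsub>AB\<^esub> tAB \<one>\<^bsub>AA\<^esub> b"
    using g x b by (simp add: m_tens \<rho> AB.A.r_distr tAB_closed tAB_mult)
  also have "m (A.t (\<gamma>' \<otimes>\<^bsub>AA\<^esub> x) \<one>\<^bsub>AA\<^esub>) = tAB (\<gamma>' \<otimes>\<^bsub>AA\<^esub> x) \<one>\<^bsub>BB\<^esub>"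
    using c by (simp add: m_tens alg_hom_one[OF coaction(1)] tAB_closed)
  also have "(tAB (\<gamma>' \<otimes>\<^bsub>AA\<^esub> x) \<one>\<^bsub>BB\<^esub> \<oplus>\<^bsub>AB\<^esub> tAB \<one>\<^bsub>AA\<^esub> b) \<ominus>\<^bsub>AB\<^esub> tAB (\<gamma>' \<otimes>\<^bsub>AA\<^esub> x) \<one>\<^bsub>BB\<^esub> = tAB \<one>\<^bsub>AA\<^esub> b"
    by (rule AB.add_sub_cancel) (simp_all add: tAB_closed c b)
  finally show ?thesis .
qed

lemma m_psi:
  assumes b: "b \<in> carrier BB"
  shows "m (\<psi> b) = tAB \<one>\<^bsub>AA\<^esub> b"
proof -
  interpret AB: k_algebra K AB by (rule AB_alg)
  note pl = alg_hom_lin[OF psi_T] and tl = tAB_lin(2)[OF RA.A.one_closed]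
  \<comment> \<open>Closure under products is where \<open>m_mult\<close> enters: its hypothesis on
    the left factor is exactly the property defining this set.\<close>
  have Q: "sub_alg K BB {b. m (\<psi> b) = tAB \<one>\<^bsub>AA\<^esub> b}"
  proof (rule sub_algI; unfold mem_Collect_eq)
    show "m (\<psi> \<one>\<^bsub>BB\<^esub>) = tAB \<one>\<^bsub>AA\<^esub> \<one>\<^bsub>BB\<^esub>"
      unfolding alg_hom_one[OF psi_T] A.T_one
      by (simp add: m_tens alg_hom_one[OF coaction(1)] tA_closed)
    fix x y assume xy: "x \<in> carrier BB" "y \<in> carrier BB" and e: "m (\<psi> x) = tAB \<one>\<^bsub>AA\<^esub> x" "m (\<psi> y) = tAB \<one>\<^bsub>AA\<^esub> y"
    show "m (\<psi> (x \<oplus>\<^bsub>BB\<^esub> y)) = tAB \<one>\<^bsub>AA\<^esub> (x \<oplus>\<^bsub>BB\<^esub> y)"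
      unfolding lin_maps_add[OF pl xy] lin_maps_add[OF m_lin psi_closed[OF xy(1)] psi_closed[OF xy(2)]] e lin_maps_add[OF tl xy] ..
    show "m (\<psi> (x \<otimes>\<^bsub>BB\<^esub> y)) = tAB \<one>\<^bsub>AA\<^esub> (x \<otimes>\<^bsub>BB\<^esub> y)"
      unfolding alg_hom_mult[OF psi_T xy] m_mult[OF psi_closed[OF xy(1)] psi_closed[OF xy(2)] xy(1) e(1)] e(2)
      by (simp add: tAB_mult xy)
  next
    fix s x assume sx: "s \<in> carrier K" "x \<in> carrier BB" and e: "m (\<psi> x) = tAB \<one>\<^bsub>AA\<^esub> x"
    show "m (\<psi> (s \<odot>\<^bsub>BB\<^esub> x)) = tAB \<one>\<^bsub>AA\<^esub> (s \<odot>\<^bsub>BB\<^esub> x)"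
      unfolding lin_maps_smult[OF pl sx] lin_maps_smult[OF m_lin sx(1) psi_closed[OF sx(2)]] e lin_maps_smult[OF tl sx] ..
  qed
  have gi: "i g' \<otimes>\<^bsub>AA\<^esub> i g = \<one>\<^bsub>AA\<^esub>" "i h' \<otimes>\<^bsub>AA\<^esub> i h = \<one>\<^bsub>AA\<^esub>"
    using gh_closed T1.g_inv T2.g_inv by (simp_all flip: alg_hom_mult[OF i.i_hom] add: alg_hom_one[OF i.i_hom])
  have "b \<in> {b. m (\<psi> b) = tAB \<one>\<^bsub>AA\<^esub> b}"
  proof (rule BM.ambiskew_generated[OF Q _ _ _ b]; unfold mem_Collect_eq)
    show "m (\<psi> (iB u)) = tAB \<one>\<^bsub>AA\<^esub> (iB u)" if "u \<in> carrier H" for u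
      unfolding psi(2)[OF that] by (rule m_j[OF that])
    show "m (\<psi> EE) = tAB \<one>\<^bsub>AA\<^esub> EE" unfolding psi(3)
      by (rule m_skew[OF i.i_closed[OF gh_closed(1)] i.i_closed[OF gh_closed(3)] gi(1) XY(1) EF(1) coaction(3)])
    show "m (\<psi> FF) = tAB \<one>\<^bsub>AA\<^esub> FF" unfolding psi(4)
      by (rule m_skew[OF i.i_closed[OF gh_closed(2)] i.i_closed[OF gh_closed(4)] gi(2) XY(2) EF(2) coaction(4)])
  qed
  then show ?thesis by simp
qed

text \<open>(y \<otimes> 1 \<otimes> 1) \<mu>(z) is \<delta>(y \<otimes> z) by the definition of
  \<delta>. Membership in H(A) thus becomes a statement about m, which is what makes \<psi>
  surjective.\<close>

lemma push_m:
  assumes u: "u \<in> carrier A.T"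
  shows "push (m u) = A.\<delta> u"
proof (rule tensor_ext[OF k_algebra_opp[OF A.R_alg] A.R_alg A.T3_alg lin_maps_comp[OF alg_hom_lin[OF push_hom] m_lin] A.\<delta>_lin _ u])
  fix y z assume "y \<in> carrier (opp AA)" and z: "z \<in> carrier AA"
  then have y: "y \<in> carrier AA" by simp
  have one: "\<one>\<^bsub>BB\<^esub> \<in> carrier BB" by (rule alg_one_closed[OF BB_alg])
  have y1: "A.t3 y \<one>\<^bsub>AA\<^esub> \<one>\<^bsub>AA\<^esub> \<in> carrier A.T3" by (simp add: tens3_closed[OF A.R_alg] y)
  note ml = k_algebra.mult_right_lin[OF A.T3_alg y1]
  have "push (m (A.t y z)) = push (tAB y \<one>\<^bsub>BB\<^esub>) \<otimes>\<^bsub>A.T3\<^esub> push (coaction z)"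
    unfolding m_tens[OF y z] by (rule alg_hom_mult[OF push_hom tA_closed[OF y] coaction_closed[OF z]])
  also have "push (tAB y \<one>\<^bsub>BB\<^esub>) = A.t3 y \<one>\<^bsub>AA\<^esub> \<one>\<^bsub>AA\<^esub>"
    unfolding push_tens[OF y one] alg_hom_one[OF psi_T] by (simp add: tens3_def A.T_one)
  also have "push (coaction z) = A.M A.T3 (tens3 K AA) z"
    unfolding push_coaction[OF z] A.M_tens3[OF z] ..
  also have "A.t3 y \<one>\<^bsub>AA\<^esub> \<one>\<^bsub>AA\<^esub> \<otimes>\<^bsub>A.T3\<^esub> A.M A.T3 (tens3 K AA) z
    = A.M A.T3 (\<lambda>a b c. A.t3 y \<one>\<^bsub>AA\<^esub> \<one>\<^bsub>AA\<^esub> \<otimes>\<^bsub>A.T3\<^esub> A.t3 a b c) z"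
    by (rule A.M_comm[OF A.T3_alg A.T3_alg ml trilin_tens3[OF A.R_alg] z])
  also have "\<dots> = A.M A.T3 (\<lambda>a b c. A.t3 (y \<otimes>\<^bsub>AA\<^esub> a) b c) z"
    by (rule A.M_cong[OF A.T3_alg trilin_comp[OF trilin_tens3[OF A.R_alg] ml] z])
      (simp add: tensor3_def tens3_def tens_mult[OF A.R_alg A.T_alg] A.t_closed A.t_mult y)
  finally show "push (m (A.t y z)) = A.\<delta> (A.t y z)" unfolding A.\<delta>_tens[OF y z] .
qed

section \<open>The inverse of \<psi>\<close>

definition "\<phi> u = tens_lift K BB (\<lambda>a b. fA a \<odot>\<^bsub>BB\<^esub> b) (m u)"

lemma slice_bilin: "k_algebra K D \<Longrightarrow> bilin K AA D D (\<lambda>a b. fA a \<odot>\<^bsub>D\<^esub> b)"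
  by (rule bilinI) (rule lin_smult_const lin_smult_var; (assumption | rule lin_maps_id fA_lin A.f_closed)+)+

lemma phi_lin: "\<phi> \<in> lin_maps K A.T BB"
  unfolding \<phi>_def[abs_def]
  by (rule lin_maps_comp[OF tens_lift_lin[OF A.R_alg BB_alg BB_alg slice_bilin[OF BB_alg]] m_lin])

lemma phi_psi:
  assumes b: "b \<in> carrier BB"
  shows "\<phi> (\<psi> b) = b"
proof -
  interpret BB: k_algebra K BB by (rule BB_alg)
  show ?thesis
    unfolding \<phi>_def m_psi[OF b] tens_lift_tens[OF A.R_alg BB_alg BB_alg slice_bilin[OF BB_alg] RA.A.one_closed b] fA_one
    using b by simp
qed

text \<open>Evaluating the first leg by the functional commutes with applying \<psi> to the second,
  so the claim reduces to evaluating the first leg of \<delta>(u) = 1 \<otimes> u.\<close>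

lemma psi_phi:
  assumes u: "u \<in> carrier A.H"
  shows "\<psi> (\<phi> u) = u"
proof -
  interpret AT: k_algebra K A.T by (rule A.T_alg)
  note uT = A.H_T[OF u]
  let ?f = "\<lambda>a v. fA a \<odot>\<^bsub>A.T\<^esub> v"
  have fc: "fA a \<in> carrier K" if "a \<in> carrier AA" for a using A.f_closed[OF that] .
  note pl = alg_hom_lin[OF psi_T] and pc = psi_closed
  have "\<psi> (tens_lift K BB (\<lambda>a b. fA a \<odot>\<^bsub>BB\<^esub> b) w) = tens_lift K A.T ?f (push w)" if w: "w \<in> carrier AB" for w
  proof (rule tensor_ext[OF A.R_alg BB_alg A.T_alg
        lin_maps_comp[OF pl tens_lift_lin[OF A.R_alg BB_alg BB_alg slice_bilin[OF BB_alg]]] _ _ w])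
    have "push \<in> lin_maps K AB (tensor K AA A.T)" using alg_hom_lin[OF push_hom] by (simp add: tensor3_def)
    then show "(\<lambda>w. tens_lift K A.T ?f (push w)) \<in> lin_maps K AB A.T"
      by (rule lin_maps_comp[OF tens_lift_lin[OF A.R_alg A.T_alg A.T_alg slice_bilin[OF A.T_alg]]])
    fix a b assume ab: "a \<in> carrier AA" "b \<in> carrier BB"
    show "\<psi> (tens_lift K BB (\<lambda>a b. fA a \<odot>\<^bsub>BB\<^esub> b) (tAB a b)) = tens_lift K A.T ?f (push (tAB a b))"
      unfolding push_tens[OF ab] tens_lift_tens[OF A.R_alg BB_alg BB_alg slice_bilin[OF BB_alg] ab]
        tens_lift_tens[OF A.R_alg A.T_alg A.T_alg slice_bilin[OF A.T_alg] ab(1) pc[OF ab(2)]]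
      by (rule lin_maps_smult[OF pl fc[OF ab(1)] ab(2)])
  qed
  from this[OF lin_maps_closed[OF m_lin uT]] have "\<psi> (\<phi> u) = tens_lift K A.T ?f (A.\<delta> u)"
    unfolding \<phi>_def push_m[OF uT] .
  also have "A.\<delta> u = tens K AA A.T \<one>\<^bsub>AA\<^esub> u" using u unfolding A.H_carrier by (rule conjunct2)
  also have "tens_lift K A.T ?f \<dots> = u"
    unfolding tens_lift_tens[OF A.R_alg A.T_alg A.T_alg slice_bilin[OF A.T_alg] RA.A.one_closed uT] fA_one
    using uT by simp
  finally show ?thesis .
qed

text \<open>\<phi> is built as a linear map only. It is multiplicative because it inverts \<psi>,
  which is a homomorphism and is injective by \<open>phi_psi\<close>.\<close>

lemma phi_hom: "\<phi> \<in> alg_hom K A.H BB"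
proof (rule alg_homI[OF A.lin_H[OF phi_lin]])
  note pc = lin_maps_closed[OF A.lin_H[OF phi_lin]]
  have inj: "x = y" if "x \<in> carrier BB" "y \<in> carrier BB" "\<psi> x = \<psi> y" for x y
    by (rule phi_psi[OF that(1), unfolded that(3) phi_psi[OF that(2)], symmetric])
  show "\<phi> \<one>\<^bsub>A.H\<^esub> = \<one>\<^bsub>BB\<^esub>"
    using phi_psi[OF alg_one_closed[OF BB_alg]] unfolding alg_hom_one[OF psi(1)] .
  fix x y assume xy: "x \<in> carrier A.H" "y \<in> carrier A.H"
  show "\<phi> (x \<otimes>\<^bsub>A.H\<^esub> y) = \<phi> x \<otimes>\<^bsub>BB\<^esub> \<phi> y"
    by (rule inj[OF pc[OF alg_mult_closed[OF A.H_alg xy]] alg_mult_closed[OF BB_alg pc[OF xy(1)] pc[OF xy(2)]]])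
      (simp only: psi_phi[OF alg_mult_closed[OF A.H_alg xy]] alg_hom_mult[OF psi(1) pc[OF xy(1)] pc[OF xy(2)]]
        psi_phi[OF xy(1)] psi_phi[OF xy(2)])
qed

end

section \<open>The Hopf structure of B and the final statement\<close>

context ambiskew_hopf begin

definition "\<Delta>B b = tens_map K BB BB \<phi> \<phi> (H_\<Delta> K AA \<mu>A (\<psi> b))"
definition "\<epsilon>B b = H_\<epsilon> K AA (\<psi> b)"

lemma hopf_B: "hopf_algebra K BB \<Delta>B \<epsilon>B" "\<phi> \<in> hopf_iso K A.H (H_\<Delta> K AA \<mu>A) (H_\<epsilon> K AA) BB \<Delta>B \<epsilon>B"
  using hopf_algebra_transport[OF BB_alg A.hopf_algebra_H phi_hom psi(1) phi_psi psi_phi]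
  by (simp_all only: \<Delta>B_def[abs_def] \<epsilon>B_def[abs_def])

lemma phi_lin_H: "\<phi> \<in> lin_maps K A.H BB" by (rule alg_hom_lin[OF phi_hom])

lemma psi_H: "b \<in> carrier BB \<Longrightarrow> \<psi> b \<in> carrier A.H" by (rule lin_maps_closed[OF alg_hom_lin[OF psi(1)]])

lemma \<Delta>B: "b \<in> carrier BB \<Longrightarrow> \<Delta>B b = tens_map K BB BB \<phi> \<phi> (A.\<Delta> (\<psi> b))"
  unfolding \<Delta>B_def A.H_\<Delta>_eq[OF psi_H] ..

lemma phi_j: "u \<in> carrier H \<Longrightarrow> \<phi> (i.j u) = iB u"
  using phi_psi[OF iB_closed] psi(2) by simp

text \<open>This is the sense in which the structure on B extends that of H. The map
  \<open>i.j\<close> respects comultiplication and counit, and \<phi> carries it to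
  \<open>iB\<close>.\<close>

lemma iB_hopf: "iB \<in> hopf_hom K H (H_\<Delta> K R \<mu>) (H_\<epsilon> K R) BB \<Delta>B \<epsilon>B"
  unfolding hopf_hom_def
proof (intro CollectI conjI ballI)
  show "iB \<in> alg_hom K H BB" by (rule iB_hom)
  fix u assume u: "u \<in> carrier H"
  have "\<epsilon>B (iB u) = A.\<epsilon> (i.j u)"
    unfolding \<epsilon>B_def psi(2)[OF u] by (rule A.H_\<epsilon>_eq[OF i.j_H[OF u]])
  then show "\<epsilon>B (iB u) = H_\<epsilon> K R u" unfolding i.j_\<epsilon>[OF u] R.H_\<epsilon>_eq[OF u] .
  note jl = alg_hom_lin[OF i.j_hom_H] and du = R.\<Delta>_closed[OF u]
  note b = tens_map_bilin[OF BB_alg BB_alg phi_lin_H phi_lin_H]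
  note BBB = k_algebra_tensor[OF BB_alg BB_alg]
  have "\<Delta>B (iB u) = tens_lift K (tensor K BB BB) (\<lambda>a b. tens K BB BB (\<phi> a) (\<phi> b)) (tens_map K A.H A.H i.j i.j (R.\<Delta> u))"
    unfolding \<Delta>B[OF iB_closed[OF u]] psi(2)[OF u] i.j_\<Delta>[OF u] by (simp only: tens_map_def[of K BB])
  also have "\<dots> = tens_lift K (tensor K BB BB) (\<lambda>a b. tens K BB BB (\<phi> (i.j a)) (\<phi> (i.j b))) (R.\<Delta> u)"
    by (rule transport_lift[OF A.H_alg R.H_alg BBB jl b du])
  also have "\<dots> = tens_lift K (tensor K BB BB) (\<lambda>a b. tens K BB BB (iB a) (iB b)) (R.\<Delta> u)"
    by (rule tens_lift_cong[OF R.H_alg R.H_alg BBB bilin_pull[OF b jl] _ du]) (simp only: phi_j)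
  finally show "\<Delta>B (iB u) = tens_lift K (tensor K BB BB) (\<lambda>a b. tens K BB BB (iB a) (iB b)) (H_\<Delta> K R \<mu> u)"
    unfolding R.H_\<Delta>_eq[OF u] .
qed

text \<open>The coproducts of E and F are those of E0 and F0 in H(A), pushed forward along \<phi>
  \<otimes> \<phi>.\<close>

lemma \<Delta>B_skew:
  assumes e: "e \<in> carrier BB" and u: "u \<in> carrier H"
    and d: "A.\<Delta> (\<psi> e) = A.tH (\<psi> e) \<one>\<^bsub>A.H\<^esub> \<oplus>\<^bsub>A.HH\<^esub> A.tH (i.j u) (\<psi> e)"
  shows "\<Delta>B e = tens K BB BB e \<one>\<^bsub>BB\<^esub> \<oplus>\<^bsub>tensor K BB BB\<^esub> tens K BB BB (iB u) e"
proof -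
  note c = psi_H[OF e] alg_one_closed[OF A.H_alg] i.j_H[OF u]
  note t = tens_map_tens[OF BB_alg BB_alg A.H_alg A.H_alg phi_lin_H phi_lin_H]
  show ?thesis
    unfolding \<Delta>B[OF e] d lin_maps_add[OF tens_map_lin[OF BB_alg BB_alg A.H_alg A.H_alg phi_lin_H phi_lin_H]
        tens_closed[OF A.H_alg A.H_alg c(1,2)] tens_closed[OF A.H_alg A.H_alg c(3,1)]]
      t[OF c(1,2)] t[OF c(3,1)] phi_psi[OF e] phi_j[OF u] alg_hom_one[OF phi_hom] ..
qed

lemma \<Delta>B_EE: "\<Delta>B EE = tens K BB BB EE \<one>\<^bsub>BB\<^esub> \<oplus>\<^bsub>tensor K BB BB\<^esub> tens K BB BB (iB (R.t g' g)) EE"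
  by (rule \<Delta>B_skew[OF EF(1) R.grouplike_H(1)[OF gl_g]], unfold psi(3) i.j_tens[OF gh_closed(3,1)]) (rule E0_\<Delta>)

lemma \<Delta>B_FF: "\<Delta>B FF = tens K BB BB FF \<one>\<^bsub>BB\<^esub> \<oplus>\<^bsub>tensor K BB BB\<^esub> tens K BB BB (iB (R.t h' h)) FF"
  by (rule \<Delta>B_skew[OF EF(2) R.grouplike_H(1)[OF gl_h]], unfold psi(4) i.j_tens[OF gh_closed(4,2)]) (rule F0_\<Delta>)

lemma group_like_H: "R.grouplike x x' \<Longrightarrow> R.t x' x \<in> hopf_group_likes K H (H_\<Delta> K R \<mu>) (H_\<epsilon> K R)"
  unfolding hopf_group_likes_def
  using R.grouplike_H[of x x'] R.H_\<Delta>_eq[of "R.t x' x"] R.H_\<epsilon>_eq[of "R.t x' x"] by simp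

lemma hat_eq: "T1.hat = tens_lift K R.T (\<lambda>r s. R.t (conj_by R g r) (\<tau> s))"
  "T2.hat = tens_lift K R.T (\<lambda>r s. R.t (conj_by R h r) (\<omega> s))"
  unfolding T1.hat_def[abs_def] T2.hat_def[abs_def] conj_by_def by (rule refl)+

end

theorem theorem5p3:
  fixes K :: "'k ring" and R :: "('k, 'a) module" and \<mu> :: "'a \<Rightarrow> ('k, 'a) tens3"
    and \<tau> \<omega> :: "'a \<Rightarrow> 'a" and g h c :: 'a and \<xi> \<kappa> :: 'k
    and \<mu>A :: "('k, 'a) amb \<Rightarrow> ('k, ('k, 'a) amb) tens3"
  assumes "hopf_galois K R \<mu>"
    and "admissible K R \<mu> \<tau> \<omega> g h c \<xi>"
    and "associated_hopf_galois K R \<mu> \<tau> \<omega> g h c \<xi> \<mu>A"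
    and "\<kappa> \<in> carrier K - {\<zero>\<^bsub>K\<^esub>}" "g \<otimes>\<^bsub>R\<^esub> h = \<kappa> \<odot>\<^bsub>R\<^esub> (h \<otimes>\<^bsub>R\<^esub> g)"
  shows "let
      A = ambiskew K R \<tau> \<omega> c \<xi>;
      H = H_alg K R \<mu>;
      t = tens K (opp R) R;
      \<tau>' = tens_lift K (opR K R) (\<lambda>r s. t (conj_by R g r) (\<tau> s));
      \<omega>' = tens_lift K (opR K R) (\<lambda>r s. t (conj_by R h r) (\<omega> s));
      gh' = inv\<^bsub>R\<^esub> (g \<otimes>\<^bsub>R\<^esub> h);
      c' = t gh' c \<ominus>\<^bsub>opR K R\<^esub> t (gh' \<otimes>\<^bsub>R\<^esub> c) \<one>\<^bsub>R\<^esub>;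
      \<xi>' = \<xi> \<otimes>\<^bsub>K\<^esub> inv\<^bsub>K\<^esub> \<kappa>;
      B = ambiskew K H \<tau>' \<omega>' c' \<xi>';
      i = amb_in K H \<tau>' \<omega>' c' \<xi>';
      E = amb_var K H \<tau>' \<omega>' c' \<xi>' VX;
      F = amb_var K H \<tau>' \<omega>' c' \<xi>' VY;
      g' = t (inv\<^bsub>R\<^esub> g) g;
      h' = t (inv\<^bsub>R\<^esub> h) h
    in hopf_algebra K H (H_\<Delta> K R \<mu>) (H_\<epsilon> K R)
     \<and> ambiskew_data K H \<tau>' \<omega>' c' \<xi>'
     \<and> g' \<in> hopf_group_likes K H (H_\<Delta> K R \<mu>) (H_\<epsilon> K R)
     \<and> h' \<in> hopf_group_likes K H (H_\<Delta> K R \<mu>) (H_\<epsilon> K R)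
     \<and> hopf_algebra K (H_alg K A \<mu>A) (H_\<Delta> K A \<mu>A) (H_\<epsilon> K A)
     \<and> (\<exists>\<Delta> \<epsilon>. hopf_algebra K B \<Delta> \<epsilon>
          \<and> i \<in> hopf_hom K H (H_\<Delta> K R \<mu>) (H_\<epsilon> K R) B \<Delta> \<epsilon>
          \<and> \<Delta> E = tens K B B E \<one>\<^bsub>B\<^esub> \<oplus>\<^bsub>tensor K B B\<^esub> tens K B B (i g') E
          \<and> \<Delta> F = tens K B B F \<one>\<^bsub>B\<^esub> \<oplus>\<^bsub>tensor K B B\<^esub> tens K B B (i h') F
          \<and> (\<exists>\<phi>. \<phi> \<in> hopf_iso K (H_alg K A \<mu>A) (H_\<Delta> K A \<mu>A) (H_\<epsilon> K A) B \<Delta> \<epsilon>))"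
proof -
  \<comment> \<open>Nontriviality of R and of A is part of being a Hopf-Galois algebra; it yields
    the two functionals on which all explicit formulas depend.\<close>
  have "k_algebra K R" "\<one>\<^bsub>R\<^esub> \<noteq> \<zero>\<^bsub>R\<^esub>" using assms(1) by (simp_all add: hopf_galois_def)
  from k_algebra.functional_exists[OF this] obtain f where f: "f \<in> lin_maps K R (base_alg K)" "f \<one>\<^bsub>R\<^esub> = \<one>\<^bsub>K\<^esub>"
    by (rule bexE)
  let ?A = "ambiskew K R \<tau> \<omega> c \<xi>"
  have "hopf_galois K ?A \<mu>A" using assms(3) by (simp add: associated_hopf_galois_def Let_def)
  then have "k_algebra K ?A" "\<one>\<^bsub>?A\<^esub> \<noteq> \<zero>\<^bsub>?A\<^esub>" by (simp_all add: hopf_galois_def)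
  from k_algebra.functional_exists[OF this] obtain fA
    where fA: "fA \<in> lin_maps K ?A (base_alg K)" "fA \<one>\<^bsub>?A\<^esub> = \<one>\<^bsub>K\<^esub>" by (rule bexE)
  interpret ambiskew_hopf K R \<mu> f \<tau> \<omega> g h c \<xi> \<kappa> \<mu>A fA
    by (intro ambiskew_hopf.intro hopf_gal.intro ambiskew_hopf_axioms.intro assms f fA)
  show ?thesis
    unfolding Let_def hat_eq[symmetric]
    by (intro conjI exI[of _ \<Delta>B] exI[of _ \<epsilon>B] exI[of _ \<phi>] R.hopf_algebra_H B_data group_like_H gl_g gl_h
        A.hopf_algebra_H hopf_B iB_hopf \<Delta>B_EE \<Delta>B_FF)
qed

end
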